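(* Suppose that $\varepsilon\ln\eta(\varepsilon)\to-\infty$ as $\varepsilon\to+0$, and let $\mu=\mu(\varepsilon)=-\frac{1}{\varepsilon\ln\eta(\varepsilon)}$. Let $|\tau|<1-\varkappa$, where $0<\varkappa<1$ is a fixed constant. Then for sufficiently small $\varepsilon$ the estimate $$\left\|\left(\mathring{\mathcal{H}}_\varepsilon(\tau)-\frac{\tau^2}{\varepsilon^2}\right)^{-1}-\mathcal{Q}_\mu^{-1}\oplus0\right\|_{L_2(\Omega_\varepsilon)\to L_2(\Omega_\varepsilon)}\leqslant C\varkappa^{-1/2}(\varepsilon^{1/2}\mu+\varepsilon)$$ holds true, where the constant $C$ is independent of $\varepsilon$, $\mu$, and $\varkappa$.
   Context: $\varepsilon>0$ is a small parameter and $\eta=\eta(\varepsilon)$ is a function with $0<\eta(\varepsilon)<\pi/2$. Let $\Omega_\varepsilon=\{x=(x_1,x_2): |x_1|<\frac{\varepsilon\pi}{2},\ 0<x_2<\pi\}$, $\mathring\Gamma_+=\{x: |x_1|<\frac{\varepsilon\pi}{2},\ x_2=\pi\}$, $\mathring\gamma_\varepsilon=\{x: |x_1|<\varepsilon\eta,\ x_2=0\}$. $\mathring{W}_{2,per}^1(\Omega_\varepsilon,\mathring\Gamma_+\cup\mathring\gamma_\varepsilon)$ is the set of functions in the Sobolev space $W_2^1(\Omega_\varepsilon)$ with zero trace on $\mathring\Gamma_+\cup\mathring\gamma_\varepsilon$ satisfying periodic boundary conditions on the lateral boundaries $x_1=\pm\varepsilon\pi/2$ of $\Omega_\varepsilon$.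 For $\tau\in[-1,1)$, $\mathring{\mathcal{H}}_\varepsilon(\tau)$ is the self-adjoint non-negative operator in $L_2(\Omega_\varepsilon)$ associated with the sesquilinear form $$\left(\left(\mathrm{i}\frac{\partial}{\partial x_1}-\frac{\tau}{\varepsilon}\right)u,\left(\mathrm{i}\frac{\partial}{\partial x_1}-\frac{\tau}{\varepsilon}\right)v\right)_{L_2(\Omega_\varepsilon)}+\left(\frac{\partial u}{\partial x_2},\frac{\partial v}{\partial x_2}\right)_{L_2(\Omega_\varepsilon)}$$ on $\mathring{W}_{2,per}^1(\Omega_\varepsilon,\mathring\Gamma_+\cup\mathring\gamma_\varepsilon)$. $\mathfrak{L}_\varepsilon$ is the subspace of $L_2(\Omega_\varepsilon)$ of functions independent of $x_1$ (identified with functions of $x_2\in(0,\pi)$), and $L_2(\Omega_\varepsilon)=\mathfrak{L}_\varepsilon\oplus\mathfrak{L}_\varepsilon^\perp$. $\mathcal{Q}_\mu$ is the self-adjoint non-negative operator in $\mathfrak{L}_\varepsilon$ given by $-\frac{d^2}{dx_2^2}$ on the functions $u\in W_2^2(0,\pi)$ with $u(\pi)=0$, $u'(0)-\mu u(0)=0$ (associated with the form $(u',v')_{L_2(0,\pi)}+\mu u(0)\overline{v(0)}$ on functions in $W_2^1(0,\pi)$ vanishing at $\pi$). The operator $\mathcal{Q}_\mu^{-1}\oplus0$ acts as $\mathcal{Q}_\mu^{-1}$ on $\mathfrak{L}_\varepsilon$ and as $0$ on $\mathfrak{L}_\varepsilon^\perp$. *)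

theory Defs
  imports "HOL-Analysis.Analysis"
begin

text \<open>
  Elements of $L_2(S)$ are represented by complex-valued functions on the whole ambient space; only
  their values almost everywhere on \<open>S\<close> matter.
\<close>

definition L2 :: "'a::euclidean_space set \<Rightarrow> ('a \<Rightarrow> complex) set" where
  "L2 S = {f. f \<in> borel_measurable (lebesgue_on S) \<and>
              integrable (lebesgue_on S) (\<lambda>x. (norm (f x))\<^sup>2)}"

definition L2_inner :: "'a::euclidean_space set \<Rightarrow> ('a \<Rightarrow> complex) \<Rightarrow> ('a \<Rightarrow> complex) \<Rightarrow> complex" where
  "L2_inner S f g = (\<integral>x. f x * cnj (g x) \<partial>lebesgue_on S)"

definition L2_norm :: "'a::euclidean_space set \<Rightarrow> ('a \<Rightarrow> complex) \<Rightarrow> real" where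
  "L2_norm S f = sqrt (\<integral>x. (norm (f x))\<^sup>2 \<partial>lebesgue_on S)"

definition L2_orth :: "'a::euclidean_space set \<Rightarrow> ('a \<Rightarrow> complex) set \<Rightarrow> ('a \<Rightarrow> complex) set" where
  "L2_orth S M = {f \<in> L2 S. \<forall>g\<in>M. L2_inner S f g = 0}"


primrec C_k :: "nat \<Rightarrow> ('a::euclidean_space \<Rightarrow> complex) \<Rightarrow> bool" where
  "C_k 0 f \<longleftrightarrow> continuous_on UNIV f"
| "C_k (Suc k) f \<longleftrightarrow> (\<forall>x. f differentiable (at x)) \<and>
                    (\<forall>v. C_k k (\<lambda>x. frechet_derivative f (at x) v))"

definition smooth :: "('a::euclidean_space \<Rightarrow> complex) \<Rightarrow> bool" where
  "smooth f \<longleftrightarrow> (\<forall>k. C_k k f)"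

definition test_function :: "'a::euclidean_space set \<Rightarrow> ('a \<Rightarrow> complex) \<Rightarrow> bool" where
  "test_function S \<phi> \<longleftrightarrow> smooth \<phi> \<and> (\<exists>K. compact K \<and> K \<subseteq> S \<and> (\<forall>x. x \<notin> K \<longrightarrow> \<phi> x = 0))"

definition has_weak_deriv ::
  "'a::euclidean_space set \<Rightarrow> 'a \<Rightarrow> ('a \<Rightarrow> complex) \<Rightarrow> ('a \<Rightarrow> complex) \<Rightarrow> bool" where
  "has_weak_deriv S e u w \<longleftrightarrow>
     (\<forall>\<phi>. test_function S \<phi> \<longrightarrow>
        (\<integral>x. u x * frechet_derivative \<phi> (at x) e \<partial>lebesgue_on S) =
        - (\<integral>x. w x * \<phi> x \<partial>lebesgue_on S))"

text \<open>The choice is unique up to null sets on an open set \<open>S\<close>.\<close>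

definition wderiv :: "'a::euclidean_space set \<Rightarrow> 'a \<Rightarrow> ('a \<Rightarrow> complex) \<Rightarrow> 'a \<Rightarrow> complex" where
  "wderiv S e u = (SOME w. w \<in> L2 S \<and> has_weak_deriv S e u w)"

definition W12 :: "'a::euclidean_space set \<Rightarrow> ('a \<Rightarrow> complex) set" where
  "W12 S = {u \<in> L2 S. \<forall>e\<in>Basis. \<exists>w\<in>L2 S. has_weak_deriv S e u w}"

definition W12_norm :: "'a::euclidean_space set \<Rightarrow> ('a \<Rightarrow> complex) \<Rightarrow> real" where
  "W12_norm S u = sqrt ((L2_norm S u)\<^sup>2 + (\<Sum>e\<in>Basis. (L2_norm S (wderiv S e u))\<^sup>2))"

definition W22 :: "'a::euclidean_space set \<Rightarrow> ('a \<Rightarrow> complex) set" where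
  "W22 S = {u \<in> W12 S. \<forall>e\<in>Basis. wderiv S e u \<in> W12 S}"

text \<open>
  \<open>g\<close> is the trace of \<open>u \<in> W12 S\<close> on the boundary segment parametrised by arc length by
  \<open>p\<close> on \<open>I\<close>: the trace operator is the extension by continuity of the restriction of smooth
  functions to the segment.
\<close>

definition has_trace ::
  "'a::euclidean_space set \<Rightarrow> (real \<Rightarrow> 'a) \<Rightarrow> real set \<Rightarrow> ('a \<Rightarrow> complex) \<Rightarrow> (real \<Rightarrow> complex) \<Rightarrow> bool"
where
  "has_trace S p I u g \<longleftrightarrow> g \<in> L2 I \<and>
     (\<exists>\<phi>. (\<forall>n::nat. smooth (\<phi> n)) \<and>
          (\<lambda>n. W12_norm S (\<lambda>x. \<phi> n x - u x)) \<longlonglongrightarrow> 0 \<and>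
          (\<lambda>n. L2_norm I (\<lambda>t. \<phi> n (p t) - g t)) \<longlonglongrightarrow> 0)"


text \<open>
  A (possibly unbounded) operator in $L_2(S)$ is represented by its graph, i.e. the set of all pairs
  \<open>(f, A f)\<close>, where both components range over all representatives of the respective classes.
  The inverse of an operator is the converse relation.
\<close>

type_synonym 'a graph = "(('a \<Rightarrow> complex) \<times> ('a \<Rightarrow> complex)) set"

definition form_operator ::
  "'a::euclidean_space set \<Rightarrow> ('a \<Rightarrow> complex) set \<Rightarrow>
   (('a \<Rightarrow> complex) \<Rightarrow> ('a \<Rightarrow> complex) \<Rightarrow> complex) \<Rightarrow> 'a graph" where
  "form_operator S V h = {(u, f). u \<in> V \<and> f \<in> L2 S \<and> (\<forall>v\<in>V. h u v = L2_inner S f v)}"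

definition op_shift :: "'a graph \<Rightarrow> complex \<Rightarrow> 'a graph" where
  "op_shift A z = {(u, \<lambda>x. f x - z * u x) | u f. (u, f) \<in> A}"

definition op_diff :: "'a graph \<Rightarrow> 'a graph \<Rightarrow> 'a graph" where
  "op_diff A B = {(f, \<lambda>x. a x - b x) | f a b. (f, a) \<in> A \<and> (f, b) \<in> B}"

text \<open>$A \oplus 0$ with respect to the decomposition $L_2(S) = M \oplus M^\perp$.\<close>

definition op_sum_zero ::
  "'a::euclidean_space set \<Rightarrow> ('a \<Rightarrow> complex) set \<Rightarrow> 'a graph \<Rightarrow> 'a graph" where
  "op_sum_zero S M A =
     {(f, u). f \<in> L2 S \<and> (\<exists>f1\<in>M. \<exists>f2\<in>L2_orth S M.
        (AE x in lebesgue_on S. f x = f1 x + f2 x) \<and> (f1, u) \<in> A)}"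

definition L2_opnorm :: "'a::euclidean_space set \<Rightarrow> 'a graph \<Rightarrow> ennreal" where
  "L2_opnorm S A = Sup {ennreal (L2_norm S g) | f g. (f, g) \<in> A \<and> L2_norm S f \<le> 1}"

definition L2_bounded_operator :: "'a::euclidean_space set \<Rightarrow> 'a graph \<Rightarrow> bool" where
  "L2_bounded_operator S A \<longleftrightarrow>
     A \<subseteq> L2 S \<times> L2 S \<and>
     (\<forall>f\<in>L2 S. \<exists>u. (f, u) \<in> A) \<and>
     (\<forall>f g u v. (f, u) \<in> A \<and> (g, v) \<in> A \<and> (AE x in lebesgue_on S. f x = g x) \<longrightarrow>
        (AE x in lebesgue_on S. u x = v x)) \<and>
     (\<forall>f g u v c. (f, u) \<in> A \<and> (g, v) \<in> A \<longrightarrow> (\<lambda>x. f x + c * g x, \<lambda>x. u x + c * v x) \<in> A) \<and>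
     L2_opnorm S A < \<infinity>"


definition \<Omega> :: "real \<Rightarrow> (real \<times> real) set" where
  "\<Omega> \<epsilon> = {x. \<bar>fst x\<bar> < \<epsilon> * pi / 2 \<and> 0 < snd x \<and> snd x < pi}"

text \<open>The second argument \<open>\<eta>\<close> is the value of the function $\eta$ at $\varepsilon$.\<close>

definition W12_per :: "real \<Rightarrow> real \<Rightarrow> (real \<times> real \<Rightarrow> complex) set" where
  "W12_per \<epsilon> \<eta> = {u \<in> W12 (\<Omega> \<epsilon>).
     has_trace (\<Omega> \<epsilon>) (\<lambda>t. (t, pi)) {t. \<bar>t\<bar> < \<epsilon> * pi / 2} u (\<lambda>_. 0) \<and>
     has_trace (\<Omega> \<epsilon>) (\<lambda>t. (t, 0)) {t. \<bar>t\<bar> < \<epsilon> * \<eta>} u (\<lambda>_. 0) \<and>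
     (\<exists>g. has_trace (\<Omega> \<epsilon>) (\<lambda>t. (- (\<epsilon> * pi / 2), t)) {0<..<pi} u g \<and>
          has_trace (\<Omega> \<epsilon>) (\<lambda>t. (\<epsilon> * pi / 2, t)) {0<..<pi} u g)}"

definition h_form ::
  "real \<Rightarrow> real \<Rightarrow> (real \<times> real \<Rightarrow> complex) \<Rightarrow> (real \<times> real \<Rightarrow> complex) \<Rightarrow> complex" where
  "h_form \<epsilon> \<tau> u v =
     (let D1 = (\<lambda>w x. \<i> * wderiv (\<Omega> \<epsilon>) (1, 0) w x - of_real (\<tau> / \<epsilon>) * w x);
          D2 = wderiv (\<Omega> \<epsilon>) (0, 1)
      in L2_inner (\<Omega> \<epsilon>) (D1 u) (D1 v) + L2_inner (\<Omega> \<epsilon>) (D2 u) (D2 v))"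

definition H_op :: "real \<Rightarrow> real \<Rightarrow> real \<Rightarrow> (real \<times> real) graph" where
  "H_op \<epsilon> \<eta> \<tau> = form_operator (\<Omega> \<epsilon>) (W12_per \<epsilon> \<eta>) (h_form \<epsilon> \<tau>)"

definition L_sub :: "real \<Rightarrow> (real \<times> real \<Rightarrow> complex) set" where
  "L_sub \<epsilon> = {F \<in> L2 (\<Omega> \<epsilon>). \<exists>f\<in>L2 {0<..<pi}. AE x in lebesgue_on (\<Omega> \<epsilon>). F x = f (snd x)}"

text \<open>
  $\mathcal{Q}_\mu$ on functions of $x_2$; \<open>v\<close> and \<open>v'\<close> are the continuous representatives on
  $[0,\pi]$ of \<open>u\<close> and its derivative, which give sense to the boundary values.
\<close>

definition Q_op1 :: "real \<Rightarrow> real graph" where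
  "Q_op1 \<mu> = {(u, f). u \<in> W22 {0<..<pi} \<and> f \<in> L2 {0<..<pi} \<and>
     (AE t in lebesgue_on {0<..<pi}. f t = - wderiv {0<..<pi} 1 (wderiv {0<..<pi} 1 u) t) \<and>
     (\<exists>v v'. continuous_on {0..pi} v \<and> continuous_on {0..pi} v' \<and>
        (AE t in lebesgue_on {0<..<pi}. u t = v t) \<and>
        (AE t in lebesgue_on {0<..<pi}. wderiv {0<..<pi} 1 u t = v' t) \<and>
        v pi = 0 \<and> v' 0 - of_real \<mu> * v 0 = 0)}"

definition Q_op :: "real \<Rightarrow> real \<Rightarrow> (real \<times> real) graph" where
  "Q_op \<epsilon> \<mu> = {(U, F). U \<in> L2 (\<Omega> \<epsilon>) \<and> F \<in> L2 (\<Omega> \<epsilon>) \<and>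
     (\<exists>(u, f)\<in>Q_op1 \<mu>.
        (AE x in lebesgue_on (\<Omega> \<epsilon>). U x = u (snd x)) \<and>
        (AE x in lebesgue_on (\<Omega> \<epsilon>). F x = f (snd x)))}"

end

theory Submission
  imports Defs
begin

text \<open>
  On functions of period \<open>\<epsilon>\<pi>\<close> in \<open>x\<^sub>1\<close>, the sharp Wirtinger inequality gives
  \<open>\<bar>(\<partial>\<^sub>1u, u)\<bar> \<le> (\<epsilon>/2) \<parallel>\<partial>\<^sub>1u\<parallel>\<^sup>2\<close>, so the form of the fibre operator minus \<open>\<tau>\<^sup>2/\<epsilon>\<^sup>2\<close> dominates
  \<open>\<kappa> \<parallel>\<partial>\<^sub>1u\<parallel>\<^sup>2 + \<parallel>\<partial>\<^sub>2u\<parallel>\<^sup>2\<close>. Hence the solution \<open>u\<close> for the right-hand side \<open>f\<close> exists, its gradient is bounded by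
  \<open>f\<close> with \<open>\<parallel>\<partial>\<^sub>1u\<parallel> = O(\<kappa>\<^sup>-\<^sup>1\<^sup>/\<^sup>2 \<parallel>f\<parallel>)\<close>, and it differs from its mean \<open>p\<close> over \<open>x\<^sub>1\<close> by at most \<open>(\<epsilon>/2) \<parallel>\<partial>\<^sub>1u\<parallel>\<close>.

  Averaging the equation over \<open>x\<^sub>1\<close> shows that \<open>p\<close> and the solution \<open>q\<close> of the limiting problem for the mean of \<open>f\<close>
  have the same second derivative and both vanish at \<open>\<pi>\<close>, so \<open>p - q = (p(0) - q(0)) (1 - x\<^sub>2/\<pi>)\<close>. To recover the
  Robin condition at \<open>0\<close>, test the equation with \<open>W (\<pi> - x\<^sub>2)\<close>, where \<open>W\<close> is the difference of two smoothed logarithms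
  at the scales \<open>\<epsilon>\<eta>\<close> and \<open>\<epsilon>\<close>: it vanishes on the window, equals \<open>-ln \<eta> = 1/(\<epsilon>\<mu>)\<close> at distance
  \<open>2\<epsilon>\<close> from it, and its Laplacian is the difference of two densities of mass \<open>\<pi>\<close>, one at scale \<open>\<epsilon>\<eta>\<close> next to the
  window, on which \<open>u\<close> vanishes, and one at scale \<open>\<epsilon>\<close>, where \<open>u\<close> is close to \<open>p(0)\<close>. An \<open>L\<^sup>1\<close> Poincare
  inequality controls both integrals by the gradient of \<open>u\<close>, uniformly in \<open>\<eta>\<close>, and the result is
  \<open>(\<pi>\<^sup>2 + \<pi>/\<mu>) (p(0) - q(0)) = O(\<parallel>\<partial>\<^sub>1u\<parallel> + \<parallel>\<partial>\<^sub>2u\<parallel> + \<parallel>f\<parallel>)\<close>.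
\<close>

section \<open>Smooth functions\<close>

text \<open>The solution has no normal derivative on the bottom edge that could be evaluated, so the
  Robin condition is extracted from the weak form with a single test function. The weight
  \<open>pi - snd x\<close> is harmonic and vanishes at the top; it turns the right-hand side into
  the integral that defines \<open>Q_at_0\<close>. The height of the logarithm enters as
  \<open>2 * hw * ln \<eta> = - (pi / \<mu>)\<close>, which is the origin of \<mu>. The rate
  \<epsilon>^{1/2} \<mu> is the product of |p(0) - q(0)| = O(\<mu>) and the norm, of order
  \<epsilon>^{1/2}, of a fixed function of x_2 on a cell of width \<epsilon> pi. The cross term of
  the form carries the unbounded factor \<tau>/\<epsilon>. Against the corrector it stays bounded: W
  + ln \<eta> has norm O(\<epsilon>), and the constant part pairs to zero with the x_1-derivative.
  That norm is uniform in \<eta> because x_2 times the gradient of a logarithm is bounded. Traces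
  are given only by approximating sequences, so estimates and integrations by parts in the form
  domain are first proved for smooth functions with explicit boundary errors and then passed to the
  limit.\<close>

lemma C_k_SucI:
  assumes "\<And>x. (f has_derivative f' x) (at x)" and "\<And>v. C_k k (\<lambda>x. f' x v)"
  shows "C_k (Suc k) f"
proof -
  have "frechet_derivative f (at x) = f' x" for x
    using frechet_derivative_at[OF assms(1)] by simp
  then show ?thesis using assms by (auto simp: differentiable_def)
qed

lemma C_k_SucD:
  assumes "C_k (Suc k) f"
  shows "(f has_derivative frechet_derivative f (at x)) (at x)"
    and "C_k k (\<lambda>x. frechet_derivative f (at x) v)"
  using assms by (auto simp: frechet_derivative_works[symmetric])

lemma C_k_Suc_imp: "C_k (Suc k) f \<Longrightarrow> C_k k f"
proof (induction k arbitrary: f)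
  case 0
  then show ?case
    by (auto intro!: continuous_at_imp_continuous_on differentiable_imp_continuous_within)
next
  case (Suc k)
  then show ?case by (metis C_k.simps(2))
qed

lemma C_k_const [simp]: "C_k k (\<lambda>x. c)"
proof (induction k arbitrary: c)
  case (Suc k)
  show ?case by (rule C_k_SucI[where f'="\<lambda>_ _. 0"]) (use Suc in auto)
qed simp

lemma C_k_bounded_linear: "bounded_linear f \<Longrightarrow> C_k k f"
proof (cases k)
  case 0
  assume "bounded_linear f"
  with 0 show ?thesis by (simp add: linear_continuous_on)
next
  case (Suc m)
  assume "bounded_linear f"
  then have "C_k (Suc m) f"
    by (intro C_k_SucI[where f'="\<lambda>_. f"]) (auto intro: bounded_linear_imp_has_derivative)
  with Suc show ?thesis by simp
qed

lemma C_k_add: "C_k k f \<Longrightarrow> C_k k g \<Longrightarrow> C_k k (\<lambda>x. f x + g x)"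
proof (induction k arbitrary: f g)
  case 0 then show ?case by (auto intro: continuous_on_add)
next
  case (Suc k)
  show ?case
    by (rule C_k_SucI[OF has_derivative_add[OF C_k_SucD(1)[OF Suc.prems(1)] C_k_SucD(1)[OF Suc.prems(2)]]])
       (intro Suc.IH C_k_SucD(2)[OF Suc.prems(1)] C_k_SucD(2)[OF Suc.prems(2)])
qed

lemma C_k_mult: "C_k k f \<Longrightarrow> C_k k g \<Longrightarrow> C_k k (\<lambda>x. f x * g x)"
proof (induction k arbitrary: f g)
  case 0 then show ?case by (auto intro: continuous_on_mult)
next
  case (Suc k)
  show ?case
    by (rule C_k_SucI[OF has_derivative_mult[OF C_k_SucD(1)[OF Suc.prems(1)] C_k_SucD(1)[OF Suc.prems(2)]]])
       (intro C_k_add Suc.IH C_k_SucD(2)[OF Suc.prems(1)] C_k_SucD(2)[OF Suc.prems(2)]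
         C_k_Suc_imp[OF Suc.prems(1)] C_k_Suc_imp[OF Suc.prems(2)])
qed

lemma C_k_cnj: "C_k k f \<Longrightarrow> C_k k (\<lambda>x. cnj (f x))"
proof (induction k arbitrary: f)
  case 0 then show ?case by (auto intro: continuous_intros)
next
  case (Suc k)
  show ?case
    by (rule C_k_SucI[OF has_derivative_cnj[OF C_k_SucD(1)[OF Suc.prems]]])
       (intro Suc.IH C_k_SucD(2)[OF Suc.prems])
qed

lemma has_derivative_Re_of_real:
  assumes "((\<lambda>x. complex_of_real (g x)) has_derivative G) F"
  shows "(g has_derivative (\<lambda>v. Re (G v))) F" 
  using bounded_linear.has_derivative[OF bounded_linear_Re assms] by simp

lemma frechet_of_real_Re:
  assumes "((\<lambda>x. complex_of_real (g x)) has_derivative G) (at x)"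
  shows "complex_of_real (Re (G v)) = G v"
proof -
  have "((\<lambda>x. complex_of_real (g x)) has_derivative (\<lambda>v. complex_of_real (Re (G v)))) (at x)"
    by (intro bounded_linear.has_derivative[OF bounded_linear_of_real[where 'a=complex]] has_derivative_Re_of_real assms)
  from has_derivative_unique[OF this assms] show ?thesis by metis
qed

text \<open>\<open>C_k\<close> speaks of complex valued functions, so the real inner function enters
  through its embedding. In that form the chain rule is a product, and the induction closes with
  \<open>C_k_mult\<close>.\<close>

lemma C_k_compose:
  fixes f :: "'a::euclidean_space \<Rightarrow> real" and h :: "real \<Rightarrow> complex"
  assumes "C_k k (\<lambda>x. complex_of_real (f x))" "C_k k h"
  shows "C_k k (\<lambda>x. h (f x))"
  using assms
proof (induction k arbitrary: h)
  case 0
  have "continuous_on UNIV (\<lambda>x. Re (complex_of_real (f x)))"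
    using 0(1) by (intro continuous_intros) simp
  then have "continuous_on UNIV f" by simp
  with 0(2) show ?case
    using continuous_on_compose2[of UNIV h UNIV f] by auto
next
  case (Suc k)
  let ?F = "\<lambda>x. frechet_derivative (\<lambda>x. complex_of_real (f x)) (at x)"
  let ?h = "\<lambda>y. frechet_derivative h (at y) 1"
  have F: "((\<lambda>x. complex_of_real (f x)) has_derivative ?F x) (at x)" for x
    by (rule C_k_SucD[OF Suc.prems(1)])
  have "((\<lambda>x. h (f x)) has_derivative (\<lambda>v. ?F x v * ?h (f x))) (at x)" for x
  proof -
    have H: "(h has_derivative frechet_derivative h (at (f x))) (at (f x))"
      by (rule C_k_SucD[OF Suc.prems(2)])
    have "((\<lambda>x. h (f x)) has_derivative (\<lambda>v. frechet_derivative h (at (f x)) (Re (?F x v)))) (at x)"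
      using has_derivative_compose[OF has_derivative_Re_of_real[OF F] H] .
    moreover have "frechet_derivative h (at (f x)) (Re (?F x v)) = ?F x v * ?h (f x)" for v
    proof -
      have "frechet_derivative h (at (f x)) (Re (?F x v) *\<^sub>R 1) = Re (?F x v) *\<^sub>R ?h (f x)"
        using linear_scale[OF has_derivative_linear[OF H]] by blast
      then show ?thesis using frechet_of_real_Re[OF F[of x], of v] by (simp add: scaleR_conv_of_real)
    qed
    ultimately show ?thesis by simp
  qed
  then show ?case
    by (rule C_k_SucI)
       (rule C_k_mult[OF C_k_SucD(2)[OF Suc.prems(1)]
         Suc.IH[OF C_k_Suc_imp[OF Suc.prems(1)] C_k_SucD(2)[OF Suc.prems(2)]]])
qed

lemma C_k_inverse:
  assumes "C_k k f" "\<And>x. f x \<noteq> 0"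
  shows "C_k k (\<lambda>x. inverse (f x))"
  using assms
proof (induction k arbitrary: f)
  case 0 then show ?case by (auto intro: continuous_on_inverse)
next
  case (Suc k)
  have D: "((\<lambda>x. inverse (f x)) has_derivative
      (\<lambda>v. (- 1) * (inverse (f x) * frechet_derivative f (at x) v * inverse (f x)))) (at x)" for x
    using Deriv.has_derivative_inverse[OF Suc.prems(2) C_k_SucD(1)[OF Suc.prems(1)], of x] by simp
  show ?case
    by (rule C_k_SucI[OF D])
       (intro C_k_mult C_k_const C_k_SucD(2)[OF Suc.prems(1)] Suc.IH C_k_Suc_imp[OF Suc.prems(1)] Suc.prems(2))
qed

lemma C_k_ln:
  fixes g :: "'a::euclidean_space \<Rightarrow> real"
  assumes "C_k k (\<lambda>x. complex_of_real (g x))" "\<And>x. g x > 0"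
  shows "C_k k (\<lambda>x. complex_of_real (ln (g x)))"
proof (cases k)
  case 0
  have "continuous_on UNIV (\<lambda>x. Re (complex_of_real (g x)))"
    using assms(1) 0 by (intro continuous_intros) simp
  then have "continuous_on UNIV g" by simp
  with 0 show ?thesis by (auto intro!: continuous_intros simp: assms(2) less_imp_neq[symmetric])
next
  case (Suc m)
  let ?F = "\<lambda>x. frechet_derivative (\<lambda>x. complex_of_real (g x)) (at x)"
  have F: "((\<lambda>x. complex_of_real (g x)) has_derivative ?F x) (at x)" for x
    using assms(1) Suc C_k_SucD by blast
  have "((\<lambda>x. complex_of_real (ln (g x))) has_derivative (\<lambda>v. ?F x v * inverse (complex_of_real (g x)))) (at x)" for x
  proof -
    have "((\<lambda>x. ln (g x)) has_derivative (\<lambda>v. Re (?F x v) * inverse (g x))) (at x)"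
      using has_derivative_ln[OF assms(2) has_derivative_Re_of_real[OF F[of x]]]
      by (simp add: divide_inverse)
    from bounded_linear.has_derivative[OF bounded_linear_of_real[where 'a=complex] this]
    show ?thesis using frechet_of_real_Re[OF F[of x]] by (simp only: of_real_mult of_real_inverse)
  qed
  moreover have g: "C_k (Suc m) (\<lambda>x. complex_of_real (g x))" using assms(1) Suc by simp
  moreover have nz: "complex_of_real (g x) \<noteq> 0" for x using assms(2)[of x] by simp
  ultimately have "C_k (Suc m) (\<lambda>x. complex_of_real (ln (g x)))"
    by (intro C_k_SucI) (auto intro: C_k_mult[OF C_k_SucD(2)[OF g] C_k_inverse[OF C_k_Suc_imp[OF g] nz]])
  with Suc show ?thesis by simp
qed

lemma smooth_const: "smooth (\<lambda>x. c)" by (simp add: smooth_def)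
lemma smooth_add: "smooth f \<Longrightarrow> smooth g \<Longrightarrow> smooth (\<lambda>x. f x + g x)"
  by (simp add: smooth_def C_k_add)
lemma smooth_mult: "smooth f \<Longrightarrow> smooth g \<Longrightarrow> smooth (\<lambda>x. f x * g x)"
  by (simp add: smooth_def C_k_mult)
lemma smooth_diff:
  assumes "smooth f" "smooth g" shows "smooth (\<lambda>x. f x - g x)"
proof -
  have "smooth (\<lambda>x. f x + (- 1) * g x)" using assms by (intro smooth_add smooth_mult smooth_const)
  then show ?thesis by simp
qed
lemma smooth_cnj: "smooth f \<Longrightarrow> smooth (\<lambda>x. cnj (f x))"
  by (simp add: smooth_def C_k_cnj)
lemma smooth_bounded_linear: "bounded_linear f \<Longrightarrow> smooth f"
  by (simp add: smooth_def C_k_bounded_linear)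
lemma smooth_compose:
  "smooth (\<lambda>x. complex_of_real (f x)) \<Longrightarrow> smooth h \<Longrightarrow> smooth (\<lambda>x. h (f x))"
  by (simp add: smooth_def C_k_compose)
lemma smooth_inverse: "smooth f \<Longrightarrow> (\<And>x. f x \<noteq> 0) \<Longrightarrow> smooth (\<lambda>x. inverse (f x))"
  by (simp add: smooth_def C_k_inverse)
lemma smooth_ln: "smooth (\<lambda>x. complex_of_real (g x)) \<Longrightarrow> (\<And>x. g x > 0) \<Longrightarrow>
    smooth (\<lambda>x. complex_of_real (ln (g x)))"
  by (simp add: smooth_def C_k_ln)
lemma smooth_prod: "finite A \<Longrightarrow> (\<And>i. i \<in> A \<Longrightarrow> smooth (f i)) \<Longrightarrow> smooth (\<lambda>x. \<Prod>i\<in>A. f i x)"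
  by (induction A rule: finite_induct) (auto intro: smooth_mult smooth_const)

lemma smooth_has_derivative: "smooth f \<Longrightarrow> (f has_derivative frechet_derivative f (at x)) (at x)"
  using C_k_SucD(1) smooth_def by blast
lemma smooth_frechet: "smooth f \<Longrightarrow> smooth (\<lambda>x. frechet_derivative f (at x) v)"
  unfolding smooth_def using C_k.simps(2) by blast
lemma smooth_continuous: "smooth f \<Longrightarrow> continuous_on S f"
  using C_k.simps(1) continuous_on_subset smooth_def by blast

lemma smooth_if_derivative:
  assumes "\<And>x. (f has_derivative f' x) (at x)" "\<And>v. smooth (\<lambda>x. f' x v)"
  shows "smooth f"
proof -
  have "C_k (Suc k) f" for k
    using assms by (intro C_k_SucI) (auto simp: smooth_def)
  then show ?thesis unfolding smooth_def using C_k_Suc_imp by blast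
qed

section \<open>Flat exponentials and a smooth step function\<close>

definition exp_flat :: "nat \<Rightarrow> real \<Rightarrow> real" where
  "exp_flat n x = (if x > 0 then exp (- inverse x) * inverse x ^ n else 0)"

lemma exp_flat_tendsto: "(exp_flat n \<longlongrightarrow> 0) (at 0)"
proof -
  have "((\<lambda>y::real. y ^ n / exp y) \<longlongrightarrow> 0) at_top"
    by (rule tendsto_power_div_exp_0)
  then have "((\<lambda>x::real. inverse x ^ n / exp (inverse x)) \<longlongrightarrow> 0) (at_right 0)"
    by (rule filterlim_compose[OF _ filterlim_inverse_at_top_right])
  then have R: "(exp_flat n \<longlongrightarrow> 0) (at_right 0)"
    by (rule Lim_transform_eventually)
       (rule eventually_mono[OF eventually_at_right_less[of 0]], simp add: exp_flat_def exp_minus field_simps)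
  have L: "(exp_flat n \<longlongrightarrow> 0) (at_left 0)"
    by (rule Lim_transform_eventually[OF tendsto_const])
       (auto simp: exp_flat_def eventually_at_left[of "-1"] intro!: exI[of _ "-1"])
  show ?thesis using L R by (simp add: filterlim_at_split)
qed

lemma DERIV_inverse_power:
  fixes x :: real
  assumes "x \<noteq> 0"
  shows "((\<lambda>x. inverse x ^ n) has_real_derivative - real n * inverse x ^ (n + 1)) (at x)"
proof (induction n)
  case (Suc n)
  have "((\<lambda>x. inverse x * inverse x ^ n) has_real_derivative - real (Suc n) * inverse x ^ (Suc n + 1)) (at x)"
    by (rule derivative_eq_intros Suc refl assms)+ (simp add: algebra_simps power2_eq_square)
  then show ?case by simp
qed simp

text \<open>The power of 1/x makes the family closed under differentiation up to linear
  combinations, so smoothness follows by induction on the order for all n at once. At 0 the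
  difference quotient of \<open>exp_flat n\<close> is \<open>exp_flat (Suc n)\<close>, which tends
  to 0.\<close>

lemma exp_flat_deriv:
  "(exp_flat n has_real_derivative (exp_flat (n + 2) x - real n * exp_flat (n + 1) x)) (at x)"
proof -
  consider "x > 0" | "x < 0" | "x = 0" by linarith
  then show ?thesis
  proof cases
    case 1
    have "((\<lambda>x. exp (- inverse x) * inverse x ^ n) has_real_derivative
        (exp_flat (n + 2) x - real n * exp_flat (n + 1) x)) (at x)"
    proof -
      have x: "x \<noteq> 0" using 1 by simp
      have "((\<lambda>x. exp (- inverse x)) has_real_derivative exp (- inverse x) * (inverse x)\<^sup>2) (at x)"
        using x by (auto intro!: derivative_eq_intros simp: power2_eq_square)
      from DERIV_mult[OF this DERIV_inverse_power[OF x, of n]] show ?thesis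
        using 1 by (simp add: exp_flat_def power2_eq_square algebra_simps)
    qed
    moreover have "eventually (\<lambda>y. y > 0) (nhds x)"
      using 1 by (rule eventually_nhds_in_open[of "{0<..}" x, simplified])
    then have "eventually (\<lambda>y. exp (- inverse y) * inverse y ^ n = exp_flat n y) (nhds x)"
      by eventually_elim (simp add: exp_flat_def)
    ultimately show ?thesis by (simp only: DERIV_cong_ev[OF refl _ refl])
  next
    case 2
    have "eventually (\<lambda>y. y < 0) (nhds x)"
      using 2 by (rule eventually_nhds_in_open[of "{..<0}" x, simplified])
    then have "eventually (\<lambda>y. 0 = exp_flat n y) (nhds x)"
      by eventually_elim (simp add: exp_flat_def)
    moreover have "((\<lambda>x. 0) has_real_derivative (exp_flat (n + 2) x - real n * exp_flat (n + 1) x)) (at x)"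
      using 2 by (simp add: exp_flat_def)
    ultimately show ?thesis by (simp only: DERIV_cong_ev[OF refl _ refl])
  next
    case 3
    have "((\<lambda>h. (exp_flat n (0 + h) - exp_flat n 0) / h) \<longlongrightarrow> 0) (at 0)"
      by (rule Lim_transform_eventually[OF exp_flat_tendsto[of "Suc n"]])
         (auto simp: exp_flat_def eventually_at_filter divide_inverse mult_ac)
    then show ?thesis using 3 by (simp add: DERIV_def exp_flat_def)
  qed
qed

lemma has_derivative_of_real_field:
  assumes "(f has_real_derivative d) (at x)"
  shows "((\<lambda>x. complex_of_real (f x)) has_derivative (\<lambda>v. complex_of_real v * complex_of_real d)) (at x)"
  using bounded_linear.has_derivative[OF bounded_linear_of_real[where 'a=complex] assms[unfolded has_field_derivative_def]]
  by (simp add: mult.commute)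

lemma smooth_exp_flat: "smooth (\<lambda>x. complex_of_real (exp_flat n x))"
proof -
  have "C_k k (\<lambda>x. complex_of_real (exp_flat n x))" for k
  proof (induction k arbitrary: n)
    case 0
    have "continuous_on UNIV (exp_flat n)"
      using DERIV_isCont[OF exp_flat_deriv] by (intro continuous_at_imp_continuous_on) blast
    then show ?case by (auto intro: continuous_intros)
  next
    case (Suc k)
    show ?case
    proof (rule C_k_SucI[OF has_derivative_of_real_field[OF exp_flat_deriv]])
      fix v :: real
      have "C_k k (\<lambda>x. complex_of_real v * (complex_of_real (exp_flat (n + 2) x)
          + (- of_nat n) * complex_of_real (exp_flat (n + 1) x)))"
        by (intro C_k_mult C_k_const C_k_add Suc.IH)
      then show "C_k k (\<lambda>x. complex_of_real v * complex_of_real (exp_flat (n + 2) x - real n * exp_flat (n + 1) x))"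
        by simp
    qed
  qed
  then show ?thesis unfolding smooth_def by blast
qed

text \<open>The transition takes place between 1 and 2. Applied to a squared radius, this interval
  becomes the shell that carries the Laplacian of the smoothed logarithm.\<close>

definition step :: "real \<Rightarrow> real" where
  "step t = exp_flat 0 (t - 1) * inverse (exp_flat 0 (t - 1) + exp_flat 0 (2 - t))"

lemma exp_flat_nonneg: "exp_flat n x \<ge> 0" and exp_flat_pos: "x > 0 \<Longrightarrow> exp_flat n x > 0"
  by (auto simp: exp_flat_def)

lemma step_denominator_pos: "exp_flat 0 (t - 1) + exp_flat 0 (2 - t) > 0"
proof (cases "t > 1")
  case True then show ?thesis using exp_flat_pos[of "t - 1" 0] exp_flat_nonneg[of 0 "2 - t"] by linarith
next
  case False then show ?thesis using exp_flat_pos[of "2 - t" 0] exp_flat_nonneg[of 0 "t - 1"] by linarith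
qed

lemma step_eq_0: "t \<le> 1 \<Longrightarrow> step t = 0" and step_eq_1: "t \<ge> 2 \<Longrightarrow> step t = 1"
  by (auto simp: step_def exp_flat_def)

lemma step_nonneg: "step t \<ge> 0"
  using step_denominator_pos[of t] exp_flat_nonneg[of 0 "t - 1"] by (simp add: step_def)

lemma step_le_1: "step t \<le> 1"
  using step_denominator_pos[of t] exp_flat_nonneg[of 0 "t - 1"] exp_flat_nonneg[of 0 "2 - t"]
  unfolding step_def divide_inverse[symmetric] by (simp add: pos_divide_le_eq)

lemma smooth_of_real_id: "smooth (\<lambda>x. complex_of_real x)"
  by (intro smooth_bounded_linear bounded_linear_of_real)

lemma smooth_step: "smooth (\<lambda>t. complex_of_real (step t))"
proof -
  have 1: "smooth (\<lambda>t. complex_of_real (t - 1))" "smooth (\<lambda>t. complex_of_real (2 - t))"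
    unfolding of_real_diff by (intro smooth_diff smooth_const smooth_of_real_id)+
  have E: "smooth (\<lambda>t. complex_of_real (exp_flat 0 (t - 1)))" "smooth (\<lambda>t. complex_of_real (exp_flat 0 (2 - t)))"
    by (rule smooth_compose[OF 1(1) smooth_exp_flat] smooth_compose[OF 1(2) smooth_exp_flat])+
  have "complex_of_real (exp_flat 0 (t - 1)) + complex_of_real (exp_flat 0 (2 - t)) \<noteq> 0" for t
    using step_denominator_pos[of t] by (metis less_irrefl of_real_add of_real_eq_0_iff)
  then show ?thesis unfolding step_def of_real_mult of_real_inverse of_real_add
    by (intro smooth_mult smooth_inverse smooth_add E)
qed

section \<open>Semi-inner products and the Riesz representation theorem\<close>

text \<open>The elements are representatives of classes, so the form is only semidefinite: functions
  equal almost everywhere have distance zero. The locale serves both for \<open>L2_inner\<close> and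
  for the shifted form \<open>B\<close>.\<close>

locale semi_ip =
  fixes V :: "('b \<Rightarrow> complex) set" and ip :: "('b \<Rightarrow> complex) \<Rightarrow> ('b \<Rightarrow> complex) \<Rightarrow> complex"
  assumes nonempty: "V \<noteq> {}"
    and comb: "u \<in> V \<Longrightarrow> v \<in> V \<Longrightarrow> (\<lambda>x. u x + c * v x) \<in> V"
    and ip_comb: "u \<in> V \<Longrightarrow> v \<in> V \<Longrightarrow> w \<in> V \<Longrightarrow> ip (\<lambda>x. u x + c * v x) w = ip u w + c * ip v w"
    and ip_sym: "u \<in> V \<Longrightarrow> v \<in> V \<Longrightarrow> ip v u = cnj (ip u v)"
    and ip_pos: "u \<in> V \<Longrightarrow> 0 \<le> Re (ip u u)"
begin

definition nrm where "nrm u = sqrt (Re (ip u u))"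

lemma nrm_nonneg: "u \<in> V \<Longrightarrow> 0 \<le> nrm u"
  by (simp add: nrm_def ip_pos)

lemma nrm_sq: "u \<in> V \<Longrightarrow> (nrm u)\<^sup>2 = Re (ip u u)"
  by (simp add: nrm_def ip_pos)

lemma ip_self: "u \<in> V \<Longrightarrow> ip u u = of_real ((nrm u)\<^sup>2)"
proof -
  assume u: "u \<in> V"
  have "Im (ip u u) = 0" using ip_sym[OF u u] by (metis cnj.simps(2) equal_neg_zero)
  then show ?thesis using nrm_sq[OF u] by (simp add: complex_eq_iff)
qed

lemma ip_comb_right:
  assumes "u \<in> V" "v \<in> V" "w \<in> V"
  shows "ip w (\<lambda>x. u x + c * v x) = ip w u + cnj c * ip w v"
  using ip_comb[OF assms] ip_sym[OF comb[OF assms(1,2)] assms(3)] ip_sym[OF assms(1,3)] ip_sym[OF assms(2,3)]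
  by simp

lemma nrm_comb_sq:
  assumes "u \<in> V" "v \<in> V"
  shows "(nrm (\<lambda>x. u x + c * v x))\<^sup>2 = (nrm u)\<^sup>2 + 2 * Re (cnj c * ip u v) + (cmod c)\<^sup>2 * (nrm v)\<^sup>2"
proof -
  have "ip (\<lambda>x. u x + c * v x) (\<lambda>x. u x + c * v x) = (ip u u + cnj c * ip u v) + c * (ip v u + cnj c * ip v v)"
    using assms by (simp add: ip_comb comb ip_comb_right)
  moreover have "Re (c * ip v u) = Re (cnj c * ip u v)"
    using ip_sym[OF assms] by simp
  moreover have "Re (c * (cnj c * ip v v)) = (cmod c)\<^sup>2 * (nrm v)\<^sup>2"
  proof -
    have "c * (cnj c * ip v v) = of_real ((cmod c)\<^sup>2 * (nrm v)\<^sup>2)"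
      by (simp add: ip_self[OF assms(2)] complex_norm_square[symmetric] mult.assoc[symmetric])
    then show ?thesis by simp
  qed
  ultimately show ?thesis using assms by (simp add: nrm_sq comb distrib_left)
qed

text \<open>With z = \<open>ip u v\<close>, the squared seminorm of u + t z v is a nonnegative
  quadratic in t. If \<open>nrm v\<close> is nonzero, its minimum gives the claim. If
  \<open>nrm v = 0\<close>, it is affine in t and can be nonnegative everywhere only for z =
  0.\<close>

lemma cauchy_schwarz:
  assumes "u \<in> V" "v \<in> V"
  shows "cmod (ip u v) \<le> nrm u * nrm v"
proof -
  define z where "z = ip u v"
  have *: "0 \<le> (nrm u)\<^sup>2 + 2 * t * (cmod z)\<^sup>2 + t\<^sup>2 * (cmod z)\<^sup>2 * (nrm v)\<^sup>2" for t :: real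
  proof -
    have "0 \<le> (nrm (\<lambda>x. u x + (of_real t * z) * v x))\<^sup>2" by simp
    also have "\<dots> = (nrm u)\<^sup>2 + 2 * Re (cnj (of_real t * z) * z) + (cmod (of_real t * z))\<^sup>2 * (nrm v)\<^sup>2"
      unfolding z_def by (rule nrm_comb_sq[OF assms])
    also have "Re (cnj (of_real t * z) * z) = t * (cmod z)\<^sup>2"
      unfolding cmod_power2 by (simp add: power2_eq_square algebra_simps)
    finally show ?thesis by (simp add: norm_mult power_mult_distrib)
  qed
  have "(cmod z)\<^sup>2 \<le> (nrm u * nrm v)\<^sup>2"
  proof (cases "nrm v = 0")
    case True
    have "cmod z = 0"
    proof (rule ccontr)
      assume "cmod z \<noteq> 0"
      \<comment> \<open>At this t the affine function takes the value -1.\<close>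
      with *[of "- ((nrm u)\<^sup>2 + 1) / (2 * (cmod z)\<^sup>2)"] True show False by (simp add: field_simps)
    qed
    then show ?thesis by simp
  next
    case False
    define k where "k = (nrm v)\<^sup>2"
    have k: "k > 0" using False by (simp add: k_def)
    have "0 \<le> k * ((nrm u)\<^sup>2 + 2 * (- 1 / k) * (cmod z)\<^sup>2 + (- 1 / k)\<^sup>2 * (cmod z)\<^sup>2 * k)"
      using *[of "- 1 / k"] k by (intro mult_nonneg_nonneg) (auto simp: k_def)
    also have "\<dots> = k * (nrm u)\<^sup>2 - (cmod z)\<^sup>2"
      using k by (simp add: field_simps power2_eq_square)
    finally show ?thesis by (simp add: k_def power_mult_distrib mult.commute)
  qed
  then show ?thesis unfolding z_def
    by (rule power2_le_imp_le) (use assms nrm_nonneg in auto)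
qed

lemma triangle:
  assumes "u \<in> V" "v \<in> V"
  shows "nrm (\<lambda>x. u x + c * v x) \<le> nrm u + cmod c * nrm v"
proof (rule power2_le_imp_le)
  have "Re (cnj c * ip u v) \<le> cmod (cnj c * ip u v)" by (rule complex_Re_le_cmod)
  also have "\<dots> \<le> cmod c * (nrm u * nrm v)"
    using cauchy_schwarz[OF assms] by (simp add: norm_mult mult_left_mono)
  finally show "(nrm (\<lambda>x. u x + c * v x))\<^sup>2 \<le> (nrm u + cmod c * nrm v)\<^sup>2"
    unfolding nrm_comb_sq[OF assms] by (simp add: power2_eq_square algebra_simps)
  show "0 \<le> nrm u + cmod c * nrm v" using assms nrm_nonneg by simp
qed

lemma diff: "u \<in> V \<Longrightarrow> v \<in> V \<Longrightarrow> (\<lambda>x. u x - v x) \<in> V"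
  using comb[of u v "-1"] by simp

lemma zero: "(\<lambda>x. 0) \<in> V"
  using nonempty diff by fastforce

lemma scale: "v \<in> V \<Longrightarrow> (\<lambda>x. c * v x) \<in> V"
  using comb[OF zero, of v c] by simp

lemma add: "u \<in> V \<Longrightarrow> v \<in> V \<Longrightarrow> (\<lambda>x. u x + v x) \<in> V"
  using comb[of u v 1] by simp

lemma nrm_diff_le: "u \<in> V \<Longrightarrow> v \<in> V \<Longrightarrow> nrm (\<lambda>x. u x - v x) \<le> nrm u + nrm v"
  using triangle[of u v "-1"] by simp

lemma nrm_add_le: "u \<in> V \<Longrightarrow> v \<in> V \<Longrightarrow> nrm (\<lambda>x. u x + v x) \<le> nrm u + nrm v"
  using triangle[of u v 1] by simp

lemma nrm_minus_commute: "u \<in> V \<Longrightarrow> v \<in> V \<Longrightarrow> nrm (\<lambda>x. u x - v x) = nrm (\<lambda>x. v x - u x)"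
proof -
  have *: "nrm (\<lambda>x. u x - v x) \<le> nrm (\<lambda>x. v x - u x)" if "u \<in> V" "v \<in> V" for u v
    using triangle[OF zero diff[OF that(2,1)], of "-1"] nrm_comb_sq[OF zero zero, of 0] 
      ip_comb[OF zero zero zero, of "-1"] by (simp add: nrm_def)
  show "u \<in> V \<Longrightarrow> v \<in> V \<Longrightarrow> ?thesis" using *[of u v] *[of v u] by simp
qed

lemma nrm_triangle_diff:
  assumes "u \<in> V" "v \<in> V" shows "\<bar>nrm u - nrm v\<bar> \<le> nrm (\<lambda>x. u x - v x)"
  using nrm_add_le[OF diff[OF assms] assms(2)] nrm_add_le[OF diff[OF assms(2,1)] assms(1)]
    nrm_minus_commute[OF assms] by simp

lemma tendsto_nrm:
  assumes "\<And>n. X n \<in> V" "u \<in> V" "(\<lambda>n. nrm (\<lambda>x. X n x - u x)) \<longlonglongrightarrow> 0"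
  shows "(\<lambda>n. nrm (X n)) \<longlonglongrightarrow> nrm u"
proof -
  have "(\<lambda>n. nrm (X n) - nrm u) \<longlonglongrightarrow> 0"
    by (rule Lim_null_comparison[OF _ assms(3)]) (use nrm_triangle_diff assms in auto)
  then show ?thesis by (simp add: LIM_zero_iff)
qed

lemma tendsto_ip:
  assumes "\<And>n. X n \<in> V" "u \<in> V" "(\<lambda>n. nrm (\<lambda>x. X n x - u x)) \<longlonglongrightarrow> 0"
    and "\<And>n. Y n \<in> V" "v \<in> V" "(\<lambda>n. nrm (\<lambda>x. Y n x - v x)) \<longlonglongrightarrow> 0"
  shows "(\<lambda>n. ip (X n) (Y n)) \<longlonglongrightarrow> ip u v"
proof -
  have "(\<lambda>n. ip (X n) (Y n) - ip u v) \<longlonglongrightarrow> 0"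
  proof (rule Lim_null_comparison)
    have "cmod (ip (X n) (Y n) - ip u v)
        \<le> nrm (\<lambda>x. X n x - u x) * nrm (Y n) + nrm u * nrm (\<lambda>x. Y n x - v x)" for n
    proof -
      have "ip (X n) (Y n) - ip u v = ip (\<lambda>x. X n x - u x) (Y n) + ip u (\<lambda>x. Y n x - v x)"
        using ip_comb[where c="-1", OF assms(1,2,4), of n n] ip_comb_right[where c="-1", OF assms(4,5,2), of n] by simp
      also have "cmod \<dots> \<le> cmod (ip (\<lambda>x. X n x - u x) (Y n)) + cmod (ip u (\<lambda>x. Y n x - v x))"
        by (rule norm_triangle_ineq)
      also have "\<dots> \<le> nrm (\<lambda>x. X n x - u x) * nrm (Y n) + nrm u * nrm (\<lambda>x. Y n x - v x)"
        by (intro add_mono cauchy_schwarz diff assms)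
      finally show ?thesis .
    qed
    then show "\<forall>\<^sub>F n in sequentially. cmod (ip (X n) (Y n) - ip u v)
        \<le> nrm (\<lambda>x. X n x - u x) * nrm (Y n) + nrm u * nrm (\<lambda>x. Y n x - v x)" by simp
    have "(\<lambda>n. nrm (\<lambda>x. X n x - u x) * nrm (Y n) + nrm u * nrm (\<lambda>x. Y n x - v x)) \<longlonglongrightarrow> 0 * nrm v + nrm u * 0"
      by (intro tendsto_intros assms(3,6) tendsto_nrm[OF assms(4-6)])
    then show "(\<lambda>n. nrm (\<lambda>x. X n x - u x) * nrm (Y n) + nrm u * nrm (\<lambda>x. Y n x - v x)) \<longlonglongrightarrow> 0" by simp
  qed
  then show ?thesis by (simp add: LIM_zero_iff)
qed

text \<open>Variational proof: a minimising sequence of the energy J is Cauchy, and the Euler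
  equation at its limit is the representation. Completeness is a premise, so that the theorem
  applies to the form norm as well as to the L2 norm.\<close>

theorem riesz:
  assumes complete: "\<And>X. (\<And>n. X n \<in> V) \<Longrightarrow> (\<And>e. e > 0 \<Longrightarrow> \<exists>N. \<forall>m\<ge>N. \<forall>n\<ge>N. nrm (\<lambda>x. X m x - X n x) < e)
      \<Longrightarrow> \<exists>u\<in>V. (\<lambda>n::nat. nrm (\<lambda>x. X n x - u x)) \<longlonglongrightarrow> 0"
    and lin: "\<And>u v c. u \<in> V \<Longrightarrow> v \<in> V \<Longrightarrow> l (\<lambda>x. u x + c * v x) = l u + c * l v"
    and bound: "\<And>v. v \<in> V \<Longrightarrow> cmod (l v) \<le> M * nrm v"
  shows "\<exists>u\<in>V. \<forall>v\<in>V. ip v u = l v"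
proof -
  define J where "J v = (nrm v)\<^sup>2 - 2 * Re (l v)" for v
  have lb: "- M\<^sup>2 \<le> J v" if "v \<in> V" for v
  proof -
    have "Re (l v) \<le> M * nrm v" using bound[OF that] complex_Re_le_cmod order_trans by blast
    moreover have "0 \<le> (nrm v - M)\<^sup>2" by simp
    ultimately show ?thesis by (simp add: J_def power2_diff algebra_simps)
  qed
  define I where "I = Inf (J ` V)"
  have bdd: "bdd_below (J ` V)" using lb by (auto intro!: bdd_belowI)
  have I_le: "I \<le> J v" if "v \<in> V" for v
    unfolding I_def by (rule cInf_lower[OF _ bdd]) (use that in auto)
  have "\<exists>v\<in>V. J v < I + 1 / real (Suc n)" for n
    using cInf_lessD[of "J ` V" "I + 1 / real (Suc n)"] nonempty unfolding I_def by auto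
  then obtain X where X: "\<And>n. X n \<in> V" "\<And>n. J (X n) < I + 1 / real (Suc n)" by metis
  \<comment> \<open>Parallelogram identity: the squared distance equals 2 J(X m) + 2 J(X n) - 4
    J(midpoint), and the value of J at the midpoint is at least I.\<close>
  have cau: "(nrm (\<lambda>x. X m x - X n x))\<^sup>2 \<le> 2 / real (Suc m) + 2 / real (Suc n)" for m n
  proof -
    let ?h = "\<lambda>x. (1/2) * X m x + (1/2) * X n x"
    have h: "?h \<in> V" using comb[OF scale[OF X(1)] X(1)] by blast
    have "l ?h = (1/2) * l (X m) + (1/2) * l (X n)"
      using lin[OF scale[OF X(1)] X(1), of "1/2" m "1/2" n] lin[OF zero X(1), of "1/2" m] lin[OF zero zero, of "-1"] by simp
    then have lh: "Re (l ?h) = (Re (l (X m)) + Re (l (X n))) / 2" by simp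
    have "(nrm ?h)\<^sup>2 = Re (ip ?h ?h)" by (rule nrm_sq[OF h])
    have e1: "(nrm (\<lambda>x. X m x + 1 * X n x))\<^sup>2 = (nrm (X m))\<^sup>2 + 2 * Re (ip (X m) (X n)) + (nrm (X n))\<^sup>2"
      using nrm_comb_sq[OF X(1) X(1), of m 1 n] by simp
    have e2: "(nrm (\<lambda>x. X m x - X n x))\<^sup>2 = (nrm (X m))\<^sup>2 - 2 * Re (ip (X m) (X n)) + (nrm (X n))\<^sup>2"
      using nrm_comb_sq[OF X(1) X(1), of m "-1" n] by simp
    have "(\<lambda>x. 0 + (1/2) * (X m x + 1 * X n x)) = ?h" by (auto simp: algebra_simps)
    then have e3: "(nrm ?h)\<^sup>2 = (nrm (\<lambda>x. X m x + 1 * X n x))\<^sup>2 / 4"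
      using nrm_comb_sq[OF zero comb[OF X(1) X(1)], of "1/2" m 1 n] ip_comb[OF zero zero comb[OF X(1) X(1)], of "-1" m 1 n]
        ip_comb[OF zero zero zero, of "-1"] nrm_sq[OF zero]
      by (simp add: norm_divide power2_eq_square)
    have "I \<le> J ?h" by (rule I_le[OF h])
    then show ?thesis using X(2)[of m] X(2)[of n] e1 e2 e3 lh unfolding J_def by simp
  qed
  have "\<exists>N. \<forall>m\<ge>N. \<forall>n\<ge>N. nrm (\<lambda>x. X m x - X n x) < e" if "e > 0" for e
  proof -
    obtain N :: nat where N: "4 / e\<^sup>2 < real N" using reals_Archimedean2 by blast
    have "nrm (\<lambda>x. X m x - X n x) < e" if "m \<ge> N" "n \<ge> N" for m n
    proof (rule power2_less_imp_less)
      have N0: "real N > 0" using N \<open>e > 0\<close> by (smt (verit) divide_pos_pos zero_less_power)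
      have "2 / real (Suc m) \<le> 2 / real (Suc N)" "2 / real (Suc n) \<le> 2 / real (Suc N)"
        using that by (auto intro!: divide_left_mono)
      moreover have "4 / real (Suc N) < 4 / real N" using N0 by (intro divide_strict_left_mono) auto
      moreover have "4 / real N < e\<^sup>2" using N N0 \<open>e > 0\<close> by (simp add: field_simps)
      ultimately show "(nrm (\<lambda>x. X m x - X n x))\<^sup>2 < e\<^sup>2" using cau[of m n] by simp
    qed (use \<open>e > 0\<close> in auto)
    then show ?thesis by blast
  qed
  then obtain u where u: "u \<in> V" "(\<lambda>n. nrm (\<lambda>x. X n x - u x)) \<longlonglongrightarrow> 0"
    using complete[of X] X(1) by blast
  have "(\<lambda>n. l (X n) - l u) \<longlonglongrightarrow> 0"
  proof (rule Lim_null_comparison)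
    have "norm (l (X n) - l u) \<le> M * nrm (\<lambda>x. X n x - u x)" for n
      using bound[OF diff[OF X(1) u(1)], of n] lin[OF X(1) u(1), of n "-1"] by simp
    then show "\<forall>\<^sub>F n in sequentially. norm (l (X n) - l u) \<le> M * nrm (\<lambda>x. X n x - u x)" by simp
    show "(\<lambda>n. M * nrm (\<lambda>x. X n x - u x)) \<longlonglongrightarrow> 0" using tendsto_mult_left[OF u(2), of M] by simp
  qed
  then have "(\<lambda>n. l (X n)) \<longlonglongrightarrow> l u" by (simp add: LIM_zero_iff)
  then have "(\<lambda>n. J (X n)) \<longlonglongrightarrow> J u"
    unfolding J_def by (intro tendsto_intros tendsto_nrm[OF X(1) u])
  moreover have "(\<lambda>n. J (X n)) \<longlonglongrightarrow> I"
  proof (rule tendsto_sandwich[OF _ _ tendsto_const])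
    show "\<forall>\<^sub>F n in sequentially. I \<le> J (X n)" using I_le X(1) by simp
    show "\<forall>\<^sub>F n in sequentially. J (X n) \<le> I + 1 / real (Suc n)" using X(2) by (simp add: less_imp_le)
    show "(\<lambda>n. I + 1 / real (Suc n)) \<longlonglongrightarrow> I"
      using tendsto_add[OF tendsto_const LIMSEQ_inverse_real_of_nat, of I] by (simp add: divide_inverse)
  qed
  ultimately have Ju: "J u = I" using LIMSEQ_unique by blast
  have Re0: "Re (ip u v) = Re (l v)" if v: "v \<in> V" for v
  proof (rule ccontr)
    define d where "d = Re (ip u v) - Re (l v)"
    assume "Re (ip u v) \<noteq> Re (l v)"
    then have d: "d \<noteq> 0" by (simp add: d_def)
    have *: "0 \<le> 2 * t * d + t\<^sup>2 * (nrm v)\<^sup>2" for t :: real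
    proof -
      have "I \<le> J (\<lambda>x. u x + of_real t * v x)" by (rule I_le[OF comb[OF u(1) v]])
      then show ?thesis
        unfolding J_def nrm_comb_sq[OF u(1) v] lin[OF u(1) v] using Ju
        by (simp add: J_def d_def algebra_simps)
    qed
    \<comment> \<open>The summand 1 keeps k positive when \<open>nrm v\<close> vanishes; the
      variation with t = -d/k then lowers the energy below its infimum.\<close>
    define k where "k = 1 + (nrm v)\<^sup>2"
    have k: "k > 0" by (simp add: k_def add_pos_nonneg)
    have "0 \<le> 2 * (- d / k) * d + (- d / k)\<^sup>2 * (nrm v)\<^sup>2" by (rule *)
    also have "\<dots> = (d\<^sup>2 / k\<^sup>2) * ((nrm v)\<^sup>2 - 2 * k)"
      using k by (simp add: field_simps power2_eq_square)
    also have "\<dots> < 0"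
    proof (rule mult_pos_neg)
      show "0 < d\<^sup>2 / k\<^sup>2" using d k by simp
      show "(nrm v)\<^sup>2 - 2 * k < 0" unfolding k_def
        by (rule less_le_trans[of _ "- (nrm v)\<^sup>2"]) auto
    qed
    finally show False by simp
  qed
  \<comment> \<open>Testing with \<open>\<i> * v\<close> turns the equality of real parts into that
    of imaginary parts.\<close>
  have "ip v u = l v" if v: "v \<in> V" for v
  proof -
    have iv: "(\<lambda>x. \<i> * v x) \<in> V" by (rule scale[OF v])
    have "ip u (\<lambda>x. \<i> * v x) = - \<i> * ip u v"
      using ip_comb_right[OF zero v u(1), of "\<i>"] ip_comb_right[OF zero zero u(1), of "-1"] by simp
    moreover have "l (\<lambda>x. \<i> * v x) = \<i> * l v"
      using lin[OF zero v, of "\<i>"] lin[OF zero zero, of "-1"] by simp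
    ultimately have "Im (ip u v) = - Im (l v)" using Re0[OF iv] by simp
    then show ?thesis using Re0[OF v] ip_sym[OF u(1) v] by (simp add: complex_eq_iff)
  qed
  then show ?thesis using u(1) by blast
qed

end

section \<open>The space of square integrable functions\<close>

lemma L2_D: "f \<in> L2 S \<Longrightarrow> f \<in> borel_measurable (lebesgue_on S)"
  "f \<in> L2 S \<Longrightarrow> integrable (lebesgue_on S) (\<lambda>x. (norm (f x))\<^sup>2)"
  by (auto simp: L2_def)

lemma L2_comb:
  assumes "f \<in> L2 S" "g \<in> L2 S" shows "(\<lambda>x. f x + c * g x) \<in> L2 S"
proof -
  have m: "(\<lambda>x. f x + c * g x) \<in> borel_measurable (lebesgue_on S)"
    using L2_D(1)[OF assms(1)] L2_D(1)[OF assms(2)] by measurable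
  have "integrable (lebesgue_on S) (\<lambda>x. 2 * (norm (f x))\<^sup>2 + (2 * (cmod c)\<^sup>2) * (norm (g x))\<^sup>2)"
    using assms by (auto simp: L2_def)
  then have "integrable (lebesgue_on S) (\<lambda>x. (norm (f x + c * g x))\<^sup>2)"
  proof (rule Bochner_Integration.integrable_bound)
    show "(\<lambda>x. (cmod (f x + c * g x))\<^sup>2) \<in> borel_measurable (lebesgue_on S)" using m by measurable
    have "(norm (f x + c * g x))\<^sup>2 \<le> 2 * (norm (f x))\<^sup>2 + 2 * (cmod c)\<^sup>2 * (norm (g x))\<^sup>2" for x
    proof -
      have "(norm (f x + c * g x))\<^sup>2 \<le> (norm (f x) + cmod c * norm (g x))\<^sup>2"
        using norm_triangle_ineq[of "f x" "c * g x"] by (intro power_mono) (auto simp: norm_mult)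
      also have "\<dots> \<le> 2 * (norm (f x))\<^sup>2 + 2 * (cmod c * norm (g x))\<^sup>2"
        using sum_squares_bound[of "norm (f x)" "cmod c * norm (g x)"] by (simp add: power2_sum)
      finally show ?thesis by (simp add: power_mult_distrib)
    qed
    then show "AE x in lebesgue_on S. norm ((cmod (f x + c * g x))\<^sup>2) \<le> norm (2 * (cmod (f x))\<^sup>2 + 2 * (cmod c)\<^sup>2 * (cmod (g x))\<^sup>2)"
      by (intro AE_I2) (auto intro: order_trans)
  qed
  with m show ?thesis by (simp add: L2_def)
qed

lemma L2_mult_integrable:
  assumes "f \<in> L2 S" "g \<in> L2 S" shows "integrable (lebesgue_on S) (\<lambda>x. f x * g x)"
proof (rule Bochner_Integration.integrable_bound)
  show "integrable (lebesgue_on S) (\<lambda>x. (norm (f x))\<^sup>2 + (norm (g x))\<^sup>2)"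
    using assms by (auto simp: L2_def)
  show "(\<lambda>x. f x * g x) \<in> borel_measurable (lebesgue_on S)"
    using L2_D(1)[OF assms(1)] L2_D(1)[OF assms(2)] by measurable
  have "norm (f x * g x) \<le> norm ((norm (f x))\<^sup>2 + (norm (g x))\<^sup>2)" for x
  proof -
    have "2 * (norm (f x) * norm (g x)) \<le> (norm (f x))\<^sup>2 + (norm (g x))\<^sup>2"
      using sum_squares_bound[of "norm (f x)" "norm (g x)"] by (simp add: mult.assoc)
    moreover have "0 \<le> norm (f x) * norm (g x)" by simp
    ultimately have "norm (f x) * norm (g x) \<le> (norm (f x))\<^sup>2 + (norm (g x))\<^sup>2" by linarith
    then show ?thesis by (simp add: norm_mult)
  qed
  then show "AE x in lebesgue_on S. norm (f x * g x) \<le> norm ((norm (f x))\<^sup>2 + (norm (g x))\<^sup>2)" by simp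
qed

lemma L2_cnj: "f \<in> L2 S \<Longrightarrow> (\<lambda>x. cnj (f x)) \<in> L2 S"
  by (auto simp: L2_def intro: borel_measurable_continuous_onI[THEN measurable_compose_rev] continuous_intros)

lemma L2_zero: "(\<lambda>x. 0) \<in> L2 S" by (simp add: L2_def)

lemma L2_inner_integrable: "f \<in> L2 S \<Longrightarrow> g \<in> L2 S \<Longrightarrow> integrable (lebesgue_on S) (\<lambda>x. f x * cnj (g x))"
  by (intro L2_mult_integrable L2_cnj)

lemma L2_inner_self: "L2_inner S f f = of_real ((L2_norm S f)\<^sup>2)"
proof -
  have "L2_inner S f f = (\<integral>x. complex_of_real ((norm (f x))\<^sup>2) \<partial>lebesgue_on S)"
    by (simp only: L2_inner_def complex_norm_square)
  then show ?thesis by (simp only: integral_complex_of_real) (simp add: L2_norm_def)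
qed

interpretation L2ip: semi_ip "L2 S" "L2_inner S" for S
proof
  show "L2 S \<noteq> {}" using L2_zero by blast
  fix u v w c assume u: "u \<in> L2 S" and v: "v \<in> L2 S"
  show "(\<lambda>x. u x + c * v x) \<in> L2 S" by (rule L2_comb[OF u v])
  show "L2_inner S v u = cnj (L2_inner S u v)"
  proof -
    have "(\<lambda>x. v x * cnj (u x)) = (\<lambda>x. cnj (u x * cnj (v x)))" by (simp add: mult.commute)
    then show ?thesis by (simp add: L2_inner_def flip: complex_cnj_mult)
  qed
  show "0 \<le> Re (L2_inner S u u)" by (simp add: L2_inner_self)
  assume w: "w \<in> L2 S"
  show "L2_inner S (\<lambda>x. u x + c * v x) w = L2_inner S u w + c * L2_inner S v w"
    using L2_inner_integrable[OF u w] L2_inner_integrable[OF v w]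
    by (simp add: L2_inner_def distrib_right mult.assoc)
qed

lemma nrm_L2 [simp]: "semi_ip.nrm (L2_inner S) = L2_norm S"
  by (rule ext) (simp add: L2ip.nrm_def L2_inner_self L2_norm_def)

lemmas L2_CS = L2ip.cauchy_schwarz[simplified]
lemmas L2_triangle = L2ip.triangle[simplified]
lemmas L2_norm_diff_le = L2ip.nrm_diff_le[simplified]
lemmas L2_norm_add_le = L2ip.nrm_add_le[simplified]
lemmas L2_tendsto_norm = L2ip.tendsto_nrm[simplified]
lemmas L2_tendsto_inner = L2ip.tendsto_ip[simplified]
lemmas L2_norm_comb_sq = L2ip.nrm_comb_sq[simplified]
lemmas L2_diff = L2ip.diff
lemmas L2_scale = L2ip.scale

lemma L2_norm_nonneg: "0 \<le> L2_norm S f" by (simp add: L2_norm_def)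

lemma L2_norm_sq: "(L2_norm S f)\<^sup>2 = (\<integral>x. (norm (f x))\<^sup>2 \<partial>lebesgue_on S)"
  by (simp add: L2_norm_def)

lemma L2_norm_zero: "L2_norm S (\<lambda>x. 0) = 0" by (simp add: L2_norm_def)

lemma L2_norm_cong_AE:
  assumes "f \<in> L2 S" "g \<in> L2 S" "AE x in lebesgue_on S. f x = g x"
  shows "L2_norm S f = L2_norm S g"
proof -
  note [measurable] = L2_D(1)[OF assms(1)] L2_D(1)[OF assms(2)]
  have "(\<integral>x. (norm (f x))\<^sup>2 \<partial>lebesgue_on S) = (\<integral>x. (norm (g x))\<^sup>2 \<partial>lebesgue_on S)"
    by (rule integral_cong_AE) (use assms(3) in auto)
  then show ?thesis by (simp add: L2_norm_def)
qed

lemma L2_inner_cong_AE: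
  assumes "f \<in> L2 S" "f' \<in> L2 S" "AE x in lebesgue_on S. f x = f' x"
    and "g \<in> L2 S" "g' \<in> L2 S" "AE x in lebesgue_on S. g x = g' x"
  shows "L2_inner S f g = L2_inner S f' g'"
proof -
  note [measurable] = L2_D(1)[OF assms(1)] L2_D(1)[OF assms(2)] L2_D(1)[OF L2_cnj[OF assms(4)]] L2_D(1)[OF L2_cnj[OF assms(5)]]
  show ?thesis unfolding L2_inner_def
    by (rule integral_cong_AE) (use assms(3,6) in auto)
qed

lemma L2_norm_eq_0_AE:
  assumes "f \<in> L2 S" "L2_norm S f = 0" shows "AE x in lebesgue_on S. f x = 0"
proof -
  have "(\<integral>x. (norm (f x))\<^sup>2 \<partial>lebesgue_on S) = 0" using assms(2) L2_norm_sq[of S f] by simp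
  then show ?thesis
    using integral_nonneg_eq_0_iff_AE[OF L2_D(2)[OF assms(1)]] by simp
qed

lemma L2_norm_mono:
  assumes "f \<in> L2 S" "g \<in> L2 S" "\<And>x. x \<in> S \<Longrightarrow> norm (f x) \<le> norm (g x)"
  shows "L2_norm S f \<le> L2_norm S g"
  unfolding L2_norm_def
  by (intro real_sqrt_le_mono integral_mono L2_D assms power_mono) auto

lemma bounded_in_L2:
  assumes "S \<in> lmeasurable" "f \<in> borel_measurable (lebesgue_on S)" "\<And>x. x \<in> S \<Longrightarrow> norm (f x) \<le> B"
  shows "f \<in> L2 S" "0 \<le> B \<Longrightarrow> L2_norm S f \<le> B * sqrt (measure lebesgue S)"
proof -
  interpret finite_measure "lebesgue_on S" by (rule finite_measure_lebesgue_on[OF assms(1)])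
  have S: "S \<in> sets lebesgue" using assms(1) by (simp add: fmeasurableD)
  have b: "(norm (f x))\<^sup>2 \<le> B\<^sup>2" if "x \<in> S" for x using assms(3)[OF that] by (intro power_mono) auto
  have i: "integrable (lebesgue_on S) (\<lambda>x. (norm (f x))\<^sup>2)"
  proof (rule integrable_const_bound)
    show "AE x in lebesgue_on S. norm ((norm (f x))\<^sup>2) \<le> B\<^sup>2" using b S by (intro AE_I2) (auto simp: space_restrict_space)
    show "(\<lambda>x. (norm (f x))\<^sup>2) \<in> borel_measurable (lebesgue_on S)" using assms(2) by measurable
  qed
  then show "f \<in> L2 S" using assms(2) by (simp add: L2_def)
  have "(\<integral>x. (norm (f x))\<^sup>2 \<partial>lebesgue_on S) \<le> (\<integral>x. B\<^sup>2 \<partial>lebesgue_on S)"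
    by (rule integral_mono[OF i]) (use b S in \<open>auto simp: space_restrict_space\<close>)
  also have "\<dots> = B\<^sup>2 * measure lebesgue S"
    using S by (simp add: measure_restrict_space space_restrict_space mult.commute)
  finally have "sqrt (\<integral>x. (norm (f x))\<^sup>2 \<partial>lebesgue_on S) \<le> sqrt (B\<^sup>2 * measure lebesgue S)" by simp
  then show "L2_norm S f \<le> B * sqrt (measure lebesgue S)" if "0 \<le> B"
    unfolding L2_norm_def using that by (simp add: real_sqrt_mult)
qed

lemma continuous_measurable_on:
  fixes f :: "'a::euclidean_space \<Rightarrow> 'b::euclidean_space"
  assumes "continuous_on S f" "open S" shows "f \<in> borel_measurable (lebesgue_on S)"
  using assms by (intro continuous_imp_measurable_on_sets_lebesgue) auto

lemma continuous_in_L2: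
  assumes "open S" "bounded S" "continuous_on (closure S) f"
  shows "f \<in> L2 S"
proof -
  have "compact (f ` closure S)" using assms by (intro compact_continuous_image) auto
  then obtain B where B: "\<And>x. x \<in> closure S \<Longrightarrow> norm (f x) \<le> B"
    using compact_imp_bounded bounded_iff by (metis imageI)
  show ?thesis
    by (rule bounded_in_L2(1)[where B="max B 0"])
       (use assms B closure_subset in \<open>auto intro!: lmeasurable_open continuous_measurable_on
          intro: continuous_on_subset simp: le_max_iff_disj\<close>)
qed

text \<open>Riesz-Fischer: along a subsequence with geometrically small increments the sum of the
  increments has finite L1 norm, because S has finite measure. Hence the subsequence converges
  almost everywhere, and Fatou's lemma bounds the distance to the limit.\<close>

theorem L2_complete:
  fixes X :: "nat \<Rightarrow> 'a::euclidean_space \<Rightarrow> complex"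
  assumes S: "S \<in> lmeasurable" and X: "\<And>n. X n \<in> L2 S"
    and cau: "\<And>e. e > 0 \<Longrightarrow> \<exists>N. \<forall>m\<ge>N. \<forall>n\<ge>N. L2_norm S (\<lambda>x. X m x - X n x) < e"
  shows "\<exists>f\<in>L2 S. (\<lambda>n. L2_norm S (\<lambda>x. X n x - f x)) \<longlonglongrightarrow> 0"
proof -
  let ?M = "lebesgue_on S"
  have Xm [measurable]: "X n \<in> borel_measurable ?M" for n by (rule L2_D(1)[OF X])
  have "\<exists>N. \<forall>m\<ge>N. \<forall>n\<ge>N. L2_norm S (\<lambda>x. X m x - X n x) < (1/2)^j" for j :: nat
    by (rule cau) simp
  then obtain N where N: "\<And>j m n. m \<ge> N j \<Longrightarrow> n \<ge> N j \<Longrightarrow> L2_norm S (\<lambda>x. X m x - X n x) < (1/2)^j"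
    by metis
  \<comment> \<open>Partial sums of N, so that the index is monotone in j and dominates
    \<open>N j\<close>.\<close>
  define r where "r j = (\<Sum>i\<le>j. N i)" for j
  have rN: "N j \<le> r j" for j unfolding r_def by (rule member_le_sum) auto
  have rmono: "r j \<le> r k" if "j \<le> k" for j k unfolding r_def using that by (intro sum_mono2) auto
  define h where "h j x = X (r (Suc j)) x - X (r j) x" for j x
  have hL2: "h j \<in> L2 S" for j unfolding h_def by (rule L2_diff[OF X X])
  have one: "(\<lambda>x. 1) \<in> L2 S" by (rule bounded_in_L2(1)[OF S, where B=1]) auto
  have hint: "integrable ?M (\<lambda>x. norm (h j x))" for j
    using L2_mult_integrable[OF hL2 one] by simp
  have hn: "(\<integral>x. norm (h j x) \<partial>?M) \<le> (1/2)^j * L2_norm S (\<lambda>x. 1)" for j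
  proof -
    have nh: "(\<lambda>x. complex_of_real (norm (h j x))) \<in> L2 S"
      using hL2[of j] by (auto simp: L2_def)
    have "(\<integral>x. norm (h j x) \<partial>?M) = cmod (L2_inner S (\<lambda>x. complex_of_real (norm (h j x))) (\<lambda>x. 1))"
      by (simp add: L2_inner_def)
    also have "\<dots> \<le> L2_norm S (\<lambda>x. complex_of_real (norm (h j x))) * L2_norm S (\<lambda>x. 1)"
      by (rule L2_CS[OF nh one])
    also have "L2_norm S (\<lambda>x. complex_of_real (norm (h j x))) = L2_norm S (h j)" by (simp add: L2_norm_def)
    also have "\<dots> \<le> (1/2)^j" unfolding h_def using N[of j "r (Suc j)" "r j"] rN[of j] rmono[of j "Suc j"] by auto
    finally show ?thesis by (simp add: mult_right_mono L2_norm_nonneg)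
  qed
  have "(\<integral>\<^sup>+x. (\<Sum>j. ennreal (norm (h j x))) \<partial>?M) = (\<Sum>j. \<integral>\<^sup>+x. ennreal (norm (h j x)) \<partial>?M)"
    by (rule nn_integral_suminf) (simp add: h_def)
  also have "\<dots> = (\<Sum>j. ennreal (\<integral>x. norm (h j x) \<partial>?M))"
    by (intro suminf_cong nn_integral_eq_integral hint) auto
  also have "\<dots> \<le> (\<Sum>j. ennreal ((1/2)^j * L2_norm S (\<lambda>x. 1)))"
    by (intro suminf_le ennreal_leI hn summableI)
  also have "\<dots> = ennreal (\<Sum>j. (1/2)^j * L2_norm S (\<lambda>x. 1))"
    by (intro suminf_ennreal2 summable_mult2 summable_geometric) (auto simp: L2_norm_nonneg)
  finally have "(\<integral>\<^sup>+x. (\<Sum>j. ennreal (norm (h j x))) \<partial>?M) \<noteq> \<infinity>" by (auto simp: top_unique)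
  then have "AE x in ?M. (\<Sum>j. ennreal (norm (h j x))) \<noteq> \<infinity>"
    by (intro nn_integral_PInf_AE) (auto simp: h_def)
  then have conv: "AE x in ?M. convergent (\<lambda>j. X (r j) x)"
  proof eventually_elim
    case (elim x)
    then have "summable (\<lambda>j. norm (h j x))" by (intro summable_suminf_not_top) auto
    then have "summable (\<lambda>j. h j x)" by (rule summable_norm_cancel)
    then have "convergent (\<lambda>n. \<Sum>j<n. h j x)" by (simp add: summable_iff_convergent)
    then have "convergent (\<lambda>n. X (r 0) x + (\<Sum>j<n. h j x))" by (simp add: convergent_add_const_iff)
    moreover have "X (r 0) x + (\<Sum>j<n. h j x) = X (r n) x" for n
      by (simp add: h_def sum_lessThan_telescope[where f="\<lambda>j. X (r j) x"])
    ultimately show ?case by simp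
  qed
  define f where "f x = lim (\<lambda>j. X (r j) x)" for x
  have fm [measurable]: "f \<in> borel_measurable ?M" unfolding f_def by (rule borel_measurable_lim_metric) simp
  have lim: "AE x in ?M. (\<lambda>j. X (r j) x) \<longlonglongrightarrow> f x"
    using conv by eventually_elim (simp add: f_def convergent_LIMSEQ_iff)
  \<comment> \<open>Fatou's lemma along the subsequence. The estimate is kept in
    \<open>ennreal\<close> because the integrability of the limit is only deduced from it.\<close>
  have fat: "(\<integral>\<^sup>+x. ennreal ((norm (X n x - f x))\<^sup>2) \<partial>?M) \<le> ennreal (((1/2)^k)\<^sup>2)" if "n \<ge> r k" for n k
  proof -
    have "(\<integral>\<^sup>+x. ennreal ((norm (X n x - f x))\<^sup>2) \<partial>?M)
        = (\<integral>\<^sup>+x. liminf (\<lambda>j. ennreal ((norm (X n x - X (r j) x))\<^sup>2)) \<partial>?M)"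
    proof (rule nn_integral_cong_AE)
      show "AE x in ?M. ennreal ((norm (X n x - f x))\<^sup>2) = liminf (\<lambda>j. ennreal ((norm (X n x - X (r j) x))\<^sup>2))"
        using lim
      proof eventually_elim
        case (elim x)
        then have "(\<lambda>j. ennreal ((norm (X n x - X (r j) x))\<^sup>2)) \<longlonglongrightarrow> ennreal ((norm (X n x - f x))\<^sup>2)"
          by (intro tendsto_intros)
        then show ?case by (intro lim_imp_Liminf[symmetric]) auto
      qed
    qed
    also have "\<dots> \<le> liminf (\<lambda>j. \<integral>\<^sup>+x. ennreal ((norm (X n x - X (r j) x))\<^sup>2) \<partial>?M)"
      by (rule nn_integral_liminf) simp
    also have "\<dots> \<le> limsup (\<lambda>j. \<integral>\<^sup>+x. ennreal ((norm (X n x - X (r j) x))\<^sup>2) \<partial>?M)"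
      by (rule Liminf_le_Limsup) simp
    also have "\<dots> \<le> ennreal (((1/2)^k)\<^sup>2)"
    proof (rule Limsup_bounded)
      show "\<forall>\<^sub>F j in sequentially. (\<integral>\<^sup>+x. ennreal ((norm (X n x - X (r j) x))\<^sup>2) \<partial>?M) \<le> ennreal (((1/2)^k)\<^sup>2)"
        unfolding eventually_sequentially
      proof (intro exI allI impI)
        fix j assume j: "j \<ge> k"
        have "(\<integral>\<^sup>+x. ennreal ((norm (X n x - X (r j) x))\<^sup>2) \<partial>?M) = ennreal ((L2_norm S (\<lambda>x. X n x - X (r j) x))\<^sup>2)"
          unfolding L2_norm_sq by (rule nn_integral_eq_integral[OF L2_D(2)[OF L2_diff[OF X X]]]) simp
        also have "\<dots> \<le> ennreal (((1/2)^k)\<^sup>2)"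
          using N[of k n "r j"] that rN[of k] rmono[OF j] by (intro ennreal_leI power_mono L2_norm_nonneg) auto
        finally show "(\<integral>\<^sup>+x. ennreal ((norm (X n x - X (r j) x))\<^sup>2) \<partial>?M) \<le> ennreal (((1/2)^k)\<^sup>2)" .
      qed
    qed
    finally show ?thesis .
  qed
  have dL2: "(\<lambda>x. X n x - f x) \<in> L2 S" if "n \<ge> r k" for n k
  proof -
    have "integrable ?M (\<lambda>x. (norm (X n x - f x))\<^sup>2)"
      by (rule integrableI_bounded) (use fat[OF that] in \<open>auto simp: less_top[symmetric] top_unique\<close>)
    then show ?thesis by (simp add: L2_def)
  qed
  have "(\<lambda>x. X (r 0) x - (X (r 0) x - f x)) \<in> L2 S" by (rule L2_diff[OF X dL2[of 0]]) simp
  then have fL2: "f \<in> L2 S" by simp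
  have bd: "L2_norm S (\<lambda>x. X n x - f x) \<le> (1/2)^k" if "n \<ge> r k" for n k
  proof -
    have "ennreal ((L2_norm S (\<lambda>x. X n x - f x))\<^sup>2) \<le> ennreal (((1/2)^k)\<^sup>2)"
      using fat[OF that] nn_integral_eq_integral[OF L2_D(2)[OF dL2[OF that]]] unfolding L2_norm_sq by simp
    then have "(L2_norm S (\<lambda>x. X n x - f x))\<^sup>2 \<le> ((1/2)^k)\<^sup>2" by (simp add: ennreal_le_iff2)
    then show ?thesis by (rule power2_le_imp_le) simp
  qed
  have "(\<lambda>n. L2_norm S (\<lambda>x. X n x - f x)) \<longlonglongrightarrow> 0"
  proof (rule LIMSEQ_I)
    fix e :: real assume "e > 0"
    then obtain k where k: "(1/2)^k < e" using real_arch_pow_inv[of e "1/2"] by auto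
    have "norm (L2_norm S (\<lambda>x. X n x - f x) - 0) < e" if "n \<ge> r k" for n
      using bd[OF that] k L2_norm_nonneg[of S "\<lambda>x. X n x - f x"] by simp
    then show "\<exists>no. \<forall>n\<ge>no. norm (L2_norm S (\<lambda>x. X n x - f x) - 0) < e" by blast
  qed
  with fL2 show ?thesis by blast
qed

section \<open>Weak derivatives\<close>

lemma integrable_lborel_compact_support:
  fixes f :: "'a::euclidean_space \<Rightarrow> complex"
  assumes "continuous_on UNIV f" "compact K" "\<And>x. x \<notin> K \<Longrightarrow> f x = 0"
  shows "integrable lborel f"
proof -
  have "integrable lborel (\<lambda>x. indicator K x *\<^sub>R f x)"
    using assms by (intro borel_integrable_compact) (auto intro: continuous_on_subset)
  moreover have "(\<lambda>x. indicator K x *\<^sub>R f x) = f" using assms(3) by (auto simp: indicator_def fun_eq_iff)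
  ultimately show ?thesis by simp
qed

lemma lebesgue_on_integral_eq_lborel:
  fixes f :: "'a::euclidean_space \<Rightarrow> complex"
  assumes "f \<in> borel_measurable borel" "\<And>x. x \<notin> S \<Longrightarrow> f x = 0" "S \<in> sets lebesgue"
  shows "(\<integral>x. f x \<partial>lebesgue_on S) = (\<integral>x. f x \<partial>lborel)"
proof -
  have "(\<integral>x. f x \<partial>lebesgue_on S) = (\<integral>x. indicator S x *\<^sub>R f x \<partial>lebesgue)"
    using assms(3) by (intro integral_restrict_space) auto
  also have "(\<lambda>x. indicator S x *\<^sub>R f x) = f" using assms(2) by (auto simp: indicator_def fun_eq_iff)
  also have "integral\<^sup>L lebesgue f = integral\<^sup>L lborel f"
    using assms(1) by (intro integral_completion) simp
  finally show ?thesis .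
qed

lemma frechet_zero_outside:
  fixes g :: "'a::euclidean_space \<Rightarrow> complex"
  assumes "(g has_derivative g') (at x)" "closed K" "\<And>x. x \<notin> K \<Longrightarrow> g x = 0" "x \<notin> K"
  shows "g' v = 0"
proof -
  have "(g has_derivative (\<lambda>_. 0)) (at x)"
    by (rule has_derivative_transform_within_open[OF has_derivative_const[of 0] open_Compl[OF assms(2)]])
       (use assms in auto)
  from has_derivative_unique[OF this assms(1)] show ?thesis by metis
qed

lemma line_has_derivative:
  fixes g :: "'a::euclidean_space \<Rightarrow> complex"
  assumes "(g has_derivative g') (at (x + t *\<^sub>R e))"
  shows "((\<lambda>t. g (x + t *\<^sub>R e)) has_derivative (\<lambda>s. g' (s *\<^sub>R e))) (at t)"
proof -
  have "((\<lambda>t. x + t *\<^sub>R e) has_derivative (\<lambda>s. s *\<^sub>R e)) (at t)"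
    by (auto intro!: derivative_eq_intros)
  from has_derivative_compose[OF this assms] show ?thesis .
qed

text \<open>Translation invariance makes every difference quotient along e integrate to zero. The
  quotients are uniformly bounded with a common compact support, so dominated convergence transfers
  this to the derivative, in any dimension and any direction.\<close>

lemma integral_directional_derivative_eq_0:
  fixes g :: "'a::euclidean_space \<Rightarrow> complex"
  assumes der: "\<And>x. (g has_derivative g' x) (at x)" and cont: "continuous_on UNIV (\<lambda>x. g' x e)"
    and K: "compact K" and z: "\<And>x. x \<notin> K \<Longrightarrow> g x = 0"
  shows "(\<integral>x. g' x e \<partial>lborel) = 0"
proof -
  have gc: "continuous_on UNIV g"
    using der has_derivative_continuous by (intro continuous_at_imp_continuous_on) blast
  have gi: "integrable lborel g" by (rule integrable_lborel_compact_support[OF gc K z])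
  have z': "g' x e = 0" if "x \<notin> K" for x
    by (rule frechet_zero_outside[OF der compact_imp_closed[OF K] z that])
  have "compact ((\<lambda>x. g' x e) ` K)"
    using K cont by (intro compact_continuous_image) (auto intro: continuous_on_subset)
  then obtain M where M: "\<And>x. x \<in> K \<Longrightarrow> norm (g' x e) \<le> M"
    using compact_imp_bounded bounded_iff by (metis imageI)
  define M' where "M' = max M 0"
  have M': "norm (g' x e) \<le> M'" for x
    using M[of x] z'[of x] by (cases "x \<in> K") (auto simp: M'_def le_max_iff_disj)
  define h where "h n = 1 / real (Suc n)" for n
  have h0: "h n > 0" "h n \<le> 1" for n by (auto simp: h_def)
  define q where "q n x = real (Suc n) *\<^sub>R (g (x + h n *\<^sub>R e) - g x)" for n x
  \<comment> \<open>The set K swept along -e for parameters up to 1: every difference quotient with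
    step at most 1 vanishes outside it.\<close>
  define K' where "K' = (\<lambda>(k, t). k - t *\<^sub>R e) ` (K \<times> {0..1::real})"
  have K': "compact K'" unfolding K'_def case_prod_unfold
    by (intro compact_continuous_image compact_Times K continuous_intros) auto
  have sub: "x \<in> K'" if "x + t *\<^sub>R e \<in> K" "0 \<le> t" "t \<le> 1" for x t
    unfolding K'_def using that by (auto intro!: image_eqI[of _ _ "(x + t *\<^sub>R e, t)"])
  have bound: "norm (q n x) \<le> M' * indicator K' x" for n x
  proof (cases "x \<in> K'")
    case True
    have "\<exists>t\<in>{0<..<h n}. norm (g (x + h n *\<^sub>R e) - g (x + 0 *\<^sub>R e)) \<le> norm (g' (x + t *\<^sub>R e) ((h n - 0) *\<^sub>R e))"
    proof (rule mvt_general)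
      show "continuous_on {0..h n} (\<lambda>t. g (x + t *\<^sub>R e))"
        by (intro continuous_on_compose2[OF gc] continuous_intros) auto
      show "((\<lambda>t. g (x + t *\<^sub>R e)) has_derivative (\<lambda>s. g' (x + t *\<^sub>R e) (s *\<^sub>R e))) (at t)" for t
        by (rule line_has_derivative[OF der])
    qed (use h0 in auto)
    then obtain t where t: "norm (g (x + h n *\<^sub>R e) - g x) \<le> norm (g' (x + t *\<^sub>R e) (h n *\<^sub>R e))" by auto
    also have "g' (x + t *\<^sub>R e) (h n *\<^sub>R e) = h n *\<^sub>R g' (x + t *\<^sub>R e) e"
      by (rule linear_scale[OF has_derivative_linear[OF der]])
    also have "norm \<dots> \<le> h n * M'" using M'[of "x + t *\<^sub>R e"] h0[of n] by (simp add: mult_left_mono)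
    finally have "real (Suc n) * norm (g (x + h n *\<^sub>R e) - g x) \<le> real (Suc n) * (h n * M')" by (intro mult_left_mono) auto
    also have "\<dots> = M'" by (simp add: h_def)
    finally show ?thesis using True by (simp add: q_def)
  next
    case False
    have "x \<notin> K" using sub[of x 0] False by auto
    moreover have "x + h n *\<^sub>R e \<notin> K" using sub[of x "h n"] h0[of n] False by auto
    ultimately show ?thesis using z False by (simp add: q_def)
  qed
  have lim: "(\<lambda>n. q n x) \<longlonglongrightarrow> g' x e" for x
  proof -
    have "((\<lambda>t. g (x + t *\<^sub>R e)) has_vector_derivative g' x e) (at 0)"
      using line_has_derivative[of g "g' x" x 0 e] der[of x] linear_scale[OF has_derivative_linear[OF der[of x]]]
      by (simp add: has_vector_derivative_def)
    then have "((\<lambda>t. (g (x + t *\<^sub>R e) - g x) /\<^sub>R t) \<longlongrightarrow> g' x e) (at 0)"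
    proof -
      assume "((\<lambda>t. g (x + t *\<^sub>R e)) has_vector_derivative g' x e) (at 0)"
      then have A: "((\<lambda>t. norm (g (x + t *\<^sub>R e) - g x - t *\<^sub>R g' x e) / norm t) \<longlongrightarrow> 0) (at 0)"
        unfolding has_vector_derivative_def has_derivative_at by simp
      have B: "norm (g (x + t *\<^sub>R e) - g x - t *\<^sub>R g' x e) / norm t
          = norm ((g (x + t *\<^sub>R e) - g x) /\<^sub>R t - g' x e)" if "t \<noteq> 0" for t
      proof -
        have "(g (x + t *\<^sub>R e) - g x) /\<^sub>R t - g' x e = (g (x + t *\<^sub>R e) - g x - t *\<^sub>R g' x e) /\<^sub>R t"
          using that by (simp add: scaleR_diff_right)
        then show ?thesis by (simp add: divide_inverse mult.commute)
      qed
      have "((\<lambda>t. norm ((g (x + t *\<^sub>R e) - g x) /\<^sub>R t - g' x e)) \<longlongrightarrow> 0) (at 0)"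
        by (rule Lim_transform_eventually[OF A]) (use B in \<open>auto simp: eventually_at_filter\<close>)
      then show ?thesis by (rule LIM_zero_cancel[OF tendsto_norm_zero_cancel])
    qed
    moreover have "filterlim h (at 0) sequentially"
      unfolding filterlim_at h_def using LIMSEQ_inverse_real_of_nat by (auto simp: divide_inverse)
    ultimately have "(\<lambda>n. (g (x + h n *\<^sub>R e) - g x) /\<^sub>R h n) \<longlonglongrightarrow> g' x e"
      by (rule filterlim_compose)
    then show ?thesis by (simp add: q_def h_def)
  qed
  have gbor: "g \<in> borel_measurable borel" by (intro borel_measurable_continuous_onI gc)
  have shift_int: "integrable lborel (\<lambda>x. g (x + c))" "(\<integral>x. g (x + c) \<partial>lborel) = (\<integral>x. g x \<partial>lborel)" for c
  proof -
    have "integrable (distr lborel borel ((+) c)) g" using gi by (simp add: lborel_distr_plus)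
    then show "integrable lborel (\<lambda>x. g (x + c))"
      by (subst (asm) integrable_distr_eq) (use gbor in \<open>auto simp: add.commute\<close>)
    have "(\<integral>x. g x \<partial>lborel) = (\<integral>x. g x \<partial>distr lborel borel ((+) c))" by (simp add: lborel_distr_plus)
    also have "\<dots> = (\<integral>x. g (c + x) \<partial>lborel)" by (rule integral_distr) (use gbor in auto)
    finally show "(\<integral>x. g (x + c) \<partial>lborel) = (\<integral>x. g x \<partial>lborel)" by (simp add: add.commute)
  qed
  have "(\<integral>x. q n x \<partial>lborel) = 0" for n
    unfolding q_def using shift_int[of "h n *\<^sub>R e"] gi by simp
  moreover have "(\<lambda>n. \<integral>x. q n x \<partial>lborel) \<longlonglongrightarrow> (\<integral>x. g' x e \<partial>lborel)"
  proof (rule integral_dominated_convergence[where w="\<lambda>x. M' * indicator K' x"])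
    show "(\<lambda>x. g' x e) \<in> borel_measurable lborel" using cont by (simp add: borel_measurable_continuous_onI)
    show "q n \<in> borel_measurable lborel" for n
      unfolding q_def[abs_def] using gbor by measurable
    show "integrable lborel (\<lambda>x. M' * indicator K' x)"
      using borel_integrable_compact[OF K', of "\<lambda>x. M'"] by (simp add: mult.commute)
  qed (use lim bound in auto)
  ultimately show ?thesis by (simp add: LIMSEQ_const_iff)
qed

text \<open>The product of f with a test function has compact support, so its directional derivative
  integrates to zero, and the product rule splits that integral.\<close>

lemma classical_weak_deriv:
  fixes S :: "'a::euclidean_space set"
  assumes S: "open S" and f: "smooth f"
  shows "has_weak_deriv S e f (\<lambda>x. frechet_derivative f (at x) e)"
  unfolding has_weak_deriv_def
proof (intro allI impI)
  fix \<phi> assume "test_function S \<phi>"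
  then obtain K where K': "compact K" "K \<subseteq> S" "\<forall>x. x \<notin> K \<longrightarrow> \<phi> x = 0" and s: "smooth \<phi>"
    unfolding test_function_def by blast
  have K: "compact K" "K \<subseteq> S" "\<And>x. x \<notin> K \<Longrightarrow> \<phi> x = 0" using K' by auto
  let ?f = "\<lambda>x. frechet_derivative f (at x)" and ?p = "\<lambda>x. frechet_derivative \<phi> (at x)"
  have Sm: "S \<in> sets lebesgue" using S by simp
  have c1: "continuous_on UNIV (\<lambda>x. f x * ?p x e)"
    by (intro continuous_intros smooth_continuous f smooth_frechet s)
  have c2: "continuous_on UNIV (\<lambda>x. ?f x e * \<phi> x)"
    by (intro continuous_intros smooth_continuous f smooth_frechet s)
  have p0: "?p x e = 0" if "x \<notin> K" for x
    by (rule frechet_zero_outside[OF smooth_has_derivative[OF s] compact_imp_closed[OF K(1)] K(3) that])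
  have i1: "integrable lborel (\<lambda>x. f x * ?p x e)"
    by (rule integrable_lborel_compact_support[OF c1 K(1)]) (simp add: p0)
  have i2: "integrable lborel (\<lambda>x. ?f x e * \<phi> x)"
    by (rule integrable_lborel_compact_support[OF c2 K(1)]) (simp add: K)
  have "0 = (\<integral>x. (\<lambda>v. f x * ?p x v + ?f x v * \<phi> x) e \<partial>lborel)"
    by (rule integral_directional_derivative_eq_0[OF has_derivative_mult[OF smooth_has_derivative[OF f] smooth_has_derivative[OF s]], symmetric])
       (use c1 c2 K in \<open>auto intro: continuous_intros\<close>)
  also have "\<dots> = (\<integral>x. f x * ?p x e \<partial>lborel) + (\<integral>x. ?f x e * \<phi> x \<partial>lborel)" using i1 i2 by simp
  also have "(\<integral>x. f x * ?p x e \<partial>lborel) = (\<integral>x. f x * ?p x e \<partial>lebesgue_on S)"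
    by (rule lebesgue_on_integral_eq_lborel[symmetric])
       (use c1 p0 K Sm in \<open>auto intro: borel_measurable_continuous_onI\<close>)
  also have "(\<integral>x. ?f x e * \<phi> x \<partial>lborel) = (\<integral>x. ?f x e * \<phi> x \<partial>lebesgue_on S)"
    by (rule lebesgue_on_integral_eq_lborel[symmetric])
       (use c2 K Sm in \<open>auto intro: borel_measurable_continuous_onI\<close>)
  finally show "(\<integral>x. f x * ?p x e \<partial>lebesgue_on S) = - (\<integral>x. ?f x e * \<phi> x \<partial>lebesgue_on S)"
    by (simp add: eq_neg_iff_add_eq_0)
qed

section \<open>Bump functions of boxes and the fundamental lemma of the calculus of
  variations\<close>

definition box_bump :: "'a::euclidean_space \<Rightarrow> 'a \<Rightarrow> nat \<Rightarrow> 'a \<Rightarrow> real" where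
  "box_bump a b n x = (\<Prod>i\<in>Basis. step (real n * (x \<bullet> i - a \<bullet> i)) * step (real n * (b \<bullet> i - x \<bullet> i)))"

lemma smooth_box_bump: "smooth (\<lambda>x. complex_of_real (box_bump a b n x))"
proof -
  have "smooth (\<lambda>x. complex_of_real (step (real n * (x \<bullet> i - a \<bullet> i))))"
    "smooth (\<lambda>x. complex_of_real (step (real n * (b \<bullet> i - x \<bullet> i))))" for i
  proof -
    have l: "smooth (\<lambda>x. complex_of_real (x \<bullet> i))"
      by (intro smooth_bounded_linear bounded_linear_compose[OF bounded_linear_of_real] bounded_linear_inner_left)
    have 1: "smooth (\<lambda>x. complex_of_real (real n * (x \<bullet> i - a \<bullet> i)))" "smooth (\<lambda>x. complex_of_real (real n * (b \<bullet> i - x \<bullet> i)))"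
      unfolding of_real_mult of_real_diff by (intro smooth_mult smooth_diff smooth_const l)+
    show "smooth (\<lambda>x. complex_of_real (step (real n * (x \<bullet> i - a \<bullet> i))))"
      "smooth (\<lambda>x. complex_of_real (step (real n * (b \<bullet> i - x \<bullet> i))))"
      using smooth_compose[OF 1(1) smooth_step] smooth_compose[OF 1(2) smooth_step] by auto
  qed
  then show ?thesis unfolding box_bump_def of_real_prod of_real_mult
    by (intro smooth_prod smooth_mult) auto
qed

lemma box_bump_bounds: "0 \<le> box_bump a b n x" "box_bump a b n x \<le> 1"
  unfolding box_bump_def
  by (auto intro!: prod_nonneg prod_le_1 mult_nonneg_nonneg mult_le_one step_nonneg step_le_1)

lemma box_bump_test:
  assumes "box a b \<subseteq> S" shows "test_function S (\<lambda>x. complex_of_real (box_bump a b n x))"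
\<comment> \<open>For n = 0 the bump is identically zero because \<open>step 0 = 0\<close>. This
  case is separate since 1/0 = 0 would make the box \<open>?K\<close> below the closed box, which
  need not lie in the open one.\<close>
proof (cases "n = 0")
  case True
  then have "box_bump a b n x = 0" for x
    unfolding box_bump_def using nonempty_Basis by (auto simp: step_eq_0 prod_zero_iff)
  then show ?thesis by (auto simp: test_function_def smooth_const intro!: exI[of _ "{}"])
next
  case False
  let ?K = "cbox (a + (1 / n) *\<^sub>R One) (b - (1 / n) *\<^sub>R One)"
  have K: "?K \<subseteq> box a b"
  proof
    fix x assume "x \<in> ?K"
    then have x: "a \<bullet> i + 1 / n \<le> x \<bullet> i \<and> x \<bullet> i \<le> b \<bullet> i - 1 / n" if "i \<in> Basis" for i
      using that by (auto simp: mem_box inner_add_left inner_diff_left)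
    have "1 / real n > 0" using False by simp
    then have "a \<bullet> i < x \<bullet> i \<and> x \<bullet> i < b \<bullet> i" if "i \<in> Basis" for i using x[OF that] by linarith
    then show "x \<in> box a b" by (simp add: mem_box)
  qed
  have "box_bump a b n x = 0" if "x \<notin> ?K" for x
  proof -
    from that obtain i where i: "i \<in> Basis" "x \<bullet> i < a \<bullet> i + 1 / n \<or> b \<bullet> i - 1 / n < x \<bullet> i"
      by (auto simp: mem_box inner_add_left inner_diff_left not_le)
    then have "step (real n * (x \<bullet> i - a \<bullet> i)) * step (real n * (b \<bullet> i - x \<bullet> i)) = 0"
      using False by (auto simp: field_simps intro!: step_eq_0)
    with i(1) show ?thesis unfolding box_bump_def by (auto simp: prod_zero_iff)
  qed
  with K assms show ?thesis
    by (auto simp: test_function_def smooth_box_bump intro!: exI[of _ ?K])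
qed

lemma box_bump_tendsto: "(\<lambda>n. box_bump a b n x) \<longlonglongrightarrow> indicator (box a b) x"
proof (cases "x \<in> box a b")
  case True
  have *: "\<forall>\<^sub>F n in sequentially. step (real n * c) = 1" if "c > 0" for c
  proof -
    obtain N :: nat where N: "2 / c < real N" using reals_Archimedean2 by blast
    have "step (real n * c) = 1" if "n \<ge> N" for n
    proof (rule step_eq_1)
      have "2 / c < real n" using N that by linarith
      then show "2 \<le> real n * c" using \<open>c > 0\<close> by (simp add: field_simps)
    qed
    then show ?thesis unfolding eventually_sequentially by blast
  qed
  have "\<forall>\<^sub>F n in sequentially. \<forall>i\<in>Basis. step (real n * (x \<bullet> i - a \<bullet> i)) = 1 \<and> step (real n * (b \<bullet> i - x \<bullet> i)) = 1"
    using True by (intro eventually_ball_finite) (auto simp: mem_box intro!: eventually_conj *)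
  then have "\<forall>\<^sub>F n in sequentially. box_bump a b n x = 1"
    by eventually_elim (simp add: box_bump_def)
  then show ?thesis using True by (simp add: tendsto_eventually)
next
  case False
  then obtain i where i: "i \<in> Basis" "x \<bullet> i \<le> a \<bullet> i \<or> b \<bullet> i \<le> x \<bullet> i"
    by (auto simp: mem_box not_less)
  have "box_bump a b n x = 0" for n
  proof -
    have "real n * (x \<bullet> i - a \<bullet> i) \<le> 1 \<or> real n * (b \<bullet> i - x \<bullet> i) \<le> 1"
    proof -
      have "real n * (x \<bullet> i - a \<bullet> i) \<le> 0 \<or> real n * (b \<bullet> i - x \<bullet> i) \<le> 0"
        using i(2) by (auto simp: mult_nonneg_nonpos)
      then show ?thesis by linarith
    qed
    then have "step (real n * (x \<bullet> i - a \<bullet> i)) * step (real n * (b \<bullet> i - x \<bullet> i)) = 0"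
      by (auto simp: step_eq_0)
    with i(1) show ?thesis unfolding box_bump_def by (auto simp: prod_zero_iff)
  qed
  then show ?thesis using False by simp
qed

lemma enn2real_cancel:
  assumes "a \<noteq> \<infinity>" "b \<noteq> \<infinity>" "enn2real a = enn2real b" shows "a = b"
proof -
  have "a < top" "b < top" using assms by (auto simp: less_top)
  then show ?thesis using assms(3) ennreal_enn2real by metis
qed

text \<open>The positive and the negative part of g are densities of finite measures that agree on
  boxes. Boxes form an intersection stable generator, so the measures and hence the densities
  agree.\<close>

lemma integrals_boxes_zero_AE_lborel:
  fixes g :: "'a::euclidean_space \<Rightarrow> real"
  assumes g: "integrable lborel g" and z: "\<And>a b. (\<integral>x. indicator (box a b) x * g x \<partial>lborel) = 0"
  shows "AE x in lborel. g x = 0"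
proof -
  have [measurable]: "g \<in> borel_measurable borel" using g by simp
  let ?P = "density lborel (\<lambda>x. ennreal (g x))" and ?N = "density lborel (\<lambda>x. ennreal (- g x))"
  have fin: "(\<integral>\<^sup>+x. ennreal (g x) \<partial>lborel) < \<infinity>" "(\<integral>\<^sup>+x. ennreal (- g x) \<partial>lborel) < \<infinity>"
    using g by (auto simp: real_integrable_def less_top[symmetric])
  have eq: "emeasure ?P X = emeasure ?N X" if "X \<in> range (\<lambda>(a, b). box a b)" for X
  proof -
    from that obtain a b where X: "X = box a b" by auto
    let ?h = "\<lambda>x. indicator X x * g x"
    have hi: "integrable lborel ?h" using integrable_real_mult_indicator[of X lborel g] g X by (simp add: mult.commute)
    have e: "emeasure ?P X = (\<integral>\<^sup>+x. ennreal (?h x) \<partial>lborel)" "emeasure ?N X = (\<integral>\<^sup>+x. ennreal (- ?h x) \<partial>lborel)"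
      using X by (auto simp: emeasure_density intro!: nn_integral_cong split: split_indicator)
    have f: "(\<integral>\<^sup>+x. ennreal (?h x) \<partial>lborel) \<noteq> \<infinity>" "(\<integral>\<^sup>+x. ennreal (- ?h x) \<partial>lborel) \<noteq> \<infinity>"
      using hi by (auto simp: real_integrable_def)
    have "(\<integral>\<^sup>+x. ennreal (?h x) \<partial>lborel) = (\<integral>\<^sup>+x. ennreal (- ?h x) \<partial>lborel)"
      by (rule enn2real_cancel[OF f])
         (use real_lebesgue_integral_def[OF hi] z[of a b] X in simp)
    then show ?thesis using e by simp
  qed
  have "?P = ?N"
  proof (rule measure_eqI_generator_eq[where E="range (\<lambda>(a, b). box a b)" and \<Omega>=UNIV
      and A="\<lambda>n. box (- (real n *\<^sub>R One)) (real n *\<^sub>R One)"])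
    show "Int_stable (range (\<lambda>(a, b). box a b :: 'a set))"
      by (auto simp: Int_stable_def box_Int_box)
    show "sets ?P = sigma_sets UNIV (range (\<lambda>(a, b). box a b))" "sets ?N = sigma_sets UNIV (range (\<lambda>(a, b). box a b))"
      by (simp_all add: borel_eq_box)
    show "(\<Union>n. box (- (real n *\<^sub>R One)) (real n *\<^sub>R One)) = (UNIV :: 'a set)"
      by (rule UN_box_eq_UNIV)
    show "emeasure ?P (box (- (real n *\<^sub>R One)) (real n *\<^sub>R One)) \<noteq> \<infinity>" for n :: nat
    proof -
      have "emeasure ?P (box (- (real n *\<^sub>R One)) (real n *\<^sub>R One)) \<le> emeasure ?P UNIV" by (intro emeasure_mono) auto
      also have "\<dots> = (\<integral>\<^sup>+x. ennreal (g x) \<partial>lborel)" by (simp add: emeasure_density)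
      finally show ?thesis using fin by (auto simp: top_unique)
    qed
  qed (use eq in auto)
  then have "AE x in lborel. ennreal (g x) = ennreal (- g x)"
    by (subst (asm) sigma_finite_measure.density_unique_iff[OF lborel.sigma_finite_measure_axioms]) auto
  then show ?thesis
  proof eventually_elim
    case (elim x)
    show ?case
    proof (cases "g x \<ge> 0")
      case True
      then have "ennreal (- g x) = 0" by (simp add: ennreal_neg)
      with elim have "g x \<le> 0" by (simp add: ennreal_eq_0_iff)
      with True show ?thesis by simp
    next
      case False
      then have "ennreal (g x) = 0" by (simp add: ennreal_neg)
      with elim have "- g x \<le> 0" by (metis ennreal_eq_0_iff)
      with False show ?thesis by simp
    qed
  qed
qed

text \<open>Only boxes inside S may be used. The function is therefore cut off to one such box B:
  any box meets B in a box inside S, so the global version applies to the cut-off function.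
  Countably many such boxes exhaust the open set.\<close>

lemma integrals_boxes_zero_AE:
  fixes g :: "'a::euclidean_space \<Rightarrow> real"
  assumes S: "open S" and g: "integrable (lebesgue_on S) g"
    and z: "\<And>a b. box a b \<subseteq> S \<Longrightarrow> (\<integral>x. indicator (box a b) x * g x \<partial>lebesgue_on S) = 0"
  shows "AE x in lebesgue_on S. g x = 0"
proof -
  have Sm: "S \<in> sets lebesgue" using S by simp
  have B: "AE x in lebesgue. x \<in> B \<longrightarrow> g x = 0" if "B = box c d" "B \<subseteq> S" for B c d
  proof -
    let ?G = "\<lambda>x. indicator B x * g x"
    have Gi: "integrable lebesgue ?G"
    proof -
      have "integrable lebesgue (\<lambda>x. indicator S x *\<^sub>R g x)"
        using g Sm by (subst (asm) integrable_restrict_space) auto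
      then have "integrable lebesgue (\<lambda>x. indicator B x *\<^sub>R (indicator S x *\<^sub>R g x))"
        by (rule integrable_mult_indicator[rotated]) (use that in auto)
      moreover have "(\<lambda>x. indicator B x *\<^sub>R (indicator S x *\<^sub>R g x)) = ?G"
        using that(2) by (auto simp: indicator_def fun_eq_iff)
      ultimately show ?thesis by (simp only:)
    qed
    \<comment> \<open>The global version concerns \<open>lborel\<close>, while \<open>?G\<close> is
      only Lebesgue measurable; a Borel version bridges the two.\<close>
    obtain G where G: "G \<in> borel_measurable lborel" "AE x in lborel. ?G x = G x"
      using completion_ex_borel_measurable_real[of ?G lborel] Gi by auto
    have AEl: "AE x in lebesgue. ?G x = G x" using G(2) by (rule AE_completion)
    have Gm: "G \<in> borel_measurable lebesgue" using G(1) by (rule measurable_completion)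
    have "integrable lebesgue G" using integrable_cong_AE_imp[OF Gi Gm] AEl by auto
    then have Gi': "integrable lborel G" using integrable_completion[OF G(1)] by simp
    have "(\<integral>x. indicator (box a b) x * G x \<partial>lborel) = 0" for a b
    proof -
      have [measurable]: "G \<in> borel_measurable borel" using G(1) by simp
      have "(\<integral>x. indicator (box a b) x * G x \<partial>lborel) = (\<integral>x. indicator (box a b) x * G x \<partial>lebesgue)"
        by (rule integral_completion[symmetric]) simp
      also have "\<dots> = (\<integral>x. indicator (box a b) x * ?G x \<partial>lebesgue)"
      proof (rule integral_cong_AE)
        show "(\<lambda>x. indicator (box a b) x * G x) \<in> borel_measurable lebesgue" 
          by (intro borel_measurable_times[OF borel_measurable_indicator Gm]) auto
        show "(\<lambda>x. indicator (box a b) x * ?G x) \<in> borel_measurable lebesgue"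

          by (intro borel_measurable_times[OF borel_measurable_indicator borel_measurable_integrable[OF Gi]]) auto
      qed (use AEl in auto)
      also have "\<dots> = (\<integral>x. indicator S x *\<^sub>R (indicator (box a b \<inter> B) x * g x) \<partial>lebesgue)"
        using that(2) by (intro Bochner_Integration.integral_cong) (auto simp: indicator_def)
      also have "\<dots> = (\<integral>x. indicator (box a b \<inter> B) x * g x \<partial>lebesgue_on S)"
        by (rule integral_restrict_space[symmetric]) (use Sm in auto)
      also have "\<dots> = 0"
      proof -
        have pq: "box a b \<inter> B = box (\<Sum>i\<in>Basis. max (a \<bullet> i) (c \<bullet> i) *\<^sub>R i) (\<Sum>i\<in>Basis. min (b \<bullet> i) (d \<bullet> i) *\<^sub>R i)"
          unfolding that(1) by (rule box_Int_box)
        have "box a b \<inter> B \<subseteq> S" using that(2) by auto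
        then show ?thesis unfolding pq by (rule z)
      qed
      finally show ?thesis .
    qed
    then have "AE x in lborel. G x = 0" by (rule integrals_boxes_zero_AE_lborel[OF Gi'])
    then have "AE x in lebesgue. G x = 0" by (rule AE_completion)
    with AEl show ?thesis by eventually_elim (auto simp: indicator_def)
  qed
  show ?thesis
  proof (rule open_countable_Union_open_box[OF S])
    fix D :: "'a set set"
    assume D: "countable D" "D \<subseteq> Pow S" "\<And>X. X \<in> D \<Longrightarrow> \<exists>a b. X = box a b" "\<Union>D = S"
    have BD: "AE x in lebesgue. x \<in> X \<longrightarrow> g x = 0" if X: "X \<in> D" for X
    proof -
      from D(3)[OF X] obtain c d where "X = box c d" by auto
      then show ?thesis by (rule B) (use X D(2) in auto)
    qed
    have "AE x in lebesgue. \<forall>X\<in>D. x \<in> X \<longrightarrow> g x = 0"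
      by (subst AE_ball_countable[OF D(1)]) (rule ballI, rule BD)
    then have "AE x in lebesgue. x \<in> S \<longrightarrow> g x = 0"
      by eventually_elim (use D(4) in auto)
    then show ?thesis using Sm by (simp add: AE_restrict_space_iff)
  qed
qed

text \<open>Box bumps are test functions bounded by 1 that converge to indicators of boxes, so w
  integrates to zero over every box inside S.\<close>

theorem weak_zero_imp_AE_zero:
  fixes w :: "'a::euclidean_space \<Rightarrow> complex"
  assumes S: "open S" and w: "integrable (lebesgue_on S) w"
    and z: "\<And>\<phi>. test_function S \<phi> \<Longrightarrow> (\<integral>x. w x * \<phi> x \<partial>lebesgue_on S) = 0"
  shows "AE x in lebesgue_on S. w x = 0"
proof -
  have wm [measurable]: "w \<in> borel_measurable (lebesgue_on S)" using w by simp
  have Sm: "S \<in> sets lebesgue" using S by simp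
  have bm: "(\<lambda>x. complex_of_real (box_bump a b n x)) \<in> borel_measurable (lebesgue_on S)" for a b n
    by (intro continuous_measurable_on smooth_continuous smooth_box_bump S)
  have im: "(\<lambda>x. complex_of_real (indicator (box a b) x)) \<in> borel_measurable (lebesgue_on S)" for a b
  proof -
    have [measurable]: "indicat_real (box a b) \<in> borel_measurable (lebesgue_on S)"
      by (intro measurable_restrict_space1 borel_measurable_indicator) auto
    show ?thesis by measurable
  qed
  have box: "(\<integral>x. w x * complex_of_real (indicator (box a b) x) \<partial>lebesgue_on S) = 0" if "box a b \<subseteq> S" for a b
  proof -
    have "(\<lambda>n. \<integral>x. w x * complex_of_real (box_bump a b n x) \<partial>lebesgue_on S)
        \<longlonglongrightarrow> (\<integral>x. w x * complex_of_real (indicator (box a b) x) \<partial>lebesgue_on S)"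
    proof (rule integral_dominated_convergence[where w="\<lambda>x. norm (w x)"])
      show "AE x in lebesgue_on S. (\<lambda>n. w x * complex_of_real (box_bump a b n x)) \<longlonglongrightarrow> w x * complex_of_real (indicator (box a b) x)"
        by (intro AE_I2 tendsto_intros box_bump_tendsto)
      show "AE x in lebesgue_on S. norm (w x * complex_of_real (box_bump a b n x)) \<le> norm (w x)" for n
        using box_bump_bounds[of a b n] by (intro AE_I2) (simp add: norm_mult mult_left_le)
    qed (use w in \<open>auto intro!: borel_measurable_times bm im\<close>)
    moreover have "(\<integral>x. w x * complex_of_real (box_bump a b n x) \<partial>lebesgue_on S) = 0" for n
      by (rule z[OF box_bump_test[OF that]])
    ultimately show ?thesis by (simp add: LIMSEQ_const_iff)
  qed
  have wi: "integrable (lebesgue_on S) (\<lambda>x. w x * complex_of_real (indicator (box a b) x))" for a b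
  proof (rule Bochner_Integration.integrable_bound[OF w])
    show "(\<lambda>x. w x * complex_of_real (indicator (box a b) x)) \<in> borel_measurable (lebesgue_on S)"
      by (intro borel_measurable_times im wm)
  qed (auto simp: norm_mult indicator_def)
  have "AE x in lebesgue_on S. Re (w x) = 0"
  proof (rule integrals_boxes_zero_AE[OF S])
    fix a b :: 'a assume "box a b \<subseteq> S"
    have "(\<integral>x. indicator (box a b) x * Re (w x) \<partial>lebesgue_on S) = (\<integral>x. Re (w x * complex_of_real (indicator (box a b) x)) \<partial>lebesgue_on S)"
      by (intro Bochner_Integration.integral_cong) (auto simp: indicator_def)
    also have "\<dots> = Re (\<integral>x. w x * complex_of_real (indicator (box a b) x) \<partial>lebesgue_on S)"
      by (rule integral_Re[OF wi])
    finally show "(\<integral>x. indicator (box a b) x * Re (w x) \<partial>lebesgue_on S) = 0" using box[OF \<open>box a b \<subseteq> S\<close>] by simp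
  qed (use w in auto)
  moreover have "AE x in lebesgue_on S. Im (w x) = 0"
  proof (rule integrals_boxes_zero_AE[OF S])
    fix a b :: 'a assume "box a b \<subseteq> S"
    have "(\<integral>x. indicator (box a b) x * Im (w x) \<partial>lebesgue_on S) = (\<integral>x. Im (w x * complex_of_real (indicator (box a b) x)) \<partial>lebesgue_on S)"
      by (intro Bochner_Integration.integral_cong) (auto simp: indicator_def)
    also have "\<dots> = Im (\<integral>x. w x * complex_of_real (indicator (box a b) x) \<partial>lebesgue_on S)"
      by (rule integral_Im[OF wi])
    finally show "(\<integral>x. indicator (box a b) x * Im (w x) \<partial>lebesgue_on S) = 0" using box[OF \<open>box a b \<subseteq> S\<close>] by simp
  qed (use w in auto)
  ultimately show ?thesis by eventually_elim (simp add: complex_eq_iff)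
qed

lemma smooth_in_L2:
  assumes "open S" "bounded S" "smooth f" shows "f \<in> L2 S"
  by (intro continuous_in_L2 smooth_continuous assms)

lemma test_in_L2:
  assumes "open S" "bounded S" "test_function S \<phi>"
  shows "\<phi> \<in> L2 S" "(\<lambda>x. frechet_derivative \<phi> (at x) e) \<in> L2 S"
  using assms by (auto simp: test_function_def intro!: smooth_in_L2 smooth_frechet)

lemma L2_integrable:
  assumes "open S" "bounded S" "f \<in> L2 S" shows "integrable (lebesgue_on S) f"
  using L2_mult_integrable[OF assms(3) smooth_in_L2[OF assms(1,2) smooth_const[of 1]]] by simp

lemma weak_deriv_unique:
  assumes S: "open S" "bounded S" and w: "w \<in> L2 S" "w' \<in> L2 S"
    and d: "has_weak_deriv S e u w" "has_weak_deriv S e u w'"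
  shows "AE x in lebesgue_on S. w x = w' x"
proof -
  have "AE x in lebesgue_on S. w x - w' x = 0"
  proof (rule weak_zero_imp_AE_zero[OF S(1)])
    show "integrable (lebesgue_on S) (\<lambda>x. w x - w' x)" by (intro L2_integrable S L2_diff w)
    fix \<phi> assume t: "test_function S \<phi>"
    have "(\<integral>x. w x * \<phi> x \<partial>lebesgue_on S) = (\<integral>x. w' x * \<phi> x \<partial>lebesgue_on S)"
      using d t by (simp add: has_weak_deriv_def)
    then show "(\<integral>x. (w x - w' x) * \<phi> x \<partial>lebesgue_on S) = 0"
      using L2_mult_integrable[OF w(1) test_in_L2(1)[OF S t]] L2_mult_integrable[OF w(2) test_in_L2(1)[OF S t]]
      by (simp add: left_diff_distrib)
  qed
  then show ?thesis by simp
qed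

lemma weak_deriv_comb:
  assumes S: "open S" "bounded S" and L: "u \<in> L2 S" "v \<in> L2 S" "w \<in> L2 S" "z \<in> L2 S"
    and d: "has_weak_deriv S e u w" "has_weak_deriv S e v z"
  shows "has_weak_deriv S e (\<lambda>x. u x + c * v x) (\<lambda>x. w x + c * z x)"
  unfolding has_weak_deriv_def
proof (intro allI impI)
  fix \<phi> assume t: "test_function S \<phi>"
  show "(\<integral>x. (u x + c * v x) * frechet_derivative \<phi> (at x) e \<partial>lebesgue_on S) = - (\<integral>x. (w x + c * z x) * \<phi> x \<partial>lebesgue_on S)"
    using d[unfolded has_weak_deriv_def, rule_format, OF t] L2_mult_integrable[OF L(1) test_in_L2(2)[OF S t, of e]]
      L2_mult_integrable[OF L(2) test_in_L2(2)[OF S t, of e]]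
      L2_mult_integrable[OF L(3) test_in_L2(1)[OF S t]] L2_mult_integrable[OF L(4) test_in_L2(1)[OF S t]]
    by (simp add: distrib_right mult.assoc)
qed

lemma weak_deriv_cong_AE:
  assumes S: "open S" "bounded S" and L: "u \<in> L2 S" "u' \<in> L2 S" "w \<in> L2 S" "w' \<in> L2 S"
    and d: "has_weak_deriv S e u w" and ae: "AE x in lebesgue_on S. u x = u' x" "AE x in lebesgue_on S. w x = w' x"
  shows "has_weak_deriv S e u' w'"
  unfolding has_weak_deriv_def
proof (intro allI impI)
  fix \<phi> assume t: "test_function S \<phi>"
  note [measurable] = L2_D(1)[OF L(1)] L2_D(1)[OF L(2)] L2_D(1)[OF L(3)] L2_D(1)[OF L(4)]
    L2_D(1)[OF test_in_L2(1)[OF S t]] L2_D(1)[OF test_in_L2(2)[OF S t, of e]]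
  have "(\<integral>x. u' x * frechet_derivative \<phi> (at x) e \<partial>lebesgue_on S) = (\<integral>x. u x * frechet_derivative \<phi> (at x) e \<partial>lebesgue_on S)"
    by (rule integral_cong_AE) (use ae in auto)
  moreover have "(\<integral>x. w' x * \<phi> x \<partial>lebesgue_on S) = (\<integral>x. w x * \<phi> x \<partial>lebesgue_on S)"
    by (rule integral_cong_AE) (use ae in auto)
  ultimately show "(\<integral>x. u' x * frechet_derivative \<phi> (at x) e \<partial>lebesgue_on S) = - (\<integral>x. w' x * \<phi> x \<partial>lebesgue_on S)"
    using d t by (simp add: has_weak_deriv_def)
qed

lemma tendsto_integral_mult:
  assumes "\<And>n. X n \<in> L2 S" "u \<in> L2 S" "(\<lambda>n. L2_norm S (\<lambda>x. X n x - u x)) \<longlonglongrightarrow> 0" "g \<in> L2 S"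
  shows "(\<lambda>n. \<integral>x. X n x * g x \<partial>lebesgue_on S) \<longlonglongrightarrow> (\<integral>x. u x * g x \<partial>lebesgue_on S)"
  using L2_tendsto_inner[OF assms(1,2,3), of "\<lambda>_ x. cnj (g x)" "\<lambda>x. cnj (g x)"] L2_cnj[OF assms(4)]
  by (simp add: L2_inner_def L2_norm_zero)

text \<open>Both sides of the defining identity are continuous in L2 for a fixed test function. This
  closedness is what makes the form domain complete.\<close>

lemma weak_deriv_limit:
  assumes S: "open S" "bounded S" and L: "\<And>n. X n \<in> L2 S" "u \<in> L2 S" "\<And>n. Y n \<in> L2 S" "w \<in> L2 S"
    and d: "\<And>n. has_weak_deriv S e (X n) (Y n)"
    and l: "(\<lambda>n. L2_norm S (\<lambda>x. X n x - u x)) \<longlonglongrightarrow> 0" "(\<lambda>n. L2_norm S (\<lambda>x. Y n x - w x)) \<longlonglongrightarrow> 0"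
  shows "has_weak_deriv S e u w"
  unfolding has_weak_deriv_def
proof (intro allI impI)
  fix \<phi> assume t: "test_function S \<phi>"
  have "(\<lambda>n. \<integral>x. X n x * frechet_derivative \<phi> (at x) e \<partial>lebesgue_on S) \<longlonglongrightarrow> (\<integral>x. u x * frechet_derivative \<phi> (at x) e \<partial>lebesgue_on S)"
    by (intro tendsto_integral_mult L l test_in_L2(2)[OF S t])
  moreover have "(\<lambda>n. - (\<integral>x. Y n x * \<phi> x \<partial>lebesgue_on S)) \<longlonglongrightarrow> - (\<integral>x. w x * \<phi> x \<partial>lebesgue_on S)"
    by (intro tendsto_minus tendsto_integral_mult L l test_in_L2(1)[OF S t])
  ultimately show "(\<integral>x. u x * frechet_derivative \<phi> (at x) e \<partial>lebesgue_on S) = - (\<integral>x. w x * \<phi> x \<partial>lebesgue_on S)"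
    using d t LIMSEQ_unique by (simp add: has_weak_deriv_def)
qed

section \<open>The Sobolev space of first order\<close>

lemma W12_I:
  assumes "f \<in> L2 S" "\<And>e. e \<in> Basis \<Longrightarrow> w e \<in> L2 S" "\<And>e. e \<in> Basis \<Longrightarrow> has_weak_deriv S e f (w e)"
  shows "f \<in> W12 S"
proof -
  have "\<exists>w\<in>L2 S. has_weak_deriv S e f w" if "e \<in> Basis" for e
    using assms(2,3)[OF that] by (intro bexI[of _ "w e"])
  then show ?thesis using assms(1) by (simp add: W12_def)
qed

lemma W12_D:
  assumes "u \<in> W12 S"
  shows "u \<in> L2 S" "e \<in> Basis \<Longrightarrow> wderiv S e u \<in> L2 S" "e \<in> Basis \<Longrightarrow> has_weak_deriv S e u (wderiv S e u)"
proof -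
  show "u \<in> L2 S" using assms by (simp add: W12_def)
  have "wderiv S e u \<in> L2 S \<and> has_weak_deriv S e u (wderiv S e u)" if "e \<in> Basis"
  proof -
    have "\<exists>w. w \<in> L2 S \<and> has_weak_deriv S e u w" using assms that by (auto simp: W12_def)
    then show ?thesis unfolding wderiv_def by (rule someI_ex)
  qed
  then show "e \<in> Basis \<Longrightarrow> wderiv S e u \<in> L2 S" "e \<in> Basis \<Longrightarrow> has_weak_deriv S e u (wderiv S e u)" by auto
qed

lemma wderiv_eq_AE:
  assumes S: "open S" "bounded S" and "w \<in> L2 S" "has_weak_deriv S e u w"
  shows "AE x in lebesgue_on S. wderiv S e u x = w x" "wderiv S e u \<in> L2 S"
proof -
  have "\<exists>w. w \<in> L2 S \<and> has_weak_deriv S e u w" using assms by auto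
  then have *: "wderiv S e u \<in> L2 S \<and> has_weak_deriv S e u (wderiv S e u)" unfolding wderiv_def by (rule someI_ex)
  then show "AE x in lebesgue_on S. wderiv S e u x = w x" "wderiv S e u \<in> L2 S"
    using weak_deriv_unique[OF S _ assms(3) _ assms(4)] by auto
qed

lemma W12_comb:
  assumes S: "open S" "bounded S" and u: "u \<in> W12 S" and v: "v \<in> W12 S"
  shows "(\<lambda>x. u x + c * v x) \<in> W12 S"
    "e \<in> Basis \<Longrightarrow> AE x in lebesgue_on S. wderiv S e (\<lambda>x. u x + c * v x) x = wderiv S e u x + c * wderiv S e v x"
proof -
  have d: "(\<lambda>x. wderiv S e u x + c * wderiv S e v x) \<in> L2 S"
    "has_weak_deriv S e (\<lambda>x. u x + c * v x) (\<lambda>x. wderiv S e u x + c * wderiv S e v x)" if "e \<in> Basis" for e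
    by (intro L2_comb W12_D(2)[OF u that] W12_D(2)[OF v that],
        intro weak_deriv_comb[OF S W12_D(1)[OF u] W12_D(1)[OF v] W12_D(2)[OF u that] W12_D(2)[OF v that]
          W12_D(3)[OF u that] W12_D(3)[OF v that]])
  show "(\<lambda>x. u x + c * v x) \<in> W12 S"
    by (rule W12_I[OF L2_comb[OF W12_D(1)[OF u] W12_D(1)[OF v]] d])
  show "e \<in> Basis \<Longrightarrow> AE x in lebesgue_on S. wderiv S e (\<lambda>x. u x + c * v x) x = wderiv S e u x + c * wderiv S e v x"
    by (rule wderiv_eq_AE[OF S d])
qed

lemma smooth_W12:
  assumes S: "open S" "bounded S" and f: "smooth f"
  shows "f \<in> W12 S" "AE x in lebesgue_on S. wderiv S e f x = frechet_derivative f (at x) e"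
proof -
  show "f \<in> W12 S"
    by (rule W12_I[OF smooth_in_L2[OF S f] smooth_in_L2[OF S smooth_frechet[OF f]] classical_weak_deriv[OF S(1) f]])
  show "AE x in lebesgue_on S. wderiv S e f x = frechet_derivative f (at x) e"
    by (rule wderiv_eq_AE(1)[OF S smooth_in_L2[OF S smooth_frechet[OF f]] classical_weak_deriv[OF S(1) f]])
qed

section \<open>Integrals over boxes\<close>

lemma integrable_on_box:
  fixes f :: "'a::euclidean_space \<Rightarrow> 'b::euclidean_space"
  assumes "continuous_on (cbox a b) f"
  shows "integrable (lebesgue_on (box a b)) f"
proof -
  have "compact (f ` cbox a b)" using assms by (intro compact_continuous_image) auto
  then obtain B where B: "\<And>x. x \<in> cbox a b \<Longrightarrow> norm (f x) \<le> B"
    using compact_imp_bounded bounded_iff by (metis imageI)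
  interpret finite_measure "lebesgue_on (box a b)" by (rule finite_measure_lebesgue_on) simp
  show ?thesis
  proof (rule integrable_const_bound)
    show "AE x in lebesgue_on (box a b). norm (f x) \<le> B"
      using B box_subset_cbox by (intro AE_I2) (auto simp: space_restrict_space)
    show "f \<in> borel_measurable (lebesgue_on (box a b))"
      by (rule continuous_measurable_on[OF continuous_on_subset[OF assms box_subset_cbox]]) (rule open_box)
  qed
qed

lemma integral_on_box:
  fixes f :: "'a::euclidean_space \<Rightarrow> 'b::euclidean_space"
  assumes "continuous_on (cbox a b) f"
  shows "(\<integral>x. f x \<partial>lebesgue_on (box a b)) = integral (cbox a b) f"
  using lebesgue_integral_eq_integral[OF integrable_on_box[OF assms]] by (simp add: integral_open_interval)

lemma integral_on_interval:
  fixes f :: "real \<Rightarrow> 'b::euclidean_space"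
  assumes "continuous_on {a..b} f"
  shows "(\<integral>x. f x \<partial>lebesgue_on {a<..<b}) = integral {a..b} f"
  using integral_on_box[of a b f] assms by (simp add: box_real)

lemma integral_on_rectangle:
  fixes f :: "real \<times> real \<Rightarrow> 'b::euclidean_space"
  assumes "continuous_on (cbox (a, c) (b, d)) f"
  shows "(\<integral>x. f x \<partial>lebesgue_on (box (a, c) (b, d))) = integral {a..b} (\<lambda>s. integral {c..d} (\<lambda>t. f (s, t)))"
    and "(\<integral>x. f x \<partial>lebesgue_on (box (a, c) (b, d))) = integral {c..d} (\<lambda>t. integral {a..b} (\<lambda>s. f (s, t)))"
proof -
  show 1: "(\<integral>x. f x \<partial>lebesgue_on (box (a, c) (b, d))) = integral {a..b} (\<lambda>s. integral {c..d} (\<lambda>t. f (s, t)))"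
    using integral_on_box[OF assms] integral_prod_continuous[OF assms] by simp
  have "continuous_on (cbox (a, c) (b, d)) (\<lambda>(x, y). f (x, y))" using assms by simp
  from integral_swap_continuous[OF this]
  show "(\<integral>x. f x \<partial>lebesgue_on (box (a, c) (b, d))) = integral {c..d} (\<lambda>t. integral {a..b} (\<lambda>s. f (s, t)))"
    using 1 by simp
qed

section \<open>Functions of the second coordinate\<close>

lemma Times_null_lborel:
  fixes N :: "real set"
  assumes "N \<in> null_sets lborel" "I \<in> sets borel"
  shows "(I :: real set) \<times> N \<in> null_sets lborel"
proof -
  have N: "N \<in> sets lborel" "emeasure lborel N = 0" using assms(1) by auto
  have "emeasure (lborel \<Otimes>\<^sub>M lborel) (I \<times> N) = emeasure lborel I * emeasure lborel N"
    using assms N by (intro lborel.emeasure_pair_measure_Times) auto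
  moreover have "I \<times> N \<in> sets (lborel \<Otimes>\<^sub>M lborel)" using assms N by (intro pair_measureI) auto
  ultimately show ?thesis using N unfolding lborel_prod by (intro null_setsI) auto
qed

text \<open>The product measure only knows Borel sets. A Lebesgue set is a Borel set up to a part of
  a null set, and the product of that null set with an interval is null in the plane.\<close>

lemma Times_lebesgue:
  fixes A I :: "real set"
  assumes A: "A \<in> sets lebesgue" and I: "I \<in> sets borel"
  shows "I \<times> A \<in> sets lebesgue" "emeasure lebesgue (I \<times> A) = emeasure lborel I * emeasure lebesgue A"
proof -
  obtain B N N' where *: "A = B \<union> N" "N \<subseteq> N'" "N' \<in> null_sets lborel" "B \<in> sets lborel"
    using A by (rule sets_completionE)
  have N: "N \<in> null_sets lebesgue" 
    by (rule null_sets_completion_subset[OF *(2) null_sets_completionI[OF *(3)]])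
  have "I \<times> N \<subseteq> I \<times> N'" using *(2) by auto
  then have IN: "I \<times> N \<in> null_sets lebesgue"

    by (rule null_sets_completion_subset[OF _ null_sets_completionI[OF Times_null_lborel[OF *(3) I]]])
  have BI: "I \<times> B \<in> sets (lborel \<Otimes>\<^sub>M lborel)" using *(4) I by (intro pair_measureI) auto
  then have BI': "I \<times> B \<in> sets lborel" by (simp only: lborel_prod)
  then have BI2: "I \<times> B \<in> sets lebesgue" by (rule sets_completionI_sets)
  have eq: "I \<times> A = (I \<times> B) \<union> (I \<times> N)" using *(1) by auto
  show "I \<times> A \<in> sets lebesgue" unfolding eq using BI2 IN by auto
  have "emeasure lebesgue (I \<times> A) = emeasure lebesgue (I \<times> B)"
    unfolding eq by (rule emeasure_Un_null_set[OF BI2 IN])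
  also have "\<dots> = emeasure (lborel \<Otimes>\<^sub>M lborel) (I \<times> B)" using BI' by (simp add: lborel_prod)
  also have "\<dots> = emeasure lborel I * emeasure lborel B"
    using * I by (intro lborel.emeasure_pair_measure_Times) auto
  also have "emeasure lborel B = emeasure lebesgue A"
    unfolding *(1) using emeasure_Un_null_set[of B lebesgue N] N * by (simp add: sets_completionI_sets)
  finally show "emeasure lebesgue (I \<times> A) = emeasure lborel I * emeasure lebesgue A" .
qed

context
  fixes l u :: real and S :: "real set"
  assumes lu: "l \<le> u" and S: "S \<in> sets lebesgue"
begin

abbreviation (input) "strip \<equiv> {l<..<u} \<times> S"

lemma strip_lebesgue: "strip \<in> sets lebesgue"
  by (rule Times_lebesgue(1)[OF S]) simp

lemma snd_measurable: "snd \<in> lebesgue_on strip \<rightarrow>\<^sub>M lebesgue_on S"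
proof (rule measurableI)
  fix B assume "B \<in> sets (lebesgue_on S)"
  then have B: "B \<in> sets lebesgue" "B \<subseteq> S" using S by (auto simp: sets_restrict_space_iff)
  have "snd -` B \<inter> space (lebesgue_on strip) = {l<..<u} \<times> B"
    using B by (auto simp: space_restrict_space)
  then show "snd -` B \<inter> space (lebesgue_on strip) \<in> sets (lebesgue_on strip)"
    using Times_lebesgue(1)[OF B(1)] B(2) strip_lebesgue by (auto simp: sets_restrict_space_iff)
qed (auto simp: space_restrict_space)

text \<open>This is Fubini for functions of the second coordinate, stated as an image measure.
  Integrals, null sets, L2 membership and norms on a strip are all read off from it, for functions
  that are merely Lebesgue measurable.\<close>

lemma distr_snd:
  "distr (lebesgue_on strip) (lebesgue_on S) snd = density (lebesgue_on S) (\<lambda>_. ennreal (u - l))"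
proof (rule measure_eqI)
  fix B assume "B \<in> sets (distr (lebesgue_on strip) (lebesgue_on S) snd)"
  then have B': "B \<in> sets (lebesgue_on S)" by simp
  then have B: "B \<in> sets lebesgue" "B \<subseteq> S" using S by (auto simp: sets_restrict_space_iff)
  have "snd -` B \<inter> space (lebesgue_on strip) = {l<..<u} \<times> B"
    using B by (auto simp: space_restrict_space)
  then have "emeasure (distr (lebesgue_on strip) (lebesgue_on S) snd) B = emeasure (lebesgue_on strip) ({l<..<u} \<times> B)"
    using emeasure_distr[OF snd_measurable B'] by simp
  also have "\<dots> = emeasure lebesgue ({l<..<u} \<times> B)"
    using B strip_lebesgue by (intro emeasure_restrict_space) auto
  also have "\<dots> = ennreal (u - l) * emeasure lebesgue B"
    using Times_lebesgue(2)[OF B(1), of "{l<..<u}"] lu by simp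
  also have "emeasure lebesgue B = emeasure (lebesgue_on S) B"
    using B S by (intro emeasure_restrict_space[symmetric]) auto
  also have "ennreal (u - l) * \<dots> = emeasure (density (lebesgue_on S) (\<lambda>_. ennreal (u - l))) B"
    using B' by (simp add: emeasure_density nn_integral_cmult_indicator)
  finally show "emeasure (distr (lebesgue_on strip) (lebesgue_on S) snd) B
      = emeasure (density (lebesgue_on S) (\<lambda>_. ennreal (u - l))) B" .
qed simp

lemma integral_snd:
  fixes h :: "real \<Rightarrow> 'b::euclidean_space"
  assumes "h \<in> borel_measurable (lebesgue_on S)"
  shows "(\<integral>x. h (snd x) \<partial>lebesgue_on strip) = (u - l) *\<^sub>R (\<integral>t. h t \<partial>lebesgue_on S)"
    and "integrable (lebesgue_on S) h \<Longrightarrow> integrable (lebesgue_on strip) (\<lambda>x. h (snd x))"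
proof -
  have "(\<integral>x. h (snd x) \<partial>lebesgue_on strip) = (\<integral>t. h t \<partial>distr (lebesgue_on strip) (lebesgue_on S) snd)"
    by (rule integral_distr[OF snd_measurable assms, symmetric])
  also have "\<dots> = (\<integral>t. (u - l) *\<^sub>R h t \<partial>lebesgue_on S)"
    unfolding distr_snd using assms lu by (intro integral_density) auto
  finally show "(\<integral>x. h (snd x) \<partial>lebesgue_on strip) = (u - l) *\<^sub>R (\<integral>t. h t \<partial>lebesgue_on S)" by simp
  assume "integrable (lebesgue_on S) h"
  then have "integrable (density (lebesgue_on S) (\<lambda>_. ennreal (u - l))) h"
    using assms lu by (subst integrable_density) auto
  then show "integrable (lebesgue_on strip) (\<lambda>x. h (snd x))"
    unfolding distr_snd[symmetric] using integrable_distr_eq[OF snd_measurable assms] by simp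
qed

lemma AE_snd:
  assumes "AE t in lebesgue_on S. P t" shows "AE x in lebesgue_on strip. P (snd x)"
proof -
  have "AE t in density (lebesgue_on S) (\<lambda>_. ennreal (u - l)). P t"
    using assms by (subst AE_density) auto
  then show ?thesis unfolding distr_snd[symmetric] by (rule AE_distrD[OF snd_measurable])
qed

lemma L2_snd:
  assumes "g \<in> L2 S" shows "(\<lambda>x. g (snd x)) \<in> L2 strip"
proof -
  note g = L2_D[OF assms]
  have "(\<lambda>x. g (snd x)) \<in> borel_measurable (lebesgue_on strip)"
    by (rule measurable_compose[OF snd_measurable g(1)])
  moreover have "(\<lambda>t. (norm (g t))\<^sup>2) \<in> borel_measurable (lebesgue_on S)" using g(1) by measurable
  then have "integrable (lebesgue_on strip) (\<lambda>x. (norm (g (snd x)))\<^sup>2)"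
    by (rule integral_snd(2)[OF _ g(2)])
  ultimately show ?thesis by (simp add: L2_def)
qed

lemma L2_inner_snd:
  assumes "g \<in> L2 S" "h \<in> L2 S"
  shows "L2_inner strip (\<lambda>x. g (snd x)) (\<lambda>x. h (snd x)) = of_real (u - l) * L2_inner S g h"
  using integral_snd(1)[OF borel_measurable_integrable[OF L2_inner_integrable[OF assms]]]
  by (simp add: L2_inner_def scaleR_conv_of_real)

lemma L2_norm_snd:
  assumes "g \<in> L2 S"
  shows "L2_norm strip (\<lambda>x. g (snd x)) = sqrt (u - l) * L2_norm S g"
  using integral_snd(1)[OF borel_measurable_integrable[OF L2_D(2)[OF assms]]]
  by (simp add: L2_norm_def real_sqrt_mult)

end

section \<open>Weak derivatives on an interval\<close>

lemma test_function_comb: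
  assumes "test_function S f" "test_function S g" shows "test_function S (\<lambda>x. f x + c * g x)"
proof -
  obtain K L where "compact K" "K \<subseteq> S" "\<forall>x. x \<notin> K \<longrightarrow> f x = 0" "compact L" "L \<subseteq> S" "\<forall>x. x \<notin> L \<longrightarrow> g x = 0"
    "smooth f" "smooth g" using assms unfolding test_function_def by auto
  then show ?thesis unfolding test_function_def
    by (intro conjI smooth_add smooth_mult smooth_const exI[of _ "K \<union> L"] compact_Un) auto
qed

lemma test_function_cnj: "test_function S f \<Longrightarrow> test_function S (\<lambda>x. cnj (f x))"
  unfolding test_function_def by (auto intro: smooth_cnj)

lemma frechet_vector_derivative:
  fixes f :: "real \<Rightarrow> complex"
  assumes "(f has_vector_derivative d) (at t)"
  shows "frechet_derivative f (at t) v = of_real v * d"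
  using frechet_derivative_at[OF assms[unfolded has_vector_derivative_def]]
  by (metis scaleR_conv_of_real)

text \<open>The mean value zero is exactly what makes the primitive vanish again to the right of the
  support, so that it has compact support in the interval.\<close>

lemma test_function_primitive:
  fixes \<psi> :: "real \<Rightarrow> complex"
  assumes t: "test_function {l<..<u} \<psi>" and lu: "l < u" and z: "(\<integral>t. \<psi> t \<partial>lebesgue_on {l<..<u}) = 0"
  obtains \<Psi> where "test_function {l<..<u} \<Psi>" "\<And>t. frechet_derivative \<Psi> (at t) 1 = \<psi> t"
proof -
  obtain K where K: "compact K" "K \<subseteq> {l<..<u}" "\<forall>x. x \<notin> K \<longrightarrow> \<psi> x = 0" and s: "smooth \<psi>"
    using t unfolding test_function_def by auto
  obtain c d where cd: "l < c" "d < u" "K \<subseteq> {c..d}"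
  proof (cases "K = {}")
    case True
    then show ?thesis using lu by (intro that[of "l + 1" "u - 1"]) auto
  next
    case False
    obtain c where c: "c \<in> K" "\<forall>x\<in>K. c \<le> x" using compact_attains_inf[OF K(1) False] by auto
    obtain d where d: "d \<in> K" "\<forall>x\<in>K. x \<le> d" using compact_attains_sup[OF K(1) False] by auto
    show ?thesis by (rule that[of c d]) (use c d K(2) in auto)
  qed
  \<comment> \<open>The maximum with l covers the case of an empty support, in which d may lie to
    the left of l.\<close>
  define d' where "d' = (max d l + u) / 2"
  have d': "d < d'" "l < d'" "d' < u" using cd lu by (auto simp: d'_def max_def)
  have z1: "\<psi> x = 0" if "x < c \<or> d' \<le> x" for x using K(3) cd that d' by force
  have sc: "continuous_on A \<psi>" for A by (rule smooth_continuous[OF s])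
  define \<Psi> where "\<Psi> t = integral {l - 1..t} \<psi>" for t
  have P0: "\<Psi> t = 0" if "t < c" for t
  proof -
    have "integral {l - 1..t} \<psi> = integral {l - 1..t} (\<lambda>_. 0)"
      by (rule Henstock_Kurzweil_Integration.integral_cong) (use z1 that in auto)
    then show ?thesis by (simp add: \<Psi>_def)
  qed
  have der: "(\<Psi> has_vector_derivative \<psi> t) (at t)" for t
  proof (cases "t < c")
    case True
    have "((\<lambda>_. 0) has_vector_derivative \<psi> t) (at t)" using z1 True by simp
    then show ?thesis
      by (rule has_vector_derivative_transform_within_open[of _ _ _ "{..<c}"]) (use True P0 in auto)
  next
    case False
    have "(\<Psi> has_vector_derivative \<psi> t) (at t within {l - 1..t + 1})"
      unfolding \<Psi>_def by (rule integral_has_vector_derivative[OF sc]) (use False cd in auto)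
    moreover have "at t within {l - 1..t + 1} = at t"
      by (rule at_within_Icc_at) (use False cd in auto)
    ultimately show ?thesis by simp
  qed
  have split: "\<Psi> t = \<Psi> d'" if "d' \<le> t" for t
  proof -
    have "integral {l - 1..d'} \<psi> + integral {d'..t} \<psi> = integral {l - 1..t} \<psi>"
      by (rule Henstock_Kurzweil_Integration.integral_combine) (use that d' in \<open>auto intro: integrable_continuous_interval sc\<close>)
    moreover have "integral {d'..t} \<psi> = integral {d'..t} (\<lambda>_. 0)"
      by (rule Henstock_Kurzweil_Integration.integral_cong) (use z1 in auto)
    ultimately show ?thesis by (simp add: \<Psi>_def)
  qed
  have "\<Psi> u = 0"
  proof -
    have "integral {l - 1..l} \<psi> + integral {l..u} \<psi> = integral {l - 1..u} \<psi>"
      by (rule Henstock_Kurzweil_Integration.integral_combine) (use lu in \<open>auto intro: integrable_continuous_interval sc\<close>)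
    moreover have "integral {l..u} \<psi> = 0" using z integral_on_interval[OF sc] by simp
    moreover have "integral {l - 1..l} \<psi> = 0" using P0[of l] cd(1) by (simp add: \<Psi>_def)
    ultimately show ?thesis by (simp add: \<Psi>_def)
  qed
  then have P1: "\<Psi> t = 0" if "d' \<le> t" for t using split[OF that] split[of u] d' by simp
  show ?thesis
  proof (rule that)
    have "smooth \<Psi>"
      by (rule smooth_if_derivative[OF der[unfolded has_vector_derivative_def]])
         (auto simp: scaleR_conv_of_real intro: smooth_mult smooth_const s)
    moreover have "\<Psi> x = 0" if "x \<notin> {c..d'}" for x using that P0 P1 by (auto simp: not_le)
    moreover have "{c..d'} \<subseteq> {l<..<u}" using cd d' by auto
    ultimately show "test_function {l<..<u} \<Psi>"
      unfolding test_function_def by (intro conjI exI[of _ "{c..d'}"]) auto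
    show "frechet_derivative \<Psi> (at t) 1 = \<psi> t" for t using frechet_vector_derivative[OF der, of t 1] by simp
  qed
qed

text \<open>Subtracting a multiple of one fixed test function with nonzero integral turns any test
  function into one of mean zero, that is, into the derivative of a test function. The weak equation
  annihilates it, which determines the action of q on all test functions.\<close>

lemma du_bois_reymond:
  assumes lu: "l < u" and q: "q \<in> L2 {l<..<u}" and d: "has_weak_deriv {l<..<u} 1 q (\<lambda>_. 0)"
  shows "\<exists>c. AE t in lebesgue_on {l<..<u::real}. q t = c"
proof -
  let ?S = "{l<..<u}"
  have S: "open ?S" "bounded ?S" by auto
  \<comment> \<open>Otherwise the constant 1 would vanish almost everywhere on the interval by the
    fundamental lemma.\<close>
  have "\<exists>\<phi>. test_function ?S \<phi> \<and> (\<integral>t. \<phi> t \<partial>lebesgue_on ?S) \<noteq> 0"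
  proof (rule ccontr)
    assume "\<not> ?thesis"
    then have "AE t in lebesgue_on ?S. (1::complex) = 0"
      by (intro weak_zero_imp_AE_zero[OF S(1)] L2_integrable[OF S smooth_in_L2[OF S smooth_const]]) auto
    then have "AE t in lebesgue. t \<notin> ?S" by (simp add: AE_restrict_space_iff)
    then have "?S \<in> null_sets lebesgue" by (simp add: AE_iff_null_sets)
    then have "emeasure lebesgue ?S = 0" by (rule null_setsD1)
    then show False using lu by simp
  qed
  then obtain \<phi> where p: "test_function ?S \<phi>" "(\<integral>t. \<phi> t \<partial>lebesgue_on ?S) \<noteq> 0" by auto
  define k where "k = (\<integral>t. \<phi> t \<partial>lebesgue_on ?S)"
  define c where "c = (\<integral>t. q t * \<phi> t \<partial>lebesgue_on ?S) / k"
  have k: "k \<noteq> 0" using p by (simp add: k_def)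
  have "AE t in lebesgue_on ?S. q t - c = 0"
  proof (rule weak_zero_imp_AE_zero[OF S(1)])
    have cL: "(\<lambda>_. c) \<in> L2 ?S" by (rule smooth_in_L2[OF S smooth_const])
    show "integrable (lebesgue_on ?S) (\<lambda>t. q t - c)" by (intro L2_integrable[OF S] L2_diff q cL)
    fix \<psi> assume t: "test_function ?S \<psi>"
    define m where "m = (\<integral>t. \<psi> t \<partial>lebesgue_on ?S)"
    have t': "test_function ?S (\<lambda>t. \<psi> t + (- m / k) * \<phi> t)" by (rule test_function_comb[OF t p(1)])
    have i: "integrable (lebesgue_on ?S) \<psi>" "integrable (lebesgue_on ?S) \<phi>"
      by (intro L2_integrable[OF S] test_in_L2(1)[OF S] t p)+
    have "(\<integral>t. \<psi> t + (- m / k) * \<phi> t \<partial>lebesgue_on ?S) = 0"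
      using i k by (simp add: m_def[symmetric] k_def[symmetric])
    from test_function_primitive[OF t' lu this] obtain \<Psi> where P: "test_function ?S \<Psi>"
      "\<And>t. frechet_derivative \<Psi> (at t) 1 = \<psi> t + (- m / k) * \<phi> t" by auto
    have iq: "integrable (lebesgue_on ?S) (\<lambda>t. q t * \<psi> t)" "integrable (lebesgue_on ?S) (\<lambda>t. q t * \<phi> t)"
      by (intro L2_mult_integrable q test_in_L2(1)[OF S] t p)+
    have "0 = (\<integral>t. q t * (\<psi> t + (- m / k) * \<phi> t) \<partial>lebesgue_on ?S)"
      using d[unfolded has_weak_deriv_def, rule_format, OF P(1)] unfolding P(2) by simp
    also have "\<dots> = (\<integral>t. q t * \<psi> t + (- m / k) * (q t * \<phi> t) \<partial>lebesgue_on ?S)"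
      by (simp add: algebra_simps)
    also have "\<dots> = (\<integral>t. q t * \<psi> t \<partial>lebesgue_on ?S) + (- m / k) * (c * k)"
      using iq k by (simp add: c_def)
    finally have "(\<integral>t. q t * \<psi> t \<partial>lebesgue_on ?S) = c * m" using k by (simp add: field_simps)
    then show "(\<integral>t. (q t - c) * \<psi> t \<partial>lebesgue_on ?S) = 0"
      using iq i by (simp add: left_diff_distrib m_def)
  qed
  then show ?thesis by auto
qed

lemma borel_representative:
  fixes f :: "'a::euclidean_space \<Rightarrow> complex"
  assumes f: "f \<in> borel_measurable (lebesgue_on S)" and S: "S \<in> sets borel"
  obtains g where "g \<in> borel_measurable borel" "\<And>x. x \<notin> S \<Longrightarrow> g x = 0"
    "AE x in lebesgue_on S. f x = g x"
proof -
  have Sl: "S \<in> sets lebesgue" using S by (simp add: sets_completionI_sets)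
  have m: "(\<lambda>x. if x \<in> S then Re (f x) else 0) \<in> borel_measurable lebesgue"
    "(\<lambda>x. if x \<in> S then Im (f x) else 0) \<in> borel_measurable lebesgue"
    using f Sl by (auto intro!: borel_measurable_if_I)
  obtain gr where gr: "gr \<in> borel_measurable lborel" "AE x in lborel. (if x \<in> S then Re (f x) else 0) = gr x"
    using completion_ex_borel_measurable_real[OF m(1)] by (elim bexE)
  obtain gi where gi: "gi \<in> borel_measurable lborel" "AE x in lborel. (if x \<in> S then Im (f x) else 0) = gi x"
    using completion_ex_borel_measurable_real[OF m(2)] by (elim bexE)
  have [measurable]: "gr \<in> borel_measurable borel" "gi \<in> borel_measurable borel" "S \<in> sets borel" using gr gi S by auto
  show thesis
  proof (rule that)
    show "(\<lambda>x. indicator S x * Complex (gr x) (gi x)) \<in> borel_measurable borel"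
      unfolding Complex_eq by measurable
    have "AE x in lebesgue. x \<in> S \<longrightarrow> f x = indicator S x * Complex (gr x) (gi x)"
      using AE_completion[OF gr(2)] AE_completion[OF gi(2)]
      by eventually_elim (auto simp: complex_eq_iff)
    then show "AE x in lebesgue_on S. f x = indicator S x * Complex (gr x) (gi x)"
      using Sl by (simp add: AE_restrict_space_iff)
  qed auto
qed

lemma integrable_lebesgue_on_subset:
  fixes f :: "'a::euclidean_space \<Rightarrow> complex"
  assumes f: "integrable (lebesgue_on S) f" and "T \<subseteq> S" "S \<in> sets lebesgue" "T \<in> sets lebesgue"
  shows "integrable (lebesgue_on T) f"
proof -
  have "integrable lebesgue (\<lambda>x. indicator S x *\<^sub>R f x)"
    using f assms(3) by (subst (asm) integrable_restrict_space) auto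
  then have "integrable lebesgue (\<lambda>x. indicator T x *\<^sub>R (indicator S x *\<^sub>R f x))"
    by (rule integrable_mult_indicator[OF assms(4)])
  moreover have "(\<lambda>x. indicator T x *\<^sub>R (indicator S x *\<^sub>R f x)) = (\<lambda>x. indicator T x *\<^sub>R f x)"
    using assms(2) by (auto simp: indicator_def fun_eq_iff)
  ultimately have "integrable lebesgue (\<lambda>x. indicator T x *\<^sub>R f x)" by (simp only:)
  then show ?thesis using assms(4) by (subst integrable_restrict_space) auto
qed

text \<open>Since f is only square integrable, the formula comes from Fubini on the triangle s < t
  instead of the product rule. The value of \<psi> at the right end is kept, so the lemma serves for
  test functions and for \<psi>(t) = t alike.\<close>

lemma integral_primitive_parts:
  fixes f \<psi> \<psi>' :: "real \<Rightarrow> complex"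
  assumes lu: "l < u" and f: "f \<in> L2 {l<..<u}"
    and \<psi>: "\<And>t. t \<in> {l..u} \<Longrightarrow> (\<psi> has_vector_derivative \<psi>' t) (at t within {l..u})"
    and c: "continuous_on {l..u} \<psi>'"
  shows "(\<integral>t. integral {l..t} f * \<psi>' t \<partial>lebesgue_on {l<..<u}) = (\<integral>t. f t * (\<psi> u - \<psi> t) \<partial>lebesgue_on {l<..<u})"
proof -
  let ?S = "{l<..<u}"
  have S: "open ?S" "bounded ?S" "?S \<in> sets lebesgue" by auto
  obtain g where g [measurable]: "g \<in> borel_measurable borel" and g0: "\<And>x. x \<notin> ?S \<Longrightarrow> g x = 0"
    and ae: "AE x in lebesgue_on ?S. f x = g x"
    using borel_representative[OF L2_D(1)[OF f], of thesis] by auto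
  have fi: "integrable (lebesgue_on ?S) f" by (rule L2_integrable[OF S(1,2) f])
  have gm: "g \<in> borel_measurable (lebesgue_on T)" for T
    using g by (intro measurable_restrict_space1 measurable_completion) simp
  have gi': "integrable (lebesgue_on ?S) g"
    using integrable_cong_AE_imp[OF fi gm] ae by (simp add: eq_commute)
  have "integrable lebesgue (\<lambda>x. indicator ?S x *\<^sub>R g x)"
    using gi' by (subst (asm) integrable_restrict_space) auto
  moreover have "(\<lambda>x. indicator ?S x *\<^sub>R g x) = g" using g0 by (auto simp: indicator_def fun_eq_iff)
  ultimately have "integrable lebesgue g" by simp
  then have gi: "integrable lborel g" using integrable_completion[of g lborel] g by simp
  define p where "p t = indicator ?S t *\<^sub>R \<psi>' t" for t
  have p [measurable]: "p \<in> borel_measurable borel"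
    unfolding p_def by (rule borel_measurable_continuous_on_indicator) (auto intro: continuous_on_subset[OF c])
  have "compact (\<psi>' ` {l..u})" using c by (intro compact_continuous_image) auto
  then obtain M where M: "\<And>t. t \<in> {l..u} \<Longrightarrow> norm (\<psi>' t) \<le> M"
    using compact_imp_bounded bounded_iff by (metis imageI)
  have pi: "integrable lborel p"
  proof (rule Bochner_Integration.integrable_bound)
    show "integrable lborel (\<lambda>t. M * indicator ?S t :: real)" using lu by simp
    have "norm (p t) \<le> norm (M * indicator ?S t :: real)" for t
      using M[of t] by (auto simp: p_def indicator_def abs_if)
    then show "AE t in lborel. norm (p t) \<le> norm (M * indicator ?S t :: real)" by simp
  qed simp
  have J: "integral {l..t} f = (\<integral>s. indicator {..<t} s * g s \<partial>lborel)" if "t \<in> ?S" for t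
  proof -
    let ?T = "{l<..<t}"
    have fT: "integrable (lebesgue_on ?T) f"
      by (rule integrable_lebesgue_on_subset[OF fi]) (use that in auto)
    have aeT: "AE x in lebesgue_on ?T. f x = g x"
      using ae that by (auto simp: AE_restrict_space_iff elim!: eventually_mono)
    have "integral {l..t} f = integral ?T f" using integral_open_interval[of l t f] by (simp add: box_real)
    also have "\<dots> = (\<integral>s. f s \<partial>lebesgue_on ?T)" using lebesgue_integral_eq_integral[OF fT] by simp
    also have "\<dots> = (\<integral>s. g s \<partial>lebesgue_on ?T)"
      by (rule integral_cong_AE[OF borel_measurable_integrable[OF fT] gm aeT])
    also have "\<dots> = (\<integral>s. indicator {..<t} s * g s \<partial>lebesgue_on ?T)"
      by (rule Bochner_Integration.integral_cong) (auto simp: space_restrict_space)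
    also have "\<dots> = (\<integral>s. indicator {..<t} s * g s \<partial>lborel)"
      by (rule lebesgue_on_integral_eq_lborel) (use g0 that in \<open>auto simp: indicator_def\<close>)
    finally show ?thesis .
  qed
  \<comment> \<open>Integrating first in s produces the primitive of f at t; integrating first in t
    produces \<open>\<psi> u - \<psi> s\<close>.\<close>
  let ?F = "\<lambda>s t. (if s < t then 1 else 0) * (g s * p t) :: complex"
  have Gi: "integrable (lborel \<Otimes>\<^sub>M lborel) (\<lambda>(s, t). g s * p t)"
  proof (rule lborel_pair.Fubini_integrable)
    show "integrable lborel (\<lambda>s. \<integral>t. norm (case (s, t) of (s, t) \<Rightarrow> g s * p t) \<partial>lborel)"
      using gi by (simp add: norm_mult)
    show "AE s in lborel. integrable lborel (\<lambda>t. case (s, t) of (s, t) \<Rightarrow> g s * p t)" using pi by simp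
  qed measurable
  have Fi: "integrable (lborel \<Otimes>\<^sub>M lborel) (\<lambda>(s, t). ?F s t)"
    by (rule Bochner_Integration.integrable_bound[OF Gi]) (measurable, auto)
  have fub: "(\<integral>t. (\<integral>s. ?F s t \<partial>lborel) \<partial>lborel) = (\<integral>s. (\<integral>t. ?F s t \<partial>lborel) \<partial>lborel)"
    using lborel_pair.Fubini_integral[of ?F] Fi by simp
  have L: "(\<integral>s. ?F s t \<partial>lborel) = (\<integral>s. indicator {..<t} s * g s \<partial>lborel) * p t" for t
  proof -
    have "(\<integral>s. ?F s t \<partial>lborel) = (\<integral>s. (indicator {..<t} s * g s) * p t \<partial>lborel)"
      by (rule Bochner_Integration.integral_cong) (auto simp: indicator_def)
    then show ?thesis by simp
  qed
  have R: "(\<integral>t. ?F s t \<partial>lborel) = g s * (\<psi> u - \<psi> s)" for s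
  proof (cases "s \<in> ?S")
    case True
    have cs: "continuous_on {s..u} \<psi>'" by (rule continuous_on_subset[OF c]) (use True in auto)
    have "(\<integral>t. ?F s t \<partial>lborel) = (\<integral>t. g s * (indicator {s<..<u} t *\<^sub>R \<psi>' t) \<partial>lborel)"
      using True by (intro Bochner_Integration.integral_cong) (auto simp: indicator_def p_def)
    also have "\<dots> = g s * (\<integral>t. indicator {s<..<u} t *\<^sub>R \<psi>' t \<partial>lborel)"
      by (rule integral_mult_right_zero)
    also have "(\<integral>t. indicator {s<..<u} t *\<^sub>R \<psi>' t \<partial>lborel) = (\<integral>t. indicator {s<..<u} t *\<^sub>R \<psi>' t \<partial>lebesgue_on {s<..<u})"
    proof (rule lebesgue_on_integral_eq_lborel[symmetric])
      show "(\<lambda>t. indicator {s<..<u} t *\<^sub>R \<psi>' t) \<in> borel_measurable borel"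
        by (rule borel_measurable_continuous_on_indicator) (auto intro: continuous_on_subset[OF cs])
    qed auto
    also have "\<dots> = (\<integral>t. \<psi>' t \<partial>lebesgue_on {s<..<u})"
      by (rule Bochner_Integration.integral_cong) (auto simp: space_restrict_space)
    also have "\<dots> = integral {s..u} \<psi>'" by (rule integral_on_interval[OF cs])
    also have "\<dots> = \<psi> u - \<psi> s"
      by (rule integral_unique[OF fundamental_theorem_of_calculus])
         (use True in \<open>auto intro: has_vector_derivative_within_subset[OF \<psi>]\<close>)
    finally show ?thesis .
  next
    case False
    then show ?thesis using g0[of s] by simp
  qed
  have "(\<integral>t. integral {l..t} f * \<psi>' t \<partial>lebesgue_on ?S) = (\<integral>t. (\<integral>s. indicator {..<t} s * g s \<partial>lborel) * p t \<partial>lebesgue_on ?S)"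
    by (rule Bochner_Integration.integral_cong) (use J in \<open>auto simp: space_restrict_space p_def\<close>)
  also have "\<dots> = (\<integral>t. (\<integral>s. indicator {..<t} s * g s \<partial>lborel) * p t \<partial>lborel)"
  proof (rule lebesgue_on_integral_eq_lborel)
    have "(\<lambda>t. (\<integral>s. ?F s t \<partial>lborel)) \<in> borel_measurable borel"
      by (rule lborel.borel_measurable_lebesgue_integral) measurable
    then show "(\<lambda>t. (\<integral>s. indicator {..<t} s * g s \<partial>lborel) * p t) \<in> borel_measurable borel" by (simp only: L)
  qed (auto simp: p_def)
  also have "\<dots> = (\<integral>s. g s * (\<psi> u - \<psi> s) \<partial>lborel)" using fub by (simp only: L R)
  also have "\<dots> = (\<integral>s. g s * (\<psi> u - \<psi> s) \<partial>lebesgue_on ?S)"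
  proof (rule lebesgue_on_integral_eq_lborel[symmetric])
    have "(\<lambda>s. (\<integral>t. ?F s t \<partial>lborel)) \<in> borel_measurable borel"
      by (rule lborel.borel_measurable_lebesgue_integral) measurable
    then show "(\<lambda>s. g s * (\<psi> u - \<psi> s)) \<in> borel_measurable borel" by (simp only: R)
  qed (use g0 in auto)
  also have "\<dots> = (\<integral>s. f s * (\<psi> u - \<psi> s) \<partial>lebesgue_on ?S)"
  proof (rule integral_cong_AE)
    have pc: "continuous_on {l<..<u} (\<lambda>s. \<psi> u - \<psi> s)"
      by (intro continuous_intros continuous_on_subset[OF continuous_on_vector_derivative[OF \<psi>]]) auto
    have pm: "(\<lambda>s. \<psi> u - \<psi> s) \<in> borel_measurable (lebesgue_on ?S)"
      by (rule continuous_measurable_on[OF pc]) auto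
    show "(\<lambda>s. g s * (\<psi> u - \<psi> s)) \<in> borel_measurable (lebesgue_on ?S)" by (intro borel_measurable_times gm pm)
    show "(\<lambda>s. f s * (\<psi> u - \<psi> s)) \<in> borel_measurable (lebesgue_on ?S)" by (intro borel_measurable_times L2_D(1)[OF f] pm)
    show "AE s in lebesgue_on ?S. g s * (\<psi> u - \<psi> s) = f s * (\<psi> u - \<psi> s)" using ae by eventually_elim simp
  qed
  finally show ?thesis .
qed

lemma L2_integrable_on:
  assumes "f \<in> L2 {l<..<u::real}" shows "f integrable_on {l..u}"
proof -
  have "integrable (lebesgue_on {l<..<u}) f" by (rule L2_integrable[OF _ _ assms]) auto
  then have "f integrable_on {l<..<u}" by (rule integrable_on_lebesgue_on) simp
  then show ?thesis using integrable_on_open_interval[of f l u] by (simp add: box_real)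
qed

lemma continuous_primitive:
  assumes "f \<in> L2 {l<..<u::real}" shows "continuous_on {l..u} (\<lambda>t. integral {l..t} f)"
  by (rule indefinite_integral_continuous_1[OF L2_integrable_on[OF assms]])

lemma smooth_vector_derivative:
  fixes \<phi> :: "real \<Rightarrow> complex"
  assumes "smooth \<phi>"
  shows "(\<phi> has_vector_derivative frechet_derivative \<phi> (at t) 1) (at t)"
proof -
  have D: "(\<phi> has_derivative frechet_derivative \<phi> (at t)) (at t)" by (rule smooth_has_derivative[OF assms])
  have "frechet_derivative \<phi> (at t) x = x *\<^sub>R frechet_derivative \<phi> (at t) 1" for x
    using linear_scale[OF has_derivative_linear[OF D], of x 1] by simp
  then have "frechet_derivative \<phi> (at t) = (\<lambda>x. x *\<^sub>R frechet_derivative \<phi> (at t) 1)" by (rule ext)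
  with D show ?thesis unfolding has_vector_derivative_def by simp
qed

lemma weak_deriv_primitive:
  assumes lu: "l < u" and f: "f \<in> L2 {l<..<u::real}"
  shows "has_weak_deriv {l<..<u} 1 (\<lambda>t. integral {l..t} f) f"
  unfolding has_weak_deriv_def
proof (intro allI impI)
  fix \<phi> assume t: "test_function {l<..<u} \<phi>"
  then have s: "smooth \<phi>" and u: "\<phi> u = 0" unfolding test_function_def by auto
  note d = smooth_vector_derivative[OF s]
  have "(\<integral>t. integral {l..t} f * frechet_derivative \<phi> (at t) 1 \<partial>lebesgue_on {l<..<u})
      = (\<integral>t. f t * (\<phi> u - \<phi> t) \<partial>lebesgue_on {l<..<u})"
    by (rule integral_primitive_parts[OF lu f has_vector_derivative_at_within[OF d] smooth_continuous[OF smooth_frechet[OF s]]])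
  then show "(\<integral>t. integral {l..t} f * frechet_derivative \<phi> (at t) 1 \<partial>lebesgue_on {l<..<u})
      = - (\<integral>t. f t * \<phi> t \<partial>lebesgue_on {l<..<u})" using u by simp
qed

text \<open>Subtracting the primitive of f leaves a function with weak derivative zero, to which
  \<open>du_bois_reymond\<close> applies.\<close>

lemma weak_deriv_imp_primitive:
  assumes lu: "l < u" and q: "q \<in> L2 {l<..<u}" and f: "f \<in> L2 {l<..<u::real}"
    and d: "has_weak_deriv {l<..<u} 1 q f"
  shows "\<exists>c. AE t in lebesgue_on {l<..<u}. q t = c + integral {l..t} f"
proof -
  have S: "open {l<..<u}" "bounded {l<..<u}" by auto
  have J: "(\<lambda>t. integral {l..t} f) \<in> L2 {l<..<u}"
    by (rule continuous_in_L2[OF S]) (use continuous_primitive[OF f] lu in simp)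
  have "has_weak_deriv {l<..<u} 1 (\<lambda>t. q t + (- 1) * integral {l..t} f) (\<lambda>t. f t + (- 1) * f t)"
    by (rule weak_deriv_comb[OF S q J f f d weak_deriv_primitive[OF lu f]])
  then have "has_weak_deriv {l<..<u} 1 (\<lambda>t. q t - integral {l..t} f) (\<lambda>t. 0)" by simp
  from du_bois_reymond[OF lu L2_diff[OF q J] this] obtain c
    where "AE t in lebesgue_on {l<..<u}. q t - integral {l..t} f = c" by auto
  then have "AE t in lebesgue_on {l<..<u}. q t = c + integral {l..t} f" by eventually_elim (simp add: algebra_simps)
  then show ?thesis by auto
qed

section \<open>One-dimensional inequalities\<close>

text \<open>Integrate the square of the deviation of g from its mean value m.\<close>

lemma integral_square_le:
  fixes g :: "real \<Rightarrow> real"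
  assumes "l < r" "continuous_on {l..r} g"
  shows "(integral {l..r} g)\<^sup>2 \<le> (r - l) * integral {l..r} (\<lambda>x. (g x)\<^sup>2)"
proof -
  define m where "m = integral {l..r} g / (r - l)"
  have i: "g integrable_on {l..r}" "(\<lambda>x. (g x)\<^sup>2) integrable_on {l..r}"
    by (intro integrable_continuous_interval continuous_intros assms)+
  have "0 \<le> integral {l..r} (\<lambda>x. (g x - m)\<^sup>2)"
    by (intro integral_nonneg integrable_continuous_interval continuous_intros assms) auto
  also have "\<dots> = integral {l..r} (\<lambda>x. (g x)\<^sup>2 - 2 * m * g x + m\<^sup>2)"
    by (intro Henstock_Kurzweil_Integration.integral_cong) (simp add: power2_diff algebra_simps)
  also have "\<dots> = integral {l..r} (\<lambda>x. (g x)\<^sup>2) - 2 * m * integral {l..r} g + m\<^sup>2 * (r - l)"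
    using i assms(1)
    by (subst Henstock_Kurzweil_Integration.integral_add Henstock_Kurzweil_Integration.integral_diff;
        (auto intro!: integrable_diff integrable_on_mult_right)?)+
  also have "\<dots> = integral {l..r} (\<lambda>x. (g x)\<^sup>2) - (integral {l..r} g)\<^sup>2 / (r - l)"
    using assms(1) by (simp add: m_def power2_eq_square)
  finally show ?thesis using assms(1) by (simp add: pos_divide_le_eq mult.commute)
qed

lemma value_diff_sq_le:
  fixes q q' :: "real \<Rightarrow> complex"
  assumes lr: "l < r" and d: "\<And>x. (q has_vector_derivative q' x) (at x)" and c: "continuous_on {l..r} q'"
    and st: "s \<in> {l..r}" "t \<in> {l..r}"
  shows "(norm (q s - q t))\<^sup>2 \<le> (r - l) * integral {l..r} (\<lambda>x. (norm (q' x))\<^sup>2)"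
proof -
  have *: "norm (q s - q t) \<le> integral {l..r} (\<lambda>x. norm (q' x))" if "t \<le> s" "s \<in> {l..r}" "t \<in> {l..r}" for s t
  proof -
    have ci: "continuous_on {t..s} q'" by (rule continuous_on_subset[OF c]) (use that in auto)
    have "(q' has_integral (q s - q t)) {t..s}"
      by (rule fundamental_theorem_of_calculus[OF that(1)]) (rule has_vector_derivative_at_within[OF d])
    then have "norm (q s - q t) = norm (integral {t..s} q')" by (simp add: integral_unique)
    also have "\<dots> \<le> integral {t..s} (\<lambda>x. norm (q' x))"
      by (rule integral_norm_bound_integral)
         (use ci in \<open>auto intro!: integrable_continuous_interval continuous_intros\<close>)
    also have "\<dots> \<le> integral {l..r} (\<lambda>x. norm (q' x))"
      by (rule integral_subset_le)
         (use ci c that in \<open>auto intro!: integrable_continuous_interval continuous_intros\<close>)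
    finally show ?thesis .
  qed
  have "norm (q s - q t) \<le> integral {l..r} (\<lambda>x. norm (q' x))"
    using *[of t s] *[of s t] st by (cases "t \<le> s") (auto simp: norm_minus_commute)
  then have "(norm (q s - q t))\<^sup>2 \<le> (integral {l..r} (\<lambda>x. norm (q' x)))\<^sup>2" by (intro power_mono) auto
  also have "\<dots> \<le> (r - l) * integral {l..r} (\<lambda>x. (norm (q' x))\<^sup>2)"
    by (rule integral_square_le[OF lr]) (intro continuous_intros c)
  finally show ?thesis .
qed

lemma norm_sq_split: "(norm (x::complex))\<^sup>2 \<le> 2 * (norm y)\<^sup>2 + 2 * (norm (x - y))\<^sup>2"
proof -
  have "norm x \<le> norm y + norm (x - y)" by norm
  then have "(norm x)\<^sup>2 \<le> (norm y + norm (x - y))\<^sup>2" by (intro power_mono) auto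
  also have "\<dots> \<le> 2 * (norm y)\<^sup>2 + 2 * (norm (x - y))\<^sup>2"
    using sum_squares_bound[of "norm y" "norm (x - y)"] by (simp add: power2_sum)
  finally show ?thesis .
qed

text \<open>The value at s differs from the value at t by at most the integrated derivative;
  averaging the squared bound over t gives the claim. This and its counterpart
  \<open>friedrichs_1d\<close> are applied on every line of the cell.\<close>

lemma trace_bound_1d:
  fixes q q' :: "real \<Rightarrow> complex"
  assumes lr: "l < r" and d: "\<And>x. (q has_vector_derivative q' x) (at x)" and c: "continuous_on {l..r} q'"
    and s: "s \<in> {l..r}"
  shows "(r - l) * (norm (q s))\<^sup>2 \<le> 2 * integral {l..r} (\<lambda>x. (norm (q x))\<^sup>2)
     + 2 * (r - l)\<^sup>2 * integral {l..r} (\<lambda>x. (norm (q' x))\<^sup>2)"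
proof -
  let ?I = "integral {l..r} (\<lambda>x. (norm (q' x))\<^sup>2)"
  have qc: "continuous_on {l..r} q"
    using d by (meson continuous_at_imp_continuous_on has_vector_derivative_continuous)
  have "(norm (q s))\<^sup>2 \<le> 2 * (norm (q t))\<^sup>2 + 2 * ((r - l) * ?I)" if "t \<in> {l..r}" for t
    using norm_sq_split[of "q s" "q t"] value_diff_sq_le[OF lr d c s that] by linarith
  then have "integral {l..r} (\<lambda>t. (norm (q s))\<^sup>2) \<le> integral {l..r} (\<lambda>t. 2 * (norm (q t))\<^sup>2 + 2 * ((r - l) * ?I))"
    by (intro integral_le integrable_continuous_interval continuous_intros qc) auto
  also have "\<dots> = 2 * integral {l..r} (\<lambda>t. (norm (q t))\<^sup>2) + (r - l) * (2 * ((r - l) * ?I))"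
    using lr by (subst Henstock_Kurzweil_Integration.integral_add)
      (auto intro!: integrable_continuous_interval continuous_intros qc)
  finally show ?thesis using lr by (simp add: power2_eq_square algebra_simps)
qed

lemma friedrichs_1d:
  fixes q q' :: "real \<Rightarrow> complex"
  assumes lr: "l < r" and d: "\<And>x. (q has_vector_derivative q' x) (at x)" and c: "continuous_on {l..r} q'"
    and s: "s \<in> {l..r}"
  shows "integral {l..r} (\<lambda>x. (norm (q x))\<^sup>2) \<le> 2 * (r - l) * (norm (q s))\<^sup>2
     + 2 * (r - l)\<^sup>2 * integral {l..r} (\<lambda>x. (norm (q' x))\<^sup>2)"
proof -
  let ?I = "integral {l..r} (\<lambda>x. (norm (q' x))\<^sup>2)"
  have qc: "continuous_on {l..r} q"
    using d by (meson continuous_at_imp_continuous_on has_vector_derivative_continuous)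
  have "(norm (q t))\<^sup>2 \<le> 2 * (norm (q s))\<^sup>2 + 2 * ((r - l) * ?I)" if "t \<in> {l..r}" for t
    using norm_sq_split[of "q t" "q s"] value_diff_sq_le[OF lr d c that s] by linarith
  then have "integral {l..r} (\<lambda>t. (norm (q t))\<^sup>2) \<le> integral {l..r} (\<lambda>t. 2 * (norm (q s))\<^sup>2 + 2 * ((r - l) * ?I))"
    by (intro integral_le integrable_continuous_interval continuous_intros qc) auto
  then show ?thesis using lr by (simp add: power2_eq_square algebra_simps)
qed

section \<open>The sharp Wirtinger inequality\<close>

lemma isCont_square_cot:
  fixes g :: "real \<Rightarrow> real"
  assumes g: "(g has_real_derivative g') (at p)" "g p = 0" and k: "k > 0"
  shows "((\<lambda>x. (g x)\<^sup>2 * cot (k * (x - p))) \<longlongrightarrow> 0) (at p)"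
proof -
  have 1: "((\<lambda>x. g x / (x - p)) \<longlongrightarrow> g') (at p)"
    using g by (simp add: has_field_derivative_iff)
  have 2: "(g \<longlongrightarrow> 0) (at p)" using DERIV_isCont[OF g(1)] g(2) by (simp add: isCont_def)
  have "((\<lambda>x. sin (k * (x - p))) has_real_derivative k) (at p)"
    by (auto intro!: derivative_eq_intros)
  then have "((\<lambda>x. sin (k * (x - p)) / (x - p)) \<longlongrightarrow> k) (at p)" by (simp add: has_field_derivative_iff)
  then have 3: "((\<lambda>x. inverse (sin (k * (x - p)) / (x - p))) \<longlongrightarrow> inverse k) (at p)"
    using k by (intro tendsto_inverse) auto
  have 4: "((\<lambda>x. cos (k * (x - p))) \<longlongrightarrow> cos (k * (p - p))) (at p)" by (intro tendsto_intros)
  have "((\<lambda>x. g x / (x - p) * g x * (cos (k * (x - p)) * inverse (sin (k * (x - p)) / (x - p)))) \<longlongrightarrow>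
      g' * 0 * (cos (k * (p - p)) * inverse k)) (at p)"
    by (intro tendsto_mult 1 2 3 4)
  then have L: "((\<lambda>x. g x / (x - p) * g x * (cos (k * (x - p)) * inverse (sin (k * (x - p)) / (x - p)))) \<longlongrightarrow> 0) (at p)"
    by simp
  have "\<forall>\<^sub>F x in at p. g x / (x - p) * g x * (cos (k * (x - p)) * inverse (sin (k * (x - p)) / (x - p)))
      = (g x)\<^sup>2 * cot (k * (x - p))"
    by (rule eventually_at_filter[THEN iffD2]) (auto simp: cot_def power2_eq_square divide_inverse)
  then show ?thesis by (rule Lim_transform_eventually[OF L])
qed

lemma cot_add_int_pi: "cot (y + of_int n * pi) = cot (y::real)"
proof -
  have s: "sin (of_int n * pi) = 0" unfolding sin_zero_iff_int2 by auto
  have "sin (y + of_int n * pi) = cos (of_int n * pi) * sin y" "cos (y + of_int n * pi) = cos (of_int n * pi) * cos y"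
    using s by (simp_all add: sin_add cos_add)
  moreover have "(cos (of_int n * pi))\<^sup>2 = 1" using sin_cos_squared_add[of "of_int n * pi"] s by simp
  then have "cos (of_int n * pi) \<noteq> 0" by auto
  ultimately show ?thesis by (simp add: cot_def)
qed

text \<open>The constant h/pi is optimal, and its exact value matters: on the cell it makes the
  cross term of the form at most |\<tau>| times the squared x_1-derivative, so a share \<kappa>
  survives for every |\<tau>| < 1 - \<kappa>. The proof subtracts a value that f takes at two points
  of distance h and completes a square: with g = f - f(b) and k = pi/h, the derivative of g^2 cot(k
  (x - b)) is at most (f'^2 - k^2 g^2)/k, and its integral over a period is zero.\<close>

lemma wirtinger_real:
  fixes f f' :: "real \<Rightarrow> real"
  assumes h: "h > 0" and d: "\<And>x. (f has_real_derivative f' x) (at x)" and c: "continuous_on {-h..h} f'"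
    and per: "f h = f (- h)"
  shows "\<exists>b. integral {-h..h} (\<lambda>x. (f x - b)\<^sup>2) \<le> (h / pi)\<^sup>2 * integral {-h..h} (\<lambda>x. (f' x)\<^sup>2)"
proof -
  have fc: "continuous_on A f" for A
    using d DERIV_isCont by (intro continuous_at_imp_continuous_on) blast
  \<comment> \<open>By periodicity \<open>f (b + h) - f b\<close> has opposite signs at b = -h and
    at b = 0.\<close>
  have "\<exists>b\<ge>-h. b \<le> 0 \<and> f (b + h) - f b = 0"
  proof (cases "f 0 \<ge> f (- h)")
    case True
    show ?thesis
      by (rule IVT2') (use True per h in \<open>auto intro!: continuous_intros continuous_on_compose2[OF fc]\<close>)
  next
    case False
    show ?thesis
      by (rule IVT') (use False per h in \<open>auto intro!: continuous_intros continuous_on_compose2[OF fc]\<close>)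
  qed
  then obtain b where b: "- h \<le> b" "b \<le> 0" "f (b + h) = f b" by auto
  define g where "g x = f x - f b" for x
  define k where "k = pi / h"
  have k: "k > 0" using h by (simp add: k_def)
  have kh: "k * h = pi" using h by (simp add: k_def)
  \<comment> \<open>These points contain all zeros of sin(k (x - b)) in [-h, h].\<close>
  define S where "S = {b - h, b, b + h, b + 2 * h}"
  have gS: "g p = 0" if pS: "p \<in> S" and pI: "p \<in> {-h..h}" for p
  proof -
    consider "p = b - h" | "p = b" | "p = b + h" | "p = b + 2 * h" using pS unfolding S_def by blast
    then show ?thesis
    proof cases
      case 1
      then have "b = 0" using pI b by auto
      then show ?thesis using 1 b(3) per by (simp add: g_def)
    next
      case 4
      then have "b = - h" using pI b by auto
      then show ?thesis using 4 per by (simp add: g_def)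
    qed (use b in \<open>auto simp: g_def\<close>)
  qed
  have sin0: "sin (k * (x - b)) \<noteq> 0" if "x \<in> {-h..h}" "x \<notin> S" for x
  proof
    assume "sin (k * (x - b)) = 0"
    then obtain n :: int where n: "k * (x - b) = of_int n * pi" using sin_zero_iff_int2 by auto
    then have "k * (x - b) = k * (of_int n * h)" using kh by (simp add: algebra_simps)
    then have xb: "x - b = of_int n * h" using k by simp
    have "of_int n * h \<le> 2 * h" "- 1 * h \<le> of_int n * h" using that(1) b xb by auto
    then have "of_int n \<le> (2::real)" "(-1::real) \<le> of_int n" using h by (auto simp only: mult_le_cancel_right_pos)
    then have "n \<le> 2" "-1 \<le> n" by auto
    then have "n = -1 \<or> n = 0 \<or> n = 1 \<or> n = 2" by auto
    then show False using xb that(2) by (auto simp: S_def)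
  qed
  have gd: "(g has_real_derivative f' x) (at x)" for x
    unfolding g_def using d by (auto intro!: derivative_eq_intros)
  define F where "F x = (g x)\<^sup>2 * cot (k * (x - b))" for x
  \<comment> \<open>On the finite exceptional set the value is free for the fundamental theorem;
    this choice makes the pointwise inequality below an equality there.\<close>
  define F' where "F' x = (if x \<in> S then ((f' x)\<^sup>2 - k\<^sup>2 * (g x)\<^sup>2) / k
    else 2 * g x * f' x * cot (k * (x - b)) - (g x)\<^sup>2 * k / (sin (k * (x - b)))\<^sup>2)" for x
  have Fd: "(F has_real_derivative F' x) (at x)" if "x \<in> {-h..h}" "x \<notin> S" for x
  proof -
    have a: "((\<lambda>x. k * (x - b)) has_real_derivative k) (at x)" by (auto intro!: derivative_eq_intros)
    have b: "((\<lambda>x. cot (k * (x - b))) has_real_derivative - inverse ((sin (k * (x - b)))\<^sup>2) * k) (at x)"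
      by (rule DERIV_chain2[OF DERIV_cot[OF sin0[OF that]] a])
    have c: "((\<lambda>x. (g x)\<^sup>2) has_real_derivative 2 * g x * f' x) (at x)"
      by (auto intro!: derivative_eq_intros gd)
    show ?thesis unfolding F_def using DERIV_mult[OF c b] that
      by (simp add: F'_def divide_inverse algebra_simps)
  qed
  \<comment> \<open>At points of S the simple pole of the cotangent is cancelled by the double zero
    of g^2.\<close>
  have Fc: "isCont F x" if "x \<in> {-h..h}" for x
  proof (cases "x \<in> S")
    case False
    then show ?thesis using Fd[OF that] DERIV_isCont by blast
  next
    case True
    have "\<exists>n::int. x = b + of_int n * h"
      using True by (auto simp: S_def intro: exI[of _ "-1"] exI[of _ 0] exI[of _ 1] exI[of _ 2])
    then obtain n :: int where n: "x = b + of_int n * h" by auto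
    have "cot (k * (y - b)) = cot (k * (y - x))" for y
    proof -
      have "k * (y - b) = k * (y - x) + of_int n * pi" using kh n by (simp add: algebra_simps)
      then show ?thesis by (simp add: cot_add_int_pi)
    qed
    then have "F = (\<lambda>y. (g y)\<^sup>2 * cot (k * (y - x)))" by (auto simp: F_def)
    then show ?thesis using isCont_square_cot[OF gd gS[OF True that] k] gS[OF True that]
      by (simp add: isCont_def)
  qed
  have "(F' has_integral (F h - F (- h))) {-h..h}"
  proof (rule fundamental_theorem_of_calculus_interior_strong[of S])
    show "(F has_vector_derivative F' x) (at x)" if "x \<in> {- h<..<h} - S" for x
      using Fd[of x] that by (simp add: has_real_derivative_iff_has_vector_derivative)
    show "continuous_on {- h..h} F" using Fc by (intro continuous_at_imp_continuous_on) auto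
  qed (use h in \<open>auto simp: S_def\<close>)
  moreover have "F h = F (- h)"
  proof -
    have "k * (h - b) = k * (- h - b) + of_int 2 * pi" using kh by (simp add: algebra_simps)
    then have "cot (k * (h - b)) = cot (k * (- h - b))" using cot_add_int_pi[of "k * (- h - b)" 2] by simp
    then show ?thesis using per by (simp add: F_def g_def)
  qed
  ultimately have Fi: "((\<lambda>x. k * F' x) has_integral 0) {-h..h}"
    using has_integral_mult_right[of F' 0 "{-h..h}" k] by simp
  have i1: "(\<lambda>x. (f' x)\<^sup>2) integrable_on {-h..h}" "(\<lambda>x. k\<^sup>2 * (g x)\<^sup>2) integrable_on {-h..h}"
    unfolding g_def by (intro integrable_continuous_interval continuous_intros c fc)+
  have "((\<lambda>x. (f' x)\<^sup>2 - k\<^sup>2 * (g x)\<^sup>2) has_integral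
      (integral {-h..h} (\<lambda>x. (f' x)\<^sup>2) - integral {-h..h} (\<lambda>x. k\<^sup>2 * (g x)\<^sup>2))) {-h..h}"
    by (intro has_integral_diff integrable_integral i1)
  from has_integral_le[OF Fi this]
  have "0 \<le> integral {-h..h} (\<lambda>x. (f' x)\<^sup>2) - integral {-h..h} (\<lambda>x. k\<^sup>2 * (g x)\<^sup>2)"
  proof -
    have "k * F' x \<le> (f' x)\<^sup>2 - k\<^sup>2 * (g x)\<^sup>2" if "x \<in> {-h..h}" for x
    proof (cases "x \<in> S")
      case True
      then show ?thesis using k by (simp add: F'_def)
    next
      case False
      define s where "s = sin (k * (x - b))"
      define co where "co = cos (k * (x - b))"
      have s: "s \<noteq> 0" using sin0[OF that False] by (simp add: s_def)
      have sc: "s\<^sup>2 + co\<^sup>2 = 1" by (simp add: s_def co_def)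
      have e: "1 / s\<^sup>2 = 1 + (co / s)\<^sup>2" using s sc by (simp add: power_divide field_simps)
      \<comment> \<open>The completed square; together with 1/sin^2 = 1 + cot^2 it compares
        \<open>k * F' x\<close> with
        \<open>(f' x)\<^sup>2 - k\<^sup>2 * (g x)\<^sup>2\<close>.\<close>
      have "0 \<le> (f' x - k * g x * (co / s))\<^sup>2" by simp
      also have "\<dots> = (f' x)\<^sup>2 - 2 * k * g x * f' x * (co / s) + k\<^sup>2 * (g x)\<^sup>2 * (co / s)\<^sup>2"
        by (simp add: power2_eq_square algebra_simps)
      also have "(co / s)\<^sup>2 = 1 / s\<^sup>2 - 1" using e by simp
      finally have "0 \<le> (f' x)\<^sup>2 - 2 * k * g x * f' x * (co / s) + k\<^sup>2 * (g x)\<^sup>2 * (1 / s\<^sup>2 - 1)" .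
      moreover have "k * F' x = 2 * k * g x * f' x * (co / s) - k\<^sup>2 * (g x)\<^sup>2 * (1 / s\<^sup>2)"
        using False by (simp add: F'_def cot_def s_def co_def power2_eq_square algebra_simps)
      ultimately show ?thesis by (simp add: right_diff_distrib)
    qed
    then show ?thesis using has_integral_le[OF Fi] \<open>((\<lambda>x. (f' x)\<^sup>2 - k\<^sup>2 * (g x)\<^sup>2) has_integral _) _\<close> by blast
  qed
  then have "k\<^sup>2 * integral {-h..h} (\<lambda>x. (g x)\<^sup>2) \<le> integral {-h..h} (\<lambda>x. (f' x)\<^sup>2)" by simp
  then have "integral {-h..h} (\<lambda>x. (g x)\<^sup>2) \<le> integral {-h..h} (\<lambda>x. (f' x)\<^sup>2) / k\<^sup>2"
    using k by (simp add: pos_le_divide_eq mult.commute)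
  also have "\<dots> = (h / pi)\<^sup>2 * integral {-h..h} (\<lambda>x. (f' x)\<^sup>2)" by (simp add: k_def power_divide)
  finally show ?thesis unfolding g_def by blast
qed

text \<open>The real version gives some constants for the real and the imaginary part. Among all
  constants the mean value minimises the L2 distance, so it may replace them.\<close>

lemma wirtinger:
  fixes q q' :: "real \<Rightarrow> complex"
  assumes h: "h > 0" and d: "\<And>x. (q has_vector_derivative q' x) (at x)" and c: "continuous_on {-h..h} q'"
    and per: "q h = q (- h)"
  shows "integral {-h..h} (\<lambda>x. (norm (q x - integral {-h..h} q / of_real (2 * h)))\<^sup>2)
    \<le> (h / pi)\<^sup>2 * integral {-h..h} (\<lambda>x. (norm (q' x))\<^sup>2)"
proof -
  let ?I = "integral {-h..h}"
  have qc: "continuous_on A q" for A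
    using d by (meson continuous_at_imp_continuous_on has_vector_derivative_continuous)
  have dR: "((\<lambda>x. Re (q x)) has_real_derivative Re (q' x)) (at x)" for x
    using d[of x] by (simp add: has_vector_derivative_complex_iff)
  have dI: "((\<lambda>x. Im (q x)) has_real_derivative Im (q' x)) (at x)" for x
    using d[of x] by (simp add: has_vector_derivative_complex_iff)
  obtain b1 where b1: "?I (\<lambda>x. (Re (q x) - b1)\<^sup>2) \<le> (h / pi)\<^sup>2 * ?I (\<lambda>x. (Re (q' x))\<^sup>2)"
    using wirtinger_real[OF h dR] per c by (auto intro: continuous_intros)
  obtain b2 where b2: "?I (\<lambda>x. (Im (q x) - b2)\<^sup>2) \<le> (h / pi)\<^sup>2 * ?I (\<lambda>x. (Im (q' x))\<^sup>2)"
    using wirtinger_real[OF h dI] per c by (auto intro: continuous_intros)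
  define m where "m = ?I q / of_real (2 * h)"
  define b where "b = Complex b1 b2"
  have qi: "q integrable_on {-h..h}" by (rule integrable_continuous_interval[OF qc])
  have mI: "?I (\<lambda>x. q x - m) = 0"
    using h qi by (subst Henstock_Kurzweil_Integration.integral_diff) (auto simp: m_def scaleR_conv_of_real)
  \<comment> \<open>Pythagoras: after integration the mixed term vanishes, because q - m has mean
    zero.\<close>
  have e: "(norm (q x - b))\<^sup>2 = (norm (q x - m))\<^sup>2 + (2 * Re (cnj (m - b) * (q x - m)) + (norm (m - b))\<^sup>2)" for x
    unfolding cmod_power2 by (simp add: power2_eq_square algebra_simps)
  have "?I (\<lambda>x. Re (cnj (m - b) * (q x - m))) = Re (?I (\<lambda>x. cnj (m - b) * (q x - m)))"
  proof -
    have "(\<lambda>x. cnj (m - b) * (q x - m)) integrable_on {-h..h}"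
      by (intro integrable_continuous_interval continuous_intros qc)
    from integral_linear[OF this bounded_linear_Re] show ?thesis by (simp add: o_def)
  qed
  also have "\<dots> = 0" using mI by simp
  finally have z: "?I (\<lambda>x. Re (cnj (m - b) * (q x - m))) = 0" .
  have "?I (\<lambda>x. (norm (q x - m))\<^sup>2) \<le> ?I (\<lambda>x. (norm (q x - m))\<^sup>2) + (2 * ?I (\<lambda>x. Re (cnj (m - b) * (q x - m))) + 2 * h * (norm (m - b))\<^sup>2)"
    using h z by simp
  also have "\<dots> = ?I (\<lambda>x. (norm (q x - b))\<^sup>2)"
  proof -
    have "?I (\<lambda>x. (norm (q x - b))\<^sup>2) = ?I (\<lambda>x. (norm (q x - m))\<^sup>2) + ?I (\<lambda>x. 2 * Re (cnj (m - b) * (q x - m)) + (norm (m - b))\<^sup>2)"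
      unfolding e by (intro Henstock_Kurzweil_Integration.integral_add integrable_continuous_interval continuous_intros qc)
    also have "?I (\<lambda>x. 2 * Re (cnj (m - b) * (q x - m)) + (norm (m - b))\<^sup>2)
        = ?I (\<lambda>x. 2 * Re (cnj (m - b) * (q x - m))) + ?I (\<lambda>x. (norm (m - b))\<^sup>2)"
      by (intro Henstock_Kurzweil_Integration.integral_add integrable_continuous_interval continuous_intros qc)
    also have "?I (\<lambda>x. 2 * Re (cnj (m - b) * (q x - m))) = 2 * ?I (\<lambda>x. Re (cnj (m - b) * (q x - m)))"
      by (rule Henstock_Kurzweil_Integration.integral_mult_right)
    finally show ?thesis using h z by simp
  qed
  also have "\<dots> = ?I (\<lambda>x. (Re (q x) - b1)\<^sup>2) + ?I (\<lambda>x. (Im (q x) - b2)\<^sup>2)"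
    unfolding cmod_power2 b_def
    by (subst Henstock_Kurzweil_Integration.integral_add[symmetric])
       (auto intro!: integrable_continuous_interval continuous_intros qc)
  also have "\<dots> \<le> (h / pi)\<^sup>2 * (?I (\<lambda>x. (Re (q' x))\<^sup>2) + ?I (\<lambda>x. (Im (q' x))\<^sup>2))"
    using b1 b2 by (simp add: distrib_left)
  also have "?I (\<lambda>x. (Re (q' x))\<^sup>2) + ?I (\<lambda>x. (Im (q' x))\<^sup>2) = ?I (\<lambda>x. (norm (q' x))\<^sup>2)"
    unfolding cmod_power2
    by (subst Henstock_Kurzweil_Integration.integral_add[symmetric])
       (auto intro!: integrable_continuous_interval continuous_intros c)
  finally show ?thesis unfolding m_def .
qed

section \<open>The form domain on the periodicity cell\<close>

abbreviation d1 :: "(real \<times> real \<Rightarrow> complex) \<Rightarrow> real \<times> real \<Rightarrow> complex" where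
  "d1 \<phi> x \<equiv> frechet_derivative \<phi> (at x) (1, 0)"
abbreviation d2 :: "(real \<times> real \<Rightarrow> complex) \<Rightarrow> real \<times> real \<Rightarrow> complex" where
  "d2 \<phi> x \<equiv> frechet_derivative \<phi> (at x) (0, 1)"

lemma slice_deriv:
  assumes "smooth \<phi>"
  shows "((\<lambda>s. \<phi> (s, t)) has_vector_derivative d1 \<phi> (s, t)) (at s)"
    and "((\<lambda>t. \<phi> (s, t)) has_vector_derivative d2 \<phi> (s, t)) (at t)"
proof -
  let ?D = "frechet_derivative \<phi> (at (s, t))"
  have D: "(\<phi> has_derivative ?D) (at (s, t))" by (rule smooth_has_derivative[OF assms])
  have sc: "?D (h *\<^sub>R e) = h *\<^sub>R ?D e" for h e
    by (rule linear_scale[OF has_derivative_linear[OF D]])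
  have e: "(\<lambda>h. ?D (h *\<^sub>R e)) = (\<lambda>h. h *\<^sub>R ?D e)" for e by (rule ext) (rule sc)
  have "((\<lambda>r. \<phi> ((0, t) + r *\<^sub>R (1, 0))) has_derivative (\<lambda>h. ?D (h *\<^sub>R (1, 0)))) (at s)"
    by (rule line_has_derivative) (use D in simp)
  then show "((\<lambda>s. \<phi> (s, t)) has_vector_derivative d1 \<phi> (s, t)) (at s)"
    unfolding e has_vector_derivative_def by simp
  have "((\<lambda>r. \<phi> ((s, 0) + r *\<^sub>R (0, 1))) has_derivative (\<lambda>h. ?D (h *\<^sub>R (0, 1)))) (at t)"
    by (rule line_has_derivative) (use D in simp)
  then show "((\<lambda>t. \<phi> (s, t)) has_vector_derivative d2 \<phi> (s, t)) (at t)"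
    unfolding e has_vector_derivative_def by simp
qed

lemma frechet_comb:
  assumes "smooth \<phi>" "smooth \<psi>"
  shows "frechet_derivative (\<lambda>x. \<phi> x + c * \<psi> x) (at x) v = frechet_derivative \<phi> (at x) v + c * frechet_derivative \<psi> (at x) v"
proof -
  have "((\<lambda>x. \<phi> x + c * \<psi> x) has_derivative (\<lambda>v. frechet_derivative \<phi> (at x) v + c * frechet_derivative \<psi> (at x) v)) (at x)"
    by (intro has_derivative_add has_derivative_mult_right smooth_has_derivative assms)
  from frechet_derivative_at[OF this] show ?thesis by metis
qed

lemma frechet_diff:
  assumes "smooth \<phi>" "smooth \<psi>"
  shows "frechet_derivative (\<lambda>x. \<phi> x - \<psi> x) (at x) v = frechet_derivative \<phi> (at x) v - frechet_derivative \<psi> (at x) v"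
  using frechet_comb[OF assms, of "-1"] by simp

lemma L2_norm_sq_interval:
  assumes "continuous_on {l..u::real} f"
  shows "(L2_norm {l<..<u} f)\<^sup>2 = integral {l..u} (\<lambda>t. (norm (f t))\<^sup>2)"
  unfolding L2_norm_sq by (rule integral_on_interval) (intro continuous_intros assms)

lemma L2_norm_subset_le:
  assumes "f \<in> L2 J" "I \<subseteq> J" "I \<in> sets lebesgue" "J \<in> sets lebesgue"
  shows "L2_norm I f \<le> L2_norm J f"
proof -
  let ?g = "\<lambda>x. (norm (f x))\<^sup>2"
  have J: "integrable lebesgue (\<lambda>x. indicator J x *\<^sub>R ?g x)"
    using L2_D(2)[OF assms(1)] assms(4) by (subst (asm) integrable_restrict_space) auto
  have "integrable lebesgue (\<lambda>x. indicator I x *\<^sub>R (indicator J x *\<^sub>R ?g x))"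
    by (rule integrable_mult_indicator[OF assms(3) J])
  moreover have "(\<lambda>x. indicator I x *\<^sub>R (indicator J x *\<^sub>R ?g x)) = (\<lambda>x. indicator I x *\<^sub>R ?g x)"
    using assms(2) by (auto simp: indicator_def fun_eq_iff)
  ultimately have I: "integrable lebesgue (\<lambda>x. indicator I x *\<^sub>R ?g x)" by (simp only:)
  have "(\<integral>x. ?g x \<partial>lebesgue_on I) = (\<integral>x. indicator I x *\<^sub>R ?g x \<partial>lebesgue)"
    using assms(3) by (intro integral_restrict_space) auto
  also have "\<dots> \<le> (\<integral>x. indicator J x *\<^sub>R ?g x \<partial>lebesgue)"
    by (rule integral_mono[OF I J]) (use assms(2) in \<open>auto simp: indicator_def\<close>)
  also have "\<dots> = (\<integral>x. ?g x \<partial>lebesgue_on J)"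
    using assms(4) by (intro integral_restrict_space[symmetric]) auto
  finally show ?thesis by (simp add: L2_norm_def)
qed

lemma sq_le_imp_le_sum:
  assumes "x\<^sup>2 \<le> A * p\<^sup>2 + B * q\<^sup>2" "A \<le> C\<^sup>2" "B \<le> C\<^sup>2" "0 \<le> p" "0 \<le> q" "0 \<le> C"
  shows "x \<le> C * (p + q :: real)"
proof (rule power2_le_imp_le)
  have "x\<^sup>2 \<le> C\<^sup>2 * p\<^sup>2 + C\<^sup>2 * q\<^sup>2"
    using assms by (meson add_mono mult_right_mono order_trans zero_le_power2)
  also have "\<dots> \<le> C\<^sup>2 * (p + q)\<^sup>2"
    using assms by (simp add: power2_sum distrib_left)
  finally show "x\<^sup>2 \<le> (C * (p + q))\<^sup>2" by (simp add: power_mult_distrib)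
qed (use assms in auto)

lemma Basis_plane: "(Basis :: (real \<times> real) set) = {(1, 0), (0, 1)}"
  by (auto simp: Basis_prod_def)

lemma has_traceI:
  assumes "g \<in> L2 I" "\<And>n::nat. smooth (\<phi> n)" "(\<lambda>n. W12_norm S (\<lambda>x. \<phi> n x - u x)) \<longlonglongrightarrow> 0"
    "(\<lambda>n. L2_norm I (\<lambda>t. \<phi> n (p t) - g t)) \<longlonglongrightarrow> 0"
  shows "has_trace S p I u g"
proof -
  have "(\<forall>n. smooth (\<phi> n)) \<and> (\<lambda>n. W12_norm S (\<lambda>x. \<phi> n x - u x)) \<longlonglongrightarrow> 0 \<and>
    (\<lambda>n. L2_norm I (\<lambda>t. \<phi> n (p t) - g t)) \<longlonglongrightarrow> 0" by (intro conjI allI assms)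
  then have "\<exists>\<phi>. (\<forall>n::nat. smooth (\<phi> n)) \<and> (\<lambda>n. W12_norm S (\<lambda>x. \<phi> n x - u x)) \<longlonglongrightarrow> 0 \<and>
    (\<lambda>n. L2_norm I (\<lambda>t. \<phi> n (p t) - g t)) \<longlonglongrightarrow> 0" by (rule exI[of _ \<phi>])
  with assms(1) show ?thesis unfolding has_trace_def by (rule conjI)
qed

text \<open>One approximant for each error replaces the sequence, which allows approximants
  belonging to different edges to be compared and exchanged.\<close>

lemma has_trace_iff_eps:
  "has_trace S p I u g \<longleftrightarrow> g \<in> L2 I \<and> (\<forall>e>0. \<exists>\<phi>. smooth \<phi> \<and> W12_norm S (\<lambda>x. \<phi> x - u x) < e \<and> L2_norm I (\<lambda>t. \<phi> (p t) - g t) < e)"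
proof safe
  assume h: "has_trace S p I u g"
  then show "g \<in> L2 I" by (simp add: has_trace_def)
  fix e :: real assume "e > 0"
  from h obtain \<phi> where p: "\<And>n::nat. smooth (\<phi> n)" "(\<lambda>n. W12_norm S (\<lambda>x. \<phi> n x - u x)) \<longlonglongrightarrow> 0"
    "(\<lambda>n. L2_norm I (\<lambda>t. \<phi> n (p t) - g t)) \<longlonglongrightarrow> 0" by (auto simp: has_trace_def)
  have "\<forall>\<^sub>F n in sequentially. W12_norm S (\<lambda>x. \<phi> n x - u x) < e \<and> L2_norm I (\<lambda>t. \<phi> n (p t) - g t) < e"
    using order_tendstoD(2)[OF p(2) \<open>e > 0\<close>] order_tendstoD(2)[OF p(3) \<open>e > 0\<close>] by eventually_elim auto
  then obtain n where "W12_norm S (\<lambda>x. \<phi> n x - u x) < e \<and> L2_norm I (\<lambda>t. \<phi> n (p t) - g t) < e"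
    using eventually_happens'[OF sequentially_bot] by blast
  then show "\<exists>\<phi>. smooth \<phi> \<and> W12_norm S (\<lambda>x. \<phi> x - u x) < e \<and> L2_norm I (\<lambda>t. \<phi> (p t) - g t) < e"
    using p(1) by auto
next
  assume g: "g \<in> L2 I"
    and h: "\<forall>e>0. \<exists>\<phi>. smooth \<phi> \<and> W12_norm S (\<lambda>x. \<phi> x - u x) < e \<and> L2_norm I (\<lambda>t. \<phi> (p t) - g t) < e"
  have "\<forall>n::nat. \<exists>\<phi>. smooth \<phi> \<and> W12_norm S (\<lambda>x. \<phi> x - u x) < inverse (real (Suc n)) \<and> L2_norm I (\<lambda>t. \<phi> (p t) - g t) < inverse (real (Suc n))"
    using h by simp
  then obtain \<phi> where p: "\<And>n::nat. smooth (\<phi> n)" "\<And>n. W12_norm S (\<lambda>x. \<phi> n x - u x) < inverse (real (Suc n))"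
    "\<And>n. L2_norm I (\<lambda>t. \<phi> n (p t) - g t) < inverse (real (Suc n))" by metis
  have "(\<lambda>n. W12_norm S (\<lambda>x. \<phi> n x - u x)) \<longlonglongrightarrow> 0"
    by (rule Lim_null_comparison[OF _ LIMSEQ_inverse_real_of_nat])
       (use p(2) in \<open>auto simp: W12_norm_def sum_nonneg intro!: always_eventually less_imp_le\<close>)
  moreover have "(\<lambda>n. L2_norm I (\<lambda>t. \<phi> n (p t) - g t)) \<longlonglongrightarrow> 0"
    by (rule Lim_null_comparison[OF _ LIMSEQ_inverse_real_of_nat])
       (use p(3) in \<open>auto simp: L2_norm_nonneg intro!: always_eventually less_imp_le\<close>)
  ultimately show "has_trace S p I u g" by (rule has_traceI[OF g p(1)])
qed

section \<open>The periodicity cell, trace inequalities and common approximants\<close>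

locale cell =
  fixes \<epsilon> :: real
  assumes eps: "0 < \<epsilon>"
begin

definition hw :: real where "hw = \<epsilon> * pi / 2"

abbreviation "Om \<equiv> \<Omega> \<epsilon>"
abbreviation "nO f \<equiv> L2_norm Om f"
abbreviation "P1 u \<equiv> wderiv Om (1, 0) u"
abbreviation "P2 u \<equiv> wderiv Om (0, 1) u"

lemma hw_pos: "0 < hw" using eps by (simp add: hw_def)

lemma Omega_box: "Om = box (- hw, 0) (hw, pi)"
  by (auto simp: \<Omega>_def mem_box Basis_plane hw_def abs_less_iff)

lemma Omega_strip: "Om = {- hw<..<hw} \<times> {0<..<pi}"
  by (auto simp: \<Omega>_def hw_def abs_less_iff)

lemma Omega_open: "open Om" and Omega_bounded: "bounded Om" and Omega_lm: "Om \<in> lmeasurable"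
  and Omega_sets: "Om \<in> sets lebesgue"
  unfolding Omega_box by auto

lemmas OmS = Omega_open Omega_bounded

lemma fub1:
  fixes f :: "real \<times> real \<Rightarrow> 'b::euclidean_space"
  assumes "continuous_on UNIV f"
  shows "(\<integral>x. f x \<partial>lebesgue_on Om) = integral {-hw..hw} (\<lambda>s. integral {0..pi} (\<lambda>t. f (s, t)))"
  unfolding Omega_box by (rule integral_on_rectangle(1)) (rule continuous_on_subset[OF assms], simp)

lemma fub2:
  fixes f :: "real \<times> real \<Rightarrow> 'b::euclidean_space"
  assumes "continuous_on UNIV f"
  shows "(\<integral>x. f x \<partial>lebesgue_on Om) = integral {0..pi} (\<lambda>t. integral {-hw..hw} (\<lambda>s. f (s, t)))"
  unfolding Omega_box by (rule integral_on_rectangle(2)) (rule continuous_on_subset[OF assms], simp)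

lemma cont_param:
  fixes f :: "real \<times> real \<Rightarrow> 'b::euclidean_space"
  assumes "continuous_on UNIV f"
  shows "continuous_on A (\<lambda>s. integral {l..u} (\<lambda>t. f (s, t)))"
    and "continuous_on A (\<lambda>t. integral {l..u} (\<lambda>s. f (s, t)))"
proof -
  have "continuous_on A (\<lambda>s. integral (cbox l u) (\<lambda>t. f (s, t)))"
    by (rule integral_continuous_on_param) (use assms in \<open>auto intro: continuous_on_subset\<close>)
  then show "continuous_on A (\<lambda>s. integral {l..u} (\<lambda>t. f (s, t)))" by simp
  have "continuous_on A (\<lambda>t. integral (cbox l u) (\<lambda>s. f (s, t)))"
  proof (rule integral_continuous_on_param)
    have "continuous_on (A \<times> cbox l u) (\<lambda>x. f (snd x, fst x))"
      by (rule continuous_on_compose2[OF assms]) (auto intro!: continuous_intros)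
    then show "continuous_on (A \<times> cbox l u) (\<lambda>(t, s). f (s, t))" by (simp add: case_prod_unfold)
  qed
  then show "continuous_on A (\<lambda>t. integral {l..u} (\<lambda>s. f (s, t)))" by simp
qed

lemma cont_slice:
  fixes f :: "real \<times> real \<Rightarrow> 'b::topological_space"
  assumes "continuous_on UNIV f"
  shows "continuous_on A (\<lambda>s. f (s, t))" "continuous_on A (\<lambda>t. f (s, t))"
  by (rule continuous_on_compose2[OF assms]; auto intro!: continuous_intros)+

lemma cont_L2:
  assumes "continuous_on UNIV f" shows "f \<in> L2 Om"
  by (rule continuous_in_L2[OF OmS]) (rule continuous_on_subset[OF assms], simp)

lemma smooth_L2: "smooth f \<Longrightarrow> f \<in> L2 Om" "smooth f \<Longrightarrow> d1 f \<in> L2 Om" "smooth f \<Longrightarrow> d2 f \<in> L2 Om"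
  by (intro cont_L2 smooth_continuous smooth_frechet; assumption)+

lemma nO_sq1:
  assumes "continuous_on UNIV f"
  shows "(nO f)\<^sup>2 = integral {-hw..hw} (\<lambda>s. integral {0..pi} (\<lambda>t. (norm (f (s, t)))\<^sup>2))"
  unfolding L2_norm_sq by (rule fub1) (intro continuous_intros assms)

lemma nO_sq2:
  assumes "continuous_on UNIV f"
  shows "(nO f)\<^sup>2 = integral {0..pi} (\<lambda>t. integral {-hw..hw} (\<lambda>s. (norm (f (s, t)))\<^sup>2))"
  unfolding L2_norm_sq by (rule fub2) (intro continuous_intros assms)

lemma W12_norm_sq: "(W12_norm Om u)\<^sup>2 = (nO u)\<^sup>2 + (nO (P1 u))\<^sup>2 + (nO (P2 u))\<^sup>2"
  by (simp add: W12_norm_def Basis_plane)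

lemma W12_L2:
  assumes "u \<in> W12 Om" shows "u \<in> L2 Om" "P1 u \<in> L2 Om" "P2 u \<in> L2 Om"
  using W12_D[OF assms] by (auto simp: Basis_plane)

lemma W12_smooth: "smooth \<phi> \<Longrightarrow> \<phi> \<in> W12 Om" by (rule smooth_W12[OF OmS])

lemma wderiv_diff_norm:
  assumes u: "u \<in> W12 Om" and v: "v \<in> W12 Om"
  shows "nO (P1 (\<lambda>x. u x - v x)) = nO (\<lambda>x. P1 u x - P1 v x)" "nO (P2 (\<lambda>x. u x - v x)) = nO (\<lambda>x. P2 u x - P2 v x)"
proof -
  have m: "(\<lambda>x. u x - v x) \<in> W12 Om" using W12_comb(1)[OF OmS u v, of "-1"] by simp
  show "nO (P1 (\<lambda>x. u x - v x)) = nO (\<lambda>x. P1 u x - P1 v x)"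
    by (rule L2_norm_cong_AE[OF W12_L2(2)[OF m] L2_diff[OF W12_L2(2)[OF u] W12_L2(2)[OF v]]])
       (use W12_comb(2)[OF OmS u v, of "(1,0)" "-1"] in \<open>simp add: Basis_plane\<close>)
  show "nO (P2 (\<lambda>x. u x - v x)) = nO (\<lambda>x. P2 u x - P2 v x)"
    by (rule L2_norm_cong_AE[OF W12_L2(3)[OF m] L2_diff[OF W12_L2(3)[OF u] W12_L2(3)[OF v]]])
       (use W12_comb(2)[OF OmS u v, of "(0,1)" "-1"] in \<open>simp add: Basis_plane\<close>)
qed

lemma smooth_deriv_norm:
  assumes p: "smooth \<phi>" and v: "v \<in> W12 Om"
  shows "nO (P1 (\<lambda>x. \<phi> x - v x)) = nO (\<lambda>x. d1 \<phi> x - P1 v x)" "nO (P2 (\<lambda>x. \<phi> x - v x)) = nO (\<lambda>x. d2 \<phi> x - P2 v x)"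
proof -
  note u = W12_smooth[OF p]
  have "nO (\<lambda>x. P1 \<phi> x - P1 v x) = nO (\<lambda>x. d1 \<phi> x - P1 v x)"
    by (rule L2_norm_cong_AE[OF L2_diff[OF W12_L2(2)[OF u] W12_L2(2)[OF v]] L2_diff[OF smooth_L2(2)[OF p] W12_L2(2)[OF v]]])
       (use smooth_W12(2)[OF OmS p, of "(1,0)"] in \<open>auto elim: eventually_mono\<close>)
  then show "nO (P1 (\<lambda>x. \<phi> x - v x)) = nO (\<lambda>x. d1 \<phi> x - P1 v x)" using wderiv_diff_norm[OF u v] by simp
  have "nO (\<lambda>x. P2 \<phi> x - P2 v x) = nO (\<lambda>x. d2 \<phi> x - P2 v x)"
    by (rule L2_norm_cong_AE[OF L2_diff[OF W12_L2(3)[OF u] W12_L2(3)[OF v]] L2_diff[OF smooth_L2(3)[OF p] W12_L2(3)[OF v]]])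
       (use smooth_W12(2)[OF OmS p, of "(0,1)"] in \<open>auto elim: eventually_mono\<close>)
  then show "nO (P2 (\<lambda>x. \<phi> x - v x)) = nO (\<lambda>x. d2 \<phi> x - P2 v x)" using wderiv_diff_norm[OF u v] by simp
qed

lemma W12_norm_bounds:
  assumes p: "smooth \<phi>" and v: "v \<in> W12 Om"
  shows "nO (\<lambda>x. \<phi> x - v x) \<le> W12_norm Om (\<lambda>x. \<phi> x - v x)"
    "nO (\<lambda>x. d1 \<phi> x - P1 v x) \<le> W12_norm Om (\<lambda>x. \<phi> x - v x)"
    "nO (\<lambda>x. d2 \<phi> x - P2 v x) \<le> W12_norm Om (\<lambda>x. \<phi> x - v x)"
    "W12_norm Om (\<lambda>x. \<phi> x - v x) \<le> nO (\<lambda>x. \<phi> x - v x) + nO (\<lambda>x. d1 \<phi> x - P1 v x) + nO (\<lambda>x. d2 \<phi> x - P2 v x)"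
proof -
  let ?w = "W12_norm Om (\<lambda>x. \<phi> x - v x)"
  note e = W12_norm_sq[of "\<lambda>x. \<phi> x - v x", unfolded smooth_deriv_norm[OF p v]]
  have w: "0 \<le> ?w" by (simp add: W12_norm_def sum_nonneg)
  show "nO (\<lambda>x. \<phi> x - v x) \<le> ?w" "nO (\<lambda>x. d1 \<phi> x - P1 v x) \<le> ?w" "nO (\<lambda>x. d2 \<phi> x - P2 v x) \<le> ?w"
    by (rule power2_le_imp_le[OF _ w], use e in simp)+
  show "?w \<le> nO (\<lambda>x. \<phi> x - v x) + nO (\<lambda>x. d1 \<phi> x - P1 v x) + nO (\<lambda>x. d2 \<phi> x - P2 v x)"
  proof (rule power2_le_imp_le)
    have "a\<^sup>2 + b\<^sup>2 + c\<^sup>2 \<le> (a + b + c)\<^sup>2" if "0 \<le> a" "0 \<le> b" "0 \<le> c" for a b c :: real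
      using that by (simp add: power2_eq_square algebra_simps)
    then show "?w\<^sup>2 \<le> (nO (\<lambda>x. \<phi> x - v x) + nO (\<lambda>x. d1 \<phi> x - P1 v x) + nO (\<lambda>x. d2 \<phi> x - P2 v x))\<^sup>2"
      unfolding e by (simp add: L2_norm_nonneg)
  qed (simp add: L2_norm_nonneg)
qed

lemma trace_horizontal:
  assumes p: "smooth \<phi>" and c: "c \<in> {0..pi}"
  shows "L2_norm {-hw<..<hw} (\<lambda>s. \<phi> (s, c)) \<le> 3 * (nO \<phi> + nO (d2 \<phi>))"
proof -
  have pc: "continuous_on UNIV \<phi>" "continuous_on UNIV (d2 \<phi>)" by (intro smooth_continuous smooth_frechet p)+
  let ?L = "L2_norm {-hw<..<hw} (\<lambda>s. \<phi> (s, c))"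
  have cn: "continuous_on UNIV (\<lambda>x. (norm (\<phi> x))\<^sup>2)" "continuous_on UNIV (\<lambda>x. (norm (d2 \<phi> x))\<^sup>2)"
    by (intro continuous_intros pc)+
  have "pi * ?L\<^sup>2 = integral {-hw..hw} (\<lambda>s. pi * (norm (\<phi> (s, c)))\<^sup>2)"
    by (subst L2_norm_sq_interval[OF cont_slice(1)[OF pc(1)]]) simp
  also have "\<dots> \<le> integral {-hw..hw} (\<lambda>s. 2 * integral {0..pi} (\<lambda>t. (norm (\<phi> (s, t)))\<^sup>2)
      + 2 * pi\<^sup>2 * integral {0..pi} (\<lambda>t. (norm (d2 \<phi> (s, t)))\<^sup>2))"
  proof (rule integral_le)
    show "(\<lambda>s. pi * (norm (\<phi> (s, c)))\<^sup>2) integrable_on {-hw..hw}"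
      by (intro integrable_continuous_interval continuous_intros cont_slice(1)[OF pc(1)])
    show "(\<lambda>s. 2 * integral {0..pi} (\<lambda>t. (norm (\<phi> (s, t)))\<^sup>2) + 2 * pi\<^sup>2 * integral {0..pi} (\<lambda>t. (norm (d2 \<phi> (s, t)))\<^sup>2)) integrable_on {-hw..hw}"
      by (intro integrable_continuous_interval continuous_intros cont_param(1)[OF cn(1)] cont_param(1)[OF cn(2)])
    fix s
    show "pi * (norm (\<phi> (s, c)))\<^sup>2 \<le> 2 * integral {0..pi} (\<lambda>t. (norm (\<phi> (s, t)))\<^sup>2)
      + 2 * pi\<^sup>2 * integral {0..pi} (\<lambda>t. (norm (d2 \<phi> (s, t)))\<^sup>2)"
      using trace_bound_1d[OF pi_gt_zero slice_deriv(2)[OF p] cont_slice(2)[OF pc(2)] c] by simp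
  qed
  also have "\<dots> = 2 * (nO \<phi>)\<^sup>2 + 2 * pi\<^sup>2 * (nO (d2 \<phi>))\<^sup>2"
    unfolding nO_sq1[OF pc(1)] nO_sq1[OF pc(2)]
    by (subst Henstock_Kurzweil_Integration.integral_add)
       (auto intro!: integrable_continuous_interval continuous_intros cont_param(1)[OF cn(1)] cont_param(1)[OF cn(2)])
  finally have "?L\<^sup>2 \<le> (2 * (nO \<phi>)\<^sup>2 + 2 * pi\<^sup>2 * (nO (d2 \<phi>))\<^sup>2) / pi"
    by (simp add: pos_le_divide_eq mult.commute)
  also have "\<dots> = (2 / pi) * (nO \<phi>)\<^sup>2 + (2 * pi) * (nO (d2 \<phi>))\<^sup>2"
    by (simp add: add_divide_distrib power2_eq_square)
  finally have "?L\<^sup>2 \<le> (2 / pi) * (nO \<phi>)\<^sup>2 + (2 * pi) * (nO (d2 \<phi>))\<^sup>2" .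
  \<comment> \<open>The constant 3 works because 9 exceeds both 2/pi and 2 pi.\<close>
  then show ?thesis
    by (rule sq_le_imp_le_sum) (use pi_gt3 pi_less_4 in \<open>auto simp: L2_norm_nonneg pos_divide_le_eq\<close>)
qed

text \<open>Its square dominates both coefficients 1/hw and 4 hw of the trace estimate on a vertical
  line. The dependence on \<epsilon> is harmless, since this bound only serves to merge approximants
  for a fixed cell.\<close>

definition Cv :: real where "Cv = sqrt (1 / hw + 4 * hw)"

lemma Cv_nonneg: "0 \<le> Cv" using hw_pos by (simp add: Cv_def)

lemma trace_vertical:
  assumes p: "smooth \<phi>" and c: "c \<in> {-hw..hw}"
  shows "L2_norm {0<..<pi} (\<lambda>t. \<phi> (c, t)) \<le> Cv * (nO \<phi> + nO (d1 \<phi>))"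
proof -
  have pc: "continuous_on UNIV \<phi>" "continuous_on UNIV (d1 \<phi>)" by (intro smooth_continuous smooth_frechet p)+
  let ?L = "L2_norm {0<..<pi} (\<lambda>t. \<phi> (c, t))"
  have h2: "- hw < hw" using hw_pos by simp
  have cn: "continuous_on UNIV (\<lambda>x. (norm (\<phi> x))\<^sup>2)" "continuous_on UNIV (\<lambda>x. (norm (d1 \<phi> x))\<^sup>2)"
    by (intro continuous_intros pc)+
  have "(2 * hw) * ?L\<^sup>2 = integral {0..pi} (\<lambda>t. (2 * hw) * (norm (\<phi> (c, t)))\<^sup>2)"
    by (subst L2_norm_sq_interval[OF cont_slice(2)[OF pc(1)]]) simp
  also have "\<dots> \<le> integral {0..pi} (\<lambda>t. 2 * integral {-hw..hw} (\<lambda>s. (norm (\<phi> (s, t)))\<^sup>2)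
      + 2 * (2 * hw)\<^sup>2 * integral {-hw..hw} (\<lambda>s. (norm (d1 \<phi> (s, t)))\<^sup>2))"
  proof (rule integral_le)
    show "(\<lambda>t. 2 * hw * (norm (\<phi> (c, t)))\<^sup>2) integrable_on {0..pi}"
      by (intro integrable_continuous_interval continuous_intros cont_slice(2)[OF pc(1)])
    show "(\<lambda>t. 2 * integral {-hw..hw} (\<lambda>s. (norm (\<phi> (s, t)))\<^sup>2) + 2 * (2 * hw)\<^sup>2 * integral {-hw..hw} (\<lambda>s. (norm (d1 \<phi> (s, t)))\<^sup>2)) integrable_on {0..pi}"
      by (intro integrable_continuous_interval continuous_intros cont_param(2)[OF cn(1)] cont_param(2)[OF cn(2)])
    fix t
    show "2 * hw * (norm (\<phi> (c, t)))\<^sup>2 \<le> 2 * integral {-hw..hw} (\<lambda>s. (norm (\<phi> (s, t)))\<^sup>2)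
      + 2 * (2 * hw)\<^sup>2 * integral {-hw..hw} (\<lambda>s. (norm (d1 \<phi> (s, t)))\<^sup>2)"
      using trace_bound_1d[OF h2 slice_deriv(1)[OF p] cont_slice(1)[OF pc(2)] c] by simp
  qed
  also have "\<dots> = 2 * (nO \<phi>)\<^sup>2 + 2 * (2 * hw)\<^sup>2 * (nO (d1 \<phi>))\<^sup>2"
    unfolding nO_sq2[OF pc(1)] nO_sq2[OF pc(2)]
    by (subst Henstock_Kurzweil_Integration.integral_add)
       (auto intro!: integrable_continuous_interval continuous_intros cont_param(2)[OF cn(1)] cont_param(2)[OF cn(2)])
  finally have "?L\<^sup>2 \<le> (2 * (nO \<phi>)\<^sup>2 + 2 * (2 * hw)\<^sup>2 * (nO (d1 \<phi>))\<^sup>2) / (2 * hw)"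
    using hw_pos by (simp add: pos_le_divide_eq mult.commute)
  also have "\<dots> = (1 / hw) * (nO \<phi>)\<^sup>2 + (4 * hw) * (nO (d1 \<phi>))\<^sup>2"
    using hw_pos by (simp add: add_divide_distrib power2_eq_square)
  finally have "?L\<^sup>2 \<le> (1 / hw) * (nO \<phi>)\<^sup>2 + (4 * hw) * (nO (d1 \<phi>))\<^sup>2" .
  then show ?thesis
    by (rule sq_le_imp_le_sum) (use hw_pos Cv_nonneg in \<open>auto simp: L2_norm_nonneg Cv_def\<close>)
qed

text \<open>In the form domain each of the four traces comes with its own approximating sequence; the
  approximants can be chosen common to all edges, and their boundary errors are collected in one number.\<close>

definition defect :: "real \<Rightarrow> (real \<times> real \<Rightarrow> complex) \<Rightarrow> real" where
  "defect \<eta> \<phi> = L2_norm {-hw<..<hw} (\<lambda>t. \<phi> (t, pi)) + L2_norm {t. \<bar>t\<bar> < \<epsilon> * \<eta>} (\<lambda>t. \<phi> (t, 0))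
     + L2_norm {0<..<pi} (\<lambda>t. \<phi> (hw, t) - \<phi> (- hw, t))"

lemma window_interval: "{t. \<bar>t\<bar> < c} = {-c<..<c::real}"
  by (auto simp: abs_less_iff)

lemma slice_L2:
  assumes "continuous_on UNIV (\<phi> :: real \<times> real \<Rightarrow> complex)"
  shows "(\<lambda>s. \<phi> (s, c)) \<in> L2 {l<..<u}" "(\<lambda>t. \<phi> (c, t)) \<in> L2 {l<..<u}"
  by (intro continuous_in_L2 cont_slice assms; auto)+

lemma smooth_dist:
  assumes p: "smooth \<phi>" "smooth \<psi>" and u: "u \<in> W12 Om"
    and e: "W12_norm Om (\<lambda>x. \<phi> x - u x) < e" "W12_norm Om (\<lambda>x. \<psi> x - u x) < e"
  shows "nO (\<lambda>x. \<phi> x - \<psi> x) < 2 * e" "nO (d1 (\<lambda>x. \<phi> x - \<psi> x)) < 2 * e" "nO (d2 (\<lambda>x. \<phi> x - \<psi> x)) < 2 * e"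
    "nO (\<lambda>x. \<phi> x - \<psi> x) + nO (d1 (\<lambda>x. \<phi> x - \<psi> x)) \<le> 4 * e"
    "3 * (nO (\<lambda>x. \<phi> x - \<psi> x) + nO (d2 (\<lambda>x. \<phi> x - \<psi> x))) < 12 * e"
proof -
  have *: "nO (\<lambda>x. f x - g x) \<le> nO (\<lambda>x. f x - h x) + nO (\<lambda>x. g x - h x)" if "f \<in> L2 Om" "g \<in> L2 Om" "h \<in> L2 Om" for f g h
    using L2_norm_diff_le[OF L2_diff[OF that(1,3)] L2_diff[OF that(2,3)]] by simp
  note b = W12_norm_bounds[OF p(1) u] W12_norm_bounds[OF p(2) u]
  show 1: "nO (\<lambda>x. \<phi> x - \<psi> x) < 2 * e"
    using *[OF smooth_L2(1)[OF p(1)] smooth_L2(1)[OF p(2)] W12_L2(1)[OF u]] b e by linarith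
  show 2: "nO (d1 (\<lambda>x. \<phi> x - \<psi> x)) < 2 * e"
    unfolding frechet_diff[OF p]
    using *[OF smooth_L2(2)[OF p(1)] smooth_L2(2)[OF p(2)] W12_L2(2)[OF u]] b e by linarith
  show 3: "nO (d2 (\<lambda>x. \<phi> x - \<psi> x)) < 2 * e"
    unfolding frechet_diff[OF p]
    using *[OF smooth_L2(3)[OF p(1)] smooth_L2(3)[OF p(2)] W12_L2(3)[OF u]] b e by linarith
  have A: "x + y \<le> 4 * e" if "x < 2 * e" "y < 2 * e" for x y :: real using that by linarith
  have B: "3 * (x + y) < 12 * e" if "x < 2 * e" "y < 2 * e" for x y :: real
  proof -
    have "x + y < 4 * e" using that by linarith
    then show ?thesis by simp
  qed
  from A[OF 1 2] B[OF 1 3]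
  show "nO (\<lambda>x. \<phi> x - \<psi> x) + nO (d1 (\<lambda>x. \<phi> x - \<psi> x)) \<le> 4 * e"
    "3 * (nO (\<lambda>x. \<phi> x - \<psi> x) + nO (d2 (\<lambda>x. \<phi> x - \<psi> x))) < 12 * e" by this+
qed

text \<open>By the trace inequalities, the boundary values of two approximants differ by no more
  than their Sobolev distance allows, so the approximant for the top edge serves for all edges.
  Conversely, the values of common approximants on one lateral edge form a Cauchy sequence, and its
  limit is the trace shared by both lateral edges.\<close>

lemma W12_per_iff:
  assumes eta: "\<eta> < pi / 2"
  shows "u \<in> W12_per \<epsilon> \<eta> \<longleftrightarrow> u \<in> W12 Om \<and>
    (\<forall>e>0. \<exists>\<phi>. smooth \<phi> \<and> W12_norm Om (\<lambda>x. \<phi> x - u x) < e \<and> defect \<eta> \<phi> < e)"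
proof
  assume uV: "u \<in> W12_per \<epsilon> \<eta>"
  let ?T = "{t. \<bar>t\<bar> < \<epsilon> * pi / 2}" and ?G = "{t. \<bar>t\<bar> < \<epsilon> * \<eta>}"
  have T: "?T = {-hw<..<hw}" by (auto simp: hw_def abs_less_iff)
  obtain g where u: "u \<in> W12 Om" and tr: "has_trace Om (\<lambda>t. (t, pi)) ?T u (\<lambda>_. 0)"
    "has_trace Om (\<lambda>t. (t, 0)) ?G u (\<lambda>_. 0)" "has_trace Om (\<lambda>t. (- hw, t)) {0<..<pi} u g"
    "has_trace Om (\<lambda>t. (hw, t)) {0<..<pi} u g"
    using uV unfolding W12_per_def hw_def by auto
  have g: "g \<in> L2 {0<..<pi}" using tr(3) by (simp add: has_trace_iff_eps)
  have "\<exists>\<phi>. smooth \<phi> \<and> W12_norm Om (\<lambda>x. \<phi> x - u x) < e \<and> defect \<eta> \<phi> < e" if e: "e > 0" for e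
  proof -
    \<comment> \<open>The defect of \<open>f1\<close> adds up to (16 + 8 Cv) d: d on the top edge,
      13 d on the window and 2 d + 8 Cv d from the two lateral edges.\<close>
    define d where "d = e / (16 + 8 * Cv)"
    have d: "d > 0" using e Cv_nonneg by (simp add: d_def)
    have de: "(16 + 8 * Cv) * d = e" using Cv_nonneg by (simp add: d_def)
    obtain f1 where f1: "smooth f1" "W12_norm Om (\<lambda>x. f1 x - u x) < d" "L2_norm ?T (\<lambda>t. f1 (t, pi)) < d"
      using tr(1) d unfolding has_trace_iff_eps by auto
    obtain f2 where f2: "smooth f2" "W12_norm Om (\<lambda>x. f2 x - u x) < d" "L2_norm ?G (\<lambda>t. f2 (t, 0)) < d"
      using tr(2) d unfolding has_trace_iff_eps by auto
    obtain f3 where f3: "smooth f3" "W12_norm Om (\<lambda>x. f3 x - u x) < d" "L2_norm {0<..<pi} (\<lambda>t. f3 (- hw, t) - g t) < d"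
      using tr(3) d unfolding has_trace_iff_eps by auto
    obtain f4 where f4: "smooth f4" "W12_norm Om (\<lambda>x. f4 x - u x) < d" "L2_norm {0<..<pi} (\<lambda>t. f4 (hw, t) - g t) < d"
      using tr(4) d unfolding has_trace_iff_eps by auto
    note c = smooth_continuous[of _ UNIV]
    have G: "L2_norm ?G (\<lambda>t. f1 (t, 0)) < 13 * d"
    proof -
      have sm: "smooth (\<lambda>x. f1 x - f2 x)" by (rule smooth_diff[OF f1(1) f2(1)])
      have "L2_norm ?G (\<lambda>t. f1 (t, 0) - f2 (t, 0)) \<le> L2_norm {-hw<..<hw} (\<lambda>t. f1 (t, 0) - f2 (t, 0))"
      proof (rule L2_norm_subset_le[OF slice_L2(1)[OF c[OF sm]]])
        have "\<epsilon> * \<eta> \<le> hw" using eta eps by (simp add: hw_def)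
        then show "?G \<subseteq> {-hw<..<hw}" by auto
      qed (auto simp: window_interval)
      also have "\<dots> \<le> 3 * (nO (\<lambda>x. f1 x - f2 x) + nO (d2 (\<lambda>x. f1 x - f2 x)))"
        by (rule trace_horizontal[OF sm]) simp
      also have "\<dots> < 12 * d" by (rule smooth_dist(5)[OF f1(1) f2(1) u f1(2) f2(2)])
      finally have "L2_norm ?G (\<lambda>t. f1 (t, 0) - f2 (t, 0)) < 12 * d" .
      moreover have "L2_norm ?G (\<lambda>t. (f1 (t, 0) - f2 (t, 0)) + f2 (t, 0)) \<le> L2_norm ?G (\<lambda>t. f1 (t, 0) - f2 (t, 0)) + L2_norm ?G (\<lambda>t. f2 (t, 0))"
        unfolding window_interval
        by (rule L2_norm_add_le[OF slice_L2(1)[OF c[OF sm]] slice_L2(1)[OF c[OF f2(1)]]])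
      ultimately show ?thesis using f2(3) by simp
    qed
    have V: "L2_norm {0<..<pi} (\<lambda>t. f1 (b, t) - g t) < d + 4 * Cv * d"
      if f: "smooth f" "W12_norm Om (\<lambda>x. f x - u x) < d" "L2_norm {0<..<pi} (\<lambda>t. f (b, t) - g t) < d" and b: "b \<in> {-hw..hw}" for f b
    proof -
      have sm: "smooth (\<lambda>x. f1 x - f x)" by (rule smooth_diff[OF f1(1) f(1)])
      have "L2_norm {0<..<pi} (\<lambda>t. f1 (b, t) - f (b, t)) \<le> Cv * (nO (\<lambda>x. f1 x - f x) + nO (d1 (\<lambda>x. f1 x - f x)))"
        by (rule trace_vertical[OF sm b])
      also have "\<dots> \<le> Cv * (4 * d)"
        by (intro mult_left_mono Cv_nonneg smooth_dist(4)[OF f1(1) f(1) u f1(2) f(2)])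
      finally have "L2_norm {0<..<pi} (\<lambda>t. f1 (b, t) - f (b, t)) \<le> 4 * Cv * d" by simp
      moreover have "L2_norm {0<..<pi} (\<lambda>t. (f1 (b, t) - f (b, t)) + (f (b, t) - g t)) \<le> L2_norm {0<..<pi} (\<lambda>t. f1 (b, t) - f (b, t)) + L2_norm {0<..<pi} (\<lambda>t. f (b, t) - g t)"
        by (rule L2_norm_add_le[OF slice_L2(2)[OF c[OF sm]] L2_diff[OF slice_L2(2)[OF c[OF f(1)]] g]])
      ultimately show ?thesis using f(3) by simp
    qed
    have "L2_norm {0<..<pi} (\<lambda>t. (f1 (hw, t) - g t) - (f1 (- hw, t) - g t)) \<le> L2_norm {0<..<pi} (\<lambda>t. f1 (hw, t) - g t) + L2_norm {0<..<pi} (\<lambda>t. f1 (- hw, t) - g t)"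
      by (intro L2_norm_diff_le L2_diff slice_L2(2)[OF c[OF f1(1)]] g)
    then have "L2_norm {0<..<pi} (\<lambda>t. f1 (hw, t) - f1 (- hw, t)) < 2 * d + 8 * Cv * d"
      using V[OF f3] V[OF f4] hw_pos by simp
    then have "defect \<eta> f1 < (16 + 8 * Cv) * d"
      using G f1(3) unfolding defect_def T by (simp add: distrib_right)
    moreover have "d \<le> e" using de d Cv_nonneg by (smt (verit) mult_le_cancel_right1)
    ultimately show ?thesis using f1 de by (intro exI[of _ f1]) auto
  qed
  then show "u \<in> W12 Om \<and> (\<forall>e>0. \<exists>\<phi>. smooth \<phi> \<and> W12_norm Om (\<lambda>x. \<phi> x - u x) < e \<and> defect \<eta> \<phi> < e)"
    using u by blast
next
  assume h: "u \<in> W12 Om \<and> (\<forall>e>0. \<exists>\<phi>. smooth \<phi> \<and> W12_norm Om (\<lambda>x. \<phi> x - u x) < e \<and> defect \<eta> \<phi> < e)"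
  then have u: "u \<in> W12 Om" by blast
  have "\<exists>\<phi>. smooth \<phi> \<and> W12_norm Om (\<lambda>x. \<phi> x - u x) < inverse (real (Suc n)) \<and> defect \<eta> \<phi> < inverse (real (Suc n))" for n
    using h by simp
  then obtain \<phi> where p: "\<And>n. smooth (\<phi> n)" "\<And>n. W12_norm Om (\<lambda>x. \<phi> n x - u x) < inverse (real (Suc n))"
    "\<And>n. defect \<eta> (\<phi> n) < inverse (real (Suc n))" by metis
  note c = smooth_continuous[OF p(1), of UNIV]
  have inv: "\<exists>N. \<forall>n\<ge>N. inverse (real (Suc n)) < e" if "e > 0" for e
    using order_tendstoD(2)[OF LIMSEQ_inverse_real_of_nat that] by (simp add: eventually_sequentially)
  have dn: "L2_norm {-hw<..<hw} (\<lambda>t. \<phi> n (t, pi)) < inverse (real (Suc n))"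
    "L2_norm {t. \<bar>t\<bar> < \<epsilon> * \<eta>} (\<lambda>t. \<phi> n (t, 0)) < inverse (real (Suc n))"
    "L2_norm {0<..<pi} (\<lambda>t. \<phi> n (hw, t) - \<phi> n (- hw, t)) < inverse (real (Suc n))" for n
    using p(3)[of n] L2_norm_nonneg[of "{-hw<..<hw}" "\<lambda>t. \<phi> n (t, pi)"]
      L2_norm_nonneg[of "{t. \<bar>t\<bar> < \<epsilon> * \<eta>}" "\<lambda>t. \<phi> n (t, 0)"]
      L2_norm_nonneg[of "{0<..<pi}" "\<lambda>t. \<phi> n (hw, t) - \<phi> n (- hw, t)"]
    unfolding defect_def by linarith+
  \<comment> \<open>Completeness supplies the lateral trace g; the definition of the domain asks for
    its existence, while the defect only measures the jump between the two sides.\<close>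
  have "\<exists>g\<in>L2 {0<..<pi}. (\<lambda>n. L2_norm {0<..<pi} (\<lambda>t. \<phi> n (hw, t) - g t)) \<longlonglongrightarrow> 0"
  proof (rule L2_complete)
    show "(\<lambda>t. \<phi> n (hw, t)) \<in> L2 {0<..<pi}" for n by (rule slice_L2(2)[OF c])
    fix e :: real assume e: "e > 0"
    define d where "d = e / (4 * Cv + 1)"
    have d: "d > 0" using e Cv_nonneg by (simp add: d_def add_nonneg_pos)
    have de: "4 * Cv * d < e"
    proof -
      have "(4 * Cv + 1) * d = e" using Cv_nonneg by (simp add: d_def)
      then show ?thesis using d by (simp add: distrib_right)
    qed
    obtain N where N: "\<And>n. n \<ge> N \<Longrightarrow> inverse (real (Suc n)) < d" using inv[OF d] by auto
    have "L2_norm {0<..<pi} (\<lambda>t. \<phi> m (hw, t) - \<phi> n (hw, t)) < e" if mn: "m \<ge> N" "n \<ge> N" for m n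
    proof -
      have sm: "smooth (\<lambda>x. \<phi> m x - \<phi> n x)" by (intro smooth_diff p)
      have "L2_norm {0<..<pi} (\<lambda>t. \<phi> m (hw, t) - \<phi> n (hw, t)) \<le> Cv * (nO (\<lambda>x. \<phi> m x - \<phi> n x) + nO (d1 (\<lambda>x. \<phi> m x - \<phi> n x)))"
        by (rule trace_vertical[OF sm]) (use hw_pos in auto)
      also have "\<dots> \<le> Cv * (4 * d)"
        by (intro mult_left_mono Cv_nonneg
            smooth_dist(4)[OF p(1) p(1) u less_trans[OF p(2) N[OF mn(1)]] less_trans[OF p(2) N[OF mn(2)]]])
      finally show ?thesis using de by simp
    qed
    then show "\<exists>N. \<forall>m\<ge>N. \<forall>n\<ge>N. L2_norm {0<..<pi} (\<lambda>t. \<phi> m (hw, t) - \<phi> n (hw, t)) < e" by blast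
  qed simp
  then obtain g where g: "g \<in> L2 {0<..<pi}" "(\<lambda>n. L2_norm {0<..<pi} (\<lambda>t. \<phi> n (hw, t) - g t)) \<longlonglongrightarrow> 0" by auto
  have W0: "(\<lambda>n. W12_norm Om (\<lambda>x. \<phi> n x - u x)) \<longlonglongrightarrow> 0"
    by (rule Lim_null_comparison[OF _ LIMSEQ_inverse_real_of_nat])
       (use p(2) in \<open>auto simp: W12_norm_def sum_nonneg intro!: always_eventually less_imp_le\<close>)
  have null: "(\<lambda>n. L2_norm I (f n)) \<longlonglongrightarrow> 0" if "\<And>n. L2_norm I (f n) < inverse (real (Suc n))" for I :: "real set" and f
    by (rule Lim_null_comparison[OF _ LIMSEQ_inverse_real_of_nat])
       (use that in \<open>auto simp: L2_norm_nonneg intro!: always_eventually less_imp_le\<close>)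
  have "has_trace Om (\<lambda>t. (t, pi)) {t. \<bar>t\<bar> < \<epsilon> * pi / 2} u (\<lambda>_. 0)"
  proof -
    have T: "{t. \<bar>t\<bar> < \<epsilon> * pi / 2} = {-hw<..<hw}" by (auto simp: hw_def abs_less_iff)
    show ?thesis unfolding T by (rule has_traceI[OF L2_zero p(1) W0]) (use null[OF dn(1)] in simp)
  qed
  moreover have "has_trace Om (\<lambda>t. (t, 0)) {t. \<bar>t\<bar> < \<epsilon> * \<eta>} u (\<lambda>_. 0)"
    by (rule has_traceI[OF L2_zero p(1) W0]) (use null[OF dn(2)] in simp)
  moreover have "has_trace Om (\<lambda>t. (hw, t)) {0<..<pi} u g"
    by (rule has_traceI[OF g(1) p(1) W0 g(2)])
  moreover have "has_trace Om (\<lambda>t. (- hw, t)) {0<..<pi} u g"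
  proof -
    have "(\<lambda>n. L2_norm {0<..<pi} (\<lambda>t. \<phi> n (- hw, t) - g t)) \<longlonglongrightarrow> 0"
    proof (rule Lim_null_comparison)
      have "L2_norm {0<..<pi} (\<lambda>t. (\<phi> n (hw, t) - g t) - (\<phi> n (hw, t) - \<phi> n (- hw, t))) \<le> L2_norm {0<..<pi} (\<lambda>t. \<phi> n (hw, t) - g t) + L2_norm {0<..<pi} (\<lambda>t. \<phi> n (hw, t) - \<phi> n (- hw, t))" for n
        by (intro L2_norm_diff_le L2_diff slice_L2(2)[OF c] g)
      then show "\<forall>\<^sub>F n in sequentially. norm (L2_norm {0<..<pi} (\<lambda>t. \<phi> n (- hw, t) - g t)) \<le> L2_norm {0<..<pi} (\<lambda>t. \<phi> n (hw, t) - g t) + L2_norm {0<..<pi} (\<lambda>t. \<phi> n (hw, t) - \<phi> n (- hw, t))"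
        by (intro always_eventually allI) (simp add: L2_norm_nonneg)
      show "(\<lambda>n. L2_norm {0<..<pi} (\<lambda>t. \<phi> n (hw, t) - g t) + L2_norm {0<..<pi} (\<lambda>t. \<phi> n (hw, t) - \<phi> n (- hw, t))) \<longlonglongrightarrow> 0"
        by (rule tendsto_add_zero[OF g(2) null[OF dn(3)]])
    qed
    then show ?thesis by (rule has_traceI[OF g(1) p(1) W0])
  qed
  ultimately show "u \<in> W12_per \<epsilon> \<eta>"
    unfolding W12_per_def using u by (auto simp: hw_def)
qed

end

section \<open>The resolvent of the fibre operator\<close>

locale periodic_cell = cell +
  fixes \<eta> :: real
  assumes eta: "0 < \<eta>" "\<eta> < pi / 2"
begin

abbreviation "V \<equiv> W12_per \<epsilon> \<eta>"

lemmas V_iff = W12_per_iff[OF eta(2)]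

lemma V_W12: "u \<in> V \<Longrightarrow> u \<in> W12 Om"
  by (simp add: V_iff)

lemmas V_L2 = W12_L2[OF V_W12]

lemma defect_parts:
  "L2_norm {-hw<..<hw} (\<lambda>t. \<phi> (t, pi)) \<le> defect \<eta> \<phi>"
  "L2_norm {t. \<bar>t\<bar> < \<epsilon> * \<eta>} (\<lambda>t. \<phi> (t, 0)) \<le> defect \<eta> \<phi>"
  "L2_norm {0<..<pi} (\<lambda>t. \<phi> (hw, t) - \<phi> (- hw, t)) \<le> defect \<eta> \<phi>"
  using L2_norm_nonneg[of "{-hw<..<hw}" "\<lambda>t. \<phi> (t, pi)"]
    L2_norm_nonneg[of "{t. \<bar>t\<bar> < \<epsilon> * \<eta>}" "\<lambda>t. \<phi> (t, 0)"]
    L2_norm_nonneg[of "{0<..<pi}" "\<lambda>t. \<phi> (hw, t) - \<phi> (- hw, t)"]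
  unfolding defect_def by linarith+

lemma tendsto_0_le:
  assumes "\<And>n. 0 \<le> f n" "\<And>n. f n \<le> g n" "g \<longlonglongrightarrow> (0::real)"
  shows "f \<longlonglongrightarrow> 0"
  by (rule Lim_null_comparison[OF _ assms(3)]) (use assms(1,2) in simp)

lemma V_seq:
  assumes u: "u \<in> V"
  shows "\<exists>\<phi> :: nat \<Rightarrow> real \<times> real \<Rightarrow> complex. (\<forall>n. smooth (\<phi> n)) \<and> (\<lambda>n. nO (\<lambda>x. \<phi> n x - u x)) \<longlonglongrightarrow> 0 \<and>
    (\<lambda>n. nO (\<lambda>x. d1 (\<phi> n) x - P1 u x)) \<longlonglongrightarrow> 0 \<and>
    (\<lambda>n. nO (\<lambda>x. d2 (\<phi> n) x - P2 u x)) \<longlonglongrightarrow> 0 \<and>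
    (\<lambda>n. L2_norm {-hw<..<hw} (\<lambda>t. \<phi> n (t, pi))) \<longlonglongrightarrow> 0 \<and>
    (\<lambda>n. L2_norm {t. \<bar>t\<bar> < \<epsilon> * \<eta>} (\<lambda>t. \<phi> n (t, 0))) \<longlonglongrightarrow> 0 \<and>
    (\<lambda>n. L2_norm {0<..<pi} (\<lambda>t. \<phi> n (hw, t) - \<phi> n (- hw, t))) \<longlonglongrightarrow> 0"
proof -
  have "\<exists>\<phi>. smooth \<phi> \<and> W12_norm Om (\<lambda>x. \<phi> x - u x) < inverse (real (Suc n)) \<and> defect \<eta> \<phi> < inverse (real (Suc n))" for n
    using u unfolding V_iff by simp
  then obtain \<phi> where p: "\<And>n. smooth (\<phi> n)" "\<And>n. W12_norm Om (\<lambda>x. \<phi> n x - u x) < inverse (real (Suc n))"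
    "\<And>n. defect \<eta> (\<phi> n) < inverse (real (Suc n))" by metis
  note b = W12_norm_bounds[OF p(1) V_W12[OF u]]
  note i = LIMSEQ_inverse_real_of_nat
  show ?thesis
  proof (intro exI[of _ \<phi>] conjI allI)
    show "smooth (\<phi> n)" for n by (rule p(1))
    show "(\<lambda>n. nO (\<lambda>x. \<phi> n x - u x)) \<longlonglongrightarrow> 0"
      by (rule tendsto_0_le[OF L2_norm_nonneg less_imp_le[OF le_less_trans[OF b(1) p(2)]] i])
    show "(\<lambda>n. nO (\<lambda>x. d1 (\<phi> n) x - P1 u x)) \<longlonglongrightarrow> 0"
      by (rule tendsto_0_le[OF L2_norm_nonneg less_imp_le[OF le_less_trans[OF b(2) p(2)]] i])
    show "(\<lambda>n. nO (\<lambda>x. d2 (\<phi> n) x - P2 u x)) \<longlonglongrightarrow> 0"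
      by (rule tendsto_0_le[OF L2_norm_nonneg less_imp_le[OF le_less_trans[OF b(3) p(2)]] i])
    show "(\<lambda>n. L2_norm {-hw<..<hw} (\<lambda>t. \<phi> n (t, pi))) \<longlonglongrightarrow> 0"
      by (rule tendsto_0_le[OF L2_norm_nonneg less_imp_le[OF le_less_trans[OF defect_parts(1) p(3)]] i])
    show "(\<lambda>n. L2_norm {t. \<bar>t\<bar> < \<epsilon> * \<eta>} (\<lambda>t. \<phi> n (t, 0))) \<longlonglongrightarrow> 0"
      by (rule tendsto_0_le[OF L2_norm_nonneg less_imp_le[OF le_less_trans[OF defect_parts(2) p(3)]] i])
    show "(\<lambda>n. L2_norm {0<..<pi} (\<lambda>t. \<phi> n (hw, t) - \<phi> n (- hw, t))) \<longlonglongrightarrow> 0"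
      by (rule tendsto_0_le[OF L2_norm_nonneg less_imp_le[OF le_less_trans[OF defect_parts(3) p(3)]] i])
  qed
qed

lemma smooth_V:
  assumes "smooth \<phi>" "defect \<eta> \<phi> = 0" shows "\<phi> \<in> V"
proof -
  have "W12_norm Om (\<lambda>x. \<phi> x - \<phi> x) \<le> nO (\<lambda>x. \<phi> x - \<phi> x) + nO (\<lambda>x. d1 \<phi> x - P1 \<phi> x) + nO (\<lambda>x. d2 \<phi> x - P2 \<phi> x)"
    by (rule W12_norm_bounds(4)[OF assms(1) W12_smooth[OF assms(1)]])
  also have "\<dots> = nO (\<lambda>x. 0) + nO (P1 (\<lambda>x. \<phi> x - \<phi> x)) + nO (P2 (\<lambda>x. \<phi> x - \<phi> x))"
    using smooth_deriv_norm[OF assms(1) W12_smooth[OF assms(1)]] by simp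
  also have "\<dots> = nO (\<lambda>x. 0) + nO (\<lambda>x. P1 \<phi> x - P1 \<phi> x) + nO (\<lambda>x. P2 \<phi> x - P2 \<phi> x)"
    by (simp only: wderiv_diff_norm[OF W12_smooth[OF assms(1)] W12_smooth[OF assms(1)]])
  finally have "W12_norm Om (\<lambda>x. \<phi> x - \<phi> x) \<le> 0" by (simp add: L2_norm_zero)
  then have "W12_norm Om (\<lambda>x. \<phi> x - \<phi> x) < e" "defect \<eta> \<phi> < e" if "e > 0" for e using that assms(2) by auto
  then show ?thesis unfolding V_iff using assms(1) W12_smooth[OF assms(1)] by blast
qed

lemma zero_V: "(\<lambda>x. 0) \<in> V"
  by (rule smooth_V[OF smooth_const]) (simp add: defect_def L2_norm_zero)

lemma defect_comb:
  assumes p: "smooth \<phi>" and q: "smooth \<psi>"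
  shows "defect \<eta> (\<lambda>x. \<phi> x + c * \<psi> x) \<le> defect \<eta> \<phi> + cmod c * defect \<eta> \<psi>"
proof -
  note s = slice_L2[OF smooth_continuous[OF p]] slice_L2[OF smooth_continuous[OF q]]
  have 1: "L2_norm {-hw<..<hw} (\<lambda>t. \<phi> (t, pi) + c * \<psi> (t, pi)) \<le> L2_norm {-hw<..<hw} (\<lambda>t. \<phi> (t, pi)) + cmod c * L2_norm {-hw<..<hw} (\<lambda>t. \<psi> (t, pi))"
    by (rule L2_triangle[OF s(1) s(3)])
  have 2: "L2_norm {t. \<bar>t\<bar> < \<epsilon> * \<eta>} (\<lambda>t. \<phi> (t, 0) + c * \<psi> (t, 0)) \<le> L2_norm {t. \<bar>t\<bar> < \<epsilon> * \<eta>} (\<lambda>t. \<phi> (t, 0)) + cmod c * L2_norm {t. \<bar>t\<bar> < \<epsilon> * \<eta>} (\<lambda>t. \<psi> (t, 0))"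
    unfolding window_interval by (rule L2_triangle[OF s(1) s(3)])
  have "L2_norm {0<..<pi} (\<lambda>t. (\<phi> (hw, t) - \<phi> (- hw, t)) + c * (\<psi> (hw, t) - \<psi> (- hw, t)))
    \<le> L2_norm {0<..<pi} (\<lambda>t. \<phi> (hw, t) - \<phi> (- hw, t)) + cmod c * L2_norm {0<..<pi} (\<lambda>t. \<psi> (hw, t) - \<psi> (- hw, t))"
    by (intro L2_triangle L2_diff s)
  moreover have "(\<lambda>t. (\<phi> (hw, t) - \<phi> (- hw, t)) + c * (\<psi> (hw, t) - \<psi> (- hw, t)))
    = (\<lambda>t. (\<phi> (hw, t) + c * \<psi> (hw, t)) - (\<phi> (- hw, t) + c * \<psi> (- hw, t)))"
    by (auto simp: algebra_simps)
  ultimately show ?thesis using 1 2 unfolding defect_def by (simp add: distrib_left)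
qed

lemma P_comb:
  assumes u: "u \<in> W12 Om" and v: "v \<in> W12 Om"
  shows "AE x in lebesgue_on Om. P1 (\<lambda>x. u x + c * v x) x = P1 u x + c * P1 v x"
    "AE x in lebesgue_on Om. P2 (\<lambda>x. u x + c * v x) x = P2 u x + c * P2 v x"
  by (rule W12_comb(2)[OF OmS u v], simp add: Basis_plane)+

lemma V_comb:
  assumes u: "u \<in> V" and v: "v \<in> V" shows "(\<lambda>x. u x + c * v x) \<in> V"
proof -
  note uW = V_W12[OF u] and vW = V_W12[OF v]
  have w: "(\<lambda>x. u x + c * v x) \<in> W12 Om" by (rule W12_comb(1)[OF OmS uW vW])
  have "\<exists>\<phi>. smooth \<phi> \<and> W12_norm Om (\<lambda>x. \<phi> x - (u x + c * v x)) < e \<and> defect \<eta> \<phi> < e" if e: "e > 0" for e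
  proof -
    define d where "d = e / (4 * (1 + cmod c))"
    have c1: "0 < 4 * (1 + cmod c)" by (simp add: add_pos_nonneg)
    have d: "d > 0" using e c1 by (simp add: d_def)
    have "d * (4 * (1 + cmod c)) = e" using c1 by (simp add: d_def)
    define D where "D = d + cmod c * d"
    have de: "4 * D = e" using \<open>d * (4 * (1 + cmod c)) = e\<close> by (simp add: D_def algebra_simps)
    obtain \<phi> where p: "smooth \<phi>" "W12_norm Om (\<lambda>x. \<phi> x - u x) < d" "defect \<eta> \<phi> < d"
      using u d unfolding V_iff by blast
    obtain \<psi> where q: "smooth \<psi>" "W12_norm Om (\<lambda>x. \<psi> x - v x) < d" "defect \<eta> \<psi> < d"
      using v d unfolding V_iff by blast
    let ?f = "\<lambda>x. \<phi> x + c * \<psi> x"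
    have sf: "smooth ?f" by (intro smooth_add smooth_mult smooth_const p q)
    note bu = W12_norm_bounds[OF p(1) uW] and bv = W12_norm_bounds[OF q(1) vW]
    have t: "nO (\<lambda>x. f x + c * g x) \<le> D" if "f \<in> L2 Om" "g \<in> L2 Om" "nO f \<le> d" "nO g \<le> d" for f g
      using L2_triangle[OF that(1,2), of c] mult_left_mono[OF that(4), of "cmod c"] that(3) by (simp add: D_def)
    have f0: "(\<lambda>x. \<phi> x - u x) \<in> L2 Om" "(\<lambda>x. \<psi> x - v x) \<in> L2 Om"
      by (intro L2_diff smooth_L2 W12_L2 p q uW vW)+
    have f1: "(\<lambda>x. d1 \<phi> x - P1 u x) \<in> L2 Om" "(\<lambda>x. d1 \<psi> x - P1 v x) \<in> L2 Om"
      by (intro L2_diff smooth_L2 W12_L2 p q uW vW)+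
    have f2: "(\<lambda>x. d2 \<phi> x - P2 u x) \<in> L2 Om" "(\<lambda>x. d2 \<psi> x - P2 v x) \<in> L2 Om"
      by (intro L2_diff smooth_L2 W12_L2 p q uW vW)+
    have "nO (\<lambda>x. ?f x - (u x + c * v x)) = nO (\<lambda>x. (\<phi> x - u x) + c * (\<psi> x - v x))"
      by (simp add: algebra_simps)
    also have "\<dots> \<le> D" by (rule t[OF f0]) (use bu bv p q in linarith)+
    finally have n0: "nO (\<lambda>x. ?f x - (u x + c * v x)) \<le> D" .
    have "nO (\<lambda>x. d1 ?f x - P1 (\<lambda>x. u x + c * v x) x) = nO (\<lambda>x. (d1 \<phi> x - P1 u x) + c * (d1 \<psi> x - P1 v x))"
      by (rule L2_norm_cong_AE[OF L2_diff[OF smooth_L2(2)[OF sf] W12_L2(2)[OF w]] L2_comb[OF f1]])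
         (use P_comb(1)[OF uW vW, of c] in \<open>eventually_elim, simp add: frechet_comb[OF p(1) q(1)] algebra_simps\<close>)
    also have "\<dots> \<le> D" by (rule t[OF f1]) (use bu bv p q in linarith)+
    finally have n1: "nO (\<lambda>x. d1 ?f x - P1 (\<lambda>x. u x + c * v x) x) \<le> D" .
    have "nO (\<lambda>x. d2 ?f x - P2 (\<lambda>x. u x + c * v x) x) = nO (\<lambda>x. (d2 \<phi> x - P2 u x) + c * (d2 \<psi> x - P2 v x))"
      by (rule L2_norm_cong_AE[OF L2_diff[OF smooth_L2(3)[OF sf] W12_L2(3)[OF w]] L2_comb[OF f2]])
         (use P_comb(2)[OF uW vW, of c] in \<open>eventually_elim, simp add: frechet_comb[OF p(1) q(1)] algebra_simps\<close>)
    also have "\<dots> \<le> D" by (rule t[OF f2]) (use bu bv p q in linarith)+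
    finally have n2: "nO (\<lambda>x. d2 ?f x - P2 (\<lambda>x. u x + c * v x) x) \<le> D" .
    have dc: "0 < D" using d by (simp add: D_def add_pos_nonneg)
    have "W12_norm Om (\<lambda>x. ?f x - (u x + c * v x)) \<le> D + D + D"
      using W12_norm_bounds(4)[OF sf w] n0 n1 n2 by linarith
    then have 1: "W12_norm Om (\<lambda>x. ?f x - (u x + c * v x)) < e" using dc de by linarith
    have "defect \<eta> ?f \<le> D"
      using defect_comb[OF p(1) q(1), of c] p(3) mult_left_mono[OF less_imp_le[OF q(3)], of "cmod c"] by (simp add: D_def)
    then have 2: "defect \<eta> ?f < e" using dc de by linarith
    show ?thesis using sf 1 2 by blast
  qed
  then show ?thesis unfolding V_iff using w by blast
qed

text \<open>The weak derivatives pass to the limit, and a smooth approximant of a late member of the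
  sequence also approximates u, with the same small defect.\<close>

lemma V_closed:
  assumes X: "\<And>n::nat. X n \<in> V" and L: "u \<in> L2 Om" "w1 \<in> L2 Om" "w2 \<in> L2 Om"
    and l: "(\<lambda>n. nO (\<lambda>x. X n x - u x)) \<longlonglongrightarrow> 0" "(\<lambda>n. nO (\<lambda>x. P1 (X n) x - w1 x)) \<longlonglongrightarrow> 0"
      "(\<lambda>n. nO (\<lambda>x. P2 (X n) x - w2 x)) \<longlonglongrightarrow> 0"
  shows "u \<in> V" "AE x in lebesgue_on Om. P1 u x = w1 x" "AE x in lebesgue_on Om. P2 u x = w2 x"
proof -
  note XW = V_W12[OF X]
  have wd: "has_weak_deriv Om (1, 0) u w1" "has_weak_deriv Om (0, 1) u w2"
    by (rule weak_deriv_limit[OF OmS W12_L2(1)[OF XW] L(1) W12_L2(2)[OF XW] L(2) W12_D(3)[OF XW] l(1,2)], simp add: Basis_plane)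
       (rule weak_deriv_limit[OF OmS W12_L2(1)[OF XW] L(1) W12_L2(3)[OF XW] L(3) W12_D(3)[OF XW] l(1,3)], simp add: Basis_plane)
  have uW: "u \<in> W12 Om"
    by (rule W12_I[where w="\<lambda>e. if e = (1, 0) then w1 else w2"]) (use L wd in \<open>auto simp: Basis_plane\<close>)
  show a1: "AE x in lebesgue_on Om. P1 u x = w1 x" by (rule wderiv_eq_AE(1)[OF OmS L(2) wd(1)])
  show a2: "AE x in lebesgue_on Om. P2 u x = w2 x" by (rule wderiv_eq_AE(1)[OF OmS L(3) wd(2)])
  have "\<exists>\<phi>. smooth \<phi> \<and> W12_norm Om (\<lambda>x. \<phi> x - u x) < e \<and> defect \<eta> \<phi> < e" if e: "e > 0" for e
  proof -
    \<comment> \<open>The Sobolev norm is estimated by three L2 norms, and each of them is split at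
      \<open>X n\<close>: six errors in all.\<close>
    have e6: "e / 6 > 0" using e by simp
    have "\<forall>\<^sub>F n in sequentially. nO (\<lambda>x. X n x - u x) < e / 6 \<and> nO (\<lambda>x. P1 (X n) x - w1 x) < e / 6 \<and> nO (\<lambda>x. P2 (X n) x - w2 x) < e / 6"
      using order_tendstoD(2)[OF l(1) e6] order_tendstoD(2)[OF l(2) e6] order_tendstoD(2)[OF l(3) e6] by eventually_elim auto
    then obtain n where n: "nO (\<lambda>x. X n x - u x) < e / 6" "nO (\<lambda>x. P1 (X n) x - w1 x) < e / 6" "nO (\<lambda>x. P2 (X n) x - w2 x) < e / 6"
      using eventually_happens'[OF sequentially_bot] by blast
    obtain \<phi> where p: "smooth \<phi>" "W12_norm Om (\<lambda>x. \<phi> x - X n x) < e / 6" "defect \<eta> \<phi> < e / 6"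
      using X[of n] e6 unfolding V_iff by blast
    note b = W12_norm_bounds[OF p(1) XW[of n]]
    have t: "nO (\<lambda>x. f x - h x) \<le> nO (\<lambda>x. f x - g x) + nO (\<lambda>x. g x - h x)" if "f \<in> L2 Om" "g \<in> L2 Om" "h \<in> L2 Om" for f g h
      using L2_norm_add_le[OF L2_diff[OF that(1,2)] L2_diff[OF that(2,3)]] by simp
    have c1: "nO (\<lambda>x. d1 \<phi> x - P1 u x) = nO (\<lambda>x. d1 \<phi> x - w1 x)"
      by (rule L2_norm_cong_AE[OF L2_diff[OF smooth_L2(2)[OF p(1)] W12_L2(2)[OF uW]] L2_diff[OF smooth_L2(2)[OF p(1)] L(2)]])
         (use a1 in \<open>eventually_elim, simp\<close>)
    have c2: "nO (\<lambda>x. d2 \<phi> x - P2 u x) = nO (\<lambda>x. d2 \<phi> x - w2 x)"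
      by (rule L2_norm_cong_AE[OF L2_diff[OF smooth_L2(3)[OF p(1)] W12_L2(3)[OF uW]] L2_diff[OF smooth_L2(3)[OF p(1)] L(3)]])
         (use a2 in \<open>eventually_elim, simp\<close>)
    have "W12_norm Om (\<lambda>x. \<phi> x - u x) < e"
      using W12_norm_bounds(4)[OF p(1) uW, unfolded c1 c2] b n p(2)
        t[OF smooth_L2(1)[OF p(1)] W12_L2(1)[OF XW[of n]] L(1)]
        t[OF smooth_L2(2)[OF p(1)] W12_L2(2)[OF XW[of n]] L(2)]
        t[OF smooth_L2(3)[OF p(1)] W12_L2(3)[OF XW[of n]] L(3)] by linarith
    then show ?thesis using p(1,3) e by (intro exI[of _ \<phi>]) auto
  qed
  then show "u \<in> V" unfolding V_iff using uW by blast
qed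

section \<open>Integration by parts and the Friedrichs inequality in the form domain\<close>

lemma interval_integral_bound:
  fixes f g :: "real \<Rightarrow> complex"
  assumes "continuous_on {l..r} f" "continuous_on {l..r} g"
  shows "cmod (integral {l..r} (\<lambda>t. f t * g t)) \<le> L2_norm {l<..<r} f * L2_norm {l<..<r} g"
proof -
  have L: "h \<in> L2 {l<..<r}" if "continuous_on {l..r} h" for h :: "real \<Rightarrow> complex"
    by (rule continuous_in_L2[OF _ _ continuous_on_subset[OF that closure_minimal]]) auto
  have "integral {l..r} (\<lambda>t. f t * g t) = (\<integral>t. f t * g t \<partial>lebesgue_on {l<..<r})"
    by (rule integral_on_interval[symmetric]) (intro continuous_intros assms)
  also have "\<dots> = L2_inner {l<..<r} f (\<lambda>t. cnj (g t))" by (simp add: L2_inner_def)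
  finally show ?thesis using L2_CS[OF L[OF assms(1)] L2_cnj[OF L[OF assms(2)]]] by (simp add: L2_norm_def)
qed

text \<open>For smooth approximants the boundary term is the lateral jump times the common lateral
  value of \<psi>, and the jump tends to zero in L2. The factor \<psi> only has to be continuous
  with one continuous partial derivative.\<close>

lemma V_parts_1:
  fixes \<psi> \<psi>' :: "real \<times> real \<Rightarrow> complex"
  assumes u: "u \<in> V" and c: "continuous_on UNIV \<psi>" "continuous_on UNIV \<psi>'"
    and d: "\<And>s t. ((\<lambda>s. \<psi> (s, t)) has_vector_derivative \<psi>' (s, t)) (at s)"
    and per: "\<And>t. \<psi> (hw, t) = \<psi> (- hw, t)"
  shows "(\<integral>x. P1 u x * \<psi> x \<partial>lebesgue_on Om) = - (\<integral>x. u x * \<psi>' x \<partial>lebesgue_on Om)"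
proof -
  obtain \<phi> where pall: "\<forall>n. smooth (\<phi> n)" and lall: "(\<lambda>n. nO (\<lambda>x. \<phi> n x - u x)) \<longlonglongrightarrow> 0"
    "(\<lambda>n. nO (\<lambda>x. d1 (\<phi> n) x - P1 u x)) \<longlonglongrightarrow> 0"
    "(\<lambda>n. nO (\<lambda>x. d2 (\<phi> n) x - P2 u x)) \<longlonglongrightarrow> 0"
    "(\<lambda>n. L2_norm {-hw<..<hw} (\<lambda>t. \<phi> n (t, pi))) \<longlonglongrightarrow> 0"
    "(\<lambda>n. L2_norm {t. \<bar>t\<bar> < \<epsilon> * \<eta>} (\<lambda>t. \<phi> n (t, 0))) \<longlonglongrightarrow> 0"
    "(\<lambda>n. L2_norm {0<..<pi} (\<lambda>t. \<phi> n (hw, t) - \<phi> n (- hw, t))) \<longlonglongrightarrow> 0"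
    using V_seq[OF u] by blast
  have p: "smooth (\<phi> n)" for n using pall by simp
  note l = lall(1,2,6)
  note pc = smooth_continuous[OF p] smooth_continuous[OF smooth_frechet[OF p]]
  have I: "(\<integral>x. d1 (\<phi> n) x * \<psi> x \<partial>lebesgue_on Om) + (\<integral>x. \<phi> n x * \<psi>' x \<partial>lebesgue_on Om)
      = integral {0..pi} (\<lambda>t. (\<phi> n (hw, t) - \<phi> n (- hw, t)) * \<psi> (hw, t))" for n
  proof -
    have "(\<integral>x. d1 (\<phi> n) x * \<psi> x \<partial>lebesgue_on Om) + (\<integral>x. \<phi> n x * \<psi>' x \<partial>lebesgue_on Om)
        = (\<integral>x. d1 (\<phi> n) x * \<psi> x + \<phi> n x * \<psi>' x \<partial>lebesgue_on Om)"
      by (intro Bochner_Integration.integral_add[symmetric] L2_mult_integrable smooth_L2 p cont_L2 c)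
    also have "\<dots> = integral {0..pi} (\<lambda>t. integral {-hw..hw} (\<lambda>s. d1 (\<phi> n) (s, t) * \<psi> (s, t) + \<phi> n (s, t) * \<psi>' (s, t)))"
      by (rule fub2) (intro continuous_intros pc c)
    also have "\<dots> = integral {0..pi} (\<lambda>t. (\<phi> n (hw, t) - \<phi> n (- hw, t)) * \<psi> (hw, t))"
    proof (rule Henstock_Kurzweil_Integration.integral_cong)
      fix t
      have "((\<lambda>s. d1 (\<phi> n) (s, t) * \<psi> (s, t) + \<phi> n (s, t) * \<psi>' (s, t)) has_integral
          (\<phi> n (hw, t) * \<psi> (hw, t) - \<phi> n (- hw, t) * \<psi> (- hw, t))) {-hw..hw}"
      proof (rule fundamental_theorem_of_calculus)
        fix s
        have "((\<lambda>s. \<phi> n (s, t) * \<psi> (s, t)) has_vector_derivative (\<phi> n (s, t) * \<psi>' (s, t) + d1 (\<phi> n) (s, t) * \<psi> (s, t))) (at s)"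
          by (rule has_vector_derivative_mult[OF slice_deriv(1)[OF p] d])
        then show "((\<lambda>s. \<phi> n (s, t) * \<psi> (s, t)) has_vector_derivative (d1 (\<phi> n) (s, t) * \<psi> (s, t) + \<phi> n (s, t) * \<psi>' (s, t))) (at s within {-hw..hw})"
          unfolding add.commute[of "d1 (\<phi> n) (s, t) * \<psi> (s, t)"] by (rule has_vector_derivative_at_within)
      qed (use hw_pos in simp)
      then show "integral {-hw..hw} (\<lambda>s. d1 (\<phi> n) (s, t) * \<psi> (s, t) + \<phi> n (s, t) * \<psi>' (s, t)) = (\<phi> n (hw, t) - \<phi> n (- hw, t)) * \<psi> (hw, t)"
        using per[of t] by (simp add: integral_unique left_diff_distrib)
    qed
    finally show ?thesis .
  qed
  have "(\<lambda>n. (\<integral>x. d1 (\<phi> n) x * \<psi> x \<partial>lebesgue_on Om) + (\<integral>x. \<phi> n x * \<psi>' x \<partial>lebesgue_on Om))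
      \<longlonglongrightarrow> (\<integral>x. P1 u x * \<psi> x \<partial>lebesgue_on Om) + (\<integral>x. u x * \<psi>' x \<partial>lebesgue_on Om)"
    by (intro tendsto_add tendsto_integral_mult smooth_L2 p V_L2[OF u] l cont_L2 c)
  moreover have "(\<lambda>n. (\<integral>x. d1 (\<phi> n) x * \<psi> x \<partial>lebesgue_on Om) + (\<integral>x. \<phi> n x * \<psi>' x \<partial>lebesgue_on Om)) \<longlonglongrightarrow> 0"
    unfolding I
  proof (rule Lim_null_comparison)
    show "\<forall>\<^sub>F n in sequentially. norm (integral {0..pi} (\<lambda>t. (\<phi> n (hw, t) - \<phi> n (- hw, t)) * \<psi> (hw, t)))
        \<le> L2_norm {0<..<pi} (\<lambda>t. \<phi> n (hw, t) - \<phi> n (- hw, t)) * L2_norm {0<..<pi} (\<lambda>t. \<psi> (hw, t))"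
      by (intro always_eventually allI interval_integral_bound continuous_intros cont_slice pc c)
    show "(\<lambda>n. L2_norm {0<..<pi} (\<lambda>t. \<phi> n (hw, t) - \<phi> n (- hw, t)) * L2_norm {0<..<pi} (\<lambda>t. \<psi> (hw, t))) \<longlonglongrightarrow> 0"
      by (rule tendsto_mult_left_zero[OF l(3)])
  qed
  ultimately have "(\<integral>x. P1 u x * \<psi> x \<partial>lebesgue_on Om) + (\<integral>x. u x * \<psi>' x \<partial>lebesgue_on Om) = 0"
    by (rule LIMSEQ_unique)
  then show ?thesis by (simp add: eq_neg_iff_add_eq_0)
qed

text \<open>The boundary term at the bottom vanishes because \<psi> does, and the one at the top
  because u has zero trace there. The values of u on the bottom edge never enter.\<close>

lemma V_parts_2:
  fixes \<psi> \<psi>' :: "real \<times> real \<Rightarrow> complex"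
  assumes u: "u \<in> V" and c: "continuous_on UNIV \<psi>" "continuous_on UNIV \<psi>'"
    and d: "\<And>s t. ((\<lambda>t. \<psi> (s, t)) has_vector_derivative \<psi>' (s, t)) (at t)"
    and bottom: "\<And>s. \<psi> (s, 0) = 0"
  shows "(\<integral>x. P2 u x * \<psi> x \<partial>lebesgue_on Om) = - (\<integral>x. u x * \<psi>' x \<partial>lebesgue_on Om)"
proof -
  obtain \<phi> where pall: "\<forall>n. smooth (\<phi> n)" and lall: "(\<lambda>n. nO (\<lambda>x. \<phi> n x - u x)) \<longlonglongrightarrow> 0"
    "(\<lambda>n. nO (\<lambda>x. d1 (\<phi> n) x - P1 u x)) \<longlonglongrightarrow> 0"
    "(\<lambda>n. nO (\<lambda>x. d2 (\<phi> n) x - P2 u x)) \<longlonglongrightarrow> 0"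
    "(\<lambda>n. L2_norm {-hw<..<hw} (\<lambda>t. \<phi> n (t, pi))) \<longlonglongrightarrow> 0"
    "(\<lambda>n. L2_norm {t. \<bar>t\<bar> < \<epsilon> * \<eta>} (\<lambda>t. \<phi> n (t, 0))) \<longlonglongrightarrow> 0"
    "(\<lambda>n. L2_norm {0<..<pi} (\<lambda>t. \<phi> n (hw, t) - \<phi> n (- hw, t))) \<longlonglongrightarrow> 0"
    using V_seq[OF u] by blast
  have p: "smooth (\<phi> n)" for n using pall by simp
  note l = lall(1,3,4)
  note pc = smooth_continuous[OF p] smooth_continuous[OF smooth_frechet[OF p]]
  have I: "(\<integral>x. d2 (\<phi> n) x * \<psi> x \<partial>lebesgue_on Om) + (\<integral>x. \<phi> n x * \<psi>' x \<partial>lebesgue_on Om)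
      = integral {-hw..hw} (\<lambda>s. \<phi> n (s, pi) * \<psi> (s, pi))" for n
  proof -
    have "(\<integral>x. d2 (\<phi> n) x * \<psi> x \<partial>lebesgue_on Om) + (\<integral>x. \<phi> n x * \<psi>' x \<partial>lebesgue_on Om)
        = (\<integral>x. d2 (\<phi> n) x * \<psi> x + \<phi> n x * \<psi>' x \<partial>lebesgue_on Om)"
      by (intro Bochner_Integration.integral_add[symmetric] L2_mult_integrable smooth_L2 p cont_L2 c)
    also have "\<dots> = integral {-hw..hw} (\<lambda>s. integral {0..pi} (\<lambda>t. d2 (\<phi> n) (s, t) * \<psi> (s, t) + \<phi> n (s, t) * \<psi>' (s, t)))"
      by (rule fub1) (intro continuous_intros pc c)
    also have "\<dots> = integral {-hw..hw} (\<lambda>s. \<phi> n (s, pi) * \<psi> (s, pi))"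
    proof (rule Henstock_Kurzweil_Integration.integral_cong)
      fix s
      have "((\<lambda>t. d2 (\<phi> n) (s, t) * \<psi> (s, t) + \<phi> n (s, t) * \<psi>' (s, t)) has_integral
          (\<phi> n (s, pi) * \<psi> (s, pi) - \<phi> n (s, 0) * \<psi> (s, 0))) {0..pi}"
      proof (rule fundamental_theorem_of_calculus)
        fix t
        have "((\<lambda>t. \<phi> n (s, t) * \<psi> (s, t)) has_vector_derivative (\<phi> n (s, t) * \<psi>' (s, t) + d2 (\<phi> n) (s, t) * \<psi> (s, t))) (at t)"
          by (rule has_vector_derivative_mult[OF slice_deriv(2)[OF p] d])
        then show "((\<lambda>t. \<phi> n (s, t) * \<psi> (s, t)) has_vector_derivative (d2 (\<phi> n) (s, t) * \<psi> (s, t) + \<phi> n (s, t) * \<psi>' (s, t))) (at t within {0..pi})"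
          unfolding add.commute[of "d2 (\<phi> n) (s, t) * \<psi> (s, t)"] by (rule has_vector_derivative_at_within)
      qed simp
      then show "integral {0..pi} (\<lambda>t. d2 (\<phi> n) (s, t) * \<psi> (s, t) + \<phi> n (s, t) * \<psi>' (s, t)) = \<phi> n (s, pi) * \<psi> (s, pi)"
        using bottom[of s] by (simp add: integral_unique)
    qed
    finally show ?thesis .
  qed
  have "(\<lambda>n. (\<integral>x. d2 (\<phi> n) x * \<psi> x \<partial>lebesgue_on Om) + (\<integral>x. \<phi> n x * \<psi>' x \<partial>lebesgue_on Om))
      \<longlonglongrightarrow> (\<integral>x. P2 u x * \<psi> x \<partial>lebesgue_on Om) + (\<integral>x. u x * \<psi>' x \<partial>lebesgue_on Om)"
    by (intro tendsto_add tendsto_integral_mult smooth_L2 p V_L2[OF u] l cont_L2 c)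
  moreover have "(\<lambda>n. (\<integral>x. d2 (\<phi> n) x * \<psi> x \<partial>lebesgue_on Om) + (\<integral>x. \<phi> n x * \<psi>' x \<partial>lebesgue_on Om)) \<longlonglongrightarrow> 0"
    unfolding I
  proof (rule Lim_null_comparison)
    show "\<forall>\<^sub>F n in sequentially. norm (integral {-hw..hw} (\<lambda>s. \<phi> n (s, pi) * \<psi> (s, pi)))
        \<le> L2_norm {-hw<..<hw} (\<lambda>s. \<phi> n (s, pi)) * L2_norm {-hw<..<hw} (\<lambda>s. \<psi> (s, pi))"
      by (intro always_eventually allI interval_integral_bound cont_slice pc c)
    show "(\<lambda>n. L2_norm {-hw<..<hw} (\<lambda>s. \<phi> n (s, pi)) * L2_norm {-hw<..<hw} (\<lambda>s. \<psi> (s, pi))) \<longlonglongrightarrow> 0"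
      by (rule tendsto_mult_left_zero[OF l(3)])
  qed
  ultimately have "(\<integral>x. P2 u x * \<psi> x \<partial>lebesgue_on Om) + (\<integral>x. u x * \<psi>' x \<partial>lebesgue_on Om) = 0"
    by (rule LIMSEQ_unique)
  then show ?thesis by (simp add: eq_neg_iff_add_eq_0)
qed

lemma smooth_friedrichs:
  assumes p: "smooth \<phi>"
  shows "(nO \<phi>)\<^sup>2 \<le> 2 * pi * (L2_norm {-hw<..<hw} (\<lambda>s. \<phi> (s, pi)))\<^sup>2 + 2 * pi\<^sup>2 * (nO (d2 \<phi>))\<^sup>2"
proof -
  have pc: "continuous_on UNIV \<phi>" "continuous_on UNIV (d2 \<phi>)" by (intro smooth_continuous smooth_frechet p)+
  have cn: "continuous_on UNIV (\<lambda>x. (norm (\<phi> x))\<^sup>2)" "continuous_on UNIV (\<lambda>x. (norm (d2 \<phi> x))\<^sup>2)"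
    by (intro continuous_intros pc)+
  have "(nO \<phi>)\<^sup>2 \<le> integral {-hw..hw} (\<lambda>s. 2 * pi * (norm (\<phi> (s, pi)))\<^sup>2 + 2 * pi\<^sup>2 * integral {0..pi} (\<lambda>t. (norm (d2 \<phi> (s, t)))\<^sup>2))"
    unfolding nO_sq1[OF pc(1)]
  proof (rule integral_le)
    show "(\<lambda>s. integral {0..pi} (\<lambda>t. (norm (\<phi> (s, t)))\<^sup>2)) integrable_on {-hw..hw}"
      by (intro integrable_continuous_interval cont_param(1)[OF cn(1)])
    show "(\<lambda>s. 2 * pi * (norm (\<phi> (s, pi)))\<^sup>2 + 2 * pi\<^sup>2 * integral {0..pi} (\<lambda>t. (norm (d2 \<phi> (s, t)))\<^sup>2)) integrable_on {-hw..hw}"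
      by (intro integrable_continuous_interval continuous_intros cont_slice(1)[OF pc(1)] cont_param(1)[OF cn(2)])
    fix s
    show "integral {0..pi} (\<lambda>t. (norm (\<phi> (s, t)))\<^sup>2) \<le> 2 * pi * (norm (\<phi> (s, pi)))\<^sup>2 + 2 * pi\<^sup>2 * integral {0..pi} (\<lambda>t. (norm (d2 \<phi> (s, t)))\<^sup>2)"
      using friedrichs_1d[OF pi_gt_zero slice_deriv(2)[OF p] cont_slice(2)[OF pc(2)], of pi] by simp
  qed
  also have "\<dots> = 2 * pi * (L2_norm {-hw<..<hw} (\<lambda>s. \<phi> (s, pi)))\<^sup>2 + 2 * pi\<^sup>2 * (nO (d2 \<phi>))\<^sup>2"
    unfolding nO_sq1[OF pc(2)] L2_norm_sq_interval[OF cont_slice(1)[OF pc(1)]]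
    by (subst Henstock_Kurzweil_Integration.integral_add)
       (auto intro!: integrable_continuous_interval continuous_intros cont_slice(1)[OF pc(1)] cont_param(1)[OF cn(2)])
  finally show ?thesis .
qed

text \<open>The Dirichlet condition on the top edge is integrated downwards along vertical lines of
  length pi, so the constant depends neither on \<epsilon> nor on \<eta>.\<close>

lemma V_friedrichs:
  assumes u: "u \<in> V" shows "nO u \<le> 6 * nO (P2 u)"
proof -
  obtain \<phi> where pall: "\<forall>n. smooth (\<phi> n)" and lall: "(\<lambda>n. nO (\<lambda>x. \<phi> n x - u x)) \<longlonglongrightarrow> 0"
    "(\<lambda>n. nO (\<lambda>x. d1 (\<phi> n) x - P1 u x)) \<longlonglongrightarrow> 0"
    "(\<lambda>n. nO (\<lambda>x. d2 (\<phi> n) x - P2 u x)) \<longlonglongrightarrow> 0"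
    "(\<lambda>n. L2_norm {-hw<..<hw} (\<lambda>t. \<phi> n (t, pi))) \<longlonglongrightarrow> 0"
    "(\<lambda>n. L2_norm {t. \<bar>t\<bar> < \<epsilon> * \<eta>} (\<lambda>t. \<phi> n (t, 0))) \<longlonglongrightarrow> 0"
    "(\<lambda>n. L2_norm {0<..<pi} (\<lambda>t. \<phi> n (hw, t) - \<phi> n (- hw, t))) \<longlonglongrightarrow> 0"
    using V_seq[OF u] by blast
  have p: "smooth (\<phi> n)" for n using pall by simp
  note l = lall(1,3,4)
  have L: "(\<lambda>n. (nO (\<phi> n))\<^sup>2) \<longlonglongrightarrow> (nO u)\<^sup>2"
    by (intro tendsto_power L2_tendsto_norm smooth_L2 p V_L2[OF u] l)
  have R: "(\<lambda>n. 2 * pi * (L2_norm {-hw<..<hw} (\<lambda>s. \<phi> n (s, pi)))\<^sup>2 + 2 * pi\<^sup>2 * (nO (d2 (\<phi> n)))\<^sup>2)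
      \<longlonglongrightarrow> 2 * pi * 0\<^sup>2 + 2 * pi\<^sup>2 * (nO (P2 u))\<^sup>2"
    by (intro tendsto_intros L2_tendsto_norm smooth_L2 p V_L2[OF u] l)
  have "(nO u)\<^sup>2 \<le> 2 * pi * 0\<^sup>2 + 2 * pi\<^sup>2 * (nO (P2 u))\<^sup>2"
    by (rule LIMSEQ_le[OF L R]) (use smooth_friedrichs[OF p] in blast)
  \<comment> \<open>Since pi < 4, the factor 2 pi^2 is at most 32.\<close>
  also have "\<dots> \<le> 36 * (nO (P2 u))\<^sup>2"
  proof -
    have "pi\<^sup>2 \<le> 4\<^sup>2" using pi_less_4 by (intro power_mono) auto
    then show ?thesis by (simp add: mult_right_mono)
  qed
  finally have "(nO u)\<^sup>2 \<le> (6 * nO (P2 u))\<^sup>2" by (simp add: power_mult_distrib)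
  then show ?thesis by (rule power2_le_imp_le) (simp add: L2_norm_nonneg)
qed

text \<open>Wirtinger's inequality requires exactly equal lateral values, whereas smooth
  approximants only have a small jump. Subtracting the jump times x_1/(2 hw) removes it; the price
  is smoothness in x_2, so only the x_1-derivative is tracked from here on.\<close>

lemma V_periodic_seq:
  assumes u: "u \<in> V"
  obtains q q' :: "nat \<Rightarrow> real \<times> real \<Rightarrow> complex" where
    "\<And>n. continuous_on UNIV (q n)" "\<And>n. continuous_on UNIV (q' n)"
    "\<And>n s t. ((\<lambda>s. q n (s, t)) has_vector_derivative q' n (s, t)) (at s)"
    "\<And>n t. q n (hw, t) = q n (- hw, t)"
    "(\<lambda>n. nO (\<lambda>x. q n x - u x)) \<longlonglongrightarrow> 0" "(\<lambda>n. nO (\<lambda>x. q' n x - P1 u x)) \<longlonglongrightarrow> 0"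
proof -
  obtain \<phi> where pall: "\<forall>n. smooth (\<phi> n)" and lall: "(\<lambda>n. nO (\<lambda>x. \<phi> n x - u x)) \<longlonglongrightarrow> 0"
    "(\<lambda>n. nO (\<lambda>x. d1 (\<phi> n) x - P1 u x)) \<longlonglongrightarrow> 0"
    "(\<lambda>n. nO (\<lambda>x. d2 (\<phi> n) x - P2 u x)) \<longlonglongrightarrow> 0"
    "(\<lambda>n. L2_norm {-hw<..<hw} (\<lambda>t. \<phi> n (t, pi))) \<longlonglongrightarrow> 0"
    "(\<lambda>n. L2_norm {t. \<bar>t\<bar> < \<epsilon> * \<eta>} (\<lambda>t. \<phi> n (t, 0))) \<longlonglongrightarrow> 0"
    "(\<lambda>n. L2_norm {0<..<pi} (\<lambda>t. \<phi> n (hw, t) - \<phi> n (- hw, t))) \<longlonglongrightarrow> 0"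
    using V_seq[OF u] by blast
  have p: "smooth (\<phi> n)" for n using pall by simp
  note l = lall(1,2,6)
  note pc = smooth_continuous[OF p] smooth_continuous[OF smooth_frechet[OF p]]
  define J where "J n t = \<phi> n (hw, t) - \<phi> n (- hw, t)" for n t
  have Jc: "continuous_on A (J n)" for n A unfolding J_def by (intro continuous_intros cont_slice pc)
  have Jc2: "continuous_on UNIV (\<lambda>x. J n (snd x))" for n
    by (rule continuous_on_compose2[OF Jc]) (auto intro!: continuous_intros)
  have JL: "J n \<in> L2 {0<..<pi}" for n by (rule continuous_in_L2[OF _ _ Jc]) auto
  define q where "q n x = \<phi> n x - J n (snd x) * of_real (fst x / (2 * hw))" for n x
  define q' where "q' n x = d1 (\<phi> n) x - J n (snd x) * of_real (1 / (2 * hw))" for n x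
  have nJ: "nO (\<lambda>x. J n (snd x)) = sqrt (2 * hw) * L2_norm {0<..<pi} (J n)" for n
    unfolding Omega_strip using L2_norm_snd[of "-hw" hw "{0<..<pi}", OF _ _ JL[of n]] hw_pos by simp
  have lJ: "(\<lambda>n. nO (\<lambda>x. J n (snd x))) \<longlonglongrightarrow> 0"
    unfolding nJ by (rule tendsto_mult_right_zero) (use l(3) in \<open>simp add: J_def[abs_def]\<close>)
  have JO: "(\<lambda>x. J n (snd x)) \<in> L2 Om" for n by (rule cont_L2[OF Jc2])
  have qc: "continuous_on UNIV (q n)" "continuous_on UNIV (q' n)" for n
    unfolding q_def q'_def using less_imp_neq[OF hw_pos] by (auto intro!: continuous_intros pc Jc2)
  show thesis
  proof (rule that[of q q'])
    show "continuous_on UNIV (q n)" "continuous_on UNIV (q' n)" for n by (rule qc)+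
    show "((\<lambda>s. q n (s, t)) has_vector_derivative q' n (s, t)) (at s)" for n s t
    proof -
      have "((\<lambda>s. complex_of_real (s / (2 * hw))) has_vector_derivative complex_of_real (1 / (2 * hw))) (at s)"
        by (rule has_vector_derivative_of_real) (use hw_pos in \<open>auto intro!: derivative_eq_intros\<close>)
      from has_vector_derivative_diff[OF slice_deriv(1)[OF p[of n], of t s] has_vector_derivative_mult_right[OF this, of "J n t"]]
      show ?thesis by (simp add: q_def q'_def)
    qed
    show "q n (hw, t) = q n (- hw, t)" for n t
    proof -
      have "complex_of_real (hw / (2 * hw)) = 1/2" "complex_of_real (- hw / (2 * hw)) = - (1/2)" using hw_pos by auto
      then show ?thesis unfolding q_def J_def by (simp add: field_simps)
    qed
    show "(\<lambda>n. nO (\<lambda>x. q n x - u x)) \<longlonglongrightarrow> 0"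
    proof (rule tendsto_0_le[OF L2_norm_nonneg])
      show "nO (\<lambda>x. q n x - u x) \<le> nO (\<lambda>x. \<phi> n x - u x) + nO (\<lambda>x. J n (snd x))" for n
      proof -
        have L: "(\<lambda>x. J n (snd x) * of_real (fst x / (2 * hw))) \<in> L2 Om"
          by (rule cont_L2) (use hw_pos in \<open>auto intro!: continuous_intros Jc2\<close>)
        have "nO (\<lambda>x. J n (snd x) * of_real (fst x / (2 * hw))) \<le> nO (\<lambda>x. J n (snd x))"
        proof (rule L2_norm_mono[OF L JO])
          fix x assume "x \<in> Om"
          then have "\<bar>fst x / (2 * hw)\<bar> \<le> 1" using hw_pos unfolding Omega_strip by (auto simp: abs_le_iff field_simps)
          then show "cmod (J n (snd x) * of_real (fst x / (2 * hw))) \<le> cmod (J n (snd x))"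
            unfolding norm_mult norm_of_real by (intro mult_left_le) auto
        qed
        moreover have "nO (\<lambda>x. (\<phi> n x - u x) - J n (snd x) * of_real (fst x / (2 * hw)))
            \<le> nO (\<lambda>x. \<phi> n x - u x) + nO (\<lambda>x. J n (snd x) * of_real (fst x / (2 * hw)))"
          by (intro L2_norm_diff_le L2_diff smooth_L2 p V_L2[OF u] L)
        moreover have "(\<lambda>x. (\<phi> n x - u x) - J n (snd x) * of_real (fst x / (2 * hw))) = (\<lambda>x. q n x - u x)"
          by (auto simp: q_def)
        ultimately show ?thesis by simp
      qed
      show "(\<lambda>n. nO (\<lambda>x. \<phi> n x - u x) + nO (\<lambda>x. J n (snd x))) \<longlonglongrightarrow> 0" by (rule tendsto_add_zero[OF l(1) lJ])
    qed
    show "(\<lambda>n. nO (\<lambda>x. q' n x - P1 u x)) \<longlonglongrightarrow> 0"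
    proof (rule tendsto_0_le[OF L2_norm_nonneg])
      show "nO (\<lambda>x. q' n x - P1 u x) \<le> nO (\<lambda>x. d1 (\<phi> n) x - P1 u x) + (1 / (2 * hw)) * nO (\<lambda>x. J n (snd x))" for n
      proof -
        have "nO (\<lambda>x. (d1 (\<phi> n) x - P1 u x) + (- of_real (1 / (2 * hw))) * J n (snd x))
            \<le> nO (\<lambda>x. d1 (\<phi> n) x - P1 u x) + cmod (- of_real (1 / (2 * hw))) * nO (\<lambda>x. J n (snd x))"
          by (intro L2_triangle L2_diff smooth_L2 p V_L2[OF u] JO)
        moreover have "(\<lambda>x. (d1 (\<phi> n) x - P1 u x) + (- of_real (1 / (2 * hw))) * J n (snd x)) = (\<lambda>x. q' n x - P1 u x)"
          by (auto simp: q'_def)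
        moreover have "cmod (- complex_of_real (1 / (2 * hw))) = 1 / (2 * hw)" using hw_pos unfolding norm_minus_cancel norm_of_real by simp
        ultimately show ?thesis by simp
      qed
      show "(\<lambda>n. nO (\<lambda>x. d1 (\<phi> n) x - P1 u x) + (1 / (2 * hw)) * nO (\<lambda>x. J n (snd x))) \<longlonglongrightarrow> 0"
        by (rule tendsto_add_zero[OF l(2) tendsto_mult_right_zero[OF lJ]])
    qed
  qed
qed

end

lemma L2_inner_scale_left: "L2_inner S (\<lambda>x. c * f x) g = c * L2_inner S f g"
  unfolding L2_inner_def mult.assoc by (rule integral_mult_right_zero)

lemma L2_inner_scale_right: "L2_inner S f (\<lambda>x. c * g x) = cnj c * L2_inner S f g"
proof -
  have "(\<lambda>x. f x * cnj (c * g x)) = (\<lambda>x. cnj c * (f x * cnj (g x)))" by (simp add: mult_ac)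
  then show ?thesis unfolding L2_inner_def by (simp only: integral_mult_right_zero)
qed

lemma L2_inner_diff_left: "f \<in> L2 S \<Longrightarrow> g \<in> L2 S \<Longrightarrow> h \<in> L2 S \<Longrightarrow>
    L2_inner S (\<lambda>x. f x - g x) h = L2_inner S f h - L2_inner S g h"
  using L2ip.ip_comb[of f S g h "-1"] by simp

lemma L2_inner_diff_right: "f \<in> L2 S \<Longrightarrow> g \<in> L2 S \<Longrightarrow> h \<in> L2 S \<Longrightarrow>
    L2_inner S h (\<lambda>x. f x - g x) = L2_inner S h f - L2_inner S h g"
  using L2ip.ip_comb_right[of f S g h "-1"] by simp

lemma L2_norm_scale: "L2_norm S (\<lambda>x. c * f x) = cmod c * L2_norm S f"
proof -
  have "(\<integral>x. (norm (c * f x))\<^sup>2 \<partial>lebesgue_on S) = (\<integral>x. (cmod c)\<^sup>2 * (norm (f x))\<^sup>2 \<partial>lebesgue_on S)"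
    by (simp add: norm_mult power_mult_distrib)
  also have "\<dots> = (cmod c)\<^sup>2 * (\<integral>x. (norm (f x))\<^sup>2 \<partial>lebesgue_on S)" by (rule integral_mult_right_zero)
  finally show ?thesis by (simp add: L2_norm_def real_sqrt_mult)
qed

text \<open>Independence of representatives follows from the bound: the difference of two graph
  elements is in the graph, and its second component has norm zero as soon as the first has.\<close>

lemma L2_bounded_operatorI:
  assumes sub: "\<And>f u. (f, u) \<in> A \<Longrightarrow> f \<in> L2 S \<and> u \<in> L2 S"
    and total: "\<And>f. f \<in> L2 S \<Longrightarrow> \<exists>u. (f, u) \<in> A"
    and comb: "\<And>f g u v c. (f, u) \<in> A \<Longrightarrow> (g, v) \<in> A \<Longrightarrow> (\<lambda>x. f x + c * g x, \<lambda>x. u x + c * v x) \<in> A"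
    and bound: "\<And>f u. (f, u) \<in> A \<Longrightarrow> L2_norm S u \<le> C * L2_norm S f"
  shows "L2_bounded_operator S A"
  unfolding L2_bounded_operator_def
proof (intro conjI)
  show "A \<subseteq> L2 S \<times> L2 S" using sub by auto
  show "\<forall>f\<in>L2 S. \<exists>u. (f, u) \<in> A" using total by auto
  show "\<forall>f g u v c. (f, u) \<in> A \<and> (g, v) \<in> A \<longrightarrow> (\<lambda>x. f x + c * g x, \<lambda>x. u x + c * v x) \<in> A"
    using comb by auto
  show "\<forall>f g u v. (f, u) \<in> A \<and> (g, v) \<in> A \<and> (AE x in lebesgue_on S. f x = g x) \<longrightarrow> (AE x in lebesgue_on S. u x = v x)"
  proof (intro allI impI, elim conjE)
    fix f g u v assume fu: "(f, u) \<in> A" and gv: "(g, v) \<in> A" and ae: "AE x in lebesgue_on S. f x = g x"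
    note L = sub[OF fu] sub[OF gv]
    have d: "(\<lambda>x. f x - g x, \<lambda>x. u x - v x) \<in> A" using comb[OF fu gv, of "-1"] by simp
    have "L2_norm S (\<lambda>x. f x - g x) = L2_norm S (\<lambda>x. 0)"
      by (rule L2_norm_cong_AE[OF _ L2_zero]) (use L ae in \<open>auto intro: L2_diff\<close>)
    then have "L2_norm S (\<lambda>x. u x - v x) \<le> 0" using bound[OF d] by (simp add: L2_norm_zero)
    then have "L2_norm S (\<lambda>x. u x - v x) = 0" using L2_norm_nonneg[of S "\<lambda>x. u x - v x"] by linarith
    then have "AE x in lebesgue_on S. u x - v x = 0" using L by (intro L2_norm_eq_0_AE L2_diff) auto
    then show "AE x in lebesgue_on S. u x = v x" by simp
  qed
  have "L2_opnorm S A \<le> ennreal (max C 0)"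
    unfolding L2_opnorm_def
  proof (rule Sup_least)
    fix r assume "r \<in> {ennreal (L2_norm S g) |f g. (f, g) \<in> A \<and> L2_norm S f \<le> 1}"
    then obtain f g where r: "r = ennreal (L2_norm S g)" and fg: "(f, g) \<in> A" "L2_norm S f \<le> 1" by auto
    have "L2_norm S g \<le> C * L2_norm S f" by (rule bound[OF fg(1)])
    also have "\<dots> \<le> max C 0 * L2_norm S f" by (intro mult_right_mono L2_norm_nonneg) simp
    also have "\<dots> \<le> max C 0 * 1" by (intro mult_left_mono fg) simp
    finally show "r \<le> ennreal (max C 0)" unfolding r by (intro ennreal_leI) simp
  qed
  also have "\<dots> < \<infinity>" by simp
  finally show "L2_opnorm S A < \<infinity>" .
qed

section \<open>Wirtinger's inequality on the cell\<close>

context periodic_cell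
begin

text \<open>The one-dimensional inequality is applied on each horizontal line. The derivative q' is
  orthogonal to functions of x_2 because it integrates to zero over each period.\<close>

lemma wirtinger_cell:
  fixes q q' :: "real \<times> real \<Rightarrow> complex"
  assumes c: "continuous_on UNIV q" "continuous_on UNIV q'"
    and d: "\<And>s t. ((\<lambda>s. q (s, t)) has_vector_derivative q' (s, t)) (at s)"
    and per: "\<And>t. q (hw, t) = q (- hw, t)"
  defines "m \<equiv> \<lambda>t. integral {-hw..hw} (\<lambda>s. q (s, t)) / of_real (2 * hw)"
  shows "continuous_on A m" "nO (\<lambda>x. q x - m (snd x)) \<le> (hw / pi) * nO q'"
    "L2_inner Om q' (\<lambda>x. m (snd x)) = 0"
proof -
  show mc: "continuous_on A m" for A
    unfolding m_def using hw_pos by (intro continuous_intros cont_param(2)[OF c(1)]) auto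
  have mc2: "continuous_on UNIV (\<lambda>x. m (snd x))"
    by (rule continuous_on_compose2[OF mc]) (auto intro!: continuous_intros)
  have qm: "continuous_on UNIV (\<lambda>x. q x - m (snd x))" by (intro continuous_intros c mc2)
  have cn: "continuous_on UNIV (\<lambda>x. (norm (q x - m (snd x)))\<^sup>2)" "continuous_on UNIV (\<lambda>x. (norm (q' x))\<^sup>2)"
    by (intro continuous_intros qm c)+
  have "(nO (\<lambda>x. q x - m (snd x)))\<^sup>2 = integral {0..pi} (\<lambda>t. integral {-hw..hw} (\<lambda>s. (norm (q (s, t) - m t))\<^sup>2))"
    using nO_sq2[OF qm] by simp
  also have "\<dots> \<le> integral {0..pi} (\<lambda>t. (hw / pi)\<^sup>2 * integral {-hw..hw} (\<lambda>s. (norm (q' (s, t)))\<^sup>2))"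
  proof (rule integral_le)
    show "(\<lambda>t. integral {-hw..hw} (\<lambda>s. (norm (q (s, t) - m t))\<^sup>2)) integrable_on {0..pi}"
      using cont_param(2)[OF cn(1)] by (intro integrable_continuous_interval) simp
    show "(\<lambda>t. (hw / pi)\<^sup>2 * integral {-hw..hw} (\<lambda>s. (norm (q' (s, t)))\<^sup>2)) integrable_on {0..pi}"
      by (intro integrable_continuous_interval continuous_intros cont_param(2)[OF cn(2)])
    fix t
    show "integral {-hw..hw} (\<lambda>s. (norm (q (s, t) - m t))\<^sup>2) \<le> (hw / pi)\<^sup>2 * integral {-hw..hw} (\<lambda>s. (norm (q' (s, t)))\<^sup>2)"
      unfolding m_def by (rule wirtinger[OF hw_pos d cont_slice(1)[OF c(2)] per])
  qed
  also have "\<dots> = ((hw / pi) * nO q')\<^sup>2"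
    unfolding power_mult_distrib nO_sq2[OF c(2)] by (rule Henstock_Kurzweil_Integration.integral_mult_right)
  finally show "nO (\<lambda>x. q x - m (snd x)) \<le> (hw / pi) * nO q'"
    by (rule power2_le_imp_le) (use hw_pos in \<open>simp add: L2_norm_nonneg\<close>)
  have "L2_inner Om q' (\<lambda>x. m (snd x)) = integral {0..pi} (\<lambda>t. integral {-hw..hw} (\<lambda>s. q' (s, t) * cnj (m t)))"
    unfolding L2_inner_def
    using fub2[of "\<lambda>x. q' x * cnj (m (snd x))"] by (simp add: continuous_intros c mc2)
  also have "\<dots> = integral {0..pi} (\<lambda>t. 0)"
  proof (rule Henstock_Kurzweil_Integration.integral_cong)
    fix t
    have "((\<lambda>s. q' (s, t)) has_integral (q (hw, t) - q (- hw, t))) {-hw..hw}"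
      by (rule fundamental_theorem_of_calculus) (use hw_pos in \<open>auto intro: has_vector_derivative_at_within[OF d]\<close>)
    then have "((\<lambda>s. q' (s, t) * cnj (m t)) has_integral ((q (hw, t) - q (- hw, t)) * cnj (m t))) {-hw..hw}"
      by (rule has_integral_mult_left)
    then have "((\<lambda>s. q' (s, t) * cnj (m t)) has_integral 0) {-hw..hw}" using per[of t] by simp
    then show "integral {-hw..hw} (\<lambda>s. q' (s, t) * cnj (m t)) = 0" by (rule integral_unique)
  qed
  finally show "L2_inner Om q' (\<lambda>x. m (snd x)) = 0" by simp
qed

text \<open>The x_1-derivative is orthogonal to functions of x_2, so the second argument may be
  replaced by its deviation from the mean, which Wirtinger's inequality estimates by the derivative
  again. The factor hw/pi equals \<epsilon>/2.\<close>

lemma V_derivative_inner_bound: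
  assumes u: "u \<in> V"
  shows "cmod (L2_inner Om (P1 u) u) \<le> (hw / pi) * (nO (P1 u))\<^sup>2"
proof -
  have "\<exists>q q' :: nat \<Rightarrow> real \<times> real \<Rightarrow> complex. (\<forall>n. continuous_on UNIV (q n)) \<and> (\<forall>n. continuous_on UNIV (q' n)) \<and>
    (\<forall>n s t. ((\<lambda>s. q n (s, t)) has_vector_derivative q' n (s, t)) (at s)) \<and> (\<forall>n t. q n (hw, t) = q n (- hw, t)) \<and>
    (\<lambda>n. nO (\<lambda>x. q n x - u x)) \<longlonglongrightarrow> 0 \<and> (\<lambda>n. nO (\<lambda>x. q' n x - P1 u x)) \<longlonglongrightarrow> 0"
    by (rule V_periodic_seq[OF u]) blast
  then obtain q q' where "\<forall>n. continuous_on UNIV (q n)" "\<forall>n. continuous_on UNIV (q' n)"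
    "\<forall>n s t. ((\<lambda>s. q n (s, t)) has_vector_derivative q' n (s, t)) (at s)" "\<forall>n t. q n (hw, t) = q n (- hw, t)"
    and l: "(\<lambda>n::nat. nO (\<lambda>x. q n x - u x)) \<longlonglongrightarrow> 0" "(\<lambda>n. nO (\<lambda>x. q' n x - P1 u x)) \<longlonglongrightarrow> 0" by blast
  then have q: "\<And>n. continuous_on UNIV (q n)" "\<And>n. continuous_on UNIV (q' n)"
    "\<And>n s t. ((\<lambda>s. q n (s, t)) has_vector_derivative q' n (s, t)) (at s)" "\<And>n t. q n (hw, t) = q n (- hw, t)" by auto
  note qL = cont_L2[OF q(1)] and q'L = cont_L2[OF q(2)]
  have "cmod (L2_inner Om (q' n) (q n)) \<le> (hw / pi) * (nO (q' n))\<^sup>2" for n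
  proof -
    let ?m = "\<lambda>t. integral {-hw..hw} (\<lambda>s. q n (s, t)) / of_real (2 * hw)"
    note w = wirtinger_cell[OF q]
    have mL: "(\<lambda>x. ?m (snd x)) \<in> L2 Om"
      by (rule cont_L2, rule continuous_on_compose2[OF w(1)]) (auto intro!: continuous_intros)
    have "L2_inner Om (q' n) (q n) = L2_inner Om (q' n) (\<lambda>x. q n x - ?m (snd x))"
      using L2_inner_diff_right[OF qL mL q'L] w(3) by simp
    also have "cmod \<dots> \<le> nO (q' n) * nO (\<lambda>x. q n x - ?m (snd x))" by (rule L2_CS[OF q'L L2_diff[OF qL mL]])
    also have "\<dots> \<le> nO (q' n) * ((hw / pi) * nO (q' n))" by (intro mult_left_mono w(2) L2_norm_nonneg)
    finally show ?thesis by (simp add: power2_eq_square mult_ac)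
  qed
  moreover have "(\<lambda>n. cmod (L2_inner Om (q' n) (q n))) \<longlonglongrightarrow> cmod (L2_inner Om (P1 u) u)"
    by (intro tendsto_norm L2_tendsto_inner q'L qL V_L2[OF u] l)
  moreover have "(\<lambda>n. (hw / pi) * (nO (q' n))\<^sup>2) \<longlonglongrightarrow> (hw / pi) * (nO (P1 u))\<^sup>2"
    by (intro tendsto_mult tendsto_const tendsto_power L2_tendsto_norm q'L V_L2[OF u] l)
  ultimately show ?thesis by (intro LIMSEQ_le) auto
qed

lemma L2_snd_cell: "g \<in> L2 {0<..<pi} \<Longrightarrow> (\<lambda>x. g (snd x)) \<in> L2 Om"
  unfolding Omega_strip by (rule L2_snd) (use hw_pos in auto)

lemma L2_inner_snd_cell:
  "g \<in> L2 {0<..<pi} \<Longrightarrow> h \<in> L2 {0<..<pi} \<Longrightarrow>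
    L2_inner Om (\<lambda>x. g (snd x)) (\<lambda>x. h (snd x)) = of_real (2 * hw) * L2_inner {0<..<pi} g h"
  unfolding Omega_strip using L2_inner_snd[of "-hw" hw "{0<..<pi}" g h] hw_pos by simp

lemma L2_norm_snd_cell:
  "g \<in> L2 {0<..<pi} \<Longrightarrow> nO (\<lambda>x. g (snd x)) = sqrt (2 * hw) * L2_norm {0<..<pi} g"
  unfolding Omega_strip using L2_norm_snd[of "-hw" hw "{0<..<pi}" g] hw_pos by simp

lemma AE_snd_cell:
  "AE t in lebesgue_on {0<..<pi}. Q t \<Longrightarrow> AE x in lebesgue_on Om. Q (snd x)"
  unfolding Omega_strip by (rule AE_snd) (use hw_pos in auto)

text \<open>The orthogonality says that g is the projection of u onto the functions of x_2. A
  projection is at least as close to u as the mean of any approximant, and for the latter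
  Wirtinger's inequality is available.\<close>

lemma V_mean_bound:
  assumes u: "u \<in> V" and g: "g \<in> L2 {0<..<pi}"
    and orth: "\<And>h. h \<in> L2 {0<..<pi} \<Longrightarrow> L2_inner Om (\<lambda>x. u x - g (snd x)) (\<lambda>x. h (snd x)) = 0"
  shows "nO (\<lambda>x. u x - g (snd x)) \<le> (hw / pi) * nO (P1 u)"
proof -
  have "\<exists>q q' :: nat \<Rightarrow> real \<times> real \<Rightarrow> complex. (\<forall>n. continuous_on UNIV (q n)) \<and> (\<forall>n. continuous_on UNIV (q' n)) \<and>
    (\<forall>n s t. ((\<lambda>s. q n (s, t)) has_vector_derivative q' n (s, t)) (at s)) \<and> (\<forall>n t. q n (hw, t) = q n (- hw, t)) \<and>
    (\<lambda>n. nO (\<lambda>x. q n x - u x)) \<longlonglongrightarrow> 0 \<and> (\<lambda>n. nO (\<lambda>x. q' n x - P1 u x)) \<longlonglongrightarrow> 0"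
    by (rule V_periodic_seq[OF u]) blast
  then obtain q q' where "\<forall>n. continuous_on UNIV (q n)" "\<forall>n. continuous_on UNIV (q' n)"
    "\<forall>n s t. ((\<lambda>s. q n (s, t)) has_vector_derivative q' n (s, t)) (at s)" "\<forall>n t. q n (hw, t) = q n (- hw, t)"
    and l: "(\<lambda>n::nat. nO (\<lambda>x. q n x - u x)) \<longlonglongrightarrow> 0" "(\<lambda>n. nO (\<lambda>x. q' n x - P1 u x)) \<longlonglongrightarrow> 0" by blast
  then have q: "\<And>n. continuous_on UNIV (q n)" "\<And>n. continuous_on UNIV (q' n)"
    "\<And>n s t. ((\<lambda>s. q n (s, t)) has_vector_derivative q' n (s, t)) (at s)" "\<And>n t. q n (hw, t) = q n (- hw, t)" by auto
  note qL = cont_L2[OF q(1)] and q'L = cont_L2[OF q(2)] and uL = V_L2(1)[OF u] and gO = L2_snd_cell[OF g]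
  have "nO (\<lambda>x. u x - g (snd x)) \<le> nO (\<lambda>x. q n x - u x) + (hw / pi) * nO (q' n)" for n
  proof -
    let ?m = "\<lambda>t. integral {-hw..hw} (\<lambda>s. q n (s, t)) / of_real (2 * hw)"
    note w = wirtinger_cell[OF q(1)[of n] q(2)[of n] q(3) q(4)]
    have mS: "?m \<in> L2 {0<..<pi}" by (rule continuous_in_L2[OF _ _ w(1)]) auto
    note mL = L2_snd_cell[OF mS]
    have z: "L2_inner Om (\<lambda>x. u x - g (snd x)) (\<lambda>x. g (snd x) - ?m (snd x)) = 0"
      by (rule orth[OF L2_diff[OF g mS]])
    have "(nO (\<lambda>x. u x - ?m (snd x)))\<^sup>2 = (nO (\<lambda>x. (u x - g (snd x)) + 1 * (g (snd x) - ?m (snd x))))\<^sup>2" by simp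
    also have "\<dots> = (nO (\<lambda>x. u x - g (snd x)))\<^sup>2 + (nO (\<lambda>x. g (snd x) - ?m (snd x)))\<^sup>2"
      unfolding L2_norm_comb_sq[OF L2_diff[OF uL gO] L2_diff[OF gO mL]] z by simp
    finally have "(nO (\<lambda>x. u x - g (snd x)))\<^sup>2 \<le> (nO (\<lambda>x. u x - ?m (snd x)))\<^sup>2" by simp
    then have "nO (\<lambda>x. u x - g (snd x)) \<le> nO (\<lambda>x. u x - ?m (snd x))"
      by (rule power2_le_imp_le) (rule L2_norm_nonneg)
    also have "\<dots> = nO (\<lambda>x. (q n x - ?m (snd x)) - (q n x - u x))" by simp
    also have "\<dots> \<le> nO (\<lambda>x. q n x - ?m (snd x)) + nO (\<lambda>x. q n x - u x)"
      by (rule L2_norm_diff_le[OF L2_diff[OF qL mL] L2_diff[OF qL uL]])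
    finally show ?thesis using w(2) by linarith
  qed
  moreover have "(\<lambda>n. nO (\<lambda>x. q n x - u x) + (hw / pi) * nO (q' n)) \<longlonglongrightarrow> 0 + (hw / pi) * nO (P1 u)"
    by (intro tendsto_add tendsto_mult tendsto_const L2_tendsto_norm q'L V_L2[OF u] l)
  ultimately have "nO (\<lambda>x. u x - g (snd x)) \<le> 0 + (hw / pi) * nO (P1 u)"
    by (intro LIMSEQ_le_const) auto
  then show ?thesis by simp
qed

end

section \<open>The shifted form and its resolvent\<close>

locale fibre = periodic_cell +
  fixes \<tau> \<kappa> :: real
  assumes kappa: "0 < \<kappa>" "\<bar>\<tau>\<bar> < 1 - \<kappa>"
begin

text \<open>This is \<open>h_form\<close> with \<tau>^2/\<epsilon>^2 times the inner product
  removed: the terms of order zero cancel, and only the cross terms still contain \<tau>.\<close>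

definition B where
  "B u v = L2_inner Om (P1 u) (P1 v) + L2_inner Om (P2 u) (P2 v)
     - of_real (\<tau> / \<epsilon>) * \<i> * (L2_inner Om (P1 u) v - L2_inner Om u (P1 v))"

lemma h_form_eq:
  assumes u: "u \<in> V" and v: "v \<in> V"
  shows "h_form \<epsilon> \<tau> u v = B u v + of_real (\<tau>\<^sup>2 / \<epsilon>\<^sup>2) * L2_inner Om u v"
proof -
  define t where "t = complex_of_real (\<tau> / \<epsilon>)"
  have ct: "cnj t = t" by (simp add: t_def)
  note L = V_L2[OF u] V_L2[OF v]
  note S = L2_scale[of "P1 u" Om \<i>, OF L(2)] L2_scale[of u Om t, OF L(1)] L2_scale[of "P1 v" Om \<i>, OF L(5)] L2_scale[of v Om t, OF L(4)]
  have "h_form \<epsilon> \<tau> u v = L2_inner Om (\<lambda>x. \<i> * P1 u x - t * u x) (\<lambda>x. \<i> * P1 v x - t * v x) + L2_inner Om (P2 u) (P2 v)"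
    by (simp add: h_form_def t_def Let_def)
  also have "L2_inner Om (\<lambda>x. \<i> * P1 u x - t * u x) (\<lambda>x. \<i> * P1 v x - t * v x)
      = (\<i> * (cnj \<i> * L2_inner Om (P1 u) (P1 v)) - \<i> * (t * L2_inner Om (P1 u) v))
        - (t * (cnj \<i> * L2_inner Om u (P1 v)) - t * (t * L2_inner Om u v))"
    unfolding L2_inner_diff_left[OF S(1,2) L2_diff[OF S(3,4)]]
    unfolding L2_inner_diff_right[OF S(3,4) S(1)] L2_inner_diff_right[OF S(3,4) S(2)]
    unfolding L2_inner_scale_left L2_inner_scale_right ct by simp
  also have "of_real (\<tau>\<^sup>2 / \<epsilon>\<^sup>2) = t * t" by (simp add: t_def power2_eq_square)
  then have "(\<i> * (cnj \<i> * L2_inner Om (P1 u) (P1 v)) - \<i> * (t * L2_inner Om (P1 u) v))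
        - (t * (cnj \<i> * L2_inner Om u (P1 v)) - t * (t * L2_inner Om u v)) + L2_inner Om (P2 u) (P2 v)
      = B u v + of_real (\<tau>\<^sup>2 / \<epsilon>\<^sup>2) * L2_inner Om u v"
    unfolding B_def t_def[symmetric] by (simp add: algebra_simps)
  finally show ?thesis .
qed

text \<open>On the diagonal the cross terms amount to 2 (\<tau>/\<epsilon>) times the imaginary part
  of (P1 u, u). By the sharp bound with hw/pi = \<epsilon>/2 this is at most |\<tau>| times the
  squared norm of \<open>P1 u\<close>, and |\<tau>| < 1 - \<kappa> leaves the share
  \<kappa>.\<close>

lemma B_self_bounds:
  assumes u: "u \<in> V"
  shows "\<kappa> * (nO (P1 u))\<^sup>2 + (nO (P2 u))\<^sup>2 \<le> Re (B u u)" "Re (B u u) \<le> 2 * (nO (P1 u))\<^sup>2 + (nO (P2 u))\<^sup>2"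
proof -
  note L = V_L2[OF u]
  define z where "z = L2_inner Om (P1 u) u"
  have "L2_inner Om u (P1 u) = cnj z" unfolding z_def by (rule L2ip.ip_sym[OF L(2,1)])
  then have e: "Re (B u u) = (nO (P1 u))\<^sup>2 + (nO (P2 u))\<^sup>2 + 2 * (\<tau> / \<epsilon>) * Im z"
    by (simp add: B_def L2_inner_self z_def[symmetric] complex_diff_cnj)
  have y: "\<bar>2 * (\<tau> / \<epsilon>) * Im z\<bar> \<le> \<bar>\<tau>\<bar> * (nO (P1 u))\<^sup>2"
  proof -
    have "\<bar>Im z\<bar> \<le> (hw / pi) * (nO (P1 u))\<^sup>2"
      using V_derivative_inner_bound[OF u] abs_Im_le_cmod[of z] unfolding z_def by linarith
    then have "2 * (\<bar>\<tau>\<bar> / \<epsilon>) * \<bar>Im z\<bar> \<le> 2 * (\<bar>\<tau>\<bar> / \<epsilon>) * ((hw / pi) * (nO (P1 u))\<^sup>2)"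
      using eps by (intro mult_left_mono) auto
    also have "\<dots> = \<bar>\<tau>\<bar> * (nO (P1 u))\<^sup>2" using eps by (simp add: hw_def)
    finally show ?thesis using eps by (simp add: abs_mult)
  qed
  have le: "\<bar>\<tau>\<bar> * (nO (P1 u))\<^sup>2 \<le> (1 - \<kappa>) * (nO (P1 u))\<^sup>2" "\<bar>\<tau>\<bar> * (nO (P1 u))\<^sup>2 \<le> 1 * (nO (P1 u))\<^sup>2"
    using kappa by (intro mult_right_mono; simp)+
  have "\<kappa> * N + P \<le> R \<and> R \<le> 2 * N + P" if "R = N + P + Y" "\<bar>Y\<bar> \<le> M" "M \<le> (1 - \<kappa>) * N" "M \<le> 1 * N" for N P R Y M :: real
    using that by (auto simp: left_diff_distrib abs_le_iff)
  from this[OF e y le]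
  show "\<kappa> * (nO (P1 u))\<^sup>2 + (nO (P2 u))\<^sup>2 \<le> Re (B u u)" "Re (B u u) \<le> 2 * (nO (P1 u))\<^sup>2 + (nO (P2 u))\<^sup>2"
    by auto
qed

sublocale form: semi_ip V B
proof
  show "V \<noteq> {}" using zero_V by blast
  fix u v w c assume u: "u \<in> V" and v: "v \<in> V"
  show "(\<lambda>x. u x + c * v x) \<in> V" by (rule V_comb[OF u v])
  show "0 \<le> Re (B u u)"
    using B_self_bounds(1)[OF u] kappa(1) by (smt (verit) mult_nonneg_nonneg zero_le_power2)
  show "B v u = cnj (B u v)"
    unfolding B_def
    using L2ip.ip_sym[OF V_L2(2)[OF u] V_L2(2)[OF v]] L2ip.ip_sym[OF V_L2(3)[OF u] V_L2(3)[OF v]]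
      L2ip.ip_sym[OF V_L2(2)[OF u] V_L2(1)[OF v]] L2ip.ip_sym[OF V_L2(1)[OF u] V_L2(2)[OF v]]
    by (simp add: algebra_simps)
  assume w: "w \<in> V"
  have m: "(\<lambda>x. u x + c * v x) \<in> V" by (rule V_comb[OF u v])
  have p1: "L2_inner Om (P1 (\<lambda>x. u x + c * v x)) h = L2_inner Om (P1 u) h + c * L2_inner Om (P1 v) h" if h: "h \<in> L2 Om" for h
  proof -
    have "L2_inner Om (P1 (\<lambda>x. u x + c * v x)) h = L2_inner Om (\<lambda>x. P1 u x + c * P1 v x) h"
      by (rule L2_inner_cong_AE[OF V_L2(2)[OF m] L2_comb[OF V_L2(2)[OF u] V_L2(2)[OF v]] P_comb(1)[OF V_W12[OF u] V_W12[OF v]] h h]) simp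
    then show ?thesis using L2ip.ip_comb[OF V_L2(2)[OF u] V_L2(2)[OF v] h] by simp
  qed
  have p2: "L2_inner Om (P2 (\<lambda>x. u x + c * v x)) h = L2_inner Om (P2 u) h + c * L2_inner Om (P2 v) h" if h: "h \<in> L2 Om" for h
  proof -
    have "L2_inner Om (P2 (\<lambda>x. u x + c * v x)) h = L2_inner Om (\<lambda>x. P2 u x + c * P2 v x) h"
      by (rule L2_inner_cong_AE[OF V_L2(3)[OF m] L2_comb[OF V_L2(3)[OF u] V_L2(3)[OF v]] P_comb(2)[OF V_W12[OF u] V_W12[OF v]] h h]) simp
    then show ?thesis using L2ip.ip_comb[OF V_L2(3)[OF u] V_L2(3)[OF v] h] by simp
  qed
  show "B (\<lambda>x. u x + c * v x) w = B u w + c * B v w"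
    unfolding B_def p1[OF V_L2(2)[OF w]] p1[OF V_L2(1)[OF w]] p2[OF V_L2(3)[OF w]]
      L2ip.ip_comb[OF V_L2(1)[OF u] V_L2(1)[OF v] V_L2(2)[OF w]]
    by (simp add: algebra_simps)
qed

lemma form_controls:
  assumes u: "u \<in> V"
  shows "nO (P2 u) \<le> form.nrm u" "sqrt \<kappa> * nO (P1 u) \<le> form.nrm u" "nO u \<le> 6 * form.nrm u"
proof -
  have n: "0 \<le> form.nrm u" by (rule form.nrm_nonneg[OF u])
  have b: "\<kappa> * (nO (P1 u))\<^sup>2 + (nO (P2 u))\<^sup>2 \<le> (form.nrm u)\<^sup>2"
    using B_self_bounds(1)[OF u] form.nrm_sq[OF u] by simp
  have k: "0 \<le> \<kappa> * (nO (P1 u))\<^sup>2" using kappa by simp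
  show 2: "nO (P2 u) \<le> form.nrm u"
    by (rule power2_le_imp_le[OF _ n]) (use b k in linarith)
  show "sqrt \<kappa> * nO (P1 u) \<le> form.nrm u"
  proof (rule power2_le_imp_le[OF _ n])
    have "(sqrt \<kappa> * nO (P1 u))\<^sup>2 = \<kappa> * (nO (P1 u))\<^sup>2" using kappa by (simp add: power_mult_distrib)
    then show "(sqrt \<kappa> * nO (P1 u))\<^sup>2 \<le> (form.nrm u)\<^sup>2" using b zero_le_power2[of "nO (P2 u)"] by linarith
  qed
  show "nO u \<le> 6 * form.nrm u" using V_friedrichs[OF u] 2 by linarith
qed

text \<open>The form norm controls the L2 norms of u and of both derivatives, and in turn is
  controlled by the gradient. Completeness is thereby reduced to that of L2 together with
  \<open>V_closed\<close>.\<close>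

lemma form_complete:
  assumes X: "\<And>n::nat. X n \<in> V"
    and cau: "\<And>e. e > 0 \<Longrightarrow> \<exists>N. \<forall>m\<ge>N. \<forall>n\<ge>N. form.nrm (\<lambda>x. X m x - X n x) < e"
  shows "\<exists>u\<in>V. (\<lambda>n. form.nrm (\<lambda>x. X n x - u x)) \<longlonglongrightarrow> 0"
proof -
  have XV: "(\<lambda>x. X m x - X n x) \<in> V" for m n by (rule form.diff[OF X X])
  have C: "\<exists>N. \<forall>m\<ge>N. \<forall>n\<ge>N. G m n < e"
    if "e > 0" "C > 0" and G: "\<And>m n. C * G m n \<le> form.nrm (\<lambda>x. X m x - X n x)" for e C :: real and G
  proof -
    have "C * e > 0" using that by simp
    then obtain N where N: "\<forall>m\<ge>N. \<forall>n\<ge>N. form.nrm (\<lambda>x. X m x - X n x) < C * e" using cau by blast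
    have "G m n < e" if "m \<ge> N" "n \<ge> N" for m n
    proof -
      have "C * G m n < C * e" using N that G[of m n] by (meson le_less_trans)
      then show ?thesis using \<open>C > 0\<close> by simp
    qed
    then show ?thesis by blast
  qed
  have "\<exists>u\<in>L2 Om. (\<lambda>n. nO (\<lambda>x. X n x - u x)) \<longlonglongrightarrow> 0"
  proof (rule L2_complete[OF Omega_lm V_L2(1)[OF X]], rule C[where C="1/6"])
    show "1 / 6 * nO (\<lambda>x. X m x - X n x) \<le> form.nrm (\<lambda>x. X m x - X n x)" for m n
      using form_controls(3)[OF XV, of m n] by simp
  qed auto
  moreover have "\<exists>u\<in>L2 Om. (\<lambda>n. nO (\<lambda>x. P1 (X n) x - u x)) \<longlonglongrightarrow> 0"
    by (rule L2_complete[OF Omega_lm V_L2(2)[OF X]], rule C[where C="sqrt \<kappa>"])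
       (use form_controls(2)[OF XV] kappa wderiv_diff_norm(1)[OF V_W12[OF X] V_W12[OF X]] in \<open>auto\<close>)
  moreover have "\<exists>u\<in>L2 Om. (\<lambda>n. nO (\<lambda>x. P2 (X n) x - u x)) \<longlonglongrightarrow> 0"
    by (rule L2_complete[OF Omega_lm V_L2(3)[OF X]], rule C[where C=1])
       (use form_controls(1)[OF XV] wderiv_diff_norm(2)[OF V_W12[OF X] V_W12[OF X]] in \<open>auto\<close>)
  ultimately obtain u w1 w2 where L: "u \<in> L2 Om" "w1 \<in> L2 Om" "w2 \<in> L2 Om"
    and l: "(\<lambda>n. nO (\<lambda>x. X n x - u x)) \<longlonglongrightarrow> 0" "(\<lambda>n. nO (\<lambda>x. P1 (X n) x - w1 x)) \<longlonglongrightarrow> 0"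
      "(\<lambda>n. nO (\<lambda>x. P2 (X n) x - w2 x)) \<longlonglongrightarrow> 0" by auto
  note cl = V_closed[OF X L l]
  have d1: "nO (P1 (\<lambda>x. X n x - u x)) = nO (\<lambda>x. P1 (X n) x - w1 x)" for n
    unfolding wderiv_diff_norm(1)[OF V_W12[OF X] V_W12[OF cl(1)]]
    by (rule L2_norm_cong_AE[OF L2_diff[OF V_L2(2)[OF X] V_L2(2)[OF cl(1)]] L2_diff[OF V_L2(2)[OF X] L(2)]])
       (use cl(2) in \<open>eventually_elim, simp\<close>)
  have d2: "nO (P2 (\<lambda>x. X n x - u x)) = nO (\<lambda>x. P2 (X n) x - w2 x)" for n
    unfolding wderiv_diff_norm(2)[OF V_W12[OF X] V_W12[OF cl(1)]]
    by (rule L2_norm_cong_AE[OF L2_diff[OF V_L2(3)[OF X] V_L2(3)[OF cl(1)]] L2_diff[OF V_L2(3)[OF X] L(3)]])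
       (use cl(3) in \<open>eventually_elim, simp\<close>)
  have DV: "(\<lambda>x. X n x - u x) \<in> V" for n by (rule form.diff[OF X cl(1)])
  have "(\<lambda>n. (form.nrm (\<lambda>x. X n x - u x))\<^sup>2) \<longlonglongrightarrow> 0"
  proof (rule tendsto_0_le)
    show "(form.nrm (\<lambda>x. X n x - u x))\<^sup>2 \<le> 2 * (nO (\<lambda>x. P1 (X n) x - w1 x))\<^sup>2 + (nO (\<lambda>x. P2 (X n) x - w2 x))\<^sup>2" for n
      using B_self_bounds(2)[OF DV] unfolding form.nrm_sq[OF DV] d1 d2 .
    have "(\<lambda>n. 2 * (nO (\<lambda>x. P1 (X n) x - w1 x))\<^sup>2 + (nO (\<lambda>x. P2 (X n) x - w2 x))\<^sup>2) \<longlonglongrightarrow> 2 * 0\<^sup>2 + 0\<^sup>2"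
      by (intro tendsto_intros l)
    then show "(\<lambda>n. 2 * (nO (\<lambda>x. P1 (X n) x - w1 x))\<^sup>2 + (nO (\<lambda>x. P2 (X n) x - w2 x))\<^sup>2) \<longlonglongrightarrow> 0" by simp
  qed simp
  then have "(\<lambda>n. sqrt ((form.nrm (\<lambda>x. X n x - u x))\<^sup>2)) \<longlonglongrightarrow> sqrt 0" by (rule tendsto_real_sqrt)
  then have "(\<lambda>n. form.nrm (\<lambda>x. X n x - u x)) \<longlonglongrightarrow> 0" using form.nrm_nonneg[OF DV] by simp
  then show ?thesis using cl(1) by blast
qed

abbreviation "resolvent \<equiv> (op_shift (H_op \<epsilon> \<eta> \<tau>) (of_real (\<tau>\<^sup>2 / \<epsilon>\<^sup>2)))\<inverse>"

text \<open>The shift of the operator is absorbed into the form, so membership in the graph of the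
  inverse becomes the weak equation for \<open>B\<close>.\<close>

lemma resolvent_iff:
  "(f, u) \<in> resolvent \<longleftrightarrow> f \<in> L2 Om \<and> u \<in> V \<and> (\<forall>v\<in>V. B u v = L2_inner Om f v)"
proof -
  let ?z = "complex_of_real (\<tau>\<^sup>2 / \<epsilon>\<^sup>2)"
  have "(f, u) \<in> resolvent \<longleftrightarrow> (\<exists>g. f = (\<lambda>x. g x - ?z * u x) \<and> u \<in> V \<and> g \<in> L2 Om \<and> (\<forall>v\<in>V. h_form \<epsilon> \<tau> u v = L2_inner Om g v))"
    by (auto simp: op_shift_def H_op_def form_operator_def)
  also have "\<dots> \<longleftrightarrow> f \<in> L2 Om \<and> u \<in> V \<and> (\<forall>v\<in>V. B u v = L2_inner Om f v)"
  proof
    assume "\<exists>g. f = (\<lambda>x. g x - ?z * u x) \<and> u \<in> V \<and> g \<in> L2 Om \<and> (\<forall>v\<in>V. h_form \<epsilon> \<tau> u v = L2_inner Om g v)"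
    then obtain g where g: "f = (\<lambda>x. g x - ?z * u x)" "u \<in> V" "g \<in> L2 Om" "\<forall>v\<in>V. h_form \<epsilon> \<tau> u v = L2_inner Om g v" by blast
    note zu = L2_scale[OF V_L2(1)[OF g(2)], of ?z]
    have "B u v = L2_inner Om f v" if v: "v \<in> V" for v
      using g(4) v h_form_eq[OF g(2) v] L2_inner_diff_left[OF g(3) zu V_L2(1)[OF v]]
      unfolding g(1) L2_inner_scale_left by (simp add: algebra_simps)
    then show "f \<in> L2 Om \<and> u \<in> V \<and> (\<forall>v\<in>V. B u v = L2_inner Om f v)"
      using g(2) L2_diff[OF g(3) zu] unfolding g(1) by blast
  next
    assume a: "f \<in> L2 Om \<and> u \<in> V \<and> (\<forall>v\<in>V. B u v = L2_inner Om f v)"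
    then have f: "f \<in> L2 Om" and u: "u \<in> V" by auto
    have "h_form \<epsilon> \<tau> u v = L2_inner Om (\<lambda>x. f x + ?z * u x) v" if v: "v \<in> V" for v
    proof -
      have "h_form \<epsilon> \<tau> u v = B u v + ?z * L2_inner Om u v" by (rule h_form_eq[OF u v])
      also have "B u v = L2_inner Om f v" using a v by blast
      also have "L2_inner Om f v + ?z * L2_inner Om u v = L2_inner Om (\<lambda>x. f x + ?z * u x) v"
        by (rule L2ip.ip_comb[OF f V_L2(1)[OF u] V_L2(1)[OF v], symmetric])
      finally show ?thesis .
    qed
    then show "\<exists>g. f = (\<lambda>x. g x - ?z * u x) \<and> u \<in> V \<and> g \<in> L2 Om \<and> (\<forall>v\<in>V. h_form \<epsilon> \<tau> u v = L2_inner Om g v)"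
      using u L2_comb[OF f V_L2(1)[OF u], of ?z] by (intro exI[of _ "\<lambda>x. f x + ?z * u x"]) auto
  qed
  finally show ?thesis .
qed

text \<open>Energy estimate: testing with u and applying \<open>form_controls\<close> gives
  \<open>form.nrm u \<le> 6 * nO f\<close>. Only the bound on the x_1-derivative has to pay the
  factor \<kappa>^{-1/2}.\<close>

lemma resolvent_bounds:
  assumes "(f, u) \<in> resolvent"
  shows "nO (P2 u) \<le> 6 * nO f" "sqrt \<kappa> * nO (P1 u) \<le> 6 * nO f" "nO u \<le> 36 * nO f"
proof -
  have f: "f \<in> L2 Om" and u: "u \<in> V" and e: "B u u = L2_inner Om f u" using assms unfolding resolvent_iff by blast+
  have "(form.nrm u)\<^sup>2 = Re (L2_inner Om f u)" using form.nrm_sq[OF u] e by simp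
  also have "\<dots> \<le> nO f * nO u" using L2_CS[OF f V_L2(1)[OF u]] complex_Re_le_cmod order_trans by blast
  also have "\<dots> \<le> nO f * (6 * form.nrm u)" by (intro mult_left_mono form_controls(3)[OF u] L2_norm_nonneg)
  finally have le: "form.nrm u * form.nrm u \<le> (6 * nO f) * form.nrm u" by (simp add: power2_eq_square mult_ac)
  have n: "form.nrm u \<le> 6 * nO f"
  proof (cases "form.nrm u = 0")
    case True then show ?thesis by (simp add: L2_norm_nonneg)
  next
    case False
    then have "form.nrm u > 0" using form.nrm_nonneg[OF u] by simp
    then show ?thesis using le by simp
  qed
  show "nO (P2 u) \<le> 6 * nO f" "sqrt \<kappa> * nO (P1 u) \<le> 6 * nO f" "nO u \<le> 36 * nO f"
    using form_controls[OF u] n by linarith+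
qed

lemma resolvent_bounded: "L2_bounded_operator Om resolvent"
proof (rule L2_bounded_operatorI[where C=36])
  show "f \<in> L2 Om \<and> u \<in> L2 Om" if "(f, u) \<in> resolvent" for f u
    using that V_L2(1) unfolding resolvent_iff by blast
  show "nO u \<le> 36 * nO f" if "(f, u) \<in> resolvent" for f u by (rule resolvent_bounds(3)[OF that])
  show "(\<lambda>x. f x + c * g x, \<lambda>x. u x + c * v x) \<in> resolvent" if fu: "(f, u) \<in> resolvent" and gv: "(g, v) \<in> resolvent" for f g u v c
  proof -
    have L: "f \<in> L2 Om" "g \<in> L2 Om" "u \<in> V" "v \<in> V" using fu gv unfolding resolvent_iff by blast+
    have "B (\<lambda>x. u x + c * v x) w = L2_inner Om (\<lambda>x. f x + c * g x) w" if w: "w \<in> V" for w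
      using fu gv w unfolding resolvent_iff form.ip_comb[OF L(3,4) w] L2ip.ip_comb[OF L(1,2) V_L2(1)[OF w]] by simp
    then show ?thesis unfolding resolvent_iff using V_comb[OF L(3,4)] L2_comb[OF L(1,2)] by blast
  qed
  show "\<exists>u. (f, u) \<in> resolvent" if f: "f \<in> L2 Om" for f
  proof -
    \<comment> \<open>\<open>riesz\<close> puts the solution into the second argument; the symmetry
      of \<open>B\<close> and of the inner product turns the equation round.\<close>
    have "\<exists>u\<in>V. \<forall>v\<in>V. B v u = L2_inner Om v f"
    proof (rule form.riesz[OF form_complete])
      show "L2_inner Om (\<lambda>x. u x + c * v x) f = L2_inner Om u f + c * L2_inner Om v f" if "u \<in> V" "v \<in> V" for u v c
        by (rule L2ip.ip_comb[OF V_L2(1)[OF that(1)] V_L2(1)[OF that(2)] f])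
      show "cmod (L2_inner Om v f) \<le> (6 * nO f) * form.nrm v" if "v \<in> V" for v
      proof -
        have "cmod (L2_inner Om v f) \<le> nO v * nO f" by (rule L2_CS[OF V_L2(1)[OF that] f])
        also have "\<dots> \<le> (6 * form.nrm v) * nO f" by (intro mult_right_mono form_controls(3)[OF that] L2_norm_nonneg)
        finally show ?thesis by (simp add: mult_ac)
      qed
    qed
    then obtain u where u: "u \<in> V" "\<And>v. v \<in> V \<Longrightarrow> B v u = L2_inner Om v f" by auto
    have "B u v = L2_inner Om f v" if v: "v \<in> V" for v
      using u(2)[OF v] form.ip_sym[OF v u(1)] L2ip.ip_sym[OF V_L2(1)[OF v] f] by simp
    then show ?thesis using u(1) f unfolding resolvent_iff by blast
  qed
qed

end

section \<open>The limiting operator\<close>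

text \<open>Boundary conditions concern continuous representatives, so equality almost everywhere
  has to be carried to the endpoints. A continuous nonnegative function with zero integral vanishes
  everywhere.\<close>

lemma interval_closure_eq:
  fixes f g :: "real \<Rightarrow> complex"
  assumes c: "continuous_on {0..pi} f" "continuous_on {0..pi} g"
    and ae: "AE t in lebesgue_on {0<..<pi}. f t = g t" and t: "t \<in> {0..pi}"
  shows "f t = g t"
proof -
  have fg: "continuous_on {0..pi} (\<lambda>t. f t - g t)" by (intro continuous_intros c)
  have L: "(\<lambda>t. f t - g t) \<in> L2 {0<..<pi}"
    by (rule continuous_in_L2[OF _ _ continuous_on_subset[OF fg closure_minimal]]) auto
  have "L2_norm {0<..<pi} (\<lambda>t. f t - g t) = L2_norm {0<..<pi} (\<lambda>t. 0)"
    by (rule L2_norm_cong_AE[OF L L2_zero]) (use ae in \<open>eventually_elim, simp\<close>)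
  then have "integral {0..pi} (\<lambda>t. (norm (f t - g t))\<^sup>2) = 0"
    using L2_norm_sq_interval[OF fg] by (simp add: L2_norm_zero)
  then have "\<forall>t\<in>{0..pi}. (norm (f t - g t))\<^sup>2 = 0"
    by (subst (asm) integral_eq_0_iff) (auto intro!: continuous_intros c)
  then show ?thesis using t by auto
qed

abbreviation "I\<^sub>\<pi> \<equiv> {0<..<pi}"

lemma I_S: "open I\<^sub>\<pi>" "bounded I\<^sub>\<pi>" by auto

lemma continuous_I_L2: "continuous_on {0..pi} f \<Longrightarrow> f \<in> L2 I\<^sub>\<pi>"
  by (rule continuous_in_L2[OF I_S continuous_on_subset[OF _ closure_minimal]]) auto

lemma norm_primitive_le:
  assumes f: "f \<in> L2 I\<^sub>\<pi>" and t: "t \<in> {0..pi}"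
  shows "norm (integral {0..t} f) \<le> 2 * L2_norm I\<^sub>\<pi> f"
proof -
  let ?T = "{0<..<t}"
  have TI: "?T \<subseteq> I\<^sub>\<pi>" using t by auto
  have T: "open ?T" "bounded ?T" by auto
  have fi: "integrable (lebesgue_on ?T) f"
    by (rule integrable_lebesgue_on_subset[OF L2_integrable[OF I_S f] TI]) auto
  have "integrable (lebesgue_on ?T) (\<lambda>x. (norm (f x))\<^sup>2)"
  proof -
    have "integrable (lebesgue_on ?T) (\<lambda>x. complex_of_real ((norm (f x))\<^sup>2))"
      by (rule integrable_lebesgue_on_subset[OF integrable_of_real[OF L2_D(2)[OF f]] TI]) auto
    then show ?thesis using integrable_Re[of "lebesgue_on ?T" "\<lambda>x. complex_of_real ((norm (f x))\<^sup>2)"] by simp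
  qed
  then have fT: "f \<in> L2 ?T" using borel_measurable_integrable[OF fi] by (simp add: L2_def)
  have oneT: "(\<lambda>_. 1) \<in> L2 ?T" by (rule smooth_in_L2[OF T smooth_const])
  have one: "L2_norm ?T (\<lambda>_. 1) \<le> 2"
  proof -
    have "L2_norm ?T (\<lambda>_. 1) = sqrt t" using t by (simp add: L2_norm_def measure_restrict_space)
    also have "\<dots> \<le> sqrt 4" using t pi_less_4 by (intro real_sqrt_le_mono) auto
    finally show ?thesis by simp
  qed
  have "integral {0..t} f = integral ?T f" using integral_open_interval[of 0 t f] by (simp add: box_real)
  also have "\<dots> = (\<integral>s. f s \<partial>lebesgue_on ?T)" using lebesgue_integral_eq_integral[OF fi] by simp
  also have "\<dots> = L2_inner ?T f (\<lambda>_. 1)" by (simp add: L2_inner_def)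
  finally have "norm (integral {0..t} f) \<le> L2_norm ?T f * L2_norm ?T (\<lambda>_. 1)"
    using L2_CS[OF fT oneT] by simp
  also have "\<dots> \<le> L2_norm I\<^sub>\<pi> f * 2"
    by (intro mult_mono one L2_norm_subset_le[OF f TI] L2_norm_nonneg) auto
  finally show ?thesis by simp
qed

text \<open>The value at 0 of the solution q. By the Robin condition, q'(t) is \<mu> q(0) minus the
  primitive of f at t; integrating over (0, pi) with q(pi) = 0 gives (1 + \<mu> pi) q(0) as the
  integral of that primitive.\<close>

definition Q_at_0 :: "real \<Rightarrow> (real \<Rightarrow> complex) \<Rightarrow> complex" where
  "Q_at_0 \<mu> f = integral {0..pi} (\<lambda>t. integral {0..t} f) / of_real (1 + \<mu> * pi)"

definition Q_deriv :: "real \<Rightarrow> (real \<Rightarrow> complex) \<Rightarrow> real \<Rightarrow> complex" where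
  "Q_deriv \<mu> f t = of_real \<mu> * Q_at_0 \<mu> f - integral {0..t} f"

definition Q_inv :: "real \<Rightarrow> (real \<Rightarrow> complex) \<Rightarrow> real \<Rightarrow> complex" where
  "Q_inv \<mu> f t = Q_at_0 \<mu> f + integral {0..t} (Q_deriv \<mu> f)"

context
  fixes \<mu> :: real
  assumes mu: "\<mu> > 0"
begin

lemma mu_pi: "1 + \<mu> * pi > 0" using mu by (simp add: add_pos_pos)

lemma Q_deriv_continuous: "f \<in> L2 I\<^sub>\<pi> \<Longrightarrow> continuous_on {0..pi} (Q_deriv \<mu> f)"
  unfolding Q_deriv_def by (rule continuous_on_diff[OF continuous_on_const continuous_primitive])

lemma Q_inv_continuous: "f \<in> L2 I\<^sub>\<pi> \<Longrightarrow> continuous_on {0..pi} (Q_inv \<mu> f)"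
  unfolding Q_inv_def
  by (rule continuous_on_add[OF continuous_on_const continuous_primitive[OF continuous_I_L2[OF Q_deriv_continuous]]])

lemma Q_inv_L2: "f \<in> L2 I\<^sub>\<pi> \<Longrightarrow> Q_inv \<mu> f \<in> L2 I\<^sub>\<pi>"
  by (rule continuous_I_L2[OF Q_inv_continuous])

lemma Q_inv_pi:
  assumes f: "f \<in> L2 I\<^sub>\<pi>" shows "Q_inv \<mu> f pi = 0"
proof -
  let ?J = "integral {0..pi} (\<lambda>t. integral {0..t} f)"
  have "integral {0..pi} (Q_deriv \<mu> f) = of_real \<mu> * Q_at_0 \<mu> f * of_real pi - ?J"
    unfolding Q_deriv_def
    by (subst Henstock_Kurzweil_Integration.integral_diff)
       (auto intro!: integrable_continuous_interval continuous_primitive f simp: scaleR_conv_of_real mult_ac)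
  then have "Q_inv \<mu> f pi = Q_at_0 \<mu> f * of_real (1 + \<mu> * pi) - ?J"
    by (simp add: Q_inv_def algebra_simps)
  also have "\<dots> = 0"
  proof -
    have "complex_of_real (1 + \<mu> * pi) \<noteq> 0" using mu_pi unfolding of_real_eq_0_iff by simp
    then show ?thesis unfolding Q_at_0_def by (simp del: of_real_add of_real_mult)
  qed
  finally show ?thesis .
qed

lemma Q_inv_op:
  assumes f: "f \<in> L2 I\<^sub>\<pi>" shows "(Q_inv \<mu> f, f) \<in> Q_op1 \<mu>"
proof -
  let ?u = "Q_inv \<mu> f" and ?d = "Q_deriv \<mu> f"
  have dL: "?d \<in> L2 I\<^sub>\<pi>" by (intro continuous_I_L2 Q_deriv_continuous f)
  have uL: "?u \<in> L2 I\<^sub>\<pi>" by (rule Q_inv_L2[OF f])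
  have cst: "has_weak_deriv I\<^sub>\<pi> 1 (\<lambda>_. c) (\<lambda>_. 0)" for c
    using classical_weak_deriv[OF I_S(1) smooth_const[of c], of 1] by (simp add: frechet_derivative_const)
  have cL: "(\<lambda>_. c) \<in> L2 I\<^sub>\<pi>" for c by (rule smooth_in_L2[OF I_S smooth_const])
  have prim: "(\<lambda>t. integral {0..t} g) \<in> L2 I\<^sub>\<pi>" if "g \<in> L2 I\<^sub>\<pi>" for g
    by (intro continuous_I_L2 continuous_primitive that)
  have d1: "has_weak_deriv I\<^sub>\<pi> 1 ?u ?d"
    using weak_deriv_comb[OF I_S cL prim[OF dL] L2_zero dL cst weak_deriv_primitive[OF pi_gt_zero dL], of "Q_at_0 \<mu> f" 1]
    by (simp add: Q_inv_def[abs_def])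
  have d2: "has_weak_deriv I\<^sub>\<pi> 1 ?d (\<lambda>t. - f t)"
    using weak_deriv_comb[OF I_S cL prim[OF f] L2_zero f cst weak_deriv_primitive[OF pi_gt_zero f], of "of_real \<mu> * Q_at_0 \<mu> f" "-1"]
    by (simp add: Q_deriv_def[abs_def])
  have mfL: "(\<lambda>t. - f t) \<in> L2 I\<^sub>\<pi>" using L2_scale[OF f, of "-1"] by simp
  have uW: "?u \<in> W12 I\<^sub>\<pi>" by (rule W12_I[where w="\<lambda>_. ?d"]) (use uL dL d1 in auto)
  note w1 = wderiv_eq_AE[OF I_S dL d1]
  have d2': "has_weak_deriv I\<^sub>\<pi> 1 (wderiv I\<^sub>\<pi> 1 ?u) (\<lambda>t. - f t)"
    by (rule weak_deriv_cong_AE[OF I_S dL w1(2) mfL mfL d2]) (use w1(1) in \<open>auto elim: eventually_mono\<close>)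
  have wW: "wderiv I\<^sub>\<pi> 1 ?u \<in> W12 I\<^sub>\<pi>" by (rule W12_I[where w="\<lambda>_ t. - f t"]) (use w1(2) mfL d2' in auto)
  have ae2: "AE t in lebesgue_on I\<^sub>\<pi>. f t = - wderiv I\<^sub>\<pi> 1 (wderiv I\<^sub>\<pi> 1 ?u) t"
    using wderiv_eq_AE(1)[OF I_S mfL d2'] by eventually_elim simp
  have "continuous_on {0..pi} ?u \<and> continuous_on {0..pi} ?d \<and> (AE t in lebesgue_on I\<^sub>\<pi>. ?u t = ?u t) \<and>
      (AE t in lebesgue_on I\<^sub>\<pi>. wderiv I\<^sub>\<pi> 1 ?u t = ?d t) \<and> ?u pi = 0 \<and> ?d 0 - of_real \<mu> * ?u 0 = 0"
    using Q_inv_continuous[OF f] Q_deriv_continuous[OF f] w1(1) Q_inv_pi[OF f] by (simp add: Q_deriv_def Q_inv_def)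
  then show ?thesis unfolding Q_op1_def using uW wW f ae2 unfolding W22_def by auto
qed

text \<open>Integrating the weak equation twice leaves two constants. The Robin condition gives c =
  \<mu> b, and the condition at pi then determines b as \<open>Q_at_0 \<mu> f\<close>.\<close>

lemma Q_op1_unique:
  assumes "(u, f) \<in> Q_op1 \<mu>"
  shows "f \<in> L2 I\<^sub>\<pi>" "u \<in> L2 I\<^sub>\<pi>" "AE t in lebesgue_on I\<^sub>\<pi>. u t = Q_inv \<mu> f t"
proof -
  obtain v v' where u: "u \<in> W22 I\<^sub>\<pi>" and f: "f \<in> L2 I\<^sub>\<pi>"
    and ae: "AE t in lebesgue_on I\<^sub>\<pi>. f t = - wderiv I\<^sub>\<pi> 1 (wderiv I\<^sub>\<pi> 1 u) t"
    and v: "continuous_on {0..pi} v" "continuous_on {0..pi} v'" "AE t in lebesgue_on I\<^sub>\<pi>. u t = v t"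
      "AE t in lebesgue_on I\<^sub>\<pi>. wderiv I\<^sub>\<pi> 1 u t = v' t" "v pi = 0" "v' 0 - of_real \<mu> * v 0 = 0"
    using assms unfolding Q_op1_def by blast
  show "f \<in> L2 I\<^sub>\<pi>" by (rule f)
  have uW: "u \<in> W12 I\<^sub>\<pi>" "wderiv I\<^sub>\<pi> 1 u \<in> W12 I\<^sub>\<pi>" using u by (auto simp: W22_def)
  have one: "(1::real) \<in> Basis" by simp
  show uL: "u \<in> L2 I\<^sub>\<pi>" by (rule W12_D(1)[OF uW(1)])
  have dL: "wderiv I\<^sub>\<pi> 1 u \<in> L2 I\<^sub>\<pi>" by (rule W12_D(1)[OF uW(2)])
  have mfL: "(\<lambda>t. - f t) \<in> L2 I\<^sub>\<pi>" using L2_scale[OF f, of "-1"] by simp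
  have "has_weak_deriv I\<^sub>\<pi> 1 (wderiv I\<^sub>\<pi> 1 u) (\<lambda>t. - f t)"
    by (rule weak_deriv_cong_AE[OF I_S dL dL W12_D(2)[OF uW(2) one] mfL W12_D(3)[OF uW(2) one]])
       (use ae in \<open>auto elim: eventually_mono\<close>)
  from weak_deriv_imp_primitive[OF pi_gt_zero dL mfL this] obtain c
    where "AE t in lebesgue_on I\<^sub>\<pi>. wderiv I\<^sub>\<pi> 1 u t = c + integral {0..t} (\<lambda>t. - f t)" by auto
  then have "AE t in lebesgue_on I\<^sub>\<pi>. v' t = c - integral {0..t} f"
    using v(4) by eventually_elim simp
  then have v': "v' t = c - integral {0..t} f" if "t \<in> {0..pi}" for t
    by (rule interval_closure_eq[OF v(2) continuous_on_diff[OF continuous_on_const continuous_primitive[OF f]] _ that])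
  have v'L: "v' \<in> L2 I\<^sub>\<pi>" by (rule continuous_I_L2[OF v(2)])
  have "has_weak_deriv I\<^sub>\<pi> 1 u v'"
    by (rule weak_deriv_cong_AE[OF I_S uL uL dL v'L W12_D(3)[OF uW(1) one]]) (use v(4) in auto)
  from weak_deriv_imp_primitive[OF pi_gt_zero uL v'L this] obtain b
    where "AE t in lebesgue_on I\<^sub>\<pi>. u t = b + integral {0..t} v'" by auto
  then have "AE t in lebesgue_on I\<^sub>\<pi>. v t = b + integral {0..t} v'"
    using v(3) by eventually_elim simp
  then have vt: "v t = b + integral {0..t} v'" if "t \<in> {0..pi}" for t
    by (rule interval_closure_eq[OF v(1) continuous_on_add[OF continuous_on_const continuous_primitive[OF v'L]] _ that])
  have v0: "v 0 = b" using vt[of 0] by simp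
  have cb: "c = of_real \<mu> * b" using v'[of 0] v(6) v0 by simp
  have "integral {0..pi} v' = integral {0..pi} (\<lambda>t. c - integral {0..t} f)"
    by (rule Henstock_Kurzweil_Integration.integral_cong) (use v' in auto)
  also have "\<dots> = c * of_real pi - integral {0..pi} (\<lambda>t. integral {0..t} f)"
    by (subst Henstock_Kurzweil_Integration.integral_diff)
       (auto intro!: integrable_continuous_interval continuous_primitive f simp: scaleR_conv_of_real mult_ac)
  finally have e1: "integral {0..pi} v' = c * of_real pi - integral {0..pi} (\<lambda>t. integral {0..t} f)" .
  have "integral {0..pi} v' = - b" using vt[of pi] v(5) by (simp add: eq_neg_iff_add_eq_0 add.commute)
  with e1 have "c * of_real pi + b = integral {0..pi} (\<lambda>t. integral {0..t} f)"
    by (simp add: algebra_simps)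
  then have "b * of_real (1 + \<mu> * pi) = integral {0..pi} (\<lambda>t. integral {0..t} f)"
    unfolding cb by (simp add: algebra_simps)
  then have b: "b = Q_at_0 \<mu> f" unfolding Q_at_0_def
    using mu_pi by (simp add: nonzero_eq_divide_eq less_imp_neq[symmetric] del: of_real_add of_real_mult)
  have "v t = Q_inv \<mu> f t" if t: "t \<in> {0..pi}" for t
  proof -
    have "integral {0..t} v' = integral {0..t} (Q_deriv \<mu> f)"
      by (rule Henstock_Kurzweil_Integration.integral_cong) (use v' t cb b in \<open>auto simp: Q_deriv_def\<close>)
    then show ?thesis using vt[OF t] b by (simp add: Q_inv_def)
  qed
  then show "AE t in lebesgue_on I\<^sub>\<pi>. u t = Q_inv \<mu> f t"
    using v(3) by (auto simp: AE_restrict_space_iff elim!: eventually_mono)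
qed

text \<open>The bound is uniform in \<mu> because \<mu> pi/(1 + \<mu> pi) is at most 1. In units of
  the norm of f the pointwise bounds are 8 for the value at 0, 4 for the derivative and 8 + 16 = 24
  for the function; the factor 2 dominates the square root of pi.\<close>

lemma Q_inv_bound:
  assumes f: "f \<in> L2 I\<^sub>\<pi>" shows "L2_norm I\<^sub>\<pi> (Q_inv \<mu> f) \<le> 48 * L2_norm I\<^sub>\<pi> f"
proof -
  let ?n = "L2_norm I\<^sub>\<pi> f"
  have n: "0 \<le> ?n" by (rule L2_norm_nonneg)
  have pc: "continuous_on {0..t} (\<lambda>t. integral {0..t} f)" if "t \<le> pi" for t
    by (rule continuous_on_subset[OF continuous_primitive[OF f]]) (use that in auto)
  have "norm (integral {0..pi} (\<lambda>t. integral {0..t} f)) \<le> integral {0..pi} (\<lambda>t. 2 * ?n)"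
    by (rule integral_norm_bound_integral)
       (use norm_primitive_le[OF f] in \<open>auto intro!: integrable_continuous_interval continuous_primitive f\<close>)
  then have J: "norm (integral {0..pi} (\<lambda>t. integral {0..t} f)) \<le> 2 * ?n * pi" by (simp add: mult_ac)
  have q0: "norm (Q_at_0 \<mu> f) = norm (integral {0..pi} (\<lambda>t. integral {0..t} f)) / (1 + \<mu> * pi)"
    unfolding Q_at_0_def norm_divide norm_of_real using mu_pi by simp
  have "norm (Q_at_0 \<mu> f) \<le> norm (integral {0..pi} (\<lambda>t. integral {0..t} f)) / 1"
    unfolding q0 using mu mu_pi by (intro divide_left_mono) auto
  also have "\<dots> \<le> 2 * ?n * pi" using J by simp
  also have "\<dots> \<le> 2 * ?n * 4" using pi_less_4 n by (intro mult_left_mono) auto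
  finally have b0: "norm (Q_at_0 \<mu> f) \<le> 8 * ?n" by simp
  have "\<mu> * norm (Q_at_0 \<mu> f) \<le> 2 * ?n"
  proof -
    have "\<mu> * norm (Q_at_0 \<mu> f) \<le> \<mu> * ((2 * ?n * pi) / (1 + \<mu> * pi))"
      unfolding q0 using mu mu_pi J by (intro mult_left_mono divide_right_mono) auto
    also have "\<dots> = (2 * ?n) * ((\<mu> * pi) / (1 + \<mu> * pi))" by simp
    also have "\<dots> \<le> (2 * ?n) * 1" using mu_pi n by (intro mult_left_mono) (auto simp: divide_le_eq)
    finally show ?thesis by simp
  qed
  then have bd: "norm (Q_deriv \<mu> f t) \<le> 4 * ?n" if "t \<in> {0..pi}" for t
    unfolding Q_deriv_def
    using norm_triangle_ineq4[of "of_real \<mu> * Q_at_0 \<mu> f" "integral {0..t} f"] norm_primitive_le[OF f that] mu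
    by (simp add: norm_mult)
  have "norm (Q_inv \<mu> f t) \<le> 24 * ?n" if t: "t \<in> {0..pi}" for t
  proof -
    have "norm (integral {0..t} (Q_deriv \<mu> f)) \<le> integral {0..t} (\<lambda>_. 4 * ?n)"
      by (rule integral_norm_bound_integral)
         (use bd t in \<open>auto intro!: integrable_continuous_interval continuous_on_subset[OF Q_deriv_continuous[OF f]]\<close>)
    also have "\<dots> = t * (4 * ?n)" using t by simp
    also have "\<dots> \<le> 4 * (4 * ?n)" using t pi_less_4 n by (intro mult_right_mono) auto
    finally show ?thesis unfolding Q_inv_def
      using norm_triangle_ineq[of "Q_at_0 \<mu> f" "integral {0..t} (Q_deriv \<mu> f)"] b0 by simp
  qed
  then have "L2_norm I\<^sub>\<pi> (Q_inv \<mu> f) \<le> (24 * ?n) * sqrt (measure lebesgue I\<^sub>\<pi>)"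
    by (intro bounded_in_L2(2) L2_D(1)[OF Q_inv_L2[OF f]]) (use n in auto)
  also have "sqrt (measure lebesgue I\<^sub>\<pi>) \<le> sqrt 4" using pi_less_4 by (intro real_sqrt_le_mono) simp
  then have "(24 * ?n) * sqrt (measure lebesgue I\<^sub>\<pi>) \<le> (24 * ?n) * 2" using n by (intro mult_left_mono) auto
  finally show ?thesis by simp
qed

lemma primitive_comb:
  assumes "f \<in> L2 I\<^sub>\<pi>" "g \<in> L2 I\<^sub>\<pi>" "t \<in> {0..pi}"
  shows "integral {0..t} (\<lambda>s. f s + c * g s) = integral {0..t} f + c * integral {0..t} g"
proof -
  have i: "h integrable_on {0..t}" if "h \<in> L2 I\<^sub>\<pi>" for h
    by (rule integrable_on_subinterval[OF L2_integrable_on[OF that]]) (use assms(3) in auto)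
  show ?thesis using i[OF assms(1)] i[OF assms(2)]
    by (subst Henstock_Kurzweil_Integration.integral_add) (auto intro: integrable_on_mult_right)
qed

lemma Q_inv_comb:
  assumes f: "f \<in> L2 I\<^sub>\<pi>" and g: "g \<in> L2 I\<^sub>\<pi>" and t: "t \<in> {0..pi}"
  shows "Q_inv \<mu> (\<lambda>s. f s + c * g s) t = Q_inv \<mu> f t + c * Q_inv \<mu> g t"
proof -
  have p: "(\<lambda>t. integral {0..t} h) \<in> L2 I\<^sub>\<pi>" if "h \<in> L2 I\<^sub>\<pi>" for h by (intro continuous_I_L2 continuous_primitive that)
  have "integral {0..pi} (\<lambda>t. integral {0..t} (\<lambda>s. f s + c * g s)) = integral {0..pi} (\<lambda>t. integral {0..t} f + c * integral {0..t} g)"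
    by (rule Henstock_Kurzweil_Integration.integral_cong) (rule primitive_comb[OF f g])
  also have "\<dots> = integral {0..pi} (\<lambda>t. integral {0..t} f) + c * integral {0..pi} (\<lambda>t. integral {0..t} g)"
    by (rule primitive_comb[OF p[OF f] p[OF g]]) simp
  finally have q: "Q_at_0 \<mu> (\<lambda>s. f s + c * g s) = Q_at_0 \<mu> f + c * Q_at_0 \<mu> g"
    by (simp add: Q_at_0_def add_divide_distrib)
  have d: "Q_deriv \<mu> (\<lambda>s. f s + c * g s) r = Q_deriv \<mu> f r + c * Q_deriv \<mu> g r" if "r \<in> {0..pi}" for r
    unfolding Q_deriv_def q primitive_comb[OF f g that] by (simp add: algebra_simps)
  have "integral {0..t} (Q_deriv \<mu> (\<lambda>s. f s + c * g s)) = integral {0..t} (\<lambda>r. Q_deriv \<mu> f r + c * Q_deriv \<mu> g r)"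
    by (rule Henstock_Kurzweil_Integration.integral_cong) (use d t in auto)
  also have "\<dots> = integral {0..t} (Q_deriv \<mu> f) + c * integral {0..t} (Q_deriv \<mu> g)"
    by (rule primitive_comb) (intro continuous_I_L2 Q_deriv_continuous f g t)+
  finally show ?thesis unfolding Q_inv_def q by (simp add: algebra_simps)
qed

end

section \<open>The limiting operator lifted to the cell\<close>

context periodic_cell
begin

abbreviation "Q_zero \<mu> \<equiv> op_sum_zero Om (L_sub \<epsilon>) ((Q_op \<epsilon> \<mu>)\<inverse>)"

text \<open>Here g is the mean of f over x_1. It is described by its pairings with functions of x_2,
  which works for classes of functions without reference to their horizontal slices.\<close>

lemma Q_zero_iff:
  assumes mu: "\<mu> > 0"
  shows "(f, U) \<in> Q_zero \<mu> \<longleftrightarrow> f \<in> L2 Om \<and> U \<in> L2 Om \<and> (\<exists>g\<in>L2 I\<^sub>\<pi>.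
    (AE x in lebesgue_on Om. U x = Q_inv \<mu> g (snd x)) \<and>
    (\<forall>h\<in>L2 I\<^sub>\<pi>. L2_inner Om f (\<lambda>x. h (snd x)) = of_real (2 * hw) * L2_inner I\<^sub>\<pi> g h))"
    (is "?l \<longleftrightarrow> ?r")
proof
  assume ?l
  then obtain f1 f2 where f: "f \<in> L2 Om" and f1: "f1 \<in> L_sub \<epsilon>" and f2: "f2 \<in> L2_orth Om (L_sub \<epsilon>)"
    and ae: "AE x in lebesgue_on Om. f x = f1 x + f2 x" and q: "(U, f1) \<in> Q_op \<epsilon> \<mu>"
    unfolding op_sum_zero_def by blast
  from q obtain u g where U: "U \<in> L2 Om" and f1L: "f1 \<in> L2 Om" and ug: "(u, g) \<in> Q_op1 \<mu>"
    and aeU: "AE x in lebesgue_on Om. U x = u (snd x)" and aef: "AE x in lebesgue_on Om. f1 x = g (snd x)"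
    unfolding Q_op_def by blast
  note un = Q_op1_unique[OF mu ug]
  have f2L: "f2 \<in> L2 Om" and f2o: "\<And>k. k \<in> L_sub \<epsilon> \<Longrightarrow> L2_inner Om f2 k = 0" using f2 by (auto simp: L2_orth_def)
  have "AE x in lebesgue_on Om. U x = Q_inv \<mu> g (snd x)"
    using aeU AE_snd_cell[OF un(3)] by eventually_elim simp
  moreover have "L2_inner Om f (\<lambda>x. h (snd x)) = of_real (2 * hw) * L2_inner I\<^sub>\<pi> g h" if h: "h \<in> L2 I\<^sub>\<pi>" for h
  proof -
    note hO = L2_snd_cell[OF h] and gO = L2_snd_cell[OF un(1)]
    have hs: "(\<lambda>x. h (snd x)) \<in> L_sub \<epsilon>" unfolding L_sub_def using hO h by auto
    have "L2_inner Om f (\<lambda>x. h (snd x)) = L2_inner Om (\<lambda>x. g (snd x) + 1 * f2 x) (\<lambda>x. h (snd x))"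
      by (rule L2_inner_cong_AE[OF f L2_comb[OF gO f2L] _ hO hO]) (use ae aef in \<open>(eventually_elim, simp) | simp\<close>)+
    also have "\<dots> = of_real (2 * hw) * L2_inner I\<^sub>\<pi> g h"
      unfolding L2ip.ip_comb[OF gO f2L hO] f2o[OF hs] L2_inner_snd_cell[OF un(1) h] by simp
    finally show ?thesis .
  qed
  ultimately show ?r using f U un(1) by blast
next
  assume ?r
  then obtain g where f: "f \<in> L2 Om" and U: "U \<in> L2 Om" and g: "g \<in> L2 I\<^sub>\<pi>"
    and ae: "AE x in lebesgue_on Om. U x = Q_inv \<mu> g (snd x)"
    and ip: "\<And>h. h \<in> L2 I\<^sub>\<pi> \<Longrightarrow> L2_inner Om f (\<lambda>x. h (snd x)) = of_real (2 * hw) * L2_inner I\<^sub>\<pi> g h" by blast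
  note gO = L2_snd_cell[OF g]
  have a1: "(\<lambda>x. g (snd x), U) \<in> (Q_op \<epsilon> \<mu>)\<inverse>"
    unfolding Q_op_def using U gO ae Q_inv_op[OF mu g] by auto
  have a2: "(\<lambda>x. g (snd x)) \<in> L_sub \<epsilon>" unfolding L_sub_def using gO g by auto
  have a3: "(\<lambda>x. f x - g (snd x)) \<in> L2_orth Om (L_sub \<epsilon>)"
    unfolding L2_orth_def
  proof (intro CollectI conjI ballI L2_diff f gO)
    fix k assume "k \<in> L_sub \<epsilon>"
    then obtain h where kL: "k \<in> L2 Om" and h: "h \<in> L2 I\<^sub>\<pi>" and k: "AE x in lebesgue_on Om. k x = h (snd x)"
      unfolding L_sub_def by blast
    note hO = L2_snd_cell[OF h] and d = L2_diff[OF f gO]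
    have "L2_inner Om (\<lambda>x. f x - g (snd x)) k = L2_inner Om (\<lambda>x. f x - g (snd x)) (\<lambda>x. h (snd x))"
      by (rule L2_inner_cong_AE[OF d d _ kL hO k]) simp
    also have "\<dots> = 0" unfolding L2_inner_diff_left[OF f gO hO] ip[OF h] L2_inner_snd_cell[OF g h] by simp
    finally show "L2_inner Om (\<lambda>x. f x - g (snd x)) k = 0" .
  qed
  have a4: "AE x in lebesgue_on Om. f x = g (snd x) + (f x - g (snd x))" by simp
  show ?l unfolding op_sum_zero_def mem_Collect_eq prod.case
    by (intro conjI f bexI[OF _ a2] bexI[OF _ a3] a4 a1)
qed

text \<open>The mean over x_1 is obtained by Riesz representation on the interval: pairing f with a
  function of x_2 is a bounded functional of that function.\<close>

lemma mean_exists: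
  assumes f: "f \<in> L2 Om"
  shows "\<exists>g\<in>L2 I\<^sub>\<pi>. \<forall>h\<in>L2 I\<^sub>\<pi>. L2_inner Om f (\<lambda>x. h (snd x)) = of_real (2 * hw) * L2_inner I\<^sub>\<pi> g h"
proof -
  have hw2: "complex_of_real (2 * hw) \<noteq> 0" using hw_pos by simp
  define l where "l h = L2_inner Om (\<lambda>x. h (snd x)) f / of_real (2 * hw)" for h
  have "\<exists>g\<in>L2 I\<^sub>\<pi>. \<forall>h\<in>L2 I\<^sub>\<pi>. L2_inner I\<^sub>\<pi> h g = l h"
  proof (rule L2ip.riesz)
    show "\<exists>u\<in>L2 I\<^sub>\<pi>. (\<lambda>n. semi_ip.nrm (L2_inner I\<^sub>\<pi>) (\<lambda>x. X n x - u x)) \<longlonglongrightarrow> 0"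
      if "\<And>n. X n \<in> L2 I\<^sub>\<pi>" "\<And>e. e > 0 \<Longrightarrow> \<exists>N. \<forall>m\<ge>N. \<forall>n\<ge>N. semi_ip.nrm (L2_inner I\<^sub>\<pi>) (\<lambda>x. X m x - X n x) < e" for X
      unfolding nrm_L2 by (rule L2_complete) (use that in auto)
    show "l (\<lambda>x. u x + c * v x) = l u + c * l v" if "u \<in> L2 I\<^sub>\<pi>" "v \<in> L2 I\<^sub>\<pi>" for u v c
      unfolding l_def L2ip.ip_comb[OF L2_snd_cell[OF that(1)] L2_snd_cell[OF that(2)] f]
      by (simp add: add_divide_distrib)
    show "cmod (l v) \<le> (sqrt (2 * hw) * nO f / (2 * hw)) * semi_ip.nrm (L2_inner I\<^sub>\<pi>) v" if v: "v \<in> L2 I\<^sub>\<pi>" for v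
    proof -
      have "cmod (L2_inner Om (\<lambda>x. v (snd x)) f) \<le> (sqrt (2 * hw) * L2_norm I\<^sub>\<pi> v) * nO f"
        using L2_CS[OF L2_snd_cell[OF v] f] L2_norm_snd_cell[OF v] by simp
      moreover have "cmod (l v) = cmod (L2_inner Om (\<lambda>x. v (snd x)) f) / (2 * hw)"
        unfolding l_def norm_divide norm_of_real using hw_pos by simp
      ultimately have "cmod (l v) \<le> ((sqrt (2 * hw) * L2_norm I\<^sub>\<pi> v) * nO f) / (2 * hw)"
        using hw_pos by (simp add: divide_right_mono)
      then show ?thesis by (simp add: mult_ac)
    qed
  qed
  then obtain g where g: "g \<in> L2 I\<^sub>\<pi>" "\<And>h. h \<in> L2 I\<^sub>\<pi> \<Longrightarrow> L2_inner I\<^sub>\<pi> h g = l h" by blast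
  have "L2_inner Om f (\<lambda>x. h (snd x)) = of_real (2 * hw) * L2_inner I\<^sub>\<pi> g h" if h: "h \<in> L2 I\<^sub>\<pi>" for h
  proof -
    have "L2_inner Om (\<lambda>x. h (snd x)) f = of_real (2 * hw) * L2_inner I\<^sub>\<pi> h g"
      using g(2)[OF h] hw2 unfolding l_def by simp
    then have "cnj (L2_inner Om (\<lambda>x. h (snd x)) f) = of_real (2 * hw) * cnj (L2_inner I\<^sub>\<pi> h g)" by simp
    then show ?thesis unfolding L2ip.ip_sym[OF L2_snd_cell[OF h] f] L2ip.ip_sym[OF h g(1)] .
  qed
  then show ?thesis using g(1) by blast
qed

lemma mean_norm_le:
  assumes f: "f \<in> L2 Om" and g: "g \<in> L2 I\<^sub>\<pi>"
    and ip: "\<And>h. h \<in> L2 I\<^sub>\<pi> \<Longrightarrow> L2_inner Om f (\<lambda>x. h (snd x)) = of_real (2 * hw) * L2_inner I\<^sub>\<pi> g h"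
  shows "nO (\<lambda>x. g (snd x)) \<le> nO f"
proof -
  note gO = L2_snd_cell[OF g]
  have "L2_inner Om f (\<lambda>x. g (snd x)) = L2_inner Om (\<lambda>x. g (snd x)) (\<lambda>x. g (snd x))"
    unfolding ip[OF g] L2_inner_snd_cell[OF g g] ..
  also have "\<dots> = of_real ((nO (\<lambda>x. g (snd x)))\<^sup>2)" by (rule L2_inner_self)
  finally have "L2_inner Om f (\<lambda>x. g (snd x)) = of_real ((nO (\<lambda>x. g (snd x)))\<^sup>2)" .
  moreover have "norm (complex_of_real ((nO (\<lambda>x. g (snd x)))\<^sup>2)) = (nO (\<lambda>x. g (snd x)))\<^sup>2"
    unfolding norm_of_real by simp
  ultimately have "(nO (\<lambda>x. g (snd x)))\<^sup>2 \<le> nO f * nO (\<lambda>x. g (snd x))"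
    using L2_CS[OF f gO] by metis
  then have "nO (\<lambda>x. g (snd x)) * nO (\<lambda>x. g (snd x)) \<le> nO f * nO (\<lambda>x. g (snd x))" by (simp add: power2_eq_square)
  then show ?thesis
    using L2_norm_nonneg[of Om "\<lambda>x. g (snd x)"] L2_norm_nonneg[of Om f]
    by (cases "nO (\<lambda>x. g (snd x)) = 0") auto
qed

lemma Q_zero_bounded:
  assumes mu: "\<mu> > 0" shows "L2_bounded_operator Om (Q_zero \<mu>)"
proof (rule L2_bounded_operatorI[where C=48])
  note iff = Q_zero_iff[OF mu]
  show "f \<in> L2 Om \<and> U \<in> L2 Om" if "(f, U) \<in> Q_zero \<mu>" for f U using that unfolding iff by blast
  show "\<exists>U. (f, U) \<in> Q_zero \<mu>" if f: "f \<in> L2 Om" for f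
  proof -
    obtain g where g: "g \<in> L2 I\<^sub>\<pi>" "\<forall>h\<in>L2 I\<^sub>\<pi>. L2_inner Om f (\<lambda>x. h (snd x)) = of_real (2 * hw) * L2_inner I\<^sub>\<pi> g h"
      using mean_exists[OF f] by blast
    have "(f, \<lambda>x. Q_inv \<mu> g (snd x)) \<in> Q_zero \<mu>"
      unfolding iff using f g L2_snd_cell[OF Q_inv_L2[OF mu g(1)]] by (intro conjI bexI[of _ g]) auto
    then show ?thesis by (rule exI[of _ "\<lambda>x. Q_inv \<mu> g (snd x)"])
  qed
  show "nO U \<le> 48 * nO f" if "(f, U) \<in> Q_zero \<mu>" for f U
  proof -
    from that obtain g where f: "f \<in> L2 Om" and U: "U \<in> L2 Om" and g: "g \<in> L2 I\<^sub>\<pi>"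
      and ae: "AE x in lebesgue_on Om. U x = Q_inv \<mu> g (snd x)"
      and ip: "\<And>h. h \<in> L2 I\<^sub>\<pi> \<Longrightarrow> L2_inner Om f (\<lambda>x. h (snd x)) = of_real (2 * hw) * L2_inner I\<^sub>\<pi> g h"
      unfolding iff by blast
    note qL = Q_inv_L2[OF mu g]
    have "nO U = nO (\<lambda>x. Q_inv \<mu> g (snd x))" by (rule L2_norm_cong_AE[OF U L2_snd_cell[OF qL] ae])
    also have "\<dots> = sqrt (2 * hw) * L2_norm I\<^sub>\<pi> (Q_inv \<mu> g)" by (rule L2_norm_snd_cell[OF qL])
    also have "\<dots> \<le> sqrt (2 * hw) * (48 * L2_norm I\<^sub>\<pi> g)"
      using hw_pos by (intro mult_left_mono Q_inv_bound[OF mu g]) simp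
    also have "\<dots> = 48 * nO (\<lambda>x. g (snd x))" unfolding L2_norm_snd_cell[OF g] by simp
    also have "\<dots> \<le> 48 * nO f" using mean_norm_le[OF f g ip] by simp
    finally show ?thesis .
  qed
  show "(\<lambda>x. f x + c * f' x, \<lambda>x. U x + c * U' x) \<in> Q_zero \<mu>" if a: "(f, U) \<in> Q_zero \<mu>" and b: "(f', U') \<in> Q_zero \<mu>" for f f' U U' c
  proof -
    from a obtain g where f: "f \<in> L2 Om" and U: "U \<in> L2 Om" and g: "g \<in> L2 I\<^sub>\<pi>"
      and ae: "AE x in lebesgue_on Om. U x = Q_inv \<mu> g (snd x)"
      and ip: "\<And>h. h \<in> L2 I\<^sub>\<pi> \<Longrightarrow> L2_inner Om f (\<lambda>x. h (snd x)) = of_real (2 * hw) * L2_inner I\<^sub>\<pi> g h"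
      unfolding iff by blast
    from b obtain g' where f': "f' \<in> L2 Om" and U': "U' \<in> L2 Om" and g': "g' \<in> L2 I\<^sub>\<pi>"
      and ae': "AE x in lebesgue_on Om. U' x = Q_inv \<mu> g' (snd x)"
      and ip': "\<And>h. h \<in> L2 I\<^sub>\<pi> \<Longrightarrow> L2_inner Om f' (\<lambda>x. h (snd x)) = of_real (2 * hw) * L2_inner I\<^sub>\<pi> g' h"
      unfolding iff by blast
    have gg: "(\<lambda>t. g t + c * g' t) \<in> L2 I\<^sub>\<pi>" by (rule L2_comb[OF g g'])
    have "AE x in lebesgue_on Om. x \<in> Om" using Omega_sets by (simp add: AE_restrict_space_iff)
    then have A: "AE x in lebesgue_on Om. U x + c * U' x = Q_inv \<mu> (\<lambda>t. g t + c * g' t) (snd x)"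
      using ae ae'
    proof eventually_elim
      case (elim x)
      then have "snd x \<in> {0..pi}" unfolding Omega_strip by auto
      then show ?case using elim Q_inv_comb[OF mu g g'] by simp
    qed
    have "L2_inner Om (\<lambda>x. f x + c * f' x) (\<lambda>x. h (snd x)) = of_real (2 * hw) * L2_inner I\<^sub>\<pi> (\<lambda>t. g t + c * g' t) h"
      if h: "h \<in> L2 I\<^sub>\<pi>" for h
      unfolding L2ip.ip_comb[OF f f' L2_snd_cell[OF h]] L2ip.ip_comb[OF g g' h] ip[OF h] ip'[OF h]
      by (simp add: algebra_simps)
    then show ?thesis unfolding iff using L2_comb[OF f f'] L2_comb[OF U U'] gg A
      by (intro conjI bexI[of _ "\<lambda>t. g t + c * g' t"]) auto
  qed
qed

end

section \<open>The logarithmic corrector\<close>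

text \<open>\<open>Lam (r\<^sup>2)\<close> smooths the positive part of \<open>ln r\<close>.\<close>

definition Lam :: "real \<Rightarrow> real" where
  "Lam s = ln (1 + step s * (s - 1)) / 2"

lemma Lam_arg_ge_1: "1 + step s * (s - 1) \<ge> 1"
  by (cases "s \<le> 1") (auto simp: step_eq_0 step_nonneg)

lemma smooth_Lam: "smooth (\<lambda>s. complex_of_real (Lam s))"
proof -
  have "smooth (\<lambda>s. complex_of_real (1 + step s * (s - 1)))"
    unfolding of_real_add of_real_mult of_real_diff
    by (intro smooth_add smooth_mult smooth_diff smooth_const smooth_step smooth_of_real_id)
  then have "smooth (\<lambda>s. complex_of_real (ln (1 + step s * (s - 1))))"
    by (rule smooth_ln) (use Lam_arg_ge_1 in \<open>auto intro: less_le_trans[of 0 1]\<close>)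
  then have "smooth (\<lambda>s. complex_of_real (ln (1 + step s * (s - 1))) * complex_of_real (1 / 2))"
    by (intro smooth_mult smooth_const)
  moreover have "(\<lambda>s. complex_of_real (ln (1 + step s * (s - 1))) * complex_of_real (1 / 2)) = (\<lambda>s. complex_of_real (Lam s))"
    by (simp add: Lam_def fun_eq_iff)
  ultimately show ?thesis by (simp only:)
qed

lemma Lam_eq_0: "s \<le> 1 \<Longrightarrow> Lam s = 0" by (simp add: Lam_def step_eq_0)
lemma Lam_eq_ln: "s \<ge> 2 \<Longrightarrow> Lam s = ln s / 2" by (simp add: Lam_def step_eq_1)

text \<open>\<open>Lam1\<close> and \<open>Lam2\<close> are the first two derivatives of
  \<open>Lam\<close>. They are taken from the complex Frechet derivative, because that is the form
  in which smoothness of \<open>Lam\<close> is known.\<close>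

definition Lam1 :: "real \<Rightarrow> real" where
  "Lam1 s = Re (frechet_derivative (\<lambda>s. complex_of_real (Lam s)) (at s) 1)"

definition Lam2 :: "real \<Rightarrow> real" where
  "Lam2 s = Re (frechet_derivative (\<lambda>s. frechet_derivative (\<lambda>s. complex_of_real (Lam s)) (at s) 1) (at s) 1)"

lemma DERIV_Lam: "(Lam has_real_derivative Lam1 s) (at s)"
proof -
  have "((\<lambda>s. Re (complex_of_real (Lam s))) has_vector_derivative Lam1 s) (at s)"
    unfolding Lam1_def
    by (rule bounded_linear.has_vector_derivative[OF bounded_linear_Re smooth_vector_derivative[OF smooth_Lam]])
  then show ?thesis by (simp add: has_real_derivative_iff_has_vector_derivative)
qed

lemma DERIV_Lam1: "(Lam1 has_real_derivative Lam2 s) (at s)"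
proof -
  have "((\<lambda>s. Re (frechet_derivative (\<lambda>s. complex_of_real (Lam s)) (at s) 1)) has_vector_derivative Lam2 s) (at s)"
    unfolding Lam2_def
    by (rule bounded_linear.has_vector_derivative[OF bounded_linear_Re smooth_vector_derivative[OF smooth_frechet[OF smooth_Lam]]])
  then show ?thesis by (simp add: has_real_derivative_iff_has_vector_derivative Lam1_def[abs_def])
qed

lemma continuous_Lam: "continuous_on A Lam" and continuous_Lam1: "continuous_on A Lam1"
  using DERIV_isCont[OF DERIV_Lam] DERIV_isCont[OF DERIV_Lam1] by (auto intro: continuous_at_imp_continuous_on)

lemma continuous_Lam2: "continuous_on A Lam2"
  unfolding Lam2_def by (intro continuous_intros smooth_continuous smooth_frechet smooth_Lam)

lemma Lam1_eq_0: "s < 1 \<Longrightarrow> Lam1 s = 0"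
proof -
  assume s: "s < 1"
  have "(Lam has_real_derivative 0) (at s)"
    by (rule has_field_derivative_transform_within_open[of "\<lambda>_. 0" 0 s "{..<1}"]) (use s in \<open>auto simp: Lam_eq_0\<close>)
  then show "Lam1 s = 0" by (rule DERIV_unique[OF DERIV_Lam])
qed

lemma Lam2_eq_0: "s < 1 \<Longrightarrow> Lam2 s = 0"
proof -
  assume s: "s < 1"
  have "(Lam1 has_real_derivative 0) (at s)"
    by (rule has_field_derivative_transform_within_open[of "\<lambda>_. 0" 0 s "{..<1}"]) (use s in \<open>auto simp: Lam1_eq_0\<close>)
  then show "Lam2 s = 0" by (rule DERIV_unique[OF DERIV_Lam1])
qed

lemma Lam1_eq: "s > 2 \<Longrightarrow> Lam1 s = inverse s / 2"
proof -
  assume s: "s > 2"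
  have "((\<lambda>s. ln s / 2) has_real_derivative inverse s / 2) (at s)"
    using DERIV_cdivide[OF DERIV_ln[of s], of 2] s by simp
  then have "(Lam has_real_derivative inverse s / 2) (at s)"
    by (rule has_field_derivative_transform_within_open[of _ _ _ "{2<..}"]) (use s in \<open>auto simp: Lam_eq_ln\<close>)
  then show "Lam1 s = inverse s / 2" by (rule DERIV_unique[OF DERIV_Lam])
qed

lemma Lam2_eq: "s > 2 \<Longrightarrow> Lam2 s = - (inverse s)\<^sup>2 / 2"
proof -
  assume s: "s > 2"
  have "((\<lambda>s. inverse s / 2) has_real_derivative - (inverse s)\<^sup>2 / 2) (at s)"
    using DERIV_cdivide[OF DERIV_inverse[of s UNIV], of 2] s by (simp add: numeral_2_eq_2)
  then have "(Lam1 has_real_derivative - (inverse s)\<^sup>2 / 2) (at s)"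
    by (rule has_field_derivative_transform_within_open[of _ _ _ "{2<..}"]) (use s in \<open>auto simp: Lam1_eq\<close>)
  then show "Lam2 s = - (inverse s)\<^sup>2 / 2" by (rule DERIV_unique[OF DERIV_Lam1])
qed

text \<open>\<open>wl (r\<^sup>2)\<close> is the Laplacian of \<open>Lam (r\<^sup>2)\<close> in the plane.\<close>

definition wl :: "real \<Rightarrow> real" where "wl s = 4 * (Lam1 s + s * Lam2 s)"

lemma wl_eq_0: "s < 1 \<or> s > 2 \<Longrightarrow> wl s = 0"
  by (auto simp: wl_def Lam1_eq_0 Lam2_eq_0 Lam1_eq Lam2_eq power2_eq_square)

lemma continuous_wl: "continuous_on A wl"
  unfolding wl_def by (intro continuous_intros continuous_Lam1 continuous_Lam2)

text \<open>For s > 2 the first quantity equals 1/2 and the second vanishes; on bounded intervals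
  both are continuous. K and M are the only data of the profile \<open>Lam\<close> that enter the
  final constant.\<close>

lemma Lam_bounds:
  obtains K M where "\<And>s. 0 \<le> s \<Longrightarrow> \<bar>s * Lam1 s\<bar> \<le> K" "\<And>s. \<bar>wl s\<bar> \<le> M" "0 \<le> K" "0 \<le> M"
proof -
  have "bounded ((\<lambda>s. s * Lam1 s) ` {0..2})"
    by (rule compact_imp_bounded[OF compact_continuous_image[OF continuous_on_mult[OF continuous_on_id continuous_Lam1] compact_Icc]])
  then obtain K where "\<forall>y \<in> (\<lambda>s. s * Lam1 s) ` {0..2}. norm y \<le> K" unfolding bounded_iff ..
  then have K: "\<And>s. s \<in> {0..2} \<Longrightarrow> norm (s * Lam1 s) \<le> K" by (drule_tac bspec[OF _ imageI])
  have "bounded (wl ` {1..2})" by (rule compact_imp_bounded[OF compact_continuous_image[OF continuous_wl compact_Icc]])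
  then obtain M where "\<forall>y \<in> wl ` {1..2}. norm y \<le> M" unfolding bounded_iff ..
  then have M: "\<And>s. s \<in> {1..2} \<Longrightarrow> norm (wl s) \<le> M" by (drule_tac bspec[OF _ imageI])
  show thesis
  proof (rule that[of "max K 1" "max M 0"])
    fix s :: real assume "0 \<le> s"
    then show "\<bar>s * Lam1 s\<bar> \<le> max K 1"
      using K[of s] by (cases "s \<le> 2") (auto simp: Lam1_eq le_max_iff_disj)
  next
    fix s :: real show "\<bar>wl s\<bar> \<le> max M 0"
      using M[of s] by (cases "s \<in> {1..2}") (auto simp: wl_eq_0 le_max_iff_disj)
  qed auto
qed

section \<open>Radial dilates of the smoothed logarithm and their derivatives\<close>

definition rr :: "real \<Rightarrow> real \<times> real \<Rightarrow> real" where "rr l x = ((fst x)\<^sup>2 + (snd x)\<^sup>2) / l\<^sup>2"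
definition Lr :: "real \<Rightarrow> real \<times> real \<Rightarrow> real" where "Lr l x = Lam (rr l x)"
definition g1 :: "real \<Rightarrow> real \<times> real \<Rightarrow> real" where "g1 l x = Lam1 (rr l x) * (2 * fst x / l\<^sup>2)"
definition g2 :: "real \<Rightarrow> real \<times> real \<Rightarrow> real" where "g2 l x = Lam1 (rr l x) * (2 * snd x / l\<^sup>2)"
definition h11 :: "real \<Rightarrow> real \<times> real \<Rightarrow> real" where
  "h11 l x = Lam2 (rr l x) * (2 * fst x / l\<^sup>2)\<^sup>2 + Lam1 (rr l x) * (2 / l\<^sup>2)"
definition h22 :: "real \<Rightarrow> real \<times> real \<Rightarrow> real" where
  "h22 l x = Lam2 (rr l x) * (2 * snd x / l\<^sup>2)\<^sup>2 + Lam1 (rr l x) * (2 / l\<^sup>2)"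

lemma h_sum: "l \<noteq> 0 \<Longrightarrow> h11 l x + h22 l x = wl (rr l x) / l\<^sup>2"
  unfolding h11_def h22_def wl_def rr_def by (simp add: field_simps power2_eq_square)

lemma DERIV_rr:
  "((\<lambda>s. rr l (s, t)) has_real_derivative 2 * s / l\<^sup>2) (at s)"
  "((\<lambda>t. rr l (s, t)) has_real_derivative 2 * t / l\<^sup>2) (at t)"
  unfolding rr_def divide_inverse by (auto intro!: derivative_eq_intros)

lemma DERIV_Lr:
  "((\<lambda>s. Lr l (s, t)) has_real_derivative g1 l (s, t)) (at s)"
  "((\<lambda>t. Lr l (s, t)) has_real_derivative g2 l (s, t)) (at t)"
  unfolding Lr_def g1_def g2_def
  using DERIV_chain2[OF DERIV_Lam DERIV_rr(1)] DERIV_chain2[OF DERIV_Lam DERIV_rr(2)] by auto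

lemma DERIV_g:
  "((\<lambda>s. g1 l (s, t)) has_real_derivative h11 l (s, t)) (at s)"
  "((\<lambda>t. g2 l (s, t)) has_real_derivative h22 l (s, t)) (at t)"
proof -
  have c: "((\<lambda>s. 2 * s / l\<^sup>2) has_real_derivative 2 / l\<^sup>2) (at s)" for s
    unfolding divide_inverse by (auto intro!: derivative_eq_intros)
  show "((\<lambda>s. g1 l (s, t)) has_real_derivative h11 l (s, t)) (at s)"
    using DERIV_mult[OF DERIV_chain2[OF DERIV_Lam1 DERIV_rr(1)[of l t s]] c[of s]]
    unfolding g1_def h11_def by (simp add: power2_eq_square mult_ac)
  show "((\<lambda>t. g2 l (s, t)) has_real_derivative h22 l (s, t)) (at t)"
    using DERIV_mult[OF DERIV_chain2[OF DERIV_Lam1 DERIV_rr(2)[of l s t]] c[of t]]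
    unfolding g2_def h22_def by (simp add: power2_eq_square mult_ac)
qed

lemma continuous_rr: "continuous_on A (rr l)"
  unfolding rr_def divide_inverse by (intro continuous_intros)

lemma continuous_radial:
  "continuous_on A (Lr l)" "continuous_on A (g1 l)" "continuous_on A (g2 l)"
  "continuous_on A (h11 l)" "continuous_on A (h22 l)" "continuous_on A (\<lambda>x. wl (rr l x) / l\<^sup>2)"
proof -
  have "continuous_on A (\<lambda>x. f (rr l x))" if "continuous_on UNIV f" for f :: "real \<Rightarrow> real"
    by (rule continuous_on_compose2[OF that continuous_rr]) auto
  note c = this[OF continuous_Lam] this[OF continuous_Lam1] this[OF continuous_Lam2] this[OF continuous_wl]
  show "continuous_on A (Lr l)" "continuous_on A (g1 l)" "continuous_on A (g2 l)"
    "continuous_on A (h11 l)" "continuous_on A (h22 l)" "continuous_on A (\<lambda>x. wl (rr l x) / l\<^sup>2)"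
    unfolding Lr_def g1_def g2_def h11_def h22_def divide_inverse by (intro continuous_intros c)+
qed

lemma smooth_Lr: "smooth (\<lambda>x. complex_of_real (Lr l x))"
proof -
  have f: "smooth (\<lambda>x. complex_of_real (fst x))" "smooth (\<lambda>x. complex_of_real (snd x))"
    by (intro smooth_bounded_linear bounded_linear_compose[OF bounded_linear_of_real] bounded_linear_fst bounded_linear_snd)+
  have "smooth (\<lambda>x. (complex_of_real (fst x) * complex_of_real (fst x) + complex_of_real (snd x) * complex_of_real (snd x)) * complex_of_real (inverse (l\<^sup>2)))"
    by (intro smooth_mult smooth_add smooth_const f)
  moreover have "(\<lambda>x. (complex_of_real (fst x) * complex_of_real (fst x) + complex_of_real (snd x) * complex_of_real (snd x)) * complex_of_real (inverse (l\<^sup>2)))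
      = (\<lambda>x. complex_of_real (rr l x))"
    by (simp add: rr_def divide_inverse power2_eq_square fun_eq_iff)
  ultimately have "smooth (\<lambda>x. complex_of_real (rr l x))" by (simp only:)
  then show ?thesis unfolding Lr_def by (rule smooth_compose[OF _ smooth_Lam])
qed

text \<open>Beyond the shell the gradient is that of ln |x| and does not depend on the scale l.
  Consequently the gradients for two scales cancel far from the origin.\<close>

lemma g_far:
  assumes "rr l x > 2" "l \<noteq> 0"
  shows "g1 l x = fst x / ((fst x)\<^sup>2 + (snd x)\<^sup>2)" "g2 l x = snd x / ((fst x)\<^sup>2 + (snd x)\<^sup>2)"
proof -
  define S where "S = (fst x)\<^sup>2 + (snd x)\<^sup>2"
  have S: "S > 0" using assms by (cases "S = 0") (auto simp: rr_def S_def sum_power2_eq_zero_iff intro: order.not_eq_order_implies_strict)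
  have *: "Lam1 (rr l x) * (2 * y / l\<^sup>2) = y / S" for y
  proof -
    have "Lam1 (rr l x) = l\<^sup>2 / S / 2" using Lam1_eq[OF assms(1)] by (simp add: rr_def S_def[symmetric])
    then show ?thesis using S assms(2) by (simp add: field_simps)
  qed
  show "g1 l x = fst x / ((fst x)\<^sup>2 + (snd x)\<^sup>2)" "g2 l x = snd x / ((fst x)\<^sup>2 + (snd x)\<^sup>2)"
    unfolding g1_def g2_def * S_def by simp_all
qed

text \<open>The gradient of a logarithm decays like 1/|x|, and |x_2| |x_i| is at most |x|^2. The
  bound is therefore independent of the scale, which is the source of the uniformity in
  \<eta>.\<close>

lemma g_times_le:
  assumes K: "\<And>s. 0 \<le> s \<Longrightarrow> \<bar>s * Lam1 s\<bar> \<le> K" and l: "l \<noteq> 0"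
  shows "\<bar>snd x * g1 l x\<bar> \<le> 2 * K" "\<bar>snd x * g2 l x\<bar> \<le> 2 * K"
proof -
  have r: "rr l x \<ge> 0" by (simp add: rr_def)
  have k: "rr l x * \<bar>Lam1 (rr l x)\<bar> \<le> K" using K[OF r] r by (simp add: abs_mult)
  have *: "\<bar>snd x * (Lam1 (rr l x) * (2 * y / l\<^sup>2))\<bar> \<le> 2 * K" if "\<bar>snd x * y\<bar> \<le> (fst x)\<^sup>2 + (snd x)\<^sup>2" for y
  proof -
    have "\<bar>snd x * (Lam1 (rr l x) * (2 * y / l\<^sup>2))\<bar> = 2 * \<bar>Lam1 (rr l x)\<bar> * (\<bar>snd x * y\<bar> / l\<^sup>2)"
      by (simp add: abs_mult)
    also have "\<dots> \<le> 2 * \<bar>Lam1 (rr l x)\<bar> * rr l x"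
      unfolding rr_def using that by (intro mult_left_mono divide_right_mono) auto
    finally show ?thesis using k by (simp add: mult_ac)
  qed
  have "\<bar>snd x * fst x\<bar> \<le> (fst x)\<^sup>2 + (snd x)\<^sup>2"
  proof -
    have "2 * (\<bar>snd x\<bar> * \<bar>fst x\<bar>) \<le> \<bar>snd x\<bar>\<^sup>2 + \<bar>fst x\<bar>\<^sup>2" using sum_squares_bound[of "\<bar>snd x\<bar>" "\<bar>fst x\<bar>"] by (simp only: mult.assoc)
    moreover have "0 \<le> \<bar>snd x\<bar> * \<bar>fst x\<bar>" by simp
    ultimately have "\<bar>snd x\<bar> * \<bar>fst x\<bar> \<le> \<bar>snd x\<bar>\<^sup>2 + \<bar>fst x\<bar>\<^sup>2" by linarith
    then show ?thesis by (simp add: abs_mult)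
  qed
  from *[OF this] show "\<bar>snd x * g1 l x\<bar> \<le> 2 * K" by (simp add: g1_def)
  have "\<bar>snd x * snd x\<bar> \<le> (fst x)\<^sup>2 + (snd x)\<^sup>2" by (simp add: power2_eq_square)
  from *[OF this] show "\<bar>snd x * g2 l x\<bar> \<le> 2 * K" by (simp add: g2_def)
qed

lemma integral_arctan:
  assumes "h > (0::real)" "l \<le> u"
  shows "integral {l..u} (\<lambda>t. h / (h\<^sup>2 + t\<^sup>2)) = arctan (u / h) - arctan (l / h)"
proof (rule integral_unique, rule fundamental_theorem_of_calculus[OF assms(2)])
  fix t
  have "((\<lambda>t. arctan (t / h)) has_real_derivative h / (h\<^sup>2 + t\<^sup>2)) (at t)"
  proof -
    have e: "inverse (1 + (t / h)\<^sup>2) * (1 / h) = h / (h\<^sup>2 + t\<^sup>2)"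
    proof -
      have p: "h\<^sup>2 + t\<^sup>2 \<noteq> 0" using assms(1) by (simp add: sum_power2_eq_zero_iff)
      have "1 + (t / h)\<^sup>2 = (h\<^sup>2 + t\<^sup>2) / h\<^sup>2" using assms(1) by (simp add: power_divide add_divide_distrib)
      then show ?thesis using assms(1) p by (simp add: power2_eq_square)
    qed
    have "((\<lambda>t. t / h) has_real_derivative 1 / h) (at t)" by (rule DERIV_cdivide[OF DERIV_ident])
    from DERIV_chain2[OF DERIV_arctan this] show ?thesis unfolding e .
  qed
  then show "((\<lambda>t. arctan (t / h)) has_vector_derivative h / (h\<^sup>2 + t\<^sup>2)) (at t within {l..u})"
    unfolding has_real_derivative_iff_has_vector_derivative by (rule has_vector_derivative_at_within)
qed

text \<open>A Hardy type inequality for functions that may be very large at 0 but grow only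
  logarithmically. Integrating the derivative of t D(t)^2, whose boundary terms vanish, bounds the
  integral N of D^2 by 2k times the integral of |D|, hence by 2k times the square root of b
  N.\<close>

lemma log_growth_L2_bound:
  fixes D D' :: "real \<Rightarrow> real"
  assumes b: "b > 0" and d: "\<And>t. (D has_real_derivative D' t) (at t)" and c: "continuous_on {0..b} D'"
    and z: "D b = 0" and k: "\<And>t. t \<in> {0..b} \<Longrightarrow> \<bar>t * D' t\<bar> \<le> k"
  shows "integral {0..b} (\<lambda>t. (D t)\<^sup>2) \<le> 4 * k\<^sup>2 * b"
proof -
  have Dc: "continuous_on A D" for A
    using DERIV_isCont[OF d] by (auto intro: continuous_at_imp_continuous_on)
  define N where "N = integral {0..b} (\<lambda>t. (D t)\<^sup>2)"
  have N: "0 \<le> N" unfolding N_def by (intro integral_nonneg integrable_continuous_interval continuous_intros Dc) auto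
  have k0: "0 \<le> k" using k[of 0] b by simp
  have "((\<lambda>t. (D t)\<^sup>2 + 2 * D t * (t * D' t)) has_integral (b * (D b)\<^sup>2 - 0 * (D 0)\<^sup>2)) {0..b}"
  proof (rule fundamental_theorem_of_calculus)
    fix t
    have "((\<lambda>t. t * (D t)\<^sup>2) has_real_derivative (D t)\<^sup>2 + 2 * D t * (t * D' t)) (at t)"
      using DERIV_mult[OF DERIV_ident DERIV_power[OF d[of t], of 2]] by (simp add: algebra_simps)
    then show "((\<lambda>t. t * (D t)\<^sup>2) has_vector_derivative (D t)\<^sup>2 + 2 * D t * (t * D' t)) (at t within {0..b})"
      unfolding has_real_derivative_iff_has_vector_derivative by (rule has_vector_derivative_at_within)
  qed (use b in simp)
  then have "integral {0..b} (\<lambda>t. (D t)\<^sup>2 + 2 * D t * (t * D' t)) = 0" using z by (simp add: integral_unique)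
  then have "N = - integral {0..b} (\<lambda>t. 2 * D t * (t * D' t))"
    unfolding N_def by (subst (asm) Henstock_Kurzweil_Integration.integral_add)
      (auto intro!: integrable_continuous_interval continuous_intros Dc c)
  also have "\<dots> = integral {0..b} (\<lambda>t. - (2 * D t * (t * D' t)))" by simp
  also have "\<dots> \<le> integral {0..b} (\<lambda>t. 2 * k * \<bar>D t\<bar>)"
  proof (rule integral_le)
    fix t assume t: "t \<in> {0..b}"
    have "- (2 * D t * (t * D' t)) \<le> \<bar>2 * D t * (t * D' t)\<bar>" by linarith
    also have "\<dots> = 2 * \<bar>D t\<bar> * \<bar>t * D' t\<bar>" by (simp add: abs_mult)
    also have "\<dots> \<le> 2 * \<bar>D t\<bar> * k" by (intro mult_left_mono k t) auto
    finally show "- (2 * D t * (t * D' t)) \<le> 2 * k * \<bar>D t\<bar>" by (simp add: mult_ac)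
  qed (intro integrable_continuous_interval continuous_intros Dc c)+
  finally have "N \<le> 2 * k * integral {0..b} (\<lambda>t. \<bar>D t\<bar>)" by simp
  then have "N\<^sup>2 \<le> (2 * k * integral {0..b} (\<lambda>t. \<bar>D t\<bar>))\<^sup>2" using N by (intro power_mono) auto
  also have "\<dots> = 4 * k\<^sup>2 * (integral {0..b} (\<lambda>t. \<bar>D t\<bar>))\<^sup>2" by (simp add: power_mult_distrib)
  also have "\<dots> \<le> 4 * k\<^sup>2 * (b * N)"
  proof (rule mult_left_mono)
    have "(integral {0..b} (\<lambda>t. \<bar>D t\<bar>))\<^sup>2 \<le> (b - 0) * integral {0..b} (\<lambda>t. (\<bar>D t\<bar>)\<^sup>2)"
      by (rule integral_square_le[OF b]) (intro continuous_intros Dc)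
    then show "(integral {0..b} (\<lambda>t. \<bar>D t\<bar>))\<^sup>2 \<le> b * N" by (simp add: N_def)
  qed simp
  finally have "N * N \<le> (4 * k\<^sup>2 * b) * N" by (simp add: power2_eq_square mult_ac)
  then have "N \<le> 4 * k\<^sup>2 * b" using N b by (cases "N = 0") auto
  then show ?thesis by (simp add: N_def)
qed

section \<open>An L1 Poincare inequality and the mass of the radial densities\<close>

lemma L1_le_L2:
  fixes g :: "'a::euclidean_space \<Rightarrow> complex"
  assumes R: "open R" "bounded R" and g: "g \<in> L2 R"
  shows "(\<integral>x. norm (g x) \<partial>lebesgue_on R) \<le> sqrt (measure lebesgue R) * L2_norm R g"
proof -
  have Rm: "R \<in> lmeasurable" using R by (simp add: lmeasurable_open)
  have ng: "(\<lambda>x. complex_of_real (norm (g x))) \<in> L2 R" using g by (auto simp: L2_def)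
  have one: "(\<lambda>_. 1) \<in> L2 R" by (rule smooth_in_L2[OF R smooth_const])
  have "(\<integral>x. norm (g x) \<partial>lebesgue_on R) = cmod (L2_inner R (\<lambda>x. complex_of_real (norm (g x))) (\<lambda>_. 1))"
    by (simp add: L2_inner_def)
  also have "\<dots> \<le> L2_norm R (\<lambda>x. complex_of_real (norm (g x))) * L2_norm R (\<lambda>_. 1)" by (rule L2_CS[OF ng one])
  also have "L2_norm R (\<lambda>x. complex_of_real (norm (g x))) = L2_norm R g" by (simp add: L2_norm_def)
  also have "L2_norm R g * L2_norm R (\<lambda>_. 1) \<le> L2_norm R g * (1 * sqrt (measure lebesgue R))"
    by (intro mult_left_mono bounded_in_L2(2)[OF Rm] L2_norm_nonneg) auto
  finally show ?thesis by (simp add: mult.commute)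
qed

text \<open>The point \<open>(x, y)\<close> is joined to \<open>(s, 0)\<close> by an L-shaped path.\<close>

lemma segment_mean_pointwise:
  assumes p: "smooth \<phi>" and c: "0 < c" "c \<le> b" and xy: "x \<in> {-b..b}" "y \<in> {0..h}"
  shows "cmod (\<phi> (x, y) - integral {-c..c} (\<lambda>s. \<phi> (s, 0)) / of_real (2 * c))
    \<le> integral {-b..b} (\<lambda>s. integral {0..h} (\<lambda>t. cmod (d2 \<phi> (s, t)))) / (2 * c) + integral {-b..b} (\<lambda>s. cmod (d1 \<phi> (s, y)))"
proof -
  have pc: "continuous_on UNIV \<phi>" "continuous_on UNIV (d1 \<phi>)" "continuous_on UNIV (d2 \<phi>)"
    by (intro smooth_continuous smooth_frechet p)+
  have cs: "continuous_on A (\<lambda>s. f (s, t))" "continuous_on A (\<lambda>t. f (s, t))" if "continuous_on UNIV f"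
    for f :: "real \<times> real \<Rightarrow> complex" and A s t
    by (rule continuous_on_compose2[OF that]; auto intro!: continuous_intros)+
  define A1 where "A1 = integral {-b..b} (\<lambda>s. cmod (d1 \<phi> (s, y)))"
  define k where "k s = integral {0..h} (\<lambda>t. cmod (d2 \<phi> (s, t)))" for s
  have kc: "continuous_on A k" for A
  proof -
    have "continuous_on A (\<lambda>s. integral (cbox 0 h) (\<lambda>t. cmod (d2 \<phi> (s, t))))"
      by (rule integral_continuous_on_param)
        (use pc(3) in \<open>auto intro!: continuous_intros continuous_on_subset[OF pc(3)] simp: case_prod_unfold\<close>)
    then show ?thesis by (simp add: k_def)
  qed
  have step: "norm (q v - q w) \<le> integral {l..r} (\<lambda>x. norm (q' x))"
    if "\<And>x. (q has_vector_derivative q' x) (at x)" "continuous_on UNIV q'" "v \<in> {l..r}" "w \<in> {l..r}" for q q' :: "real \<Rightarrow> complex" and v w l r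
  proof -
    have *: "norm (q v - q w) \<le> integral {l..r} (\<lambda>x. norm (q' x))" if "w \<le> v" "v \<in> {l..r}" "w \<in> {l..r}" for v w
    proof -
      have ci: "continuous_on A q'" for A by (rule continuous_on_subset[OF \<open>continuous_on UNIV q'\<close>]) auto
      have "(q' has_integral (q v - q w)) {w..v}"
        by (rule fundamental_theorem_of_calculus[OF that(1)]) (rule has_vector_derivative_at_within[OF \<open>\<And>x. (q has_vector_derivative q' x) (at x)\<close>])
      then have "norm (q v - q w) = norm (integral {w..v} q')" by (simp add: integral_unique)
      also have "\<dots> \<le> integral {w..v} (\<lambda>x. norm (q' x))"
        by (rule integral_norm_bound_integral) (auto intro!: integrable_continuous_interval continuous_intros ci)
      also have "\<dots> \<le> integral {l..r} (\<lambda>x. norm (q' x))"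
        by (rule integral_subset_le) (use that in \<open>auto intro!: integrable_continuous_interval continuous_intros ci\<close>)
      finally show ?thesis .
    qed
    show ?thesis using *[of w v] *[of v w] that(3,4) by (cases "w \<le> v") (auto simp: norm_minus_commute)
  qed
  have pt: "cmod (\<phi> (x, y) - \<phi> (s, 0)) \<le> A1 + k s" if "s \<in> {-c..c}" for s
  proof -
    have "cmod (\<phi> (x, y) - \<phi> (s, y)) \<le> A1"
      unfolding A1_def by (rule step[of "\<lambda>s. \<phi> (s, y)", OF slice_deriv(1)[OF p] cs(1)[OF pc(2)]]) (use xy that c in auto)
    moreover have "cmod (\<phi> (s, y) - \<phi> (s, 0)) \<le> k s"
      unfolding k_def by (rule step[of "\<lambda>t. \<phi> (s, t)", OF slice_deriv(2)[OF p] cs(2)[OF pc(3)]]) (use xy in auto)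
    ultimately show ?thesis using norm_triangle_ineq[of "\<phi> (x, y) - \<phi> (s, y)" "\<phi> (s, y) - \<phi> (s, 0)"] by simp
  qed
  have "(\<phi> (x, y) - integral {-c..c} (\<lambda>s. \<phi> (s, 0)) / of_real (2 * c)) * of_real (2 * c) = integral {-c..c} (\<lambda>s. \<phi> (x, y) - \<phi> (s, 0))"
  proof -
    have nz: "complex_of_real (2 * c) \<noteq> 0" using c by simp
    have "integral {-c..c} (\<lambda>s. \<phi> (x, y) - \<phi> (s, 0)) = integral {-c..c} (\<lambda>s. \<phi> (x, y)) - integral {-c..c} (\<lambda>s. \<phi> (s, 0))"
      by (intro Henstock_Kurzweil_Integration.integral_diff integrable_continuous_interval cs(1)[OF pc(1)] continuous_intros)
    moreover have "integral {-c..c} (\<lambda>s. \<phi> (x, y)) = \<phi> (x, y) * of_real (2 * c)"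
      using c by (simp add: scaleR_conv_of_real mult_ac)
    ultimately show ?thesis using nz by (simp only: left_diff_distrib nonzero_divide_mult_cancel_right times_divide_eq_left nonzero_eq_divide_eq)
        (simp add: nonzero_mult_div_cancel_right)
  qed
  then have "cmod ((\<phi> (x, y) - integral {-c..c} (\<lambda>s. \<phi> (s, 0)) / of_real (2 * c)) * of_real (2 * c)) \<le> integral {-c..c} (\<lambda>s. A1 + k s)"
    using pt by (simp only:) (intro integral_norm_bound_integral integrable_continuous_interval continuous_intros cs(1)[OF pc(1)] kc)
  also have "\<dots> = 2 * c * A1 + integral {-c..c} k"
    using c by (subst Henstock_Kurzweil_Integration.integral_add) (auto intro!: integrable_continuous_interval kc)
  also have "integral {-c..c} k \<le> integral {-b..b} k"
    by (rule integral_subset_le) (use c in \<open>auto intro!: integrable_continuous_interval kc integral_nonneg continuous_intros cs(2)[OF pc(3)] simp: k_def\<close>)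
  finally have "cmod (\<phi> (x, y) - integral {-c..c} (\<lambda>s. \<phi> (s, 0)) / of_real (2 * c)) * (2 * c) \<le> 2 * c * A1 + integral {-b..b} k"
    using c by (simp add: norm_mult)
  then have "cmod (\<phi> (x, y) - integral {-c..c} (\<lambda>s. \<phi> (s, 0)) / of_real (2 * c)) \<le> (2 * c * A1 + integral {-b..b} k) / (2 * c)"
    using c by (subst pos_le_divide_eq) auto
  also have "\<dots> = integral {-b..b} k / (2 * c) + A1" using c by (simp add: add_divide_distrib)
  finally show ?thesis unfolding A1_def k_def .
qed

text \<open>The Laplacian of \<open>Lr l\<close>: a radial density living on the shell l^2 \<le>
  |x|^2 \<le> 2 l^2.\<close>

definition wt :: "real \<Rightarrow> real \<times> real \<Rightarrow> real" where "wt l x = wl (rr l x) / l\<^sup>2"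

lemma continuous_wt: "continuous_on A (wt l)"
  unfolding wt_def[abs_def] by (rule continuous_radial)

lemma has_integral_DERIV:
  fixes f f' :: "real \<Rightarrow> real"
  assumes "l \<le> u" "\<And>t. (f has_real_derivative f' t) (at t)"
  shows "integral {l..u} f' = f u - f l"
  by (rule integral_unique, rule fundamental_theorem_of_calculus[OF assms(1)])
    (rule has_vector_derivative_at_within, rule assms(2)[unfolded has_real_derivative_iff_has_vector_derivative])

text \<open>The pointwise bound is integrated over the box, and L1 norms of the gradient are turned
  into L2 norms. When b, h and c are all of order l, the right-hand side is of order l^2 times the
  gradient norm, which exactly offsets the size 1/l^2 of the density \<open>wt l\<close>.\<close>

lemma segment_mean_L1:
  assumes p: "smooth \<phi>" and c: "0 < c" "c \<le> b" and h: "0 < h"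
  defines "R \<equiv> box (-b, 0) (b, h)"
  shows "(\<integral>x. cmod (\<phi> x - integral {-c..c} (\<lambda>s. \<phi> (s, 0)) / of_real (2 * c)) \<partial>lebesgue_on R)
    \<le> sqrt (2 * b * h) * ((b * h / c) * L2_norm R (d2 \<phi>) + 2 * b * L2_norm R (d1 \<phi>))"
proof -
  have pc: "continuous_on A \<phi>" "continuous_on A (d1 \<phi>)" "continuous_on A (d2 \<phi>)" for A
    by (intro smooth_continuous smooth_frechet p)+
  have R: "open R" "bounded R" by (auto simp: R_def)
  have b: "0 < b" using c by simp
  have R_in: "x \<in> R \<Longrightarrow> fst x \<in> {-b..b} \<and> snd x \<in> {0..h}" for x
    by (auto simp: R_def box_def Basis_plane inner_prod_def)
  define m where "m = integral {-c..c} (\<lambda>s. \<phi> (s, 0)) / of_real (2 * c)"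
  define A where "A y = integral {-b..b} (\<lambda>s. cmod (d1 \<phi> (s, y)))" for y
  define k where "k = integral {-b..b} (\<lambda>s. integral {0..h} (\<lambda>t. cmod (d2 \<phi> (s, t))))"
  have Ac: "continuous_on S A" for S
  proof -
    have "continuous_on S (\<lambda>t. integral (cbox (-b) b) (\<lambda>s. cmod (d1 \<phi> (s, t))))"
      by (rule integral_continuous_on_param)
        (auto intro!: continuous_on_norm continuous_on_compose2[OF pc(2)[of UNIV]] continuous_intros simp: case_prod_unfold)
    then show ?thesis by (simp add: A_def[abs_def])
  qed
  have k: "k = (\<integral>x. cmod (d2 \<phi> x) \<partial>lebesgue_on R)"
    unfolding k_def R_def by (rule integral_on_rectangle(1)[symmetric]) (intro continuous_intros pc)
  have a: "integral {0..h} A = (\<integral>x. cmod (d1 \<phi> x) \<partial>lebesgue_on R)"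
    unfolding A_def R_def by (rule integral_on_rectangle(2)[symmetric]) (intro continuous_intros pc)
  have mR: "measure lebesgue R = 2 * b * h"
  proof -
    have "measure lebesgue R = (\<integral>x. (1::real) \<partial>lebesgue_on R)" using R by (simp add: measure_restrict_space lmeasurable_open space_restrict_space)
    also have "\<dots> = integral {-b..b} (\<lambda>s. integral {0..h} (\<lambda>t. 1::real))"
      unfolding R_def by (rule integral_on_rectangle(1)) (intro continuous_intros)
    finally show ?thesis using b h by simp
  qed
  have sm: "smooth (d1 \<phi>)" "smooth (d2 \<phi>)" by (rule smooth_frechet[OF p])+
  have "(\<integral>x. cmod (\<phi> x - m) \<partial>lebesgue_on R) \<le> (\<integral>x. k / (2 * c) + A (snd x) \<partial>lebesgue_on R)"
  proof (rule integral_mono)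
    show "integrable (lebesgue_on R) (\<lambda>x. cmod (\<phi> x - m))"
      unfolding R_def by (intro integrable_on_box continuous_intros pc)
    show "integrable (lebesgue_on R) (\<lambda>x. k / (2 * c) + A (snd x))"
      unfolding R_def by (intro integrable_on_box continuous_on_add continuous_on_const continuous_on_compose2[OF Ac continuous_on_snd[OF continuous_on_id] subset_UNIV])
    fix x assume "x \<in> space (lebesgue_on R)"
    then have "x \<in> R" by (simp add: space_restrict_space)
    then have "fst x \<in> {-b..b}" "snd x \<in> {0..h}" using R_in by blast+
    from segment_mean_pointwise[OF p c this] show "cmod (\<phi> x - m) \<le> k / (2 * c) + A (snd x)"
      by (simp add: m_def k_def A_def)
  qed
  also have "\<dots> = integral {-b..b} (\<lambda>s. integral {0..h} (\<lambda>t. k / (2 * c) + A (snd (s, t))))"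
    unfolding R_def by (intro integral_on_rectangle(1) continuous_on_add continuous_on_const continuous_on_compose2[OF Ac continuous_on_snd[OF continuous_on_id] subset_UNIV])
  also have "\<dots> = 2 * b * (h * (k / (2 * c)) + integral {0..h} A)"
  proof -
    have "integral {0..h} (\<lambda>t. k / (2 * c) + A t) = h * (k / (2 * c)) + integral {0..h} A"
      using h by (subst Henstock_Kurzweil_Integration.integral_add) (auto intro!: integrable_continuous_interval Ac)
    then show ?thesis using b by simp
  qed
  also have "\<dots> = (b * h / c) * k + 2 * b * integral {0..h} A"
    using c by (simp add: field_simps)
  also have "\<dots> \<le> (b * h / c) * (sqrt (2 * b * h) * L2_norm R (d2 \<phi>)) + 2 * b * (sqrt (2 * b * h) * L2_norm R (d1 \<phi>))"
    unfolding k a using L1_le_L2[OF R smooth_in_L2[OF R sm(2)]] L1_le_L2[OF R smooth_in_L2[OF R sm(1)]] b c h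
    by (intro add_mono mult_left_mono) (auto simp: mR)
  also have "\<dots> = sqrt (2 * b * h) * ((b * h / c) * L2_norm R (d2 \<phi>) + 2 * b * L2_norm R (d1 \<phi>))"
    by (simp add: distrib_left mult_ac)
  finally show ?thesis unfolding m_def .
qed

context cell
begin

text \<open>Divergence theorem: the shell lies inside the cell, so on the lateral and top edges the
  gradient is that of ln |x|, while the normal component vanishes at the bottom. The fluxes are the
  angles under which these edges are seen from the origin, and together they fill the half
  plane.\<close>

lemma wt_mass:
  assumes l: "l > 0" "2 * l\<^sup>2 < hw\<^sup>2" "2 * l\<^sup>2 < pi\<^sup>2"
  shows "(\<integral>x. wt l x \<partial>lebesgue_on Om) = pi"
proof -
  have far: "rr l x > 2" if "hw\<^sup>2 \<le> (fst x)\<^sup>2 \<or> pi\<^sup>2 \<le> (snd x)\<^sup>2" for x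
  proof -
    have "2 * l\<^sup>2 < (fst x)\<^sup>2 + (snd x)\<^sup>2"
      using that l zero_le_power2[of "fst x"] zero_le_power2[of "snd x"] by linarith
    then show ?thesis using l by (simp add: rr_def less_divide_eq)
  qed
  have ig: "integrable (lebesgue_on Om) f" if "continuous_on UNIV f" for f :: "real \<times> real \<Rightarrow> real"
    unfolding Omega_box by (rule integrable_on_box[OF continuous_on_subset[OF that]]) simp
  have "(\<integral>x. wt l x \<partial>lebesgue_on Om) = (\<integral>x. h11 l x + h22 l x \<partial>lebesgue_on Om)"
    using l by (simp add: h_sum wt_def)
  also have "\<dots> = (\<integral>x. h11 l x \<partial>lebesgue_on Om) + (\<integral>x. h22 l x \<partial>lebesgue_on Om)"
    by (intro Bochner_Integration.integral_add ig continuous_radial)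
  also have "(\<integral>x. h11 l x \<partial>lebesgue_on Om) = integral {0..pi} (\<lambda>t. integral {-hw..hw} (\<lambda>s. h11 l (s, t)))"
    by (intro fub2 continuous_radial)
  also have "\<dots> = integral {0..pi} (\<lambda>t. 2 * (hw / (hw\<^sup>2 + t\<^sup>2)))"
  proof (rule Henstock_Kurzweil_Integration.integral_cong)
    fix t
    have "integral {-hw..hw} (\<lambda>s. h11 l (s, t)) = g1 l (hw, t) - g1 l (-hw, t)"
      by (rule has_integral_DERIV[OF _ DERIV_g(1)]) (use hw_pos in simp)
    also have "g1 l (hw, t) = hw / (hw\<^sup>2 + t\<^sup>2)" using g_far(1)[OF far, of "(hw, t)"] l by simp
    also have "g1 l (-hw, t) = - (hw / (hw\<^sup>2 + t\<^sup>2))" using g_far(1)[OF far, of "(-hw, t)"] l by simp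
    finally show "integral {-hw..hw} (\<lambda>s. h11 l (s, t)) = 2 * (hw / (hw\<^sup>2 + t\<^sup>2))" by simp
  qed
  also have "\<dots> = 2 * arctan (pi / hw)"
    unfolding Henstock_Kurzweil_Integration.integral_mult_right using integral_arctan[OF hw_pos, of 0 pi] by simp
  also have "(\<integral>x. h22 l x \<partial>lebesgue_on Om) = integral {-hw..hw} (\<lambda>s. integral {0..pi} (\<lambda>t. h22 l (s, t)))"
    by (intro fub1 continuous_radial)
  also have "\<dots> = integral {-hw..hw} (\<lambda>s. pi / (pi\<^sup>2 + s\<^sup>2))"
  proof (rule Henstock_Kurzweil_Integration.integral_cong)
    fix s
    have "integral {0..pi} (\<lambda>t. h22 l (s, t)) = g2 l (s, pi) - g2 l (s, 0)"
      by (rule has_integral_DERIV[OF _ DERIV_g(2)]) simp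
    also have "g2 l (s, pi) = pi / (s\<^sup>2 + pi\<^sup>2)" using g_far(2)[OF far, of "(s, pi)"] l by simp
    also have "g2 l (s, 0) = 0" by (simp add: g2_def)
    finally show "integral {0..pi} (\<lambda>t. h22 l (s, t)) = pi / (pi\<^sup>2 + s\<^sup>2)" by (simp add: add.commute)
  qed
  also have "\<dots> = 2 * arctan (hw / pi)"
    using integral_arctan[OF pi_gt_zero, of "-hw" hw] hw_pos by (simp add: arctan_minus)
  also have "2 * arctan (pi / hw) + 2 * arctan (hw / pi) = pi"
    using arctan_inverse[of "pi / hw"] hw_pos by (simp add: sgn_if field_simps)
  finally show ?thesis .
qed

text \<open>Because the density has mass pi and lives on the box R, the difference is the integral
  over R of \<open>\<phi> x - m\<close> against the density. The lemma is used at two scales: with b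
  = h = 2l and c = l for l = \<delta>, and with b = h = c = hw for l = \<epsilon>.\<close>

lemma wt_flux:
  assumes M: "\<And>s. \<bar>wl s\<bar> \<le> M" and l: "l > 0" "2 * l\<^sup>2 < b\<^sup>2" "2 * l\<^sup>2 < h\<^sup>2"
    and c: "0 < c" "c \<le> b" and b: "b \<le> hw" "b \<le> 2 * l" and h: "0 < h" "h \<le> pi" "h \<le> 2 * l" and bh: "b * h \<le> 4 * l * c"
    and p: "smooth \<phi>"
  shows "cmod ((\<integral>x. \<phi> x * of_real (wt l x) \<partial>lebesgue_on Om) - of_real pi * (integral {-c..c} (\<lambda>s. \<phi> (s, 0)) / of_real (2 * c)))
    \<le> 12 * M * (nO (d1 \<phi>) + nO (d2 \<phi>))"
proof -
  define m where "m = integral {-c..c} (\<lambda>s. \<phi> (s, 0)) / of_real (2 * c)"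
  define R where "R = box (-b, 0) (b, h)"
  have b0: "0 < b" using c by simp
  have M0: "0 \<le> M" using M[of 0] by linarith
  have pc: "continuous_on A \<phi>" for A by (rule smooth_continuous[OF p])
  have RO: "R \<subseteq> Om" using b h by (auto simp: R_def Omega_box box_def Basis_plane inner_prod_def)
  have Rs: "R \<in> sets lebesgue" by (simp add: R_def)
  have wt0: "wt l x = 0" if "x \<in> Om" "x \<notin> R" for x
  proof -
    have "b \<le> \<bar>fst x\<bar> \<or> h \<le> \<bar>snd x\<bar>"
      using that by (auto simp: R_def Omega_box box_def Basis_plane inner_prod_def)
    then have "b\<^sup>2 \<le> (fst x)\<^sup>2 \<or> h\<^sup>2 \<le> (snd x)\<^sup>2" using b0 h(1) by (metis abs_le_square_iff abs_of_pos)
    then have "2 * l\<^sup>2 < (fst x)\<^sup>2 + (snd x)\<^sup>2"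
      using l zero_le_power2[of "fst x"] zero_le_power2[of "snd x"] by linarith
    then have "rr l x > 2" using l by (simp add: rr_def less_divide_eq)
    then show ?thesis by (simp add: wt_def wl_eq_0)
  qed
  have wtM: "\<bar>wt l x\<bar> \<le> M / l\<^sup>2" for x using M[of "rr l x"] by (simp add: wt_def divide_right_mono)
  have ig: "integrable (lebesgue_on (box d e)) f" if "continuous_on UNIV f" for f :: "real \<times> real \<Rightarrow> complex" and d e
    by (rule integrable_on_box[OF continuous_on_subset[OF that]]) simp
  have igr: "integrable (lebesgue_on (box d e)) f" if "continuous_on UNIV f" for f :: "real \<times> real \<Rightarrow> real" and d e
    by (rule integrable_on_box[OF continuous_on_subset[OF that]]) simp
  have cw: "continuous_on A (\<lambda>x. complex_of_real (wt l x))" for A by (intro continuous_intros continuous_wt)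
  have mass: "(\<integral>x. wt l x \<partial>lebesgue_on Om) = pi"
  proof (rule wt_mass[OF l(1)])
    have "b\<^sup>2 \<le> hw\<^sup>2" "h\<^sup>2 \<le> pi\<^sup>2" using b h b0 by (intro power_mono; simp)+
    then show "2 * l\<^sup>2 < hw\<^sup>2" "2 * l\<^sup>2 < pi\<^sup>2" using l by linarith+
  qed
  have "(\<integral>x. \<phi> x * of_real (wt l x) \<partial>lebesgue_on Om) - of_real pi * m
      = (\<integral>x. \<phi> x * of_real (wt l x) \<partial>lebesgue_on Om) - (\<integral>x. m * of_real (wt l x) \<partial>lebesgue_on Om)"
    using mass by (simp add: mult.commute)
  also have "\<dots> = (\<integral>x. \<phi> x * of_real (wt l x) - m * of_real (wt l x) \<partial>lebesgue_on Om)"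
    unfolding Omega_box by (rule Bochner_Integration.integral_diff[symmetric]; intro ig continuous_intros pc cw)
  also have "\<dots> = (\<integral>x. (\<phi> x - m) * of_real (wt l x) \<partial>lebesgue_on R)"
  proof -
    have "(\<integral>x. \<phi> x * of_real (wt l x) - m * of_real (wt l x) \<partial>lebesgue_on Om)
        = (\<integral>x. indicator Om x *\<^sub>R (\<phi> x * of_real (wt l x) - m * of_real (wt l x)) \<partial>lebesgue)"
      by (rule integral_restrict_space) (use Omega_sets in auto)
    also have "\<dots> = (\<integral>x. indicator R x *\<^sub>R ((\<phi> x - m) * of_real (wt l x)) \<partial>lebesgue)"
      using RO wt0 by (intro Bochner_Integration.integral_cong) (auto simp: indicator_def algebra_simps)
    also have "\<dots> = (\<integral>x. (\<phi> x - m) * of_real (wt l x) \<partial>lebesgue_on R)"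
      by (rule integral_restrict_space[symmetric]) (use Rs in auto)
    finally show ?thesis .
  qed
  finally have "cmod ((\<integral>x. \<phi> x * of_real (wt l x) \<partial>lebesgue_on Om) - of_real pi * m)
      \<le> (\<integral>x. cmod ((\<phi> x - m) * of_real (wt l x)) \<partial>lebesgue_on R)" by simp
  also have "\<dots> \<le> (\<integral>x. M / l\<^sup>2 * cmod (\<phi> x - m) \<partial>lebesgue_on R)"
    unfolding R_def
  proof (rule integral_mono; (intro igr continuous_intros pc continuous_wt cw)?)
    fix x show "cmod ((\<phi> x - m) * of_real (wt l x)) \<le> M / l\<^sup>2 * cmod (\<phi> x - m)"
      using mult_left_mono[OF wtM norm_ge_zero, of "\<phi> x - m" x] by (simp add: norm_mult mult_ac)
  qed
  also have "\<dots> = M / l\<^sup>2 * (\<integral>x. cmod (\<phi> x - m) \<partial>lebesgue_on R)" by simp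
  also have "\<dots> \<le> M / l\<^sup>2 * (sqrt (2 * b * h) * ((b * h / c) * L2_norm R (d2 \<phi>) + 2 * b * L2_norm R (d1 \<phi>)))"
    unfolding m_def R_def by (intro mult_left_mono segment_mean_L1 p c h) (use M0 in simp)
  also have "\<dots> \<le> M / l\<^sup>2 * ((3 * l) * (4 * l * nO (d2 \<phi>) + 4 * l * nO (d1 \<phi>)))"
  proof (rule mult_left_mono)
    \<comment> \<open>Here 2 b h is at most 8 l^2, below 9 l^2. The factors 3 l and 4 l give the
      constant 12 after cancelling l^2.\<close>
    have "2 * b * h \<le> 2 * (2 * l) * (2 * l)" using b h b0 by (intro mult_mono) auto
    also have "\<dots> \<le> (3 * l)\<^sup>2" using zero_le_power2[of l] by (simp add: power2_eq_square)
    finally have 1: "sqrt (2 * b * h) \<le> 3 * l" using l by (intro real_le_lsqrt) auto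
    have n: "L2_norm R (d1 \<phi>) \<le> nO (d1 \<phi>)" "L2_norm R (d2 \<phi>) \<le> nO (d2 \<phi>)"
      by (rule L2_norm_subset_le[OF _ RO Rs Omega_sets], rule smooth_L2[OF p])+
    have 2: "(b * h / c) * L2_norm R (d2 \<phi>) \<le> (4 * l) * nO (d2 \<phi>)"
      by (rule mult_mono[OF _ n(2)]) (use bh c l in \<open>auto simp: divide_le_eq L2_norm_nonneg\<close>)
    have 3: "(2 * b) * L2_norm R (d1 \<phi>) \<le> (4 * l) * nO (d1 \<phi>)"
      by (rule mult_mono[OF _ n(1)]) (use b l in \<open>auto simp: L2_norm_nonneg\<close>)
    show "sqrt (2 * b * h) * ((b * h / c) * L2_norm R (d2 \<phi>) + 2 * b * L2_norm R (d1 \<phi>))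
      \<le> (3 * l) * (4 * l * nO (d2 \<phi>) + 4 * l * nO (d1 \<phi>))"
      by (rule mult_mono[OF 1 add_mono[OF 2 3]]) (use b0 h c l in \<open>auto simp: L2_norm_nonneg\<close>)
  qed (use M0 in simp)
  also have "\<dots> = 12 * M * (nO (d1 \<phi>) + nO (d2 \<phi>))"
    using l by (simp add: field_simps power2_eq_square)
  finally show ?thesis unfolding m_def .
qed

end

context periodic_cell
begin

text \<open>The mean of u over the bottom edge, expressed through the derivative by means of the
  zero trace at the top. In this form it makes sense for every u in the form domain and is
  continuous in L2 of the derivative.\<close>

definition bottom_mean :: "(real \<times> real \<Rightarrow> complex) \<Rightarrow> complex" where
  "bottom_mean u = - (\<integral>x. P2 u x \<partial>lebesgue_on Om) / of_real (2 * hw)"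

lemma smooth_bottom_integral:
  assumes p: "smooth \<phi>"
  shows "integral {-hw..hw} (\<lambda>s. \<phi> (s, 0)) = integral {-hw..hw} (\<lambda>s. \<phi> (s, pi)) - (\<integral>x. d2 \<phi> x \<partial>lebesgue_on Om)"
proof -
  have pc: "continuous_on UNIV \<phi>" "continuous_on UNIV (d2 \<phi>)"
    by (intro smooth_continuous smooth_frechet p)+
  have "(\<integral>x. d2 \<phi> x \<partial>lebesgue_on Om) = integral {-hw..hw} (\<lambda>s. integral {0..pi} (\<lambda>t. d2 \<phi> (s, t)))"
    by (rule fub1[OF pc(2)])
  also have "\<dots> = integral {-hw..hw} (\<lambda>s. \<phi> (s, pi) - \<phi> (s, 0))"
  proof (rule Henstock_Kurzweil_Integration.integral_cong)
    fix s
    have "((\<lambda>t. d2 \<phi> (s, t)) has_integral (\<phi> (s, pi) - \<phi> (s, 0))) {0..pi}"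
      by (rule fundamental_theorem_of_calculus[OF pi_ge_zero has_vector_derivative_at_within[OF slice_deriv(2)[OF p]]])
    then show "integral {0..pi} (\<lambda>t. d2 \<phi> (s, t)) = \<phi> (s, pi) - \<phi> (s, 0)" by (rule integral_unique)
  qed
  also have "\<dots> = integral {-hw..hw} (\<lambda>s. \<phi> (s, pi)) - integral {-hw..hw} (\<lambda>s. \<phi> (s, 0))"
    by (intro Henstock_Kurzweil_Integration.integral_diff integrable_continuous_interval cont_slice(1)[OF pc(1)])
  finally show ?thesis by simp
qed

lemma window_integral_tendsto:
  fixes \<phi> :: "nat \<Rightarrow> real \<times> real \<Rightarrow> complex"
  assumes p: "\<And>n::nat. smooth (\<phi> n)" and l: "(\<lambda>n. L2_norm {-c<..<c} (\<lambda>s. \<phi> n (s, y))) \<longlonglongrightarrow> 0"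
  shows "(\<lambda>n. integral {-c..c} (\<lambda>s. \<phi> n (s, y))) \<longlonglongrightarrow> 0"
proof (rule tendsto_norm_zero_cancel, rule tendsto_0_le)
  fix n
  have "continuous_on {-c..c} (\<lambda>s. \<phi> n (s, y))" by (rule cont_slice(1)[OF smooth_continuous[OF p]])
  from interval_integral_bound[OF this continuous_on_const[of _ 1]]
  show "norm (integral {-c..c} (\<lambda>s. \<phi> n (s, y))) \<le> L2_norm {-c<..<c} (\<lambda>s. \<phi> n (s, y)) * L2_norm {-c<..<c} (\<lambda>_. 1)"
    by simp
  show "(\<lambda>n. L2_norm {-c<..<c} (\<lambda>s. \<phi> n (s, y)) * L2_norm {-c<..<c} (\<lambda>_. 1)) \<longlonglongrightarrow> 0"
    using tendsto_mult_right[OF l, of "L2_norm {-c<..<c} (\<lambda>_. 1)"] by simp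
qed simp

lemma V_flux_limit:
  fixes \<phi> :: "nat \<Rightarrow> real \<times> real \<Rightarrow> complex"
  assumes u: "u \<in> V" and p: "\<And>n. smooth (\<phi> n)"
    and l: "(\<lambda>n. nO (\<lambda>x. \<phi> n x - u x)) \<longlonglongrightarrow> 0" "(\<lambda>n. nO (\<lambda>x. d1 (\<phi> n) x - P1 u x)) \<longlonglongrightarrow> 0"
      "(\<lambda>n. nO (\<lambda>x. d2 (\<phi> n) x - P2 u x)) \<longlonglongrightarrow> 0"
    and b: "\<And>n. cmod ((\<integral>x. \<phi> n x * of_real (wt r x) \<partial>lebesgue_on Om) - A n) \<le> C * (nO (d1 (\<phi> n)) + nO (d2 (\<phi> n)))"
    and A: "A \<longlonglongrightarrow> a"
  shows "cmod ((\<integral>x. u x * of_real (wt r x) \<partial>lebesgue_on Om) - a) \<le> C * (nO (P1 u) + nO (P2 u))"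
proof -
  have wL: "(\<lambda>x. complex_of_real (wt r x)) \<in> L2 Om" by (intro cont_L2 continuous_intros continuous_wt)
  have "(\<lambda>n. cmod ((\<integral>x. \<phi> n x * of_real (wt r x) \<partial>lebesgue_on Om) - A n))
      \<longlonglongrightarrow> cmod ((\<integral>x. u x * of_real (wt r x) \<partial>lebesgue_on Om) - a)"
    by (intro tendsto_norm tendsto_diff A tendsto_integral_mult[OF smooth_L2(1)[OF p] V_L2(1)[OF u] l(1) wL])
  moreover have "(\<lambda>n. C * (nO (d1 (\<phi> n)) + nO (d2 (\<phi> n)))) \<longlonglongrightarrow> C * (nO (P1 u) + nO (P2 u))"
    by (intro tendsto_mult tendsto_const tendsto_add L2_tendsto_norm[OF smooth_L2(2)[OF p] V_L2(2)[OF u] l(2)]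
      L2_tendsto_norm[OF smooth_L2(3)[OF p] V_L2(3)[OF u] l(3)])
  ultimately show ?thesis using b by (intro LIMSEQ_le) auto
qed

end

lemma has_vector_derivative_of_real:
  "(f has_real_derivative f') (at x) \<Longrightarrow> ((\<lambda>x. complex_of_real (f x)) has_vector_derivative of_real f') (at x)"
  unfolding has_real_derivative_iff_has_vector_derivative
  by (rule bounded_linear.has_vector_derivative[OF bounded_linear_of_real])

section \<open>The corrector, its flux and its deviation from a constant\<close>

locale corrector = fibre +
  fixes K M :: real
  assumes K: "\<And>s. 0 \<le> s \<Longrightarrow> \<bar>s * Lam1 s\<bar> \<le> K" and M: "\<And>s. \<bar>wl s\<bar> \<le> M"
    and small: "\<epsilon> \<le> 1" "\<eta> < 1 / 2"
begin

abbreviation "\<delta> \<equiv> \<epsilon> * \<eta>"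

lemma delta: "0 < \<delta>" "\<delta> < \<epsilon> / 2" using eps eta small by auto

lemma pi_4: "pi \<le> 4" "3 < pi" using pi_less_4 pi_gt3 by auto

lemma hw_bounds: "hw \<le> 2 * \<epsilon>" "\<epsilon> < hw" "hw \<le> pi" "2 * \<epsilon>\<^sup>2 < hw\<^sup>2"
proof -
  show "hw \<le> 2 * \<epsilon>" using mult_left_mono[OF pi_4(1), of \<epsilon>] eps by (simp add: hw_def)
  have *: "\<epsilon> * 3 < \<epsilon> * pi" using eps pi_4(2) by simp
  then show "\<epsilon> < hw" using eps by (simp add: hw_def)
  show "hw \<le> pi" using mult_right_mono[OF small(1) pi_ge_zero] pi_gt_zero unfolding hw_def by linarith
  have "(\<epsilon> * 3)\<^sup>2 < (\<epsilon> * pi)\<^sup>2" using * eps by (intro power_strict_mono) auto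
  moreover have "(\<epsilon> * 3)\<^sup>2 = 9 * \<epsilon>\<^sup>2" "(\<epsilon> * pi)\<^sup>2 = 4 * hw\<^sup>2" by (simp_all add: hw_def power_mult_distrib power_divide)
  moreover have "0 < \<epsilon>\<^sup>2" using eps by simp
  ultimately show "2 * \<epsilon>\<^sup>2 < hw\<^sup>2" by linarith
qed

text \<open>At scale \<delta> the segment of averaging is the window itself, where the trace of u
  vanishes. At scale \<epsilon> it is the whole bottom edge, whose average is
  \<open>bottom_mean\<close>.\<close>

lemma V_flux:
  assumes u: "u \<in> V"
  shows "cmod (\<integral>x. u x * of_real (wt \<delta> x) \<partial>lebesgue_on Om) \<le> 12 * M * (nO (P1 u) + nO (P2 u))"
    and "cmod ((\<integral>x. u x * of_real (wt \<epsilon> x) \<partial>lebesgue_on Om) - of_real pi * bottom_mean u) \<le> 12 * M * (nO (P1 u) + nO (P2 u))"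
proof -
  obtain \<phi> :: "nat \<Rightarrow> real \<times> real \<Rightarrow> complex" where p: "\<And>n. smooth (\<phi> n)"
    and l: "(\<lambda>n. nO (\<lambda>x. \<phi> n x - u x)) \<longlonglongrightarrow> 0" "(\<lambda>n. nO (\<lambda>x. d1 (\<phi> n) x - P1 u x)) \<longlonglongrightarrow> 0"
      "(\<lambda>n. nO (\<lambda>x. d2 (\<phi> n) x - P2 u x)) \<longlonglongrightarrow> 0"
    and tr: "(\<lambda>n. L2_norm {-hw<..<hw} (\<lambda>t. \<phi> n (t, pi))) \<longlonglongrightarrow> 0"
      "(\<lambda>n. L2_norm {t. \<bar>t\<bar> < \<epsilon> * \<eta>} (\<lambda>t. \<phi> n (t, 0))) \<longlonglongrightarrow> 0"
    using V_seq[OF u] by blast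
  have "(\<lambda>n. of_real pi * (integral {-\<delta>..\<delta>} (\<lambda>s. \<phi> n (s, 0)) / of_real (2 * \<delta>))) \<longlonglongrightarrow> of_real pi * (0 / of_real (2 * \<delta>))"
    using delta window_integral_tendsto[OF p tr(2)[unfolded window_interval]] by (intro tendsto_intros) auto
  moreover have "cmod ((\<integral>x. \<phi> n x * of_real (wt \<delta> x) \<partial>lebesgue_on Om) - of_real pi * (integral {-\<delta>..\<delta>} (\<lambda>s. \<phi> n (s, 0)) / of_real (2 * \<delta>)))
      \<le> 12 * M * (nO (d1 (\<phi> n)) + nO (d2 (\<phi> n)))" for n
  proof -
    have *: "2 * d\<^sup>2 < (2 * d)\<^sup>2" "(2 * d) * (2 * d) \<le> 4 * d * d" if "0 < d" for d :: real
      using zero_less_power[OF that, of 2] by (simp_all add: power_mult_distrib)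
    have "2 * \<delta> \<le> hw" "2 * \<delta> \<le> pi" "\<delta> \<le> 2 * \<delta>" "0 < 2 * \<delta>" using delta hw_bounds small(1) pi_4(2) by linarith+
    from wt_flux[OF M delta(1) *(1)[OF delta(1)] *(1)[OF delta(1)] delta(1) this(3) this(1) order_refl this(4) this(2) order_refl *(2)[OF delta(1)] p]
    show ?thesis .
  qed
  ultimately have "cmod ((\<integral>x. u x * of_real (wt \<delta> x) \<partial>lebesgue_on Om) - of_real pi * (0 / of_real (2 * \<delta>))) \<le> 12 * M * (nO (P1 u) + nO (P2 u))"
    by (intro V_flux_limit[OF u p l])
  then show "cmod (\<integral>x. u x * of_real (wt \<delta> x) \<partial>lebesgue_on Om) \<le> 12 * M * (nO (P1 u) + nO (P2 u))" by simp
  have "(\<lambda>n. \<integral>x. d2 (\<phi> n) x * 1 \<partial>lebesgue_on Om) \<longlonglongrightarrow> (\<integral>x. P2 u x * 1 \<partial>lebesgue_on Om)"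
    by (rule tendsto_integral_mult[OF smooth_L2(3)[OF p] V_L2(3)[OF u] l(3) smooth_L2(1)[OF smooth_const]])
  then have i: "(\<lambda>n. integral {-hw..hw} (\<lambda>s. \<phi> n (s, 0))) \<longlonglongrightarrow> 0 - (\<integral>x. P2 u x \<partial>lebesgue_on Om)"
    unfolding smooth_bottom_integral[OF p] by (intro tendsto_diff window_integral_tendsto[OF p tr(1)]) simp
  have "(\<lambda>n. of_real pi * (integral {-hw..hw} (\<lambda>s. \<phi> n (s, 0)) / of_real (2 * hw))) \<longlonglongrightarrow> of_real pi * bottom_mean u"
    using tendsto_mult[OF tendsto_const[of "of_real pi"] tendsto_divide[OF i tendsto_const[of "of_real (2 * hw)"]]] hw_pos
    by (simp add: bottom_mean_def)
  moreover have "cmod ((\<integral>x. \<phi> n x * of_real (wt \<epsilon> x) \<partial>lebesgue_on Om) - of_real pi * (integral {-hw..hw} (\<lambda>s. \<phi> n (s, 0)) / of_real (2 * hw)))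
      \<le> 12 * M * (nO (d1 (\<phi> n)) + nO (d2 (\<phi> n)))" for n
    by (rule wt_flux[OF M, of \<epsilon> hw hw hw]) (use eps hw_bounds hw_pos p in auto)
  ultimately show "cmod ((\<integral>x. u x * of_real (wt \<epsilon> x) \<partial>lebesgue_on Om) - of_real pi * bottom_mean u) \<le> 12 * M * (nO (P1 u) + nO (P2 u))"
    by (intro V_flux_limit[OF u p l])
qed

definition W :: "real \<times> real \<Rightarrow> real" where "W x = Lr \<delta> x - Lr \<epsilon> x"
definition G1 :: "real \<times> real \<Rightarrow> real" where "G1 x = g1 \<delta> x - g1 \<epsilon> x"
definition G2 :: "real \<times> real \<Rightarrow> real" where "G2 x = g2 \<delta> x - g2 \<epsilon> x"

lemma continuous_W: "continuous_on A W" "continuous_on A G1" "continuous_on A G2"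
  unfolding W_def[abs_def] G1_def[abs_def] G2_def[abs_def] by (intro continuous_intros continuous_radial)+

lemma DERIV_W:
  "((\<lambda>s. W (s, t)) has_real_derivative G1 (s, t)) (at s)"
  "((\<lambda>t. W (s, t)) has_real_derivative G2 (s, t)) (at t)"
  unfolding W_def G1_def G2_def by (intro DERIV_diff DERIV_Lr)+

lemma rr_delta_ge: "rr \<epsilon> x \<le> rr \<delta> x"
  unfolding rr_def using delta eps by (intro divide_left_mono power_mono mult_pos_pos) auto

lemma rr_far: "hw \<le> \<bar>fst x\<bar> \<Longrightarrow> rr \<epsilon> x > 2"
proof -
  assume "hw \<le> \<bar>fst x\<bar>"
  then have "hw\<^sup>2 \<le> (fst x)\<^sup>2" using hw_pos by (metis abs_le_square_iff abs_of_pos)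
  then have "2 * \<epsilon>\<^sup>2 < (fst x)\<^sup>2 + (snd x)\<^sup>2" using hw_bounds(4) zero_le_power2[of "snd x"] by linarith
  then show ?thesis using eps by (simp add: rr_def less_divide_eq)
qed

text \<open>Integration by parts leaves u paired with the Laplacian of W, which is
  \<open>wt \<delta>\<close> minus \<open>wt \<epsilon>\<close>. There are no boundary terms: the
  two gradients cancel near the lateral edges, \<open>G2\<close> vanishes at the bottom and u at the
  top. The constant 24 M is twice the bound of \<open>V_flux\<close>.\<close>

lemma V_corrector_flux:
  assumes u: "u \<in> V"
  shows "cmod ((\<integral>x. P1 u x * of_real (G1 x) \<partial>lebesgue_on Om) + (\<integral>x. P2 u x * of_real (G2 x) \<partial>lebesgue_on Om)
    - of_real pi * bottom_mean u) \<le> 24 * M * (nO (P1 u) + nO (P2 u))"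
proof -
  have far: "rr \<epsilon> (s, t) > 2" "rr \<delta> (s, t) > 2" if "\<bar>s\<bar> = hw" for s t
    using rr_far[of "(s, t)"] rr_delta_ge[of "(s, t)"] that by auto
  have per: "G1 (hw, t) = G1 (-hw, t)" for t
    using far[of hw t] far[of "-hw" t] hw_pos delta(1) eps eta by (simp add: G1_def g_far)
  have ch: "continuous_on A (\<lambda>x. complex_of_real (h11 \<delta> x - h11 \<epsilon> x))" "continuous_on A (\<lambda>x. complex_of_real (h22 \<delta> x - h22 \<epsilon> x))" for A
    by (intro continuous_intros continuous_radial)+
  have 1: "(\<integral>x. P1 u x * of_real (G1 x) \<partial>lebesgue_on Om) = - (\<integral>x. u x * of_real (h11 \<delta> x - h11 \<epsilon> x) \<partial>lebesgue_on Om)"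
  proof (rule V_parts_1[OF u])
    show "((\<lambda>s. complex_of_real (G1 (s, t))) has_vector_derivative of_real (h11 \<delta> (s, t) - h11 \<epsilon> (s, t))) (at s)" for s t
      unfolding G1_def by (intro has_vector_derivative_of_real DERIV_diff DERIV_g)
  qed (simp_all only: per continuous_on_of_real continuous_W ch)
  have 2: "(\<integral>x. P2 u x * of_real (G2 x) \<partial>lebesgue_on Om) = - (\<integral>x. u x * of_real (h22 \<delta> x - h22 \<epsilon> x) \<partial>lebesgue_on Om)"
  proof (rule V_parts_2[OF u])
    show "((\<lambda>t. complex_of_real (G2 (s, t))) has_vector_derivative of_real (h22 \<delta> (s, t) - h22 \<epsilon> (s, t))) (at t)" for s t
      unfolding G2_def by (intro has_vector_derivative_of_real DERIV_diff DERIV_g)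
    show "complex_of_real (G2 (s, 0)) = 0" for s by (simp add: G2_def g2_def)
  qed (simp_all only: continuous_on_of_real continuous_W ch)
  note uL = V_L2(1)[OF u]
  have ig: "integrable (lebesgue_on Om) (\<lambda>x. u x * of_real (q x))" if "continuous_on UNIV q" for q
    by (rule L2_mult_integrable[OF uL cont_L2]) (intro continuous_intros that)
  have "(\<integral>x. u x * of_real (h11 \<delta> x - h11 \<epsilon> x) \<partial>lebesgue_on Om) + (\<integral>x. u x * of_real (h22 \<delta> x - h22 \<epsilon> x) \<partial>lebesgue_on Om)
      = (\<integral>x. u x * of_real (h11 \<delta> x - h11 \<epsilon> x) + u x * of_real (h22 \<delta> x - h22 \<epsilon> x) \<partial>lebesgue_on Om)"
    by (intro Bochner_Integration.integral_add[symmetric] ig continuous_intros continuous_radial)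
  also have "\<dots> = (\<integral>x. u x * of_real (wt \<delta> x) - u x * of_real (wt \<epsilon> x) \<partial>lebesgue_on Om)"
  proof (rule Bochner_Integration.integral_cong[OF refl])
    fix x
    have "\<delta> \<noteq> 0" "\<epsilon> \<noteq> 0" using delta eps by auto
    from this[THEN h_sum] have "wt \<delta> x = h11 \<delta> x + h22 \<delta> x" "wt \<epsilon> x = h11 \<epsilon> x + h22 \<epsilon> x"
      by (simp_all only: wt_def)
    then show "u x * of_real (h11 \<delta> x - h11 \<epsilon> x) + u x * of_real (h22 \<delta> x - h22 \<epsilon> x) = u x * of_real (wt \<delta> x) - u x * of_real (wt \<epsilon> x)"
      by (simp add: algebra_simps)
  qed
  also have "\<dots> = (\<integral>x. u x * of_real (wt \<delta> x) \<partial>lebesgue_on Om) - (\<integral>x. u x * of_real (wt \<epsilon> x) \<partial>lebesgue_on Om)"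
    by (intro Bochner_Integration.integral_diff ig continuous_wt)
  finally have e: "(\<integral>x. P1 u x * of_real (G1 x) \<partial>lebesgue_on Om) + (\<integral>x. P2 u x * of_real (G2 x) \<partial>lebesgue_on Om) - of_real pi * bottom_mean u
      = ((\<integral>x. u x * of_real (wt \<epsilon> x) \<partial>lebesgue_on Om) - of_real pi * bottom_mean u) - (\<integral>x. u x * of_real (wt \<delta> x) \<partial>lebesgue_on Om)"
    unfolding 1 2 by (simp add: algebra_simps)
  show ?thesis unfolding e
    by (rule order_trans[OF norm_triangle_ineq4]) (use V_flux[OF u] in linarith)
qed

text \<open>The deviation of W from the constant value -ln \<eta> that it takes away from the
  window.\<close>

definition D :: "real \<times> real \<Rightarrow> real" where "D x = W x + ln \<eta>"

lemma continuous_D: "continuous_on A D"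
  unfolding D_def[abs_def] by (intro continuous_intros continuous_W)

lemma D_far: "rr \<epsilon> x \<ge> 2 \<Longrightarrow> D x = 0"
proof -
  assume 2: "rr \<epsilon> x \<ge> 2"
  define S where "S = (fst x)\<^sup>2 + (snd x)\<^sup>2"
  have S: "S > 0"
  proof -
    have "0 \<le> S" by (simp add: S_def)
    moreover have "S \<noteq> 0" using 2 by (auto simp: rr_def S_def[symmetric])
    ultimately show ?thesis by simp
  qed
  have "rr \<delta> x \<ge> 2" using 2 rr_delta_ge[of x] by linarith
  have "ln (rr l x) = ln S - 2 * ln l" if "0 < l" for l
    unfolding rr_def S_def[symmetric] using S that by (simp add: ln_div ln_realpow)
  from this[OF delta(1)] this[OF eps] have "ln (rr \<delta> x) = ln S - 2 * ln \<delta>" "ln (rr \<epsilon> x) = ln S - 2 * ln \<epsilon>" .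
  moreover have "ln \<delta> = ln \<epsilon> + ln \<eta>" using eps eta by (simp add: ln_mult)
  ultimately show ?thesis unfolding D_def W_def Lr_def Lam_eq_ln[OF 2] Lam_eq_ln[OF \<open>rr \<delta> x \<ge> 2\<close>] by linarith
qed

lemma tG_bound: "\<bar>snd x * G1 x\<bar> \<le> 4 * K" "\<bar>snd x * G2 x\<bar> \<le> 4 * K"
proof -
  have "\<delta> \<noteq> 0" "\<epsilon> \<noteq> 0" using delta eps by auto
  note g = g_times_le[OF K this(1), of x] g_times_le[OF K this(2), of x]
  show "\<bar>snd x * G1 x\<bar> \<le> 4 * K" "\<bar>snd x * G2 x\<bar> \<le> 4 * K"
    unfolding G1_def G2_def right_diff_distrib using g by linarith+
qed

lemma K_nonneg: "0 \<le> K" using K[of 0] by simp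
lemma M_nonneg: "0 \<le> M" using M[of 0] by simp

text \<open>On the window D equals ln \<eta>, which is unbounded as \<eta> tends to 0. On each
  vertical line, however, D vanishes from height 2 \<epsilon> on and x_2 times its derivative is
  bounded by 4 K, so \<open>log_growth_L2_bound\<close> gives an integral O(\<epsilon>); the width
  of the cell contributes the second factor \<epsilon>.\<close>

lemma nO_D: "nO (\<lambda>x. of_real (D x)) \<le> 23 * K * \<epsilon>"
proof -
  have slice: "integral {0..pi} (\<lambda>t. (norm (complex_of_real (D (s, t))))\<^sup>2) \<le> 128 * K\<^sup>2 * \<epsilon>" for s
  proof -
    have DD: "((\<lambda>t. D (s, t)) has_real_derivative G2 (s, t)) (at t)" for t
      unfolding D_def using DERIV_add[OF DERIV_W(2) DERIV_const] by simp
    have c: "continuous_on A (\<lambda>t. D (s, t))" "continuous_on A (\<lambda>t. G2 (s, t))" for A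
      by (rule cont_slice(2), rule continuous_D, rule cont_slice(2), rule continuous_W)
    have z: "D (s, t) = 0" if "2 * \<epsilon> \<le> t" for t
    proof (rule D_far)
      have "(2 * \<epsilon>)\<^sup>2 \<le> t\<^sup>2" using that eps by (intro power_mono) auto
      moreover have "(2 * \<epsilon>)\<^sup>2 = 4 * \<epsilon>\<^sup>2" by (simp add: power_mult_distrib)
      ultimately have "2 * \<epsilon>\<^sup>2 \<le> s\<^sup>2 + t\<^sup>2" using zero_le_power2[of s] zero_le_power2[of \<epsilon>] by linarith
      then show "2 \<le> rr \<epsilon> (s, t)" using eps by (simp add: rr_def le_divide_eq)
    qed
    have e2: "0 \<le> 2 * \<epsilon>" "2 * \<epsilon> \<le> pi" using eps small pi_4 by auto
    have i: "(\<lambda>t. (norm (complex_of_real (D (s, t))))\<^sup>2) integrable_on {0..pi}"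
      by (intro integrable_continuous_interval continuous_intros c)
    have "integral {0..pi} (\<lambda>t. (norm (complex_of_real (D (s, t))))\<^sup>2)
        = integral {0..2 * \<epsilon>} (\<lambda>t. (norm (complex_of_real (D (s, t))))\<^sup>2) + integral {2 * \<epsilon>..pi} (\<lambda>t. (norm (complex_of_real (D (s, t))))\<^sup>2)"
      by (rule Henstock_Kurzweil_Integration.integral_combine[symmetric, OF e2 i])
    also have "integral {2 * \<epsilon>..pi} (\<lambda>t. (norm (complex_of_real (D (s, t))))\<^sup>2) = integral {2 * \<epsilon>..pi} (\<lambda>t. 0)"
      by (rule Henstock_Kurzweil_Integration.integral_cong) (simp add: z)
    also have "integral {0..2 * \<epsilon>} (\<lambda>t. (norm (complex_of_real (D (s, t))))\<^sup>2) \<le> 4 * (4 * K)\<^sup>2 * (2 * \<epsilon>)"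
      using log_growth_L2_bound[of "2 * \<epsilon>" "\<lambda>t. D (s, t)" "\<lambda>t. G2 (s, t)" "4 * K", OF _ DD c(2) z] tG_bound(2)[of "(s, _)"] eps by simp
    finally show ?thesis by (simp add: power_mult_distrib)
  qed
  have cD: "continuous_on UNIV (\<lambda>x. complex_of_real (D x))" by (intro continuous_intros continuous_D)
  have "(nO (\<lambda>x. of_real (D x)))\<^sup>2 = integral {-hw..hw} (\<lambda>s. integral {0..pi} (\<lambda>t. (norm (complex_of_real (D (s, t))))\<^sup>2))"
    by (rule nO_sq1[OF cD])
  also have "\<dots> \<le> integral {-hw..hw} (\<lambda>s. 128 * K\<^sup>2 * \<epsilon>)"
  proof (rule integral_le)
    have "continuous_on UNIV (\<lambda>x. (norm (complex_of_real (D x)))\<^sup>2)" by (intro continuous_intros continuous_D)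
    from cont_param(1)[OF this] show "(\<lambda>s. integral {0..pi} (\<lambda>t. (norm (complex_of_real (D (s, t))))\<^sup>2)) integrable_on {-hw..hw}"
      by (rule integrable_continuous_interval)
  qed (use slice in auto)
  also have "\<dots> = 2 * hw * (128 * K\<^sup>2 * \<epsilon>)" using hw_pos by simp
  also have "\<dots> \<le> (4 * \<epsilon>) * (128 * K\<^sup>2 * \<epsilon>)" using hw_bounds(1) eps by (intro mult_right_mono) auto
  \<comment> \<open>Here 23^2 = 529 exceeds 4 times 128 = 512.\<close>
  also have "\<dots> \<le> (23 * K * \<epsilon>)\<^sup>2" using zero_le_power2[of "K * \<epsilon>"] by (simp add: power2_eq_square algebra_simps)
  finally show ?thesis by (rule power2_le_imp_le) (use K_nonneg eps in simp)
qed

end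

context cell
begin

text \<open>With a real weight the bilinear integral of the integrations by parts and the inner
  product of the form coincide, so both kinds of rules apply to it.\<close>

definition pair :: "(real \<times> real \<Rightarrow> complex) \<Rightarrow> (real \<times> real \<Rightarrow> real) \<Rightarrow> complex" where
  "pair a r = (\<integral>x. a x * complex_of_real (r x) \<partial>lebesgue_on Om)"

lemma of_real_L2: "continuous_on UNIV r \<Longrightarrow> (\<lambda>x. complex_of_real (r x)) \<in> L2 Om"
  by (intro cont_L2 continuous_intros)

lemma pair_comb:
  assumes a: "a \<in> L2 Om" and r: "continuous_on UNIV r" "continuous_on UNIV s"
  shows "pair a (\<lambda>x. r x + c * s x) = pair a r + of_real c * pair a s"
proof -
  have "pair a (\<lambda>x. r x + c * s x) = (\<integral>x. a x * of_real (r x) + of_real c * (a x * of_real (s x)) \<partial>lebesgue_on Om)"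
    by (simp add: pair_def algebra_simps)
  also have "\<dots> = pair a r + (\<integral>x. of_real c * (a x * of_real (s x)) \<partial>lebesgue_on Om)"
    unfolding pair_def
    by (intro Bochner_Integration.integral_add integrable_mult_right L2_mult_integrable[OF a of_real_L2] r)
  finally show ?thesis by (simp add: pair_def)
qed

lemma pair_eq_inner: "pair a r = L2_inner Om a (\<lambda>x. of_real (r x))"
  by (simp add: pair_def L2_inner_def)

lemma pair_bound:
  assumes "a \<in> L2 Om" "continuous_on UNIV r"
  shows "cmod (pair a r) \<le> nO a * nO (\<lambda>x. of_real (r x))"
  unfolding pair_eq_inner by (rule L2_CS[OF assms(1) of_real_L2[OF assms(2)]])

lemma measure_Om: "measure lebesgue Om = 2 * hw * pi"
proof -
  have "measure lebesgue Om = (\<integral>x. (1::real) \<partial>lebesgue_on Om)"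
    using Omega_lm by (simp add: measure_restrict_space space_restrict_space)
  also have "\<dots> = integral {-hw..hw} (\<lambda>s. integral {0..pi} (\<lambda>t. 1::real))"
    by (rule fub1) (rule continuous_on_const)
  finally show ?thesis using hw_pos by simp
qed

end

context periodic_cell
begin

text \<open>Periodicity makes the x_1-derivative orthogonal to every function of x_2, in particular
  to the constant part of the corrector times \<open>pi - snd x\<close>.\<close>

lemma pair_P1_snd:
  assumes u: "u \<in> V" and q: "continuous_on UNIV q"
  shows "(\<integral>x. P1 u x * q (snd x) \<partial>lebesgue_on Om) = 0"
proof -
  have "(\<integral>x. P1 u x * q (snd x) \<partial>lebesgue_on Om) = - (\<integral>x. u x * 0 \<partial>lebesgue_on Om)"
    by (rule V_parts_1[OF u, where \<psi>' = "\<lambda>_. 0"])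
      (auto intro: continuous_on_compose2[OF q continuous_on_snd[OF continuous_on_id]])
  then show ?thesis by simp
qed

end

section \<open>Testing the resolvent equation with the corrector\<close>

context corrector
begin

text \<open>The flux contributes 4 times 24 M. The coefficients of K are 16 + 184 = 200 for the
  x_1-derivative, 16 + 23 = 39 for the x_2-derivative and 92 for f; the largest one is
  taken.\<close>

definition C1 :: real where "C1 = 96 * M + 200 * K"

text \<open>The test function is W times \<zeta> = pi - x_2. Since \<zeta> is affine, the product
  rule yields pi times the flux of the corrector, remainders containing x_2 times its gradient, and
  W itself. Writing W = D - ln \<eta> isolates the terms with ln \<eta> on the left; everything with
  D is bounded by its small norm.\<close>

lemma corrector_equation:
  assumes fu: "(f, u) \<in> resolvent"
  shows "cmod (of_real (pi\<^sup>2 - 2 * hw * ln \<eta>) * bottom_mean u + of_real (ln \<eta>) * pair f (\<lambda>x. pi - snd x))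
    \<le> C1 * (nO (P1 u) + nO (P2 u) + nO f)"
proof -
  have f: "f \<in> L2 Om" and u: "u \<in> V" and eq: "\<And>v. v \<in> V \<Longrightarrow> B u v = L2_inner Om f v"
    using fu unfolding resolvent_iff by auto
  note uL = V_L2[OF u]
  define \<zeta> :: "real \<times> real \<Rightarrow> real" where "\<zeta> x = pi - snd x" for x
  define vt where "vt x = complex_of_real (W x * \<zeta> x)" for x
  have cz: "continuous_on A \<zeta>" "continuous_on A (snd :: real \<times> real \<Rightarrow> real)" for A
    unfolding \<zeta>_def[abs_def] by (intro continuous_intros)+
  note cont = continuous_W continuous_D cz continuous_on_mult continuous_on_diff continuous_on_add continuous_on_const
  have dvt: "((\<lambda>s. vt (s, t)) has_vector_derivative of_real (G1 (s, t) * \<zeta> (s, t))) (at s)"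
    "((\<lambda>t. vt (s, t)) has_vector_derivative of_real (G2 (s, t) * \<zeta> (s, t) - W (s, t))) (at t)" for s t
  proof -
    have "((\<lambda>s. W (s, t) * \<zeta> (s, t)) has_real_derivative G1 (s, t) * \<zeta> (s, t)) (at s)"
      using DERIV_mult[OF DERIV_W(1) DERIV_const[of "pi - t"]] by (simp add: \<zeta>_def)
    then show "((\<lambda>s. vt (s, t)) has_vector_derivative of_real (G1 (s, t) * \<zeta> (s, t))) (at s)"
      unfolding vt_def by (rule has_vector_derivative_of_real)
    have "((\<lambda>t. W (s, t) * \<zeta> (s, t)) has_real_derivative G2 (s, t) * \<zeta> (s, t) - W (s, t)) (at t)"
      using DERIV_mult[OF DERIV_W(2) DERIV_diff[OF DERIV_const[of pi] DERIV_ident]] by (simp add: \<zeta>_def)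
    then show "((\<lambda>t. vt (s, t)) has_vector_derivative of_real (G2 (s, t) * \<zeta> (s, t) - W (s, t))) (at t)"
      unfolding vt_def by (rule has_vector_derivative_of_real)
  qed
  have sm: "smooth vt"
  proof -
    have "smooth (\<lambda>x. (complex_of_real (Lr \<delta> x) - complex_of_real (Lr \<epsilon> x)) * (complex_of_real pi - complex_of_real (snd x)))"
      by (intro smooth_mult smooth_diff smooth_Lr smooth_const smooth_bounded_linear
        bounded_linear_compose[OF bounded_linear_of_real bounded_linear_snd])
    moreover have "vt = (\<lambda>x. (complex_of_real (Lr \<delta> x) - complex_of_real (Lr \<epsilon> x)) * (complex_of_real pi - complex_of_real (snd x)))"
      by (simp add: vt_def \<zeta>_def W_def fun_eq_iff)
    ultimately show ?thesis by (simp only:)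
  qed
  have side: "vt (hw, t) = vt (-hw, t)" for t by (simp add: vt_def W_def Lr_def rr_def \<zeta>_def)
  \<comment> \<open>The defect is zero: \<zeta> vanishes on the top edge, both logarithms vanish on
    the window, and W is even in x_1.\<close>
  have vV: "vt \<in> V"
  proof (rule smooth_V[OF sm])
    have 1: "(\<lambda>t. vt (t, pi)) = (\<lambda>t. 0)" by (simp add: vt_def \<zeta>_def)
    have 3: "(\<lambda>t. vt (hw, t) - vt (-hw, t)) = (\<lambda>t. 0)" by (simp add: side)
    have "vt (t, 0) = 0" if "\<bar>t\<bar> < \<epsilon> * \<eta>" for t
    proof -
      have "t\<^sup>2 \<le> \<delta>\<^sup>2" using that delta(1) abs_le_square_iff[of t \<delta>] by simp
      then have "rr \<delta> (t, 0) \<le> 1" using delta(1) by (simp only: rr_def fst_conv snd_conv) (auto simp: divide_le_eq_1)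
      then show ?thesis using rr_delta_ge[of "(t, 0)"] by (simp add: vt_def W_def Lr_def Lam_eq_0)
    qed
    then have 2: "L2_norm {t. \<bar>t\<bar> < \<epsilon> * \<eta>} (\<lambda>t. vt (t, 0)) \<le> L2_norm {t. \<bar>t\<bar> < \<epsilon> * \<eta>} (\<lambda>t. 0)"
      unfolding window_interval
      by (intro L2_norm_mono slice_L2 smooth_continuous[OF sm] L2_zero) auto
    show "defect \<eta> vt = 0" unfolding defect_def 1 3
      using 2 by (simp add: L2_norm_zero order_antisym L2_norm_nonneg)
  qed
  have ae: "AE x in lebesgue_on Om. P1 vt x = of_real (G1 x * \<zeta> x)" "AE x in lebesgue_on Om. P2 vt x = of_real (G2 x * \<zeta> x - W x)"
  proof -
    have "d1 vt x = of_real (G1 x * \<zeta> x)" "d2 vt x = of_real (G2 x * \<zeta> x - W x)" for x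
      using vector_derivative_unique_at[OF slice_deriv(1)[OF sm] dvt(1), of "fst x" "snd x"]
        vector_derivative_unique_at[OF slice_deriv(2)[OF sm] dvt(2), of "fst x" "snd x"] by simp_all
    then show "AE x in lebesgue_on Om. P1 vt x = of_real (G1 x * \<zeta> x)" "AE x in lebesgue_on Om. P2 vt x = of_real (G2 x * \<zeta> x - W x)"
      using smooth_W12(2)[OF OmS sm, where e = "(1, 0)"] smooth_W12(2)[OF OmS sm, where e = "(0, 1)"] by simp_all
  qed
  note L2I = of_real_L2[OF continuous_on_mult[OF continuous_W(2) cz(1)]]
    of_real_L2[OF continuous_on_diff[OF continuous_on_mult[OF continuous_W(3) cz(1)] continuous_W(1)]]
  note vL = V_L2[OF vV]
  have i1: "L2_inner Om a (P1 vt) = pair a (\<lambda>x. G1 x * \<zeta> x)" if "a \<in> L2 Om" for a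
    unfolding pair_eq_inner by (rule L2_inner_cong_AE[OF that that AE_I2[OF refl] vL(2) L2I(1) ae(1)])
  have i2: "L2_inner Om a (P2 vt) = pair a (\<lambda>x. G2 x * \<zeta> x - W x)" if "a \<in> L2 Om" for a
    unfolding pair_eq_inner by (rule L2_inner_cong_AE[OF that that AE_I2[OF refl] vL(3) L2I(2) ae(2)])
  have i0: "L2_inner Om a vt = pair a (\<lambda>x. W x * \<zeta> x)" for a
    unfolding pair_eq_inner vt_def[abs_def] ..
  \<comment> \<open>Both cross terms of \<open>B\<close> become the same pairing of
    \<open>P1 u\<close> with \<open>W x * \<zeta> x\<close>, so u is not paired with the large
    gradient \<open>G1\<close>.\<close>
  have parts: "pair u (\<lambda>x. G1 x * \<zeta> x) = - pair (P1 u) (\<lambda>x. W x * \<zeta> x)"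
  proof -
    have "(\<integral>x. P1 u x * vt x \<partial>lebesgue_on Om) = - (\<integral>x. u x * complex_of_real (G1 x * \<zeta> x) \<partial>lebesgue_on Om)"
      by (rule V_parts_1[OF u _ _ dvt(1) side]) (intro smooth_continuous[OF sm] continuous_on_of_real cont)+
    then show ?thesis by (simp add: pair_def vt_def)
  qed
  define E where "E = pair (P1 u) (\<lambda>x. D x * \<zeta> x)"
  have WD: "pair a (\<lambda>x. W x * \<zeta> x) = pair a (\<lambda>x. D x * \<zeta> x) - of_real (ln \<eta>) * pair a \<zeta>" if "a \<in> L2 Om" for a
  proof -
    have "(\<lambda>x. W x * \<zeta> x) = (\<lambda>x. D x * \<zeta> x + (- ln \<eta>) * \<zeta> x)" by (simp add: D_def algebra_simps)
    then show ?thesis using pair_comb[OF that, of "\<lambda>x. D x * \<zeta> x" \<zeta> "- ln \<eta>"] by (simp add: cont)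
  qed
  \<comment> \<open>Removes the constant -ln \<eta> from the cross term and leaves only D
    there.\<close>
  have z1: "pair (P1 u) \<zeta> = 0"
    using pair_P1_snd[OF u, of "\<lambda>t. complex_of_real (pi - t)"] by (simp add: pair_def \<zeta>_def continuous_intros)
  \<comment> \<open>The gradient G is not bounded uniformly in \<eta>, but x_2 G is. The remaining
    part, pi times the pairing with G, is handled by \<open>V_corrector_flux\<close>.\<close>
  have zG: "pair a (\<lambda>x. G x * \<zeta> x) = of_real pi * pair a G - pair a (\<lambda>x. snd x * G x)" if "a \<in> L2 Om" "continuous_on UNIV G" for a G
  proof -
    have "(\<lambda>x. G x * \<zeta> x) = (\<lambda>x. - 1 * (snd x * G x) + pi * G x)" by (simp add: \<zeta>_def algebra_simps)
    moreover have "pair a (\<lambda>x. - 1 * (snd x * G x) + pi * G x) = pair a (\<lambda>x. - 1 * (snd x * G x)) + of_real pi * pair a G"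
      by (rule pair_comb[OF that(1)]) (intro cont that)+
    moreover have "pair a (\<lambda>x. - 1 * (snd x * G x)) = - pair a (\<lambda>x. snd x * G x)" by (simp add: pair_def)
    ultimately show ?thesis by simp
  qed
  have P2W: "pair (P2 u) (\<lambda>x. G2 x * \<zeta> x - W x)
      = of_real pi * pair (P2 u) G2 - pair (P2 u) (\<lambda>x. snd x * G2 x) - pair (P2 u) D - of_real (2 * hw * ln \<eta>) * bottom_mean u"
  proof -
    have 1: "pair (P2 u) (\<lambda>x. G2 x * \<zeta> x + - 1 * W x) = pair (P2 u) (\<lambda>x. G2 x * \<zeta> x) + of_real (- 1) * pair (P2 u) W"
      by (rule pair_comb[OF uL(3)]) (intro cont)+
    have 2: "pair (P2 u) (\<lambda>x. D x + (- ln \<eta>) * 1) = pair (P2 u) D + of_real (- ln \<eta>) * pair (P2 u) (\<lambda>_. 1)"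
      by (rule pair_comb[OF uL(3)]) (intro cont)+
    have 3: "W = (\<lambda>x. D x + (- ln \<eta>) * 1)" by (simp add: D_def fun_eq_iff)
    have 4: "pair (P2 u) (\<lambda>_. 1) = - of_real (2 * hw) * bottom_mean u" using hw_pos by (simp add: pair_def bottom_mean_def)
    have "pair (P2 u) (\<lambda>x. G2 x * \<zeta> x - W x) = pair (P2 u) (\<lambda>x. G2 x * \<zeta> x) - pair (P2 u) W" using 1 by simp
    also have "pair (P2 u) W = pair (P2 u) D + of_real (2 * hw * ln \<eta>) * bottom_mean u"
      using 2 unfolding 3[symmetric] 4 by simp
    finally show ?thesis unfolding zG[OF uL(3) continuous_W(3)] by simp
  qed
  define A where "A = pair (P1 u) G1 + pair (P2 u) G2 - of_real pi * bottom_mean u"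
  define b1 where "b1 = pair (P1 u) (\<lambda>x. snd x * G1 x)"
  define b2 where "b2 = pair (P2 u) (\<lambda>x. snd x * G2 x)"
  define e2 where "e2 = pair (P2 u) D"
  define ef where "ef = pair f (\<lambda>x. D x * \<zeta> x)"
  have "B u vt = L2_inner Om f vt" by (rule eq[OF vV])
  then have "of_real pi * pair (P1 u) G1 - b1 + (of_real pi * pair (P2 u) G2 - b2 - e2 - of_real (2 * hw * ln \<eta>) * bottom_mean u)
      - of_real (\<tau> / \<epsilon>) * \<i> * (2 * E) = ef - of_real (ln \<eta>) * pair f \<zeta>"
    unfolding B_def i1[OF uL(2)] i2[OF uL(3)] i1[OF uL(1)] i0 parts P2W zG[OF uL(2) continuous_W(2)] WD[OF uL(2)] WD[OF f] z1
      b1_def b2_def e2_def ef_def E_def by simp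
  then have id: "of_real (pi\<^sup>2 - 2 * hw * ln \<eta>) * bottom_mean u + of_real (ln \<eta>) * pair f \<zeta>
      = - (of_real pi * A) + b1 + b2 + e2 + of_real (\<tau> / \<epsilon>) * \<i> * (2 * E) + ef"
    unfolding A_def of_real_diff power2_eq_square of_real_mult by algebra
  define n1 where "n1 = nO (P1 u)"
  define n2 where "n2 = nO (P2 u)"
  define nf where "nf = nO f"
  have n0: "0 \<le> n1" "0 \<le> n2" "0 \<le> nf" by (simp_all add: n1_def n2_def nf_def L2_norm_nonneg)
  have kd: "0 \<le> 23 * K * \<epsilon>" using K_nonneg eps by simp
  have De: "nO (\<lambda>x. of_real (D x)) \<le> 23 * K"
    using nO_D mult_left_mono[OF small(1), of "23 * K"] K_nonneg by simp
  have Dz: "nO (\<lambda>x. of_real (D x * \<zeta> x)) \<le> 4 * (23 * K * \<epsilon>)"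
  proof -
    have "nO (\<lambda>x. of_real (D x * \<zeta> x)) \<le> nO (\<lambda>x. 4 * of_real (D x))"
    proof (rule L2_norm_mono)
      show "(\<lambda>x. complex_of_real (D x * \<zeta> x)) \<in> L2 Om" by (intro of_real_L2 cont)
      show "(\<lambda>x. 4 * complex_of_real (D x)) \<in> L2 Om" by (intro L2_scale of_real_L2 cont)
      fix x assume "x \<in> Om"
      then have "\<bar>\<zeta> x\<bar> \<le> 4" using pi_4 by (auto simp: \<Omega>_def \<zeta>_def)
      then show "norm (complex_of_real (D x * \<zeta> x)) \<le> norm (4 * complex_of_real (D x))"
        using mult_left_mono[of "\<bar>\<zeta> x\<bar>" 4 "\<bar>D x\<bar>"] by (simp add: norm_mult abs_mult mult_ac)
    qed
    also have "\<dots> = 4 * nO (\<lambda>x. of_real (D x))" by (simp add: L2_norm_scale)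
    finally show ?thesis using nO_D by linarith
  qed
  have tG: "nO (\<lambda>x. of_real (snd x * G x)) \<le> 16 * K" if "continuous_on UNIV G" "\<And>x. \<bar>snd x * G x\<bar> \<le> 4 * K" for G :: "real \<times> real \<Rightarrow> real"
  proof -
    have "nO (\<lambda>x. of_real (snd x * G x)) \<le> (4 * K) * sqrt (measure lebesgue Om)"
      by (rule bounded_in_L2(2)[OF Omega_lm L2_D(1)[OF of_real_L2]])
        (use that K_nonneg in \<open>auto intro!: continuous_intros simp del: of_real_mult\<close>)
    also have "\<dots> \<le> (4 * K) * 4"
    proof (intro mult_left_mono real_le_lsqrt)
      have "2 * hw * pi \<le> 4 * 4" using hw_bounds(1) small(1) pi_4 hw_pos by (intro mult_mono) auto
      then show "measure lebesgue Om \<le> 4\<^sup>2" by (simp add: measure_Om)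
    qed (use K_nonneg in auto)
    finally show ?thesis by simp
  qed
  have 1: "cmod (of_real pi * A) \<le> 96 * M * (n1 + n2)"
  proof -
    have "cmod A \<le> 24 * M * (n1 + n2)" unfolding A_def n1_def n2_def pair_def by (rule V_corrector_flux[OF u])
    then have "pi * cmod A \<le> 4 * (24 * M * (n1 + n2))" using pi_4 by (intro mult_mono) auto
    then show ?thesis by (simp add: norm_mult)
  qed
  have 2: "cmod b1 \<le> 16 * K * n1"
    using pair_bound[OF uL(2), of "\<lambda>x. snd x * G1 x"] mult_left_mono[OF tG[OF continuous_W(2) tG_bound(1)], of n1] n0
    unfolding b1_def n1_def by (simp add: cont mult_ac)
  have 3: "cmod b2 \<le> 16 * K * n2"
    using pair_bound[OF uL(3), of "\<lambda>x. snd x * G2 x"] mult_left_mono[OF tG[OF continuous_W(3) tG_bound(2)], of n2] n0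
    unfolding b2_def n2_def by (simp add: cont mult_ac)
  have 4: "cmod e2 \<le> 23 * K * n2"
    using pair_bound[OF uL(3), of D] mult_left_mono[OF De, of n2] n0
    unfolding e2_def n2_def by (simp add: cont mult_ac)
  have 5: "cmod ef \<le> 92 * K * nf"
  proof -
    have "4 * (23 * K * \<epsilon>) \<le> 92 * K" using mult_left_mono[OF small(1), of "92 * K"] K_nonneg by simp
    then have "nf * nO (\<lambda>x. of_real (D x * \<zeta> x)) \<le> nf * (92 * K)" using Dz n0 by (intro mult_left_mono) auto
    then show ?thesis using pair_bound[OF f, of "\<lambda>x. D x * \<zeta> x"] unfolding ef_def nf_def by (simp add: cont mult_ac)
  qed
  \<comment> \<open>The factor \<epsilon> in the norm of D \<zeta> cancels the denominator of
    \<tau>/\<epsilon>.\<close>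
  have 6: "cmod (of_real (\<tau> / \<epsilon>) * \<i> * (2 * E)) \<le> 184 * K * n1"
  proof -
    have "cmod E \<le> n1 * (4 * (23 * K * \<epsilon>))"
      using pair_bound[OF uL(2), of "\<lambda>x. D x * \<zeta> x"] mult_left_mono[OF Dz, of n1] n0 unfolding E_def n1_def by (simp add: cont mult_ac)
    moreover have "\<bar>\<tau>\<bar> \<le> 1" using kappa by simp
    ultimately have "\<bar>\<tau>\<bar> * cmod E \<le> 1 * (n1 * (4 * (23 * K * \<epsilon>)))" by (intro mult_mono) auto
    then have "2 * (\<bar>\<tau>\<bar> * cmod E) / \<epsilon> \<le> 2 * (1 * (n1 * (4 * (23 * K * \<epsilon>)))) / \<epsilon>"
      by (rule divide_right_mono[OF mult_left_mono]) (use eps in auto)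
    also have "\<dots> = 184 * K * n1" using eps by simp
    also have "2 * (\<bar>\<tau>\<bar> * cmod E) / \<epsilon> = cmod (of_real (\<tau> / \<epsilon>) * \<i> * (2 * E))" using eps by (simp add: norm_mult norm_divide)
    finally show ?thesis .
  qed
  have "cmod (of_real (pi\<^sup>2 - 2 * hw * ln \<eta>) * bottom_mean u + of_real (ln \<eta>) * pair f \<zeta>)
      \<le> cmod (of_real pi * A) + cmod b1 + cmod b2 + cmod e2 + cmod (of_real (\<tau> / \<epsilon>) * \<i> * (2 * E)) + cmod ef"
    unfolding id by (intro order_trans[OF norm_triangle_ineq] add_mono order_refl) (simp only: norm_minus_cancel order_refl)
  also have "\<dots> \<le> 96 * M * (n1 + n2) + 16 * K * n1 + 16 * K * n2 + 23 * K * n2 + 184 * K * n1 + 92 * K * nf"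
    by (intro add_mono 1 2 3 4 5 6)
  also have "\<dots> \<le> C1 * (n1 + n2 + nf)"
  proof -
    have "0 \<le> K * n1" "0 \<le> K * n2" "0 \<le> K * nf" "0 \<le> M * nf" using K_nonneg M_nonneg n0 by auto
    then show ?thesis unfolding C1_def by (simp add: algebra_simps)
  qed
  finally show ?thesis unfolding \<zeta>_def n1_def n2_def nf_def .
qed

end

section \<open>Averaging the resolvent equation over the first coordinate\<close>

lemma L2_inner_cnj_right: "L2_inner S f (\<lambda>x. cnj (g x)) = (\<integral>x. f x * g x \<partial>lebesgue_on S)"
  by (simp add: L2_inner_def)

lemma frechet_cnj:
  fixes \<phi> :: "real \<Rightarrow> complex"
  assumes "smooth \<phi>"
  shows "frechet_derivative (\<lambda>t. cnj (\<phi> t)) (at t) 1 = cnj (frechet_derivative \<phi> (at t) 1)"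
  using frechet_vector_derivative[OF bounded_linear.has_vector_derivative[OF bounded_linear_cnj smooth_vector_derivative[OF assms]], of t 1]
  by simp

context fibre
begin

text \<open>A test function on the interval vanishes near both ends, so as a function of x_2 it
  satisfies the conditions on the top edge and on the window. It is constant in x_1, which makes all
  cross terms disappear.\<close>

lemma snd_V:
  assumes h: "test_function I\<^sub>\<pi> h"
  shows "(\<lambda>x. h (snd x)) \<in> V"
    "AE x in lebesgue_on Om. P1 (\<lambda>x. h (snd x)) x = 0"
    "AE x in lebesgue_on Om. P2 (\<lambda>x. h (snd x)) x = frechet_derivative h (at (snd x)) 1"
proof -
  have sh: "smooth h" and z: "h 0 = 0" "h pi = 0" using h by (auto simp: test_function_def)
  have sm: "smooth (\<lambda>x. h (snd (x :: real \<times> real)))"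
    by (rule smooth_compose[OF smooth_bounded_linear[OF bounded_linear_compose[OF bounded_linear_of_real bounded_linear_snd]] sh])
  show "(\<lambda>x. h (snd x)) \<in> V" by (rule smooth_V[OF sm]) (simp add: defect_def z L2_norm_zero)
  have "d1 (\<lambda>x. h (snd x)) x = 0" "d2 (\<lambda>x. h (snd x)) x = frechet_derivative h (at (snd x)) 1" for x
    using vector_derivative_unique_at[OF slice_deriv(1)[OF sm], of "snd x" 0 "fst x"]
      vector_derivative_unique_at[OF slice_deriv(2)[OF sm], of "fst x" _ "snd x", unfolded snd_conv, OF smooth_vector_derivative[OF sh]]
    by simp_all
  then show "AE x in lebesgue_on Om. P1 (\<lambda>x. h (snd x)) x = 0"
    "AE x in lebesgue_on Om. P2 (\<lambda>x. h (snd x)) x = frechet_derivative h (at (snd x)) 1"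
    using smooth_W12(2)[OF OmS sm, where e = "(1, 0)"] smooth_W12(2)[OF OmS sm, where e = "(0, 1)"] by simp_all
qed

text \<open>Averaging the resolvent equation over \<open>x\<^sub>1\<close> yields a two-point problem for the mean of the
  solution, in which only the boundary condition at \<open>0\<close> is missing.\<close>

lemma mean_equation:
  assumes fu: "(f, u) \<in> resolvent" and g: "g \<in> L2 I\<^sub>\<pi>"
    and Hf: "\<And>h. h \<in> L2 I\<^sub>\<pi> \<Longrightarrow> L2_inner Om f (\<lambda>x. h (snd x)) = of_real (2 * hw) * L2_inner I\<^sub>\<pi> g h"
  obtains p k where "p \<in> L2 I\<^sub>\<pi>" "\<And>h. h \<in> L2 I\<^sub>\<pi> \<Longrightarrow> L2_inner Om u (\<lambda>x. h (snd x)) = of_real (2 * hw) * L2_inner I\<^sub>\<pi> p h"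
    "AE t in lebesgue_on I\<^sub>\<pi>. p t = bottom_mean u + integral {0..t} (\<lambda>s. k - integral {0..s} g)"
    "bottom_mean u = - integral {0..pi} (\<lambda>s. k - integral {0..s} g)"
proof -
  have f: "f \<in> L2 Om" and u: "u \<in> V" and eq: "\<And>v. v \<in> V \<Longrightarrow> B u v = L2_inner Om f v"
    using fu unfolding resolvent_iff by auto
  note uL = V_L2[OF u]
  have h2: "complex_of_real (2 * hw) \<noteq> 0" using hw_pos by simp
  \<comment> \<open>P is the mean of the x_2-derivative. The equation tested with functions of x_2
    will say that the weak derivative of P is -g.\<close>
  obtain P where P: "P \<in> L2 I\<^sub>\<pi>" and HP: "\<And>h. h \<in> L2 I\<^sub>\<pi> \<Longrightarrow> L2_inner Om (P2 u) (\<lambda>x. h (snd x)) = of_real (2 * hw) * L2_inner I\<^sub>\<pi> P h"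
    using mean_exists[OF uL(3)] by blast
  obtain p where p: "p \<in> L2 I\<^sub>\<pi>" and Hp: "\<And>h. h \<in> L2 I\<^sub>\<pi> \<Longrightarrow> L2_inner Om u (\<lambda>x. h (snd x)) = of_real (2 * hw) * L2_inner I\<^sub>\<pi> p h"
    using mean_exists[OF uL(1)] by blast
  have lt: "(0::real) < pi" by simp
  have mg: "(\<lambda>t. - g t) \<in> L2 I\<^sub>\<pi>" using L2_scale[OF g, of "-1"] by simp
  have "has_weak_deriv I\<^sub>\<pi> 1 P (\<lambda>t. - g t)"
    unfolding has_weak_deriv_def
  proof (intro allI impI)
    fix \<phi> assume t: "test_function I\<^sub>\<pi> \<phi>"
    have s: "smooth \<phi>" using t by (simp add: test_function_def)
    define h where "h t = cnj (\<phi> t)" for t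
    define h' where "h' t = cnj (frechet_derivative \<phi> (at t) 1)" for t
    have ht: "test_function I\<^sub>\<pi> h" unfolding h_def[abs_def] by (rule test_function_cnj[OF t])
    have hL: "h \<in> L2 I\<^sub>\<pi>" by (rule test_in_L2(1)[OF I_S ht])
    have h'L: "h' \<in> L2 I\<^sub>\<pi>" unfolding h'_def by (rule L2_cnj[OF test_in_L2(2)[OF I_S t]])
    note v = snd_V[OF ht]
    note vL = V_L2[OF v(1)]
    have e: "frechet_derivative h (at t) 1 = h' t" for t unfolding h_def[abs_def] h'_def by (rule frechet_cnj[OF s])
    have 1: "L2_inner Om a (P1 (\<lambda>x. h (snd x))) = 0" if "a \<in> L2 Om" for a
      using L2_inner_cong_AE[OF that that AE_I2[OF refl] vL(2) L2_zero v(2)] by (simp add: L2_inner_def)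
    have 2: "L2_inner Om (P2 u) (P2 (\<lambda>x. h (snd x))) = L2_inner Om (P2 u) (\<lambda>x. h' (snd x))"
      by (rule L2_inner_cong_AE[OF uL(3) uL(3) AE_I2[OF refl] vL(3) L2_snd_cell[OF h'L] v(3)[unfolded e]])
    have 3: "L2_inner Om (P1 u) (\<lambda>x. h (snd x)) = 0"
    proof -
      have "(\<integral>x. P1 u x * cnj (h (snd x)) \<partial>lebesgue_on Om) = - (\<integral>x. u x * 0 \<partial>lebesgue_on Om)"
        by (rule V_parts_1[OF u, where \<psi>' = "\<lambda>_. 0"])
          (auto intro!: continuous_intros continuous_on_compose2[OF smooth_continuous[OF s, of UNIV]] simp: h_def)
      then show ?thesis by (simp add: L2_inner_def)
    qed
    have "B u (\<lambda>x. h (snd x)) = L2_inner Om (P2 u) (\<lambda>x. h' (snd x))"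
      unfolding B_def 1[OF uL(2)] 1[OF uL(1)] 2 3 by simp
    from this[symmetric, unfolded eq[OF v(1)] HP[OF h'L] Hf[OF hL]]
    have "of_real (2 * hw) * L2_inner I\<^sub>\<pi> P h' = of_real (2 * hw) * L2_inner I\<^sub>\<pi> g h" .
    then have "L2_inner I\<^sub>\<pi> P h' = L2_inner I\<^sub>\<pi> g h" using h2 by (simp only: mult_cancel_left) simp
    then show "(\<integral>t. P t * frechet_derivative \<phi> (at t) 1 \<partial>lebesgue_on I\<^sub>\<pi>) = - (\<integral>t. - g t * \<phi> t \<partial>lebesgue_on I\<^sub>\<pi>)"
      by (simp add: L2_inner_def h_def h'_def)
  qed
  from weak_deriv_imp_primitive[OF lt P mg this]
  obtain k where "AE t in lebesgue_on I\<^sub>\<pi>. P t = k + integral {0..t} (\<lambda>t. - g t)" by blast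
  then have Pk: "AE t in lebesgue_on I\<^sub>\<pi>. P t = k - integral {0..t} g" by simp
  define q where "q t = k - integral {0..t} g" for t
  have qc: "continuous_on {0..pi} q" unfolding q_def by (intro continuous_intros continuous_primitive[OF g])
  have q: "q \<in> L2 I\<^sub>\<pi>" by (rule continuous_I_L2[OF qc])
  have Hq: "(\<integral>x. P2 u x * h (snd x) \<partial>lebesgue_on Om) = of_real (2 * hw) * (\<integral>t. q t * h t \<partial>lebesgue_on I\<^sub>\<pi>)" if "h \<in> L2 I\<^sub>\<pi>" for h
  proof -
    have "L2_inner Om (P2 u) (\<lambda>x. cnj (h (snd x))) = of_real (2 * hw) * L2_inner I\<^sub>\<pi> P (\<lambda>t. cnj (h t))" by (rule HP[OF L2_cnj[OF that]])
    also have "L2_inner I\<^sub>\<pi> P (\<lambda>t. cnj (h t)) = L2_inner I\<^sub>\<pi> q (\<lambda>t. cnj (h t))"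
      by (rule L2_inner_cong_AE[OF P q _ L2_cnj[OF that] L2_cnj[OF that] AE_I2[OF refl]]) (simp add: q_def Pk)
    finally show ?thesis by (simp only: L2_inner_cnj_right)
  qed
  have Hu: "(\<integral>x. u x * h (snd x) \<partial>lebesgue_on Om) = of_real (2 * hw) * (\<integral>t. p t * h t \<partial>lebesgue_on I\<^sub>\<pi>)" if "h \<in> L2 I\<^sub>\<pi>" for h
    using Hp[OF L2_cnj[OF that]] by (simp only: L2_inner_cnj_right)
  \<comment> \<open>The function h has to vanish only at 0, since u vanishes at the top. Test
    functions then show that q is the weak derivative of p.\<close>
  have parts: "(\<integral>t. q t * h t \<partial>lebesgue_on I\<^sub>\<pi>) = - (\<integral>t. p t * h' t \<partial>lebesgue_on I\<^sub>\<pi>)"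
    if h: "continuous_on UNIV h" "continuous_on UNIV h'" "\<And>t. (h has_vector_derivative h' t) (at t)" "h 0 = 0" for h h'
  proof -
    have L: "h \<in> L2 I\<^sub>\<pi>" "h' \<in> L2 I\<^sub>\<pi>"
      by (rule continuous_I_L2[OF continuous_on_subset[OF h(1)]], simp, rule continuous_I_L2[OF continuous_on_subset[OF h(2)]], simp)
    have "(\<integral>x. P2 u x * h (snd x) \<partial>lebesgue_on Om) = - (\<integral>x. u x * h' (snd x) \<partial>lebesgue_on Om)"
    proof (rule V_parts_2[OF u])
      show "continuous_on UNIV (\<lambda>x::real \<times> real. h (snd x))" "continuous_on UNIV (\<lambda>x::real \<times> real. h' (snd x))"
        by (rule continuous_on_compose2[OF h(1)] continuous_on_compose2[OF h(2)]; auto intro: continuous_intros)+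
    qed (use h in auto)
    then have "of_real (2 * hw) * (\<integral>t. q t * h t \<partial>lebesgue_on I\<^sub>\<pi>) = of_real (2 * hw) * (- (\<integral>t. p t * h' t \<partial>lebesgue_on I\<^sub>\<pi>))"
      unfolding Hq[OF L(1)] Hu[OF L(2)] by simp
    then show ?thesis using h2 by (simp only: mult_cancel_left) simp
  qed
  have "has_weak_deriv I\<^sub>\<pi> 1 p q"
    unfolding has_weak_deriv_def
  proof (intro allI impI)
    fix \<phi> assume t: "test_function I\<^sub>\<pi> \<phi>"
    have s: "smooth \<phi>" using t by (simp add: test_function_def)
    have "\<phi> 0 = 0" using t by (auto simp: test_function_def)
    from parts[OF smooth_continuous[OF s] smooth_continuous[OF smooth_frechet[OF s]] smooth_vector_derivative[OF s] this]
    show "(\<integral>t. p t * frechet_derivative \<phi> (at t) 1 \<partial>lebesgue_on I\<^sub>\<pi>) = - (\<integral>t. q t * \<phi> t \<partial>lebesgue_on I\<^sub>\<pi>)" by simp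
  qed
  from weak_deriv_imp_primitive[OF lt p q this]
  obtain c where pc: "AE t in lebesgue_on I\<^sub>\<pi>. p t = c + integral {0..t} q" by blast
  have qi: "(\<integral>t. q t * 1 \<partial>lebesgue_on I\<^sub>\<pi>) = integral {0..pi} q" using integral_on_interval[OF qc] by simp
  have vd: "(complex_of_real has_vector_derivative 1) (at t within S)" for t S
    using bounded_linear.has_vector_derivative[OF bounded_linear_of_real has_vector_derivative_id] by simp
  have tL: "(\<lambda>t. complex_of_real t) \<in> L2 I\<^sub>\<pi>" "(\<lambda>t. complex_of_real pi) \<in> L2 I\<^sub>\<pi>" by (intro continuous_I_L2 continuous_intros)+
  \<comment> \<open>Testing with h(t) = t, which does not vanish at pi, encodes the boundary value
    p(pi) = 0.\<close>
  have c: "c = - integral {0..pi} q"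
  proof -
    have prL: "(\<lambda>t. integral {0..t} q) \<in> L2 I\<^sub>\<pi>" by (rule continuous_I_L2[OF continuous_primitive[OF q]])
    have "(\<integral>t. q t * of_real t \<partial>lebesgue_on I\<^sub>\<pi>) = - (\<integral>t. p t * 1 \<partial>lebesgue_on I\<^sub>\<pi>)"
      by (rule parts[OF _ _ vd]) (auto intro: continuous_intros)
    also have "(\<integral>t. p t * 1 \<partial>lebesgue_on I\<^sub>\<pi>) = (\<integral>t. c + integral {0..t} q * 1 \<partial>lebesgue_on I\<^sub>\<pi>)"
    proof (rule integral_cong_AE)
      show "(\<lambda>t. p t * 1) \<in> borel_measurable (lebesgue_on I\<^sub>\<pi>)" "(\<lambda>t. c + integral {0..t} q * 1) \<in> borel_measurable (lebesgue_on I\<^sub>\<pi>)"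
        using L2_D(1)[OF p] L2_D(1)[OF prL] by simp_all
    qed (use pc in simp)
    also have "\<dots> = (\<integral>t. c \<partial>lebesgue_on I\<^sub>\<pi>) + (\<integral>t. integral {0..t} q * 1 \<partial>lebesgue_on I\<^sub>\<pi>)"
      by (intro Bochner_Integration.integral_add) (use L2_integrable[OF I_S prL] L2_integrable[OF I_S smooth_in_L2[OF I_S smooth_const]] in auto)
    also have "(\<integral>t. c \<partial>lebesgue_on I\<^sub>\<pi>) = of_real pi * c"
      using integral_on_interval[of 0 pi "\<lambda>_. c"] by (simp add: scaleR_conv_of_real)
    also have "(\<integral>t. integral {0..t} q * 1 \<partial>lebesgue_on I\<^sub>\<pi>) = (\<integral>t. q t * (of_real pi - of_real t) \<partial>lebesgue_on I\<^sub>\<pi>)"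
      by (rule integral_primitive_parts[OF lt q vd]) (rule continuous_on_const)
    also have "\<dots> = (\<integral>t. q t * of_real pi \<partial>lebesgue_on I\<^sub>\<pi>) - (\<integral>t. q t * of_real t \<partial>lebesgue_on I\<^sub>\<pi>)"
      unfolding right_diff_distrib by (intro Bochner_Integration.integral_diff L2_mult_integrable q tL)
    also have "(\<integral>t. q t * of_real pi \<partial>lebesgue_on I\<^sub>\<pi>) = of_real pi * integral {0..pi} q" using qi by simp
    finally have "of_real pi * (c + integral {0..pi} q) = 0" by (simp add: algebra_simps)
    then show ?thesis by (simp add: add_eq_0_iff2)
  qed
  \<comment> \<open>Identifies \<open>bottom_mean u\<close> with the value at 0 of the continuous
    representative of p.\<close>
  have m: "bottom_mean u = c"
  proof -
    have "(\<integral>x. P2 u x * 1 \<partial>lebesgue_on Om) = of_real (2 * hw) * (\<integral>t. q t * 1 \<partial>lebesgue_on I\<^sub>\<pi>)"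
      by (rule Hq[of "\<lambda>_. 1"]) (rule smooth_in_L2[OF I_S smooth_const])
    then show ?thesis unfolding bottom_mean_def c qi using h2 by simp
  qed
  show thesis by (rule that[OF p Hp]) (use pc c in \<open>auto simp: m q_def[abs_def]\<close>)
qed

lemma mean_minus_limit:
  assumes fu: "(f, u) \<in> resolvent" and g: "g \<in> L2 I\<^sub>\<pi>" and mu: "\<mu> > 0"
    and Hf: "\<And>h. h \<in> L2 I\<^sub>\<pi> \<Longrightarrow> L2_inner Om f (\<lambda>x. h (snd x)) = of_real (2 * hw) * L2_inner I\<^sub>\<pi> g h"
  obtains p where "p \<in> L2 I\<^sub>\<pi>" "\<And>h. h \<in> L2 I\<^sub>\<pi> \<Longrightarrow> L2_inner Om u (\<lambda>x. h (snd x)) = of_real (2 * hw) * L2_inner I\<^sub>\<pi> p h"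
    "AE t in lebesgue_on I\<^sub>\<pi>. p t - Q_inv \<mu> g t = (bottom_mean u - Q_at_0 \<mu> g) * of_real (1 - t / pi)"
proof -
  have "\<exists>p k. p \<in> L2 I\<^sub>\<pi> \<and> (\<forall>h. h \<in> L2 I\<^sub>\<pi> \<longrightarrow> L2_inner Om u (\<lambda>x. h (snd x)) = of_real (2 * hw) * L2_inner I\<^sub>\<pi> p h) \<and>
    (AE t in lebesgue_on I\<^sub>\<pi>. p t = bottom_mean u + integral {0..t} (\<lambda>s. k - integral {0..s} g)) \<and>
    bottom_mean u = - integral {0..pi} (\<lambda>s. k - integral {0..s} g)"
    by (rule mean_equation[OF fu g Hf]) blast+
  then obtain p k where p: "p \<in> L2 I\<^sub>\<pi>" "\<And>h. h \<in> L2 I\<^sub>\<pi> \<Longrightarrow> L2_inner Om u (\<lambda>x. h (snd x)) = of_real (2 * hw) * L2_inner I\<^sub>\<pi> p h"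
    and ae: "AE t in lebesgue_on I\<^sub>\<pi>. p t = bottom_mean u + integral {0..t} (\<lambda>s. k - integral {0..s} g)"
    and end0: "bottom_mean u = - integral {0..pi} (\<lambda>s. k - integral {0..s} g)" by blast
  have J: "(\<lambda>s. integral {0..s} g) integrable_on {0..t}" if "t \<le> pi" for t
    by (rule integrable_continuous_interval[OF continuous_on_subset[OF continuous_primitive[OF g]]]) (use that in auto)
  have split: "integral {0..t} (\<lambda>s. c - integral {0..s} g) = of_real t * c - integral {0..t} (\<lambda>s. integral {0..s} g)"
    if "0 \<le> t" "t \<le> pi" for c t
    using that by (subst Henstock_Kurzweil_Integration.integral_diff) (auto intro: J simp: scaleR_conv_of_real)
  \<comment> \<open>The derivatives of p and q contain the same primitive of g, so d is the constant
    slope of p - q.\<close>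
  define d where "d = k - of_real \<mu> * Q_at_0 \<mu> g"
  have diff: "bottom_mean u + integral {0..t} (\<lambda>s. k - integral {0..s} g) - Q_inv \<mu> g t = bottom_mean u - Q_at_0 \<mu> g + of_real t * d"
    if "0 \<le> t" "t \<le> pi" for t
    unfolding Q_inv_def Q_deriv_def[abs_def] split[OF that] d_def by (simp add: algebra_simps)
  have "0 = bottom_mean u - Q_at_0 \<mu> g + of_real pi * d"
    using diff[of pi] Q_inv_pi[OF mu g] end0 by simp
  then have e: "bottom_mean u - Q_at_0 \<mu> g = - (of_real pi * d)" by (simp add: eq_neg_iff_add_eq_0)
  have lin: "bottom_mean u - Q_at_0 \<mu> g + of_real t * d = (bottom_mean u - Q_at_0 \<mu> g) * of_real (1 - t / pi)" for t
    unfolding e by (simp add: algebra_simps)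
  have "AE t in lebesgue_on I\<^sub>\<pi>. t \<in> I\<^sub>\<pi>" by (rule AE_I2) (simp add: space_restrict_space)
  with ae have "AE t in lebesgue_on I\<^sub>\<pi>. p t - Q_inv \<mu> g t = (bottom_mean u - Q_at_0 \<mu> g) * of_real (1 - t / pi)"
    by eventually_elim (use diff lin in auto)
  then show thesis using that p by blast
qed

end

section \<open>The error estimate\<close>

context corrector
begin

lemma C1_nonneg: "0 \<le> C1" using K_nonneg M_nonneg by (simp add: C1_def)

text \<open>The error is split at the mean p of u. The part u - p is bounded by \<epsilon>/2 times
  the x_1-derivative, hence the 3 = 6/2 in the constant; the part p - q is the jump e times the
  profile 1 - x_2/pi, bounded through \<open>corrector_equation\<close>.\<close>

lemma resolvent_minus_limit:
  assumes fu: "(f, u) \<in> resolvent" and fU: "(f, U) \<in> Q_zero \<mu>" and mu: "\<mu> = - 1 / (\<epsilon> * ln \<eta>)"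
  shows "nO (\<lambda>x. u x - U x) \<le> (3 + 13 * C1) * (1 / sqrt \<kappa>) * (sqrt \<epsilon> * \<mu> + \<epsilon>) * nO f"
proof -
  have ln: "ln \<eta> < 0" using eta small by simp
  have mu0: "\<mu> > 0" unfolding mu using ln eps by (intro divide_neg_neg mult_pos_neg) auto
  have f: "f \<in> L2 Om" and u: "u \<in> V" using fu unfolding resolvent_iff by auto
  obtain g where U: "U \<in> L2 Om" and g: "g \<in> L2 I\<^sub>\<pi>" and Ug: "AE x in lebesgue_on Om. U x = Q_inv \<mu> g (snd x)"
    and Hf: "\<And>h. h \<in> L2 I\<^sub>\<pi> \<Longrightarrow> L2_inner Om f (\<lambda>x. h (snd x)) = of_real (2 * hw) * L2_inner I\<^sub>\<pi> g h"
    using fU unfolding Q_zero_iff[OF mu0] by blast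
  have "\<exists>p. p \<in> L2 I\<^sub>\<pi> \<and> (\<forall>h. h \<in> L2 I\<^sub>\<pi> \<longrightarrow> L2_inner Om u (\<lambda>x. h (snd x)) = of_real (2 * hw) * L2_inner I\<^sub>\<pi> p h) \<and>
    (AE t in lebesgue_on I\<^sub>\<pi>. p t - Q_inv \<mu> g t = (bottom_mean u - Q_at_0 \<mu> g) * of_real (1 - t / pi))"
    by (rule mean_minus_limit[OF fu g mu0 Hf]) blast+
  then obtain p where p: "p \<in> L2 I\<^sub>\<pi>" and Hp: "\<And>h. h \<in> L2 I\<^sub>\<pi> \<Longrightarrow> L2_inner Om u (\<lambda>x. h (snd x)) = of_real (2 * hw) * L2_inner I\<^sub>\<pi> p h"
    and pQ: "AE t in lebesgue_on I\<^sub>\<pi>. p t - Q_inv \<mu> g t = (bottom_mean u - Q_at_0 \<mu> g) * of_real (1 - t / pi)" by blast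
  note uL = V_L2[OF u] and pL = L2_snd_cell[OF p]
  define e where "e = bottom_mean u - Q_at_0 \<mu> g"
  define S where "S = nO (P1 u) + nO (P2 u) + nO f"
  \<comment> \<open>Integrating by parts, the integral of g(t)(pi - t) is that of the primitive of
    g, the numerator of \<open>Q_at_0\<close>. Hence the source term of the tested equation is a
    multiple of q(0).\<close>
  have pf: "pair f (\<lambda>x. pi - snd x) = of_real (2 * hw * (1 + \<mu> * pi)) * Q_at_0 \<mu> g"
  proof -
    have hL: "(\<lambda>t. complex_of_real (pi - t)) \<in> L2 I\<^sub>\<pi>" by (intro continuous_I_L2 continuous_intros)
    have vd: "(complex_of_real has_vector_derivative 1) (at t within S)" for t S
      using bounded_linear.has_vector_derivative[OF bounded_linear_of_real has_vector_derivative_id] by simp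
    have "pair f (\<lambda>x. pi - snd x) = of_real (2 * hw) * L2_inner I\<^sub>\<pi> g (\<lambda>t. complex_of_real (pi - t))"
      unfolding pair_eq_inner using Hf[OF hL] by simp
    also have "L2_inner I\<^sub>\<pi> g (\<lambda>t. complex_of_real (pi - t)) = (\<integral>t. g t * (of_real pi - of_real t) \<partial>lebesgue_on I\<^sub>\<pi>)"
      by (simp add: L2_inner_def)
    also have "\<dots> = (\<integral>t. integral {0..t} g * 1 \<partial>lebesgue_on I\<^sub>\<pi>)"
      by (rule integral_primitive_parts[OF pi_gt_zero g vd, symmetric]) (rule continuous_on_const)
    also have "\<dots> = integral {0..pi} (\<lambda>t. integral {0..t} g)"
      using integral_on_interval[OF continuous_primitive[OF g]] by simp
    also have "\<dots> = of_real (1 + \<mu> * pi) * Q_at_0 \<mu> g"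
      unfolding Q_at_0_def using mu_pi[OF mu0] by (simp del: of_real_add)
    finally show ?thesis by simp
  qed
  \<comment> \<open>Since 2 hw = \<epsilon> pi, this is the definition of \<mu>. It makes the
    coefficients of p(0) and of q(0) in the tested equation opposite numbers.\<close>
  have hm: "2 * hw * ln \<eta> = - (pi / \<mu>)" unfolding mu hw_def using ln eps by simp
  have "of_real (pi\<^sup>2 - 2 * hw * ln \<eta>) * bottom_mean u + of_real (ln \<eta>) * pair f (\<lambda>x. pi - snd x) = of_real (pi\<^sup>2 + pi / \<mu>) * e"
  proof -
    have "ln \<eta> * (2 * hw * (1 + \<mu> * pi)) = (2 * hw * ln \<eta>) * (1 + \<mu> * pi)" by simp
    also have "\<dots> = - (pi\<^sup>2 + pi / \<mu>)" unfolding hm using mu0 by (simp add: field_simps power2_eq_square)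
    finally have "of_real (ln \<eta>) * pair f (\<lambda>x. pi - snd x) = - of_real (pi\<^sup>2 + pi / \<mu>) * Q_at_0 \<mu> g"
      unfolding pf by (simp only: mult.assoc[symmetric] of_real_mult[symmetric] of_real_minus)
    then show ?thesis unfolding hm e_def by (simp add: algebra_simps)
  qed
  then have "cmod (of_real (pi\<^sup>2 + pi / \<mu>) * e) \<le> C1 * S"
    using corrector_equation[OF fu] by (simp only: S_def)
  then have "(pi\<^sup>2 + pi / \<mu>) * cmod e \<le> C1 * S" using mu0 by (simp only: norm_mult norm_of_real) (simp add: abs_of_pos add_pos_pos)
  \<comment> \<open>Keeping only the summand pi/\<mu> of the coefficient yields the rate \<mu> for
    the jump.\<close>
  moreover have "pi / \<mu> * cmod e \<le> (pi\<^sup>2 + pi / \<mu>) * cmod e" by (intro mult_right_mono) auto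
  ultimately have "pi / \<mu> * cmod e \<le> C1 * S" by linarith
  then have e: "pi * cmod e \<le> \<mu> * (C1 * S)" using mu0 by (simp add: field_simps)
  \<comment> \<open>13 = 6 + 6 + 1, from the two derivatives and f; the last two are enlarged by 1
    \<le> 1/sqrt \<kappa>.\<close>
  have S: "S \<le> 13 * (1 / sqrt \<kappa>) * nO f" and n1: "nO (P1 u) \<le> 6 * (1 / sqrt \<kappa>) * nO f"
  proof -
    have k: "0 < sqrt \<kappa>" "1 \<le> 1 / sqrt \<kappa>" using kappa by auto
    show 1: "nO (P1 u) \<le> 6 * (1 / sqrt \<kappa>) * nO f"
      using resolvent_bounds(2)[OF fu] k(1) by (simp add: field_simps)
    have "nO f \<le> (1 / sqrt \<kappa>) * nO f" using mult_right_mono[OF k(2) L2_norm_nonneg, of Om f] by simp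
    then show "S \<le> 13 * (1 / sqrt \<kappa>) * nO f" unfolding S_def using 1 resolvent_bounds(1)[OF fu] by linarith
  qed
  have "nO (\<lambda>x. u x - p (snd x)) \<le> (hw / pi) * nO (P1 u)"
  proof (rule V_mean_bound[OF u p])
    fix h :: "real \<Rightarrow> complex" assume h: "h \<in> L2 I\<^sub>\<pi>"
    show "L2_inner Om (\<lambda>x. u x - p (snd x)) (\<lambda>x. h (snd x)) = 0"
      unfolding L2_inner_diff_left[OF uL(1) pL L2_snd_cell[OF h]] Hp[OF h] L2_inner_snd_cell[OF p h] by simp
  qed
  also have "\<dots> \<le> (\<epsilon> / 2) * (6 * (1 / sqrt \<kappa>) * nO f)"
    using n1 eps by (intro mult_mono) (auto simp: hw_def L2_norm_nonneg)
  finally have 1: "nO (\<lambda>x. u x - p (snd x)) \<le> 3 * \<epsilon> * (1 / sqrt \<kappa>) * nO f" by simp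
  have rc: "continuous_on UNIV (\<lambda>x::real \<times> real. e * complex_of_real (1 - snd x / pi))" by (intro continuous_intros) auto
  have "AE x in lebesgue_on Om. p (snd x) - U x = e * complex_of_real (1 - snd x / pi)"
    using AE_snd_cell[OF pQ] Ug by eventually_elim (simp add: e_def)
  then have "nO (\<lambda>x. p (snd x) - U x) = nO (\<lambda>x. e * complex_of_real (1 - snd x / pi))"
    by (rule L2_norm_cong_AE[OF L2_diff[OF pL U] cont_L2[OF rc]])
  also have "\<dots> \<le> cmod e * sqrt (measure lebesgue Om)"
  proof (rule bounded_in_L2(2)[OF Omega_lm L2_D(1)[OF cont_L2[OF rc]]])
    fix x assume "x \<in> Om"
    then have "0 < snd x" "snd x < pi" by (auto simp: \<Omega>_def)
    then have "\<bar>1 - snd x / pi\<bar> \<le> 1" by (simp add: abs_le_iff divide_le_eq)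
    then show "norm (e * complex_of_real (1 - snd x / pi)) \<le> cmod e"
      using mult_left_mono[of "\<bar>1 - snd x / pi\<bar>" 1 "cmod e"] by (simp only: norm_mult norm_of_real) simp
  qed simp
  also have "sqrt (measure lebesgue Om) = sqrt \<epsilon> * pi"
    unfolding measure_Om hw_def by (simp add: real_sqrt_mult)
  also have "cmod e * (sqrt \<epsilon> * pi) = sqrt \<epsilon> * (pi * cmod e)" by simp
  also have "\<dots> \<le> sqrt \<epsilon> * (\<mu> * (C1 * (13 * (1 / sqrt \<kappa>) * nO f)))"
    using e mult_left_mono[OF mult_left_mono[OF S C1_nonneg], of \<mu>] mu0 eps by (intro mult_left_mono) auto
  finally have 2: "nO (\<lambda>x. p (snd x) - U x) \<le> 13 * C1 * (sqrt \<epsilon> * \<mu>) * (1 / sqrt \<kappa>) * nO f" by (simp add: mult_ac)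
  have "nO (\<lambda>x. u x - U x) = nO (\<lambda>x. (u x - p (snd x)) + (p (snd x) - U x))" by simp
  also have "\<dots> \<le> nO (\<lambda>x. u x - p (snd x)) + nO (\<lambda>x. p (snd x) - U x)"
    by (rule L2_norm_add_le[OF L2_diff[OF uL(1) pL] L2_diff[OF pL U]])
  also have "\<dots> \<le> (3 * \<epsilon> + 13 * C1 * (sqrt \<epsilon> * \<mu>)) * ((1 / sqrt \<kappa>) * nO f)"
    using 1 2 by (simp only: distrib_right mult.assoc)
  also have "\<dots> \<le> ((3 + 13 * C1) * (sqrt \<epsilon> * \<mu> + \<epsilon>)) * ((1 / sqrt \<kappa>) * nO f)"
  proof (rule mult_right_mono)
    have "0 \<le> C1 * \<epsilon>" "0 \<le> sqrt \<epsilon> * \<mu>" using C1_nonneg eps mu0 by auto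
    then show "3 * \<epsilon> + 13 * C1 * (sqrt \<epsilon> * \<mu>) \<le> (3 + 13 * C1) * (sqrt \<epsilon> * \<mu> + \<epsilon>)" by (simp add: algebra_simps)
    show "0 \<le> (1 / sqrt \<kappa>) * nO f" using kappa by (simp add: L2_norm_nonneg)
  qed
  finally show ?thesis by (simp only: mult_ac)
qed

end

theorem theorem2p3:
  "\<exists>C>0. \<forall>\<eta> :: real \<Rightarrow> real.
     (\<forall>\<epsilon>>0. 0 < \<eta> \<epsilon> \<and> \<eta> \<epsilon> < pi / 2) \<longrightarrow>
     filterlim (\<lambda>\<epsilon>. \<epsilon> * ln (\<eta> \<epsilon>)) at_bot (at_right 0) \<longrightarrow>
     (\<forall>\<kappa>. 0 < \<kappa> \<and> \<kappa> < 1 \<longrightarrow>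
       (\<exists>\<epsilon>0>0. \<forall>\<epsilon> \<tau> \<mu>. 0 < \<epsilon> \<and> \<epsilon> < \<epsilon>0 \<and> \<bar>\<tau>\<bar> < 1 - \<kappa> \<and> \<mu> = - 1 / (\<epsilon> * ln (\<eta> \<epsilon>)) \<longrightarrow>
          L2_bounded_operator (\<Omega> \<epsilon>) ((op_shift (H_op \<epsilon> (\<eta> \<epsilon>) \<tau>) (of_real (\<tau>\<^sup>2 / \<epsilon>\<^sup>2)))\<inverse>) \<and>
          L2_bounded_operator (\<Omega> \<epsilon>) (op_sum_zero (\<Omega> \<epsilon>) (L_sub \<epsilon>) ((Q_op \<epsilon> \<mu>)\<inverse>)) \<and>
          L2_opnorm (\<Omega> \<epsilon>)
            (op_diff ((op_shift (H_op \<epsilon> (\<eta> \<epsilon>) \<tau>) (of_real (\<tau>\<^sup>2 / \<epsilon>\<^sup>2)))\<inverse>)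
                     (op_sum_zero (\<Omega> \<epsilon>) (L_sub \<epsilon>) ((Q_op \<epsilon> \<mu>)\<inverse>)))
          \<le> ennreal (C * \<kappa> powr (-1/2) * (\<epsilon> powr (1/2) * \<mu> + \<epsilon>))))"
proof -
  obtain K M where KM: "\<And>s. 0 \<le> s \<Longrightarrow> \<bar>s * Lam1 s\<bar> \<le> K" "\<And>s. \<bar>wl s\<bar> \<le> M" "0 \<le> K" "0 \<le> M"
    by (rule Lam_bounds) blast
  \<comment> \<open>K and M depend only on the profile \<open>Lam\<close>, so the constant is fixed
    before \<eta>, \<kappa> and \<epsilon>.\<close>
  define C where "C = 3 + 13 * (96 * M + 200 * K)"
  have C: "0 < C" using KM by (simp add: C_def add_pos_nonneg)
  show ?thesis
  proof (rule exI[of _ C], rule conjI[OF C], intro allI impI)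
    fix \<eta> :: "real \<Rightarrow> real" and \<kappa> :: real
    assume eta: "\<forall>\<epsilon>>0. 0 < \<eta> \<epsilon> \<and> \<eta> \<epsilon> < pi / 2" and lim: "filterlim (\<lambda>\<epsilon>. \<epsilon> * ln (\<eta> \<epsilon>)) at_bot (at_right 0)"
      and kappa: "0 < \<kappa> \<and> \<kappa> < 1"
    \<comment> \<open>The threshold -1 is enough: with \<epsilon> < 1 and a negative logarithm it
      gives \<open>ln (\<eta> \<epsilon>) < - 1\<close>, hence a window parameter below exp(-1),
      which is at most the 1/2 demanded by the locale \<open>corrector\<close>.\<close>
    have "eventually (\<lambda>\<epsilon>. \<epsilon> * ln (\<eta> \<epsilon>) < - 1) (at_right 0)"
      using lim unfolding filterlim_at_bot_dense by blast
    then obtain b where b: "b > 0" "\<And>\<epsilon>. 0 < \<epsilon> \<Longrightarrow> \<epsilon> < b \<Longrightarrow> \<epsilon> * ln (\<eta> \<epsilon>) < - 1"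
      unfolding eventually_at_right_field by blast
    show "\<exists>\<epsilon>0>0. \<forall>\<epsilon> \<tau> \<mu>. 0 < \<epsilon> \<and> \<epsilon> < \<epsilon>0 \<and> \<bar>\<tau>\<bar> < 1 - \<kappa> \<and> \<mu> = - 1 / (\<epsilon> * ln (\<eta> \<epsilon>)) \<longrightarrow>
          L2_bounded_operator (\<Omega> \<epsilon>) ((op_shift (H_op \<epsilon> (\<eta> \<epsilon>) \<tau>) (of_real (\<tau>\<^sup>2 / \<epsilon>\<^sup>2)))\<inverse>) \<and>
          L2_bounded_operator (\<Omega> \<epsilon>) (op_sum_zero (\<Omega> \<epsilon>) (L_sub \<epsilon>) ((Q_op \<epsilon> \<mu>)\<inverse>)) \<and>
          L2_opnorm (\<Omega> \<epsilon>)
            (op_diff ((op_shift (H_op \<epsilon> (\<eta> \<epsilon>) \<tau>) (of_real (\<tau>\<^sup>2 / \<epsilon>\<^sup>2)))\<inverse>)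
                     (op_sum_zero (\<Omega> \<epsilon>) (L_sub \<epsilon>) ((Q_op \<epsilon> \<mu>)\<inverse>)))
          \<le> ennreal (C * \<kappa> powr (-1/2) * (\<epsilon> powr (1/2) * \<mu> + \<epsilon>))"
    proof (intro exI[of _ "min b 1"] conjI allI impI; (elim conjE)?)
      show "0 < min b 1" using b by simp
      fix \<epsilon> \<tau> \<mu> :: real
      assume e: "0 < \<epsilon>" "\<epsilon> < min b 1" and t: "\<bar>\<tau>\<bar> < 1 - \<kappa>" and mu: "\<mu> = - 1 / (\<epsilon> * ln (\<eta> \<epsilon>))"
      have l1: "\<epsilon> * ln (\<eta> \<epsilon>) < - 1" using b(2) e by simp
      have eh: "\<eta> \<epsilon> < 1 / 2"
      proof -
        have "ln (\<eta> \<epsilon>) < 0" using l1 e(1) by (smt (verit) mult_nonneg_nonneg)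
        then have "ln (\<eta> \<epsilon>) \<le> \<epsilon> * ln (\<eta> \<epsilon>)" using e mult_right_mono_neg[of \<epsilon> 1 "ln (\<eta> \<epsilon>)"] by simp
        then have "\<eta> \<epsilon> < exp (- 1)" using l1 eta e(1) by (metis exp_less_mono exp_ln le_less_trans)
        also have "exp (- 1 :: real) \<le> 1 / 2"
          using exp_ge_add_one_self[of 1] by (simp add: exp_minus inverse_eq_divide divide_le_eq)
        finally show ?thesis .
      qed
      interpret corrector \<epsilon> "\<eta> \<epsilon>" \<tau> \<kappa> K M
        by unfold_locales (use e eta kappa t KM eh in auto)
      have mu0: "0 < \<mu>" unfolding mu using l1 by (intro divide_neg_neg) auto
      show "L2_bounded_operator (\<Omega> \<epsilon>) resolvent" by (rule resolvent_bounded)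
      show "L2_bounded_operator (\<Omega> \<epsilon>) (Q_zero \<mu>)" by (rule Q_zero_bounded[OF mu0])
      have CC: "C = 3 + 13 * C1" by (simp add: C_def C1_def)
      have pw: "\<kappa> powr (-1/2) = 1 / sqrt \<kappa>" "\<epsilon> powr (1/2) = sqrt \<epsilon>"
        using kappa e by (simp_all add: powr_minus powr_half_sqrt inverse_eq_divide)
      show "L2_opnorm (\<Omega> \<epsilon>) (op_diff resolvent (Q_zero \<mu>)) \<le> ennreal (C * \<kappa> powr (-1/2) * (\<epsilon> powr (1/2) * \<mu> + \<epsilon>))"
        unfolding L2_opnorm_def
      proof (rule Sup_least)
        fix y assume "y \<in> {ennreal (nO g) |f g. (f, g) \<in> op_diff resolvent (Q_zero \<mu>) \<and> nO f \<le> 1}"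
        then obtain f u U where y: "y = ennreal (nO (\<lambda>x. u x - U x))"
          and fu: "(f, u) \<in> resolvent" and fU: "(f, U) \<in> Q_zero \<mu>" and f1: "nO f \<le> 1"
          unfolding op_diff_def by blast
        have "nO (\<lambda>x. u x - U x) \<le> C * (1 / sqrt \<kappa>) * (sqrt \<epsilon> * \<mu> + \<epsilon>) * nO f"
          unfolding CC by (rule resolvent_minus_limit[OF fu fU mu])
        also have "\<dots> \<le> C * (1 / sqrt \<kappa>) * (sqrt \<epsilon> * \<mu> + \<epsilon>) * 1"
          using C kappa e mu0 f1 by (intro mult_left_mono) auto
        finally show "y \<le> ennreal (C * \<kappa> powr (-1/2) * (\<epsilon> powr (1/2) * \<mu> + \<epsilon>))"
          unfolding y pw by (intro ennreal_leI) simp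
      qed
    qed
  qed
qed

end
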